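(* The estimate $$\frac{(2R)^{n+1}p_n(z)}{\sqrt{n+1}\,(z+2+\sqrt{z^2-4})^{n}}= \frac{z+\sqrt{z^2-4}}{\sqrt{z^2-4}}+O(1/n)$$ holds uniformly as $n\to\infty$ on compact subsets of $\Sigma_1\cup\partial \Sigma_0\setminus\{x_\mu\}$. For every $z=2\cos\theta$, $0\leq \theta\leq \arccos(x_\mu/2)$, where $x_\mu=(1+\mu^2)^2-2$, we have $$p_n(z)= \sqrt{n+1}\left(\frac{2}{R}\right)^{n+1}\cos^n(\theta/2)\left\{\frac{\sin( (n+2)\theta/2)}{2\sin\theta}+\epsilon_n(z)\right\},$$ where $\epsilon_n(z)$ decays geometrically fast as $n\to\infty$, uniformly on compact subsets of $(x_\mu,2]$, while $\epsilon_n(z)=O(1/n)$ uniformly on $[x_\mu,2]$ as $n\to\infty$.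
   Context: Fix $R>2$. Let $L_1=\{w-1+(w-1)^{-1}:|w|=R\}$; this is an analytic Jordan curve. Let $G_1$ be the bounded component of $\mathbb{C}\setminus L_1$, and let $\{p_n\}_{n\ge 0}$ be the unique sequence of polynomials such that $p_n$ has degree $n$ and positive leading coefficient and $\frac1\pi\int_{G_1}p_n(z)\overline{p_m(z)}\,dx\,dy$ equals $0$ if $n\ne m$ and $1$ if $n=m$. $\sqrt{z^2-4}$ denotes the branch in $\mathbb{C}\setminus[-2,2]$ that is positive on $(2,\infty)$, extended to $[-2,2]$ by its boundary values from the upper half plane. Set $\psi(w)=Rw-1+\frac{1}{Rw-1}$, which maps $\{|w|>1\}\cup\{\infty\}$ conformally onto the unbounded component of $\overline{\mathbb{C}}\setminus L_1$ and is univalent in $|w|>\rho$ with $\rho=2/R$ (the smallest such number). Let $\varphi$ be a conformal map of $G_1$ onto the unit disk; it extends meromorphically so that $\varphi(\psi(w))$ is meromorphic in $\rho<|w|<1/\rho$. Let $\mu\ge 0$ be the smallest number such that $\varphi(\psi(w))$ has a meromorphic continuation, denoted $h_\varphi(w)$, to $\mu<|w|<1/\rho$; for this curve $$\mu=\frac{R-\sqrt{R^2-4}}{2}.$$ $\Sigma$ is the set of $z\in G_1$ such that the equation $h_\varphi(w)=\varphi(z)$ has at least one solution in $\mu<|w|<1$, and $\Sigma_0=G_1\setminus\Sigma$. For $z\in\Sigma$, let $\omega_{z,1},\dots,\omega_{z,s}$ be the finitely many solutions of largest modulus in $\mu<|w|<1$ and let $\alpha_{z,k}$ be the multiplicity of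 $h_\varphi$ at $\omega_{z,k}$; for $p\ge 1$, $\Sigma_p=\{z\in\Sigma:\alpha_{z,1}+\dots+\alpha_{z,s}=p\}$. (These sets do not depend on the choice of $\varphi$.) Explicitly, for this curve it is known that $G_1=\Sigma_0\cup\Sigma_1\cup\Sigma_2$, $\Sigma_2=(x_\mu,2]$, $\Sigma_1=\psi(\{w:|w|<1,\ |w|>\mu,\ |w-1/R|>1/R\})$, and $\Sigma_0=\{z\in G_1:|z+2+\sqrt{z^2-4}|\le 2R\mu\}$. $\partial\Sigma_0$ is the boundary of $\Sigma_0$. At $\theta=0$ the quotient $\sin((n+2)\theta/2)/(2\sin\theta)$ is understood as its limit. "Decays geometrically fast, uniformly on a compact set $E$" means there are $C>0$ and $c\in(0,1)$ (depending on $E$) with $|\epsilon_n(z)|\le Cc^n$ for all $z\in E$ and all large $n$. *)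

theory Defs
  imports "HOL-Complex_Analysis.Complex_Analysis"
begin

definition L1 :: "real \<Rightarrow> complex set" where
  "L1 R = {w - 1 + inverse (w - 1) | w. cmod w = R}"

(* inside S is the union of the bounded components of - S; for a Jordan curve there is just one. *)
definition G1 :: "real \<Rightarrow> complex set" where
  "G1 R = inside (L1 R)"

definition psi :: "real \<Rightarrow> complex \<Rightarrow> complex" where
  "psi R w = of_real R * w - 1 + 1 / (of_real R * w - 1)"

definition rho :: "real \<Rightarrow> real" where
  "rho R = 2 / R"

definition area_orthonormal_polys :: "complex set \<Rightarrow> (nat \<Rightarrow> complex poly) \<Rightarrow> bool" where
  "area_orthonormal_polys G p \<longleftrightarrow>
     (\<forall>n. degree (p n) = n \<and> lead_coeff (p n) \<in> \<real> \<and> 0 < Re (lead_coeff (p n))) \<and>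
     (\<forall>n m. 1 / of_real pi * (LINT z:G|lborel. poly (p n) z * cnj (poly (p m) z))
              = (if n = m then 1 else 0))"

definition conformal_onto_disk :: "complex set \<Rightarrow> (complex \<Rightarrow> complex) \<Rightarrow> bool" where
  "conformal_onto_disk G \<phi> \<longleftrightarrow> \<phi> holomorphic_on G \<and> bij_betw \<phi> G (ball 0 1)"

(* The branch of sqrt (z^2 - 4) that is positive on (2, infinity). Off [-2, 2] the number
   (z - 2) / (z + 2) is not in (-infinity, 0], so the principal root is analytic there; on [-2, 2]
   the principal root gives the boundary values from the upper half plane.
   See the lemmas that follow. *)
definition sqrt4 :: "complex \<Rightarrow> complex" where
  "sqrt4 z = (z + 2) * csqrt ((z - 2) / (z + 2))"

lemma sqrt4_squared: "(sqrt4 z)\<^sup>2 = z\<^sup>2 - 4"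
proof (cases "z = -2")
  case False
  hence "z + 2 \<noteq> 0" by (simp add: eq_neg_iff_add_eq_0)
  hence "(z + 2)\<^sup>2 * ((z - 2) / (z + 2)) = (z + 2) * (z - 2)"
    by (simp add: power2_eq_square)
  also have "(z + 2) * (z - 2) = z\<^sup>2 - 4" by (simp add: power2_eq_square algebra_simps)
  finally show ?thesis
    unfolding sqrt4_def power_mult_distrib power2_csqrt .
qed (simp add: sqrt4_def)

lemma sqrt4_holomorphic: "sqrt4 holomorphic_on - (of_real ` {-2..2})"
proof -
  have *: "z + 2 \<noteq> 0 \<and> (z - 2) / (z + 2) \<notin> \<real>\<^sub>\<le>\<^sub>0" if z: "z \<notin> of_real ` {-2..2}" for z :: complex
  proof
    have "z \<noteq> of_real (-2)" using z by force
    thus nz: "z + 2 \<noteq> 0" by (simp add: eq_neg_iff_add_eq_0)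
    show "(z - 2) / (z + 2) \<notin> \<real>\<^sub>\<le>\<^sub>0"
    proof
      assume "(z - 2) / (z + 2) \<in> \<real>\<^sub>\<le>\<^sub>0"
      then obtain t where t: "(z - 2) / (z + 2) = of_real t" "t \<le> 0"
        by (auto elim: nonpos_Reals_cases)
      hence "z - 2 = of_real t * (z + 2)" using nz by (simp add: field_simps)
      hence "z * of_real (1 - t) = of_real (2 * (1 + t))" by (simp add: algebra_simps)
      hence "z = of_real (2 * (1 + t)) / of_real (1 - t)"
        using t(2) by (metis add_0 diff_le_0_iff_le diff_add_cancel eq_divide_imp not_one_le_zero
            of_real_eq_0_iff order.trans)
      hence "z = of_real (2 * (1 + t) / (1 - t))" by simp
      moreover have "2 * (1 + t) / (1 - t) \<in> {-2..2}" using t(2) by (simp add: field_simps)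
      ultimately show False using z by blast
    qed
  qed
  show ?thesis unfolding sqrt4_def
    by (intro holomorphic_intros) (use * in auto)
qed

lemma sqrt4_pos: "x > 2 \<Longrightarrow> sqrt4 (of_real x) = of_real (sqrt (x\<^sup>2 - 4))"
proof -
  assume x: "x > 2"
  have "csqrt ((of_real x - 2) / (of_real x + 2)) = of_real (sqrt ((x - 2) / (x + 2)))"
    using x of_real_sqrt[of "(x - 2) / (x + 2)"] by simp
  moreover have "(x + 2) * sqrt ((x - 2) / (x + 2)) = sqrt (x\<^sup>2 - 4)"
  proof (rule real_sqrt_unique[symmetric])
    have "(x + 2)\<^sup>2 * ((x - 2) / (x + 2)) = (x + 2) * (x - 2)"
      using x by (simp add: power2_eq_square)
    also have "(x + 2) * (x - 2) = x\<^sup>2 - 4" by (simp add: power2_eq_square algebra_simps)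
    finally show "((x + 2) * sqrt ((x - 2) / (x + 2)))\<^sup>2 = x\<^sup>2 - 4"
      using x by (simp add: power_mult_distrib)
  qed (use x in simp)
  ultimately show ?thesis
    unfolding sqrt4_def by (metis of_real_add of_real_mult of_real_numeral)
qed

lemma sqrt4_boundary_values:
  assumes x: "x \<in> {-2..2}"
  shows "(sqrt4 \<longlongrightarrow> sqrt4 (of_real x)) (at (of_real x) within {z. 0 < Im z})"
proof (cases "x = 2 \<or> x = -2")
  case True
  have norm_eq: "norm (sqrt4 z) = sqrt (norm (z\<^sup>2 - 4))" for z
    by (metis norm_ge_zero norm_power real_sqrt_unique sqrt4_squared)
  have "((\<lambda>z. sqrt (norm (z\<^sup>2 - 4))) \<longlongrightarrow> sqrt (norm ((of_real x)\<^sup>2 - 4 :: complex)))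
          (at (of_real x) within {z. 0 < Im z})"
    by (intro tendsto_intros)
  moreover have "(of_real x)\<^sup>2 - 4 = (0 :: complex)" using True by auto
  ultimately have "((\<lambda>z. norm (sqrt4 z)) \<longlongrightarrow> 0) (at (of_real x) within {z. 0 < Im z})"
    by (simp add: norm_eq)
  moreover have "sqrt4 (of_real x) = 0" using True by (auto simp: sqrt4_def)
  ultimately show ?thesis by (simp add: tendsto_norm_zero_iff)
next
  case False
  hence x': "-2 < x" "x < 2" using x by auto
  define S where "S = {z. 0 < Im z}"
  define q :: "complex \<Rightarrow> complex" where "q = (\<lambda>z. (z - 2) / (z + 2))"
  have nz: "of_real x + 2 \<noteq> (0 :: complex)"
    using x' by (auto simp: complex_eq_iff)
  have qx: "q (of_real x) = of_real ((x - 2) / (x + 2))" by (simp add: q_def)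
  have neg: "(x - 2) / (x + 2) < 0" using x' by (simp add: divide_neg_pos)
  have rot: "csqrt w = \<i> * csqrt (- w)" if "Im w > 0 \<or> (Im w = 0 \<and> Re w < 0)" for w
  proof -
    have "csqrt (- (- w)) = \<i> * csqrt (- w)"
      using that by (intro csqrt_minus) auto
    thus ?thesis by simp
  qed
  have "(q \<longlongrightarrow> q (of_real x)) (at (of_real x) within S)"
    unfolding q_def by (intro tendsto_intros nz)
  moreover have "isCont csqrt (- q (of_real x))"
    using neg by (intro continuous_at_csqrt) (simp add: qx complex_nonpos_Reals_iff)
  ultimately have "((\<lambda>z. csqrt (- q z)) \<longlongrightarrow> csqrt (- q (of_real x))) (at (of_real x) within S)"
    by (intro isCont_tendsto_compose[of _ csqrt] tendsto_minus)
  hence lim: "((\<lambda>z. (z + 2) * (\<i> * csqrt (- q z))) \<longlongrightarrow>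
      (of_real x + 2) * (\<i> * csqrt (- q (of_real x)))) (at (of_real x) within S)"
    by (intro tendsto_intros)
  have *: "sqrt4 z = (z + 2) * (\<i> * csqrt (- q z))" if "z \<in> S" for z
  proof -
    have "z + 2 \<noteq> 0" using that by (auto simp: S_def complex_eq_iff)
    hence "q z = 1 - 4 / (z + 2)" by (simp add: q_def field_simps)
    moreover have "Im (4 / (z + 2)) < 0"
      using that by (simp add: S_def Im_divide divide_neg_pos sum_power2_gt_zero_iff)
    ultimately have "Im (q z) > 0" by simp
    hence "csqrt (q z) = \<i> * csqrt (- q z)" by (intro rot) simp
    thus ?thesis by (simp add: sqrt4_def q_def)
  qed
  have "sqrt4 (of_real x) = (of_real x + 2) * csqrt (q (of_real x))"
    by (simp add: sqrt4_def q_def)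
  also have "csqrt (q (of_real x)) = \<i> * csqrt (- q (of_real x))"
    by (rule rot) (simp only: qx Im_complex_of_real Re_complex_of_real neg, simp)
  finally show ?thesis
    using lim * unfolding S_def[symmetric]
    by (metis (no_types, lifting) Lim_transform_within_set_eq Lim_cong_within)
qed

(* psi maps rho R < |w| < 1 into G1 R, so \<phi> \<circ> psi R is given there, and a meromorphic function
   on the annulus r < |w| < 1 / rho R is determined by it. Nicely meromorphic functions have
   their removable singularities removed and take the dummy value 0 at poles. *)
definition mero_continuation :: "real \<Rightarrow> (complex \<Rightarrow> complex) \<Rightarrow> real \<Rightarrow> (complex \<Rightarrow> complex) \<Rightarrow> bool" where
  "mero_continuation R \<phi> r h \<longleftrightarrow>
     h nicely_meromorphic_on {w. r < cmod w \<and> cmod w < 1 / rho R} \<and>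
     (\<forall>w. rho R < cmod w \<and> cmod w < 1 \<longrightarrow> h w = \<phi> (psi R w))"

(* \<mu> is the smallest inner radius of a continuation, and h the continuation for that radius. *)
definition maximal_mero_continuation ::
    "real \<Rightarrow> (complex \<Rightarrow> complex) \<Rightarrow> real \<Rightarrow> (complex \<Rightarrow> complex) \<Rightarrow> bool" where
  "maximal_mero_continuation R \<phi> \<mu> h \<longleftrightarrow>
     0 \<le> \<mu> \<and> \<mu> \<le> rho R \<and> mero_continuation R \<phi> \<mu> h \<and>
     (\<forall>r h'. 0 \<le> r \<and> r \<le> rho R \<and> mero_continuation R \<phi> r h' \<longrightarrow> \<mu> \<le> r)"

(* Poles are excluded explicitly because of their dummy value 0. *)
definition solutions :: "(complex \<Rightarrow> complex) \<Rightarrow> real \<Rightarrow> (complex \<Rightarrow> complex) \<Rightarrow> complex \<Rightarrow> complex set" where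
  "solutions \<phi> \<mu> h z = {w. \<mu> < cmod w \<and> cmod w < 1 \<and> \<not> is_pole h w \<and> h w = \<phi> z}"

definition top_solutions :: "(complex \<Rightarrow> complex) \<Rightarrow> real \<Rightarrow> (complex \<Rightarrow> complex) \<Rightarrow> complex \<Rightarrow> complex set" where
  "top_solutions \<phi> \<mu> h z =
     {w \<in> solutions \<phi> \<mu> h z. \<forall>v \<in> solutions \<phi> \<mu> h z. cmod v \<le> cmod w}"

definition multiplicity_at :: "(complex \<Rightarrow> complex) \<Rightarrow> complex \<Rightarrow> int" where
  "multiplicity_at h w = zorder (\<lambda>v. h v - h w) w"

definition Sigma_all :: "real \<Rightarrow> (complex \<Rightarrow> complex) \<Rightarrow> real \<Rightarrow> (complex \<Rightarrow> complex) \<Rightarrow> complex set" where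
  "Sigma_all R \<phi> \<mu> h = {z \<in> G1 R. solutions \<phi> \<mu> h z \<noteq> {}}"

definition Sigma_zero :: "real \<Rightarrow> (complex \<Rightarrow> complex) \<Rightarrow> real \<Rightarrow> (complex \<Rightarrow> complex) \<Rightarrow> complex set" where
  "Sigma_zero R \<phi> \<mu> h = G1 R - Sigma_all R \<phi> \<mu> h"

(* Meant for p \<ge> 1. *)
definition Sigma_level ::
    "real \<Rightarrow> (complex \<Rightarrow> complex) \<Rightarrow> real \<Rightarrow> (complex \<Rightarrow> complex) \<Rightarrow> nat \<Rightarrow> complex set" where
  "Sigma_level R \<phi> \<mu> h p =
     {z \<in> Sigma_all R \<phi> \<mu> h. (\<Sum>w\<in>top_solutions \<phi> \<mu> h z. multiplicity_at h w) = int p}"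

definition x_mu :: "real \<Rightarrow> real" where
  "x_mu \<mu> = (1 + \<mu>\<^sup>2)\<^sup>2 - 2"

definition sine_quotient :: "nat \<Rightarrow> real \<Rightarrow> real" where
  "sine_quotient n \<theta> =
     (if \<theta> = 0 then Lim (at 0) (\<lambda>t. sin ((real n + 2) * t / 2) / (2 * sin t))
      else sin ((real n + 2) * \<theta> / 2) / (2 * sin \<theta>))"

lemma sine_quotient_0: "sine_quotient n 0 = (real n + 2) / 4"
proof -
  have "((\<lambda>t. sin (a * t / 2) / (2 * sin t)) \<longlongrightarrow> a / 4) (at 0)" for a :: real
  proof -
    have "((\<lambda>t. sin (a * t / 2) / t) \<longlongrightarrow> a / 2) (at 0)"
    proof -
      have "((\<lambda>t. sin (a * t / 2)) has_real_derivative a / 2) (at 0)"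
        by (auto intro!: derivative_eq_intros)
      from DERIV_D[OF this] show ?thesis by simp
    qed
    moreover have "((\<lambda>t. 2 * (sin t / t)) \<longlongrightarrow> 2 * 1) (at (0::real))"
      using DERIV_D[OF DERIV_sin[of 0]] by (intro tendsto_intros) simp
    ultimately have "((\<lambda>t. sin (a * t / 2) / t / (2 * (sin t / t))) \<longlongrightarrow> a / 2 / (2 * 1)) (at 0)"
      by (rule tendsto_divide) simp
    moreover have "\<forall>\<^sub>F t in at 0. sin (a * t / 2) / t / (2 * (sin t / t)) = sin (a * t / 2) / (2 * sin t)"
      by (auto simp: eventually_at_filter)
    ultimately show ?thesis
      by (auto elim: Lim_transform_eventually)
  qed
  from this[of "real n + 2"] show ?thesis
    unfolding sine_quotient_def by (simp only: simp_thms if_True, intro tendsto_Lim) simp_all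
qed

end

theory Submission
  imports Defs
begin

text \<open>
  Write \<open>z = J u = u + 1/u\<close>. In this coordinate the curve is the image of the circle
  \<open>|u + 1| = R\<close>, and the domain consists of the points \<open>J u\<close> with \<open>|u| \<ge> 1\<close> and \<open>|u + 1| < R\<close>
  (\<open>G1_eq\<close>). The two circles \<open>|u| = 1\<close> and \<open>|u + 1| = R\<close> are made concentric by a Moebius map
  \<open>u = U \<zeta>\<close>, \<open>1 + u = X \<zeta>\<close>: they become \<open>|\<zeta>| = 1\<close> and \<open>|\<zeta>| = 1/m\<close>, where \<open>m < 1\<close> solves
  \<open>m + 1/m = R\<close>, and \<open>u \<mapsto> 1/u\<close> becomes \<open>\<zeta> \<mapsto> 1/\<zeta>\<close>.

  \<^bold>\<open>Orthogonality.\<close> Let \<open>q_j\<close> be the normalised derivatives of the Faber polynomials, so that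
  \<open>q_j (J u) (1 - 1/u\<^sup>2) = (1 + u)^j - (1 + 1/u)^j / u\<^sup>2\<close>. Expanding \<open>p_n = \<Sum> c_j q_j\<close> and putting
  \<open>k x = \<Sum> c_j x^j\<close> gives \<open>p_n (J u) (1 - 1/u\<^sup>2) = k (1 + u) - k (1 + 1/u) / u\<^sup>2\<close>. In the variable
  \<open>log \<zeta>\<close> the area integral is over a rectangle, and it only involves the functions
  \<open>\<zeta>^i - \<zeta>^(-i)\<close>, which are orthogonal there. The result (\<open>gram_faber\<close>) is that the inner product
  of \<open>p_n\<close> and \<open>q_j\<close> is a known positive constant times the \<open>j\<close>-th Taylor coefficient of
  \<open>k - twist k\<close>, where \<open>twist\<close> is composition with the contraction \<open>\<zeta> \<mapsto> m^4 \<zeta>\<close>, as it acts on the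
  differential \<open>k (X) dX\<close>. Hence \<open>k - twist k\<close> is \<open>g x^n\<close> up to terms of degree above \<open>n\<close>; these
  terms come from \<open>twist k\<close>, which is holomorphic in a larger disc, so they are geometrically
  small, once the coefficients \<open>c_j\<close> are bounded a priori (\<open>gram_lower_bound\<close>).

  \<^bold>\<open>Error terms.\<close> Inverting \<open>1 - twist\<close> by a Neumann series writes \<open>k\<close> as \<open>g x^n\<close> plus an error that
  is governed by \<open>\<Sum> m^(4 i) |X (m^(4 i) \<zeta>)|^n\<close> over \<open>i \<ge> 1\<close> (\<open>main_error\<close>). The limit of the
  orbit is \<open>|X 0| = R m\<close>. If \<open>|X \<zeta>| \<ge> R m\<close>, the size of \<open>X\<close> drops along the orbit
  by at least the factor \<open>exp (- d m^(4 i))\<close>, and the sum is \<open>O(1/n) |X \<zeta>|^n\<close>; if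
  \<open>|X \<zeta>| \<ge> R m + \<delta>\<close>, it is geometrically small. Thus \<open>p_n (J u)\<close> is asymptotic to a multiple of
  \<open>q_n (J u)\<close>, with an error \<open>O(1/n) |1 + u|^n\<close> down to and including the critical circle
  \<open>|1 + u| = R m\<close> (\<open>uniform_error\<close>, \<open>geometric_error\<close>). For \<open>|u| > 1\<close> the term with \<open>1/u\<close> is
  negligible, which is the first formula. For \<open>u = e^(i \<theta>)\<close> both terms have the same size, and
  \<open>q_n (2 cos \<theta>)\<close> is the sine quotient, which is the second one. There the factor \<open>1 - 1/u\<^sup>2\<close>
  vanishes at \<open>z = 2\<close>, so near that point the error is estimated on a small circle around \<open>u = 1\<close>
  and transferred inwards by the maximum principle.

  \<^bold>\<open>The sets.\<close> Let \<open>h\<close> continue \<open>\<phi> (\<psi> w)\<close>. On \<open>|w| = 1\<close> we have \<open>|h| = 1\<close>, so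
  \<open>h (1 / cnj w) = 1 / cnj (h w)\<close>; together with the symmetry \<open>u \<mapsto> 1/u\<close> this gives
  \<open>h w = 1 / cnj (h (cnj (\<sigma> w)))\<close> with \<open>\<sigma> w = R - 1/w\<close>. The fixed point \<open>m\<close> of \<open>\<sigma>\<close> is repelling,
  and \<open>|w| - m\<close> grows under \<open>\<sigma>\<close>. The relation therefore continues \<open>h\<close> to \<open>|w| > m\<close>; it takes one
  value infinitely often near \<open>m\<close>, so \<open>m\<close> is the radius \<open>\<mu>\<close> (\<open>maximal_eq_m\<close>). Using the relation twice
  moves any solution of \<open>h w = \<phi> (J u)\<close> to a larger one, until it is one of \<open>(u + 1)/R\<close> and
  \<open>(1/u + 1)/R\<close>. Consequently \<open>\<Sigma>_0\<close> is given by \<open>|1 + u| \<le> R m\<close> (\<open>Sigma_zero_eq\<close>), and for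
  \<open>|u| = 1\<close> the two solutions are equally large or coincide, which excludes these points from
  \<open>\<Sigma>_1\<close> (\<open>Sigma_one_subset\<close>).
\<close>


section \<open>Change of variables for area integrals in the complex plane\<close>

unbundle no fps_syntax

text \<open>
  The change of variables theorem for Lebesgue integrals is about maps of \<open>real^'n\<close>;
  this isomorphism transports it to the complex plane.
\<close>

definition complex_of_vec :: "real^2 \<Rightarrow> complex" where
  "complex_of_vec v = Complex (v $ 1) (v $ 2)"

definition vec_of_complex :: "complex \<Rightarrow> real^2" where
  "vec_of_complex z = (\<chi> i. if i = 1 then Re z else Im z)"

lemma vec_of_complex_nth [simp]: "vec_of_complex z $ 1 = Re z" "vec_of_complex z $ 2 = Im z"
  by (auto simp: vec_of_complex_def)

lemma complex_of_vec_inverse [simp]: "vec_of_complex (complex_of_vec v) = v"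
  by (simp add: complex_of_vec_def vec_eq_iff forall_2)

lemma vec_of_complex_inverse [simp]: "complex_of_vec (vec_of_complex z) = z"
  by (simp add: complex_of_vec_def complex_eq_iff)

lemma bounded_linear_complex_of_vec: "bounded_linear complex_of_vec"
proof -
  have "linear complex_of_vec"
    by (auto intro!: linearI simp: complex_of_vec_def complex_eq_iff)
  thus ?thesis by (simp add: linear_conv_bounded_linear)
qed

lemma bounded_linear_vec_of_complex: "bounded_linear vec_of_complex"
proof -
  have "linear vec_of_complex"
    by (auto intro!: linearI simp: vec_eq_iff forall_2)
  thus ?thesis by (simp add: linear_conv_bounded_linear)
qed

lemma measurable_complex_of_vec [measurable]: "complex_of_vec \<in> borel_measurable borel"
  by (intro borel_measurable_continuous_onI linear_continuous_on bounded_linear_complex_of_vec)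

lemma measurable_vec_of_complex [measurable]: "vec_of_complex \<in> borel_measurable borel"
  by (intro borel_measurable_continuous_onI linear_continuous_on bounded_linear_vec_of_complex)

lemma Basis_vec2: "(Basis :: (real^2) set) = {axis 1 1, axis 2 1}"
  by (auto simp: Basis_vec_def UNIV_2)

lemma lborel_complex_of_vec: "distr lborel borel complex_of_vec = lborel"
proof (rule lborel_eqI [symmetric])
  fix l u :: complex
  assume le: "\<And>b. b \<in> Basis \<Longrightarrow> l \<bullet> b \<le> u \<bullet> b"
  have "complex_of_vec -` box l u = box (vec_of_complex l) (vec_of_complex u)"
    by (auto simp: box_def complex_of_vec_def Basis_complex_def Basis_vec2 inner_axis inner_complex_def)
  hence "emeasure (distr lborel borel complex_of_vec) (box l u)
      = emeasure lborel (box (vec_of_complex l) (vec_of_complex u))"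
    by (simp add: emeasure_distr)
  also have "\<dots> = (\<Prod>b\<in>Basis. (vec_of_complex u - vec_of_complex l) \<bullet> b)"
    using le[of 1] le[of \<i>] by (intro emeasure_lborel_box)
      (auto simp: Basis_vec2 inner_axis Basis_complex_def inner_complex_def)
  also have "(\<Prod>b\<in>Basis. (vec_of_complex u - vec_of_complex l) \<bullet> b) = (\<Prod>b\<in>Basis. (u - l) \<bullet> b)"
    by (auto simp: Basis_vec2 inner_axis Basis_complex_def inner_complex_def axis_eq_axis)
  finally show "emeasure (distr lborel borel complex_of_vec) (box l u) = (\<Prod>b\<in>Basis. (u - l) \<bullet> b)" .
qed simp

lemma integral_complex_of_vec:
  fixes f :: "complex \<Rightarrow> complex"
  assumes "f \<in> borel_measurable borel"
  shows "(LINT v|lborel. f (complex_of_vec v)) = (LINT z|lborel. f z)"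
  using integral_distr[of complex_of_vec lborel borel f] assms
  by (simp add: lborel_complex_of_vec)

lemma integrable_complex_of_vec:
  fixes f :: "complex \<Rightarrow> complex"
  assumes "f \<in> borel_measurable borel"
  shows "integrable lborel (\<lambda>v. f (complex_of_vec v)) \<longleftrightarrow> integrable lborel f"
  using integrable_distr_eq[of complex_of_vec lborel borel f] assms
  by (simp add: lborel_complex_of_vec)

text \<open>
  The Jacobian of a holomorphic map: its real derivative is multiplication by a complex number.
\<close>

lemma det_matrix_complex_mult:
  "det (matrix (\<lambda>v. vec_of_complex (c * complex_of_vec v))) = (cmod c)\<^sup>2"
  by (simp add: det_2 matrix_def axis_def complex_of_vec_def cmod_power2)
     (simp add: power2_eq_square)

text \<open>
  This is the real change of variables theorem for the map \<open>g\<close> between planar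
  domains, whose Jacobian determinant is \<open>|g'|\<^sup>2\<close>.
\<close>

theorem holomorphic_change_of_variables:
  fixes f g :: "complex \<Rightarrow> complex"
  assumes S: "open S" and g: "g holomorphic_on S" and inj: "inj_on g S"
    and f: "set_integrable lborel (g ` S) f"
    and gS: "g ` S \<in> sets borel"
    and fm: "f \<in> borel_measurable borel"
  shows "(LINT z:g ` S|lborel. f z) = (LINT w:S|lborel. of_real ((cmod (deriv g w))\<^sup>2) * f (g w))"
proof -
  define T where "T = vec_of_complex ` S"
  define G where "G = (\<lambda>v. vec_of_complex (g (complex_of_vec v)))"
  define G' where "G' = (\<lambda>v w. vec_of_complex (deriv g (complex_of_vec v) * complex_of_vec w))"
  define F where "F = (\<lambda>v. vec_of_complex (f (complex_of_vec v)))"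
  have T_eq: "T = complex_of_vec -` S" unfolding T_def
    by (auto simp: image_iff) (metis complex_of_vec_inverse)
  have openT: "open T"
    unfolding T_eq using S
    by (metis bounded_linear_complex_of_vec continuous_open_vimage linear_continuous_at)
  have der: "(G has_derivative G' v) (at v within T)" if "v \<in> T" for v
  proof -
    have "complex_of_vec v \<in> S" using that by (simp add: T_eq)
    hence "(g has_field_derivative deriv g (complex_of_vec v)) (at (complex_of_vec v))"
      using g S holomorphic_derivI by blast
    hence "(g has_derivative (*) (deriv g (complex_of_vec v))) (at (complex_of_vec v))"
      by (simp add: has_field_derivative_def)
    thus ?thesis unfolding G_def G'_def
      using bounded_linear_complex_of_vec bounded_linear_vec_of_complex
      by (intro bounded_linear.has_derivative[OF bounded_linear_vec_of_complex]
         has_derivative_compose[OF bounded_linear.has_derivative[OF bounded_linear_complex_of_vec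
           has_derivative_ident]]) auto
  qed
  have injG: "inj_on G T"
    using inj unfolding G_def T_eq inj_on_def
    by (metis complex_of_vec_inverse vec_of_complex_inverse vimage_eq)
  have GT: "G ` T = complex_of_vec -` (g ` S)"
    unfolding G_def T_def by (auto simp: image_image image_iff) (metis complex_of_vec_inverse)
  have detG: "\<bar>det (matrix (G' v))\<bar> = (cmod (deriv g (complex_of_vec v)))\<^sup>2" for v
    unfolding G'_def by (simp add: det_matrix_complex_mult)
  let ?h = "\<lambda>z. indicator (g ` S) z *\<^sub>R f z"
  have hm: "?h \<in> borel_measurable borel" using gS fm by measurable
  have "integrable lborel (\<lambda>v. ?h (complex_of_vec v))"
    using f integrable_complex_of_vec[OF hm] by (simp add: set_integrable_def)
  hence 1: "set_integrable lborel (G ` T) (\<lambda>v. f (complex_of_vec v))"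
    by (simp add: set_integrable_def GT indicator_def)
  have vec_scaleR: "vec_of_complex (r *\<^sub>R z) = r *\<^sub>R vec_of_complex z" for r z
    using bounded_linear_vec_of_complex by (simp add: linear_simps)
  have 2: "set_integrable lborel (G ` T) F"
    using integrable_bounded_linear[OF bounded_linear_vec_of_complex 1[unfolded set_integrable_def]]
    by (simp add: set_integrable_def F_def vec_scaleR)
  have 3: "F absolutely_integrable_on (G ` T)"
    using 2 unfolding set_integrable_def by (subst integrable_completion) auto
  have Tl: "T \<in> sets lebesgue" using openT by auto
  let ?D = "\<lambda>v. \<bar>det (matrix (G' v))\<bar> *\<^sub>R F (G v)"
  let ?d = "\<lambda>w. of_real ((cmod (deriv g w))\<^sup>2) * f (g w)"
  note cv = has_absolute_integral_change_of_variables[OF Tl der injG, of F "integral (G ` T) F"]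
  have 4: "?D absolutely_integrable_on T" and 5: "integral T ?D = integral (G ` T) F"
    using cv 3 by auto
  have D_eq: "?D v = vec_of_complex (?d (complex_of_vec v))" for v
    by (simp add: detG F_def G_def flip: vec_scaleR) (simp add: scaleR_conv_of_real)
  have dm: "(\<lambda>w. indicator S w *\<^sub>R ?d w) \<in> borel_measurable borel"
  proof -
    have m1: "(\<lambda>w. indicator S w *\<^sub>R deriv g w) \<in> borel_measurable borel"
      using borel_measurable_continuous_on_indicator[of S "deriv g"] S g
      by (simp add: holomorphic_deriv holomorphic_on_imp_continuous_on)
    have m2: "(\<lambda>w. indicator S w *\<^sub>R g w) \<in> borel_measurable borel"
      using borel_measurable_continuous_on_indicator[of S g] S g
      by (simp add: holomorphic_on_imp_continuous_on)
    have "(\<lambda>w. indicator S w *\<^sub>R (of_real ((cmod (indicator S w *\<^sub>R deriv g w))\<^sup>2) *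
        f (indicator S w *\<^sub>R g w))) \<in> borel_measurable borel"
    proof -
      have "indicator S \<in> borel_measurable borel" using S by (simp add: borel_measurable_indicator)
      moreover have "(\<lambda>w. f (indicator S w *\<^sub>R g w)) \<in> borel_measurable borel"
        by (rule measurable_compose[OF m2 fm])
      moreover have "(\<lambda>w. complex_of_real ((cmod (indicator S w *\<^sub>R deriv g w))\<^sup>2)) \<in> borel_measurable borel"
        using measurable_compose[OF m1, of norm borel]
        by (intro measurable_compose[OF _ borel_measurable_of_real] borel_measurable_power) simp_all
      ultimately show ?thesis by (intro borel_measurable_scaleR borel_measurable_times)
    qed
    also have "(\<lambda>w. indicator S w *\<^sub>R (of_real ((cmod (indicator S w *\<^sub>R deriv g w))\<^sup>2) *
        f (indicator S w *\<^sub>R g w))) = (\<lambda>w. indicator S w *\<^sub>R ?d w)"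
      by (auto simp: indicator_def)
    finally show ?thesis .
  qed
  have ind: "indicator T v = (indicator S (complex_of_vec v) :: real)" for v
    by (simp add: T_eq indicator_def)
  have "(\<lambda>v. indicator T v *\<^sub>R ?D v) = (\<lambda>v. vec_of_complex (indicator S (complex_of_vec v) *\<^sub>R ?d (complex_of_vec v)))"
    by (simp only: D_eq ind vec_scaleR)
  moreover have "\<dots> \<in> borel_measurable borel" using dm by measurable
  ultimately have 6: "set_integrable lborel T ?D"
    using 4 by (simp add: set_integrable_def integrable_completion)
  have "vec_of_complex (LINT z:g ` S|lborel. f z) = vec_of_complex (LINT v|lborel. ?h (complex_of_vec v))"
    using integral_complex_of_vec[OF hm] by (simp add: set_lebesgue_integral_def)
  also have "\<dots> = (LINT v|lborel. vec_of_complex (?h (complex_of_vec v)))"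
    using integral_bounded_linear[OF bounded_linear_vec_of_complex 1[unfolded set_integrable_def]]
    by (simp add: GT indicator_def)
  also have "\<dots> = (LINT v:G ` T|lborel. F v)"
    by (simp add: set_lebesgue_integral_def F_def vec_scaleR GT indicator_def)
  also have "\<dots> = integral (G ` T) F"
    using set_borel_integral_eq_integral(2)[OF 2] .
  also have "\<dots> = (LINT v:T|lborel. ?D v)"
    using 5 set_borel_integral_eq_integral(2)[OF 6] by simp
  also have "\<dots> = (LINT v|lborel. vec_of_complex (indicator S (complex_of_vec v) *\<^sub>R ?d (complex_of_vec v)))"
    unfolding set_lebesgue_integral_def by (simp only: D_eq ind vec_scaleR)
  also have "\<dots> = vec_of_complex (LINT v|lborel. indicator S (complex_of_vec v) *\<^sub>R ?d (complex_of_vec v))"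
  proof (rule integral_bounded_linear[OF bounded_linear_vec_of_complex])
    have "integrable lborel (\<lambda>v. complex_of_vec (vec_of_complex (indicator S (complex_of_vec v) *\<^sub>R ?d (complex_of_vec v))))"
      using 6 unfolding set_integrable_def D_eq ind vec_scaleR [symmetric]
      by (rule integrable_bounded_linear[OF bounded_linear_complex_of_vec])
    thus "integrable lborel (\<lambda>v. indicator S (complex_of_vec v) *\<^sub>R ?d (complex_of_vec v))"
      by simp
  qed
  also have "(LINT v|lborel. indicator S (complex_of_vec v) *\<^sub>R ?d (complex_of_vec v)) = (LINT w:S|lborel. ?d w)"
    using integral_complex_of_vec[OF dm] by (simp add: set_lebesgue_integral_def)
  finally show ?thesis by (metis vec_of_complex_inverse)
qed

section \<open>The Joukowski coordinate\<close>

text \<open>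
  The Joukowski map. It is two-to-one, and \<open>u\<close> and \<open>1/u\<close> have the same
  image.
\<close>

definition jouk :: "complex \<Rightarrow> complex" where
  "jouk u = u + inverse u"

lemma jouk_inverse [simp]: "jouk (inverse u) = jouk u"
  by (simp add: jouk_def)

lemma jouk_eq_iff:
  assumes "u \<noteq> 0" "v \<noteq> 0"
  shows "jouk u = jouk v \<longleftrightarrow> u = v \<or> u * v = 1"
proof -
  have "jouk u - jouk v = (u - v) * (u * v - 1) / (u * v)"
    using assms by (simp add: jouk_def field_simps)
  hence "jouk u - jouk v = 0 \<longleftrightarrow> (u - v = 0 \<or> u * v - 1 = 0)"
    using assms by simp
  thus ?thesis by auto
qed

lemma jouk_surj: obtains u where "1 \<le> cmod u" "jouk u = z"
proof -
  define s where "s = csqrt (z\<^sup>2 / 4 - 1)"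
  have s2: "s\<^sup>2 = z\<^sup>2 / 4 - 1" by (simp add: s_def)
  define u where "u = z / 2 + s"
  define v where "v = z / 2 - s"
  have uv: "u * v = 1" using s2 by (simp add: u_def v_def algebra_simps power2_eq_square)
  have nz: "u \<noteq> 0" "v \<noteq> 0" using uv by auto
  have v: "inverse u = v" "inverse v = u" using uv nz by (auto simp: field_simps)
  have j: "jouk u = z" "jouk v = z" by (auto simp: jouk_def v) (auto simp: u_def v_def)
  have "cmod u * cmod v = 1" using uv by (metis norm_mult norm_one)
  hence "1 \<le> cmod u \<or> 1 \<le> cmod v"
    using mult_strict_mono[of "cmod u" 1 "cmod v" 1] by fastforce
  thus ?thesis using that j by blast
qed

text \<open>
  This makes \<open>jouk\<close> proper outside the unit disc, which is what the closedness of
  images rests on.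
\<close>

lemma jouk_norm_ge: "1 \<le> cmod u \<Longrightarrow> cmod u \<le> cmod (jouk u) + 1"
proof -
  assume u: "1 \<le> cmod u"
  have "cmod (jouk u - inverse u) \<le> cmod (jouk u) + cmod (inverse u)"
    by (rule norm_triangle_ineq4)
  hence "cmod u \<le> cmod (jouk u) + cmod (inverse u)" by (simp add: jouk_def)
  also have "cmod (inverse u) \<le> 1" using u by (simp add: norm_inverse inverse_le_1_iff)
  finally show ?thesis by simp
qed

lemma continuous_on_jouk: "(\<And>u. u \<in> S \<Longrightarrow> u \<noteq> 0) \<Longrightarrow> continuous_on S jouk"
  unfolding jouk_def by (intro continuous_intros) auto

lemma L1_eq: "L1 R = jouk ` {u. cmod (u + 1) = R}"
proof -
  have "\<exists>u. jouk (w - 1) = jouk u \<and> cmod (u + 1) = R" if "cmod w = R" for w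
    using that by (intro exI[of _ "w - 1"]) simp
  moreover have "\<exists>w. jouk u = jouk (w - 1) \<and> cmod w = R" if "cmod (u + 1) = R" for u
    using that by (intro exI[of _ "u + 1"]) simp
  ultimately show ?thesis unfolding L1_def jouk_def by blast
qed

text \<open>
  A convergent sequence of values has bounded preimages outside the unit disc, so a subsequence of
  these converges.
\<close>

lemma closed_jouk_image:
  assumes S: "closed S" and ge: "\<And>u. u \<in> S \<Longrightarrow> 1 \<le> cmod u"
  shows "closed (jouk ` S)"
proof -
  have "\<exists>u\<in>S. jouk u = z" if f: "\<forall>n. f n \<in> jouk ` S" and lim: "f \<longlonglongrightarrow> z" for f :: "nat \<Rightarrow> complex" and z
  proof -
    have "\<forall>n. \<exists>v. v \<in> S \<and> f n = jouk v" using f by auto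
    then obtain u where u: "\<And>n. u n \<in> S" "\<And>n. f n = jouk (u n)" by metis
    have "Bseq f" using lim by (intro convergent_imp_Bseq convergentI)
    then obtain B where B: "\<And>n. cmod (f n) \<le> B" by (auto simp: Bseq_def)
    have mem: "u n \<in> S \<inter> cball 0 (B + 1)" for n
      using u(1)[of n] u(2)[of n] ge[OF u(1)[of n]] jouk_norm_ge[of "u n"] B[of n] by simp
    moreover have "compact (S \<inter> cball 0 (B + 1))"
      using S by (simp add: closed_Int_compact)
    ultimately have "\<exists>l\<in>S \<inter> cball 0 (B + 1). \<exists>r. strict_mono r \<and> (u \<circ> r) \<longlonglongrightarrow> l"
      unfolding compact_def by simp
    then obtain l r where l: "l \<in> S" "strict_mono r" "(u \<circ> r) \<longlonglongrightarrow> l" by blast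
    have nz: "l \<noteq> 0" using ge[OF l(1)] by auto
    have "(\<lambda>n. jouk ((u \<circ> r) n)) \<longlonglongrightarrow> jouk l"
      unfolding jouk_def by (intro tendsto_intros l nz)
    moreover have "(\<lambda>n. jouk ((u \<circ> r) n)) = f \<circ> r" using u by auto
    moreover have "(f \<circ> r) \<longlonglongrightarrow> z" using lim l(2) by (rule LIMSEQ_subseq_LIMSEQ)
    ultimately have "jouk l = z" by (metis LIMSEQ_unique)
    thus ?thesis using l(1) by blast
  qed
  thus ?thesis unfolding closed_sequential_limits by blast
qed

lemma norm_ge_of_shift: "cmod (u + 1) \<ge> R \<Longrightarrow> cmod u \<ge> R - 1"
  using norm_triangle_ineq[of u 1] by simp

lemma connected_subset_closed_cover:
  assumes "closed P" "closed Q" "P \<union> Q = UNIV" "connected K" "z \<in> K" "K \<subseteq> - L" "P \<inter> Q \<subseteq> L" "z \<in> P"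
  shows "K \<subseteq> P"
  using connected_closedD[of K P Q] assms by blast

text \<open>
  The image of \<open>{|u| \<ge> 1, |u + 1| \<le> R}\<close> and the image of \<open>{|u + 1|
  \<ge> R}\<close> are closed, cover the plane and meet only in the curve, because
  \<open>jouk\<close> is injective outside the unit disc. A component of the complement lies in
  one of them; the first image is bounded, and the interior of the second is connected and
  unbounded.
\<close>

theorem G1_eq:
  assumes R: "R > 2"
  shows "G1 R = jouk ` {u. 1 \<le> cmod u \<and> cmod (u + 1) < R}"
proof -
  let ?A = "{u. 1 \<le> cmod u \<and> cmod (u + 1) < R}"
  let ?Ac = "{u. 1 \<le> cmod u \<and> cmod (u + 1) \<le> R}"
  let ?C = "{u. cmod (u + 1) = R}"
  let ?E = "{u. cmod (u + 1) > R}"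
  let ?Ec = "{u. cmod (u + 1) \<ge> R}"
  have big: "cmod u > 1" if "cmod (u + 1) \<ge> R" for u
    using norm_ge_of_shift[OF that] R by linarith
  \<comment> \<open>Equality would force u v = 1, but both moduli are at least 1 and the second one exceeds 1.\<close>
  have disj: "jouk u \<noteq> jouk v" if "u \<in> ?Ac" "v \<in> ?Ec" "u \<noteq> v" for u v
  proof
    assume "jouk u = jouk v"
    moreover have "u \<noteq> 0" using that(1) by auto
    moreover have "v \<noteq> 0" using that(2) big[of v] by auto
    ultimately have "u * v = 1" using that by (simp add: jouk_eq_iff)
    hence "cmod u * cmod v = 1" by (metis norm_mult norm_one)
    moreover have "cmod u * cmod v > 1" using that big[of v]
      using mult_le_less_imp_less[of 1 "cmod u" 1 "cmod v"] by simp
    ultimately show False by simp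
  qed
  have cont: "continuous_on ?Ac jouk" by (rule continuous_on_jouk) auto
  have "bounded ?Ac"
  proof (rule boundedI)
    fix u assume "u \<in> ?Ac" thus "cmod u \<le> R + 1"
      using norm_triangle_ineq4[of "u + 1" 1] by simp
  qed
  moreover have "closed ?Ac" by (intro closed_Collect_conj closed_Collect_le continuous_intros)
  ultimately have "compact ?Ac" by (simp only: compact_eq_bounded_closed)
  hence cpt: "compact (jouk ` ?Ac)" by (rule compact_continuous_image[OF cont])
  have clE: "closed (jouk ` ?Ec)"
  proof (rule closed_jouk_image)
    show "closed ?Ec" by (intro closed_Collect_le continuous_intros)
  qed (use big in \<open>auto intro: less_imp_le\<close>)
  have L1_sub: "L1 R \<subseteq> jouk ` ?Ac" "L1 R \<subseteq> jouk ` ?Ec"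
    unfolding L1_eq by (intro image_mono; use big in \<open>force intro: less_imp_le\<close>)+
  have inter: "jouk ` ?Ac \<inter> jouk ` ?Ec \<subseteq> L1 R"
  proof
    fix z assume "z \<in> jouk ` ?Ac \<inter> jouk ` ?Ec"
    then obtain u v where "u \<in> ?Ac" "v \<in> ?Ec" "z = jouk u" "z = jouk v" by blast
    hence "u = v" using disj[of u v] by metis
    hence "cmod (u + 1) = R" using \<open>u \<in> ?Ac\<close> \<open>v \<in> ?Ec\<close> by simp
    thus "z \<in> L1 R" using \<open>z = jouk u\<close> unfolding L1_eq by blast
  qed
  have cover: "jouk ` ?Ac \<union> jouk ` ?Ec = UNIV"
  proof -
    have "z \<in> jouk ` ?Ac \<union> jouk ` ?Ec" for z
    proof -
      obtain u where "1 \<le> cmod u" "jouk u = z" using jouk_surj .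
      thus ?thesis by (cases "cmod (u + 1) \<le> R") auto
    qed
    thus ?thesis by blast
  qed
  show ?thesis
  proof (intro equalityI subsetI)
    fix z assume z: "z \<in> jouk ` ?A"
    then obtain u where u: "u \<in> ?A" "z = jouk u" by blast
    have zL: "z \<notin> L1 R"
    proof
      assume "z \<in> L1 R"
      then obtain v where v: "cmod (v + 1) = R" "jouk u = jouk v" using u(2) by (auto simp: L1_eq)
      have "u \<noteq> v" using u(1) v(1) by auto
      with disj[of u v] u(1) v show False by simp
    qed
    define K where "K = connected_component_set (- L1 R) z"
    have "connected K" by (simp add: K_def)
    moreover have "z \<in> K" using zL by (simp add: K_def connected_component_refl_eq)
    moreover have "K \<subseteq> - L1 R" unfolding K_def by (rule connected_component_subset)
    moreover have "z \<in> jouk ` ?Ac" using u by auto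
    ultimately have "K \<subseteq> jouk ` ?Ac"
      by (rule connected_subset_closed_cover[OF compact_imp_closed[OF cpt] clE cover _ _ _ inter])
    hence "bounded K" using cpt bounded_subset compact_imp_bounded by blast
    thus "z \<in> G1 R" using zL by (simp add: G1_def inside_def K_def)
  next
    fix z assume z: "z \<in> G1 R"
    hence zL: "z \<notin> L1 R" and bd: "bounded (connected_component_set (- L1 R) z)"
      by (auto simp: G1_def inside_def)
    obtain u where u: "1 \<le> cmod u" "jouk u = z" using jouk_surj .
    show "z \<in> jouk ` ?A"
    proof (rule ccontr)
      assume "z \<notin> jouk ` ?A"
      with u have "cmod (u + 1) \<ge> R" by auto
      moreover have "cmod (u + 1) \<noteq> R" using zL u by (auto simp: L1_eq)
      ultimately have uE: "u \<in> ?E" by simp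
      have "dist (-1) u = cmod (u + 1)" for u :: complex
        by (metis dist_norm norm_minus_commute diff_minus_eq_add)
      hence E_eq: "?E = - cball (-1) R" by auto
      have "connected (- cball (-1::complex) R)"
        by (intro connected_complement_bounded_convex) auto
      hence "connected (jouk ` ?E)" unfolding E_eq[symmetric]
      proof (intro connected_continuous_image continuous_on_jouk)
        fix v assume "v \<in> ?E" thus "v \<noteq> 0" using big[of v] by auto
      qed
      moreover have "jouk ` ?E \<subseteq> - L1 R"
      proof -
        have "jouk v \<noteq> jouk w" if "v \<in> ?E" "cmod (w + 1) = R" for v w
        proof -
          have "w \<noteq> v" using that by auto
          with disj[of w v] big[of w] that show ?thesis by (metis (mono_tags, lifting) less_imp_le mem_Collect_eq order_refl)
        qed
        hence "y \<notin> L1 R" if "y \<in> jouk ` ?E" for y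
          using that unfolding L1_eq image_iff by (metis (mono_tags, lifting) mem_Collect_eq)
        thus ?thesis by (metis ComplI subsetI)
      qed
      moreover have "z \<in> jouk ` ?E" using uE u by blast
      ultimately have sub: "jouk ` ?E \<subseteq> connected_component_set (- L1 R) z"
        by (intro connected_component_maximal)
      have "bounded (jouk ` ?E)" using bd sub bounded_subset by blast
      then obtain B where B: "\<And>z. z \<in> jouk ` ?E \<Longrightarrow> cmod z \<le> B" by (auto simp: bounded_iff)
      define t where "t = max R (B + 2)"
      have "complex_of_real t + 1 = of_real (t + 1)" by simp
      hence "cmod (complex_of_real t + 1) = \<bar>t + 1\<bar>" by (simp only: norm_of_real)
      hence "cmod (complex_of_real t + 1) = t + 1" using R by (simp add: t_def)
      hence "complex_of_real t \<in> ?E" by (simp add: t_def)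
      hence "cmod (jouk (of_real t)) \<le> B" using B by blast
      moreover have "cmod (complex_of_real t) = t" using R by (simp add: t_def)
      moreover have "cmod (complex_of_real t) \<le> cmod (jouk (of_real t)) + 1"
        using R by (intro jouk_norm_ge) (simp add: t_def)
      ultimately show False by (simp add: t_def)
    qed
  qed
qed

section \<open>A coordinate in which both boundary circles are concentric\<close>

lemma cmod_one_plus_sq:
  "(cmod (1 + of_real c * \<zeta>))\<^sup>2 = 1 + 2 * c * Re \<zeta> + c\<^sup>2 * (cmod \<zeta>)\<^sup>2"
  unfolding cmod_power2 by (simp add: power2_eq_square algebra_simps)

lemma abs_less_iff_sq: "0 \<le> x \<Longrightarrow> 0 \<le> y \<Longrightarrow> x < y \<longleftrightarrow> x\<^sup>2 < (y::real)\<^sup>2"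
  by (meson power2_less_imp_less power_strict_mono zero_less_numeral)

locale outer_radius =
  fixes R :: real
  assumes R_gt_2: "R > 2"
begin

text \<open>
  The smaller root of \<open>m + 1/m = R\<close>. It turns out to be the inner radius
  \<open>\<mu>\<close> of the maximal continuation.
\<close>

definition m :: real where "m = (R - sqrt (R\<^sup>2 - 4)) / 2"

lemma disc_pos: "R\<^sup>2 - 4 > 0"
proof -
  have "2\<^sup>2 < R\<^sup>2" using R_gt_2 by (intro power_strict_mono) auto
  thus ?thesis by simp
qed

lemma m_quadratic: "m\<^sup>2 + 1 = R * m"
proof -
  have "(sqrt (R\<^sup>2 - 4))\<^sup>2 = R\<^sup>2 - 4" using disc_pos by simp
  thus ?thesis unfolding m_def by (simp add: power2_eq_square field_simps)
qed

lemma m_pos: "m > 0"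
proof -
  have "sqrt (R\<^sup>2 - 4) < sqrt (R\<^sup>2)" by (rule real_sqrt_less_mono) simp
  thus ?thesis using R_gt_2 by (simp add: m_def)
qed

lemma m_less_1: "m < 1"
proof (rule ccontr)
  assume "\<not> m < 1"
  have "(R - 2)\<^sup>2 < R\<^sup>2 - 4" using R_gt_2 by (simp add: power2_eq_square algebra_simps)
  hence "sqrt ((R - 2)\<^sup>2) < sqrt (R\<^sup>2 - 4)" by (rule real_sqrt_less_mono)
  thus False using R_gt_2 \<open>\<not> m < 1\<close> by (simp add: m_def)
qed

lemma R_sq: "R\<^sup>2 = (1 + m\<^sup>2)\<^sup>2 / m\<^sup>2"
proof -
  have "R\<^sup>2 * m\<^sup>2 = (1 + m\<^sup>2)\<^sup>2"
    unfolding power_mult_distrib[symmetric] m_quadratic[symmetric] by (simp add: add.commute)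
  thus ?thesis using m_pos by (simp add: field_simps)
qed

lemma m2: "m\<^sup>2 > 0" "m\<^sup>2 < 1" "m\<^sup>2 < m"
  using m_pos m_less_1 by (auto simp: power2_eq_square mult_less_cancel_left1 intro: mult_strict_mono[of m 1 m 1, simplified])

lemma m4: "m ^ 4 > 0" "m ^ 4 < 1"
  using m_pos m_less_1 by (auto simp: power_less_one_iff)

text \<open>
  The coordinates \<open>1 + u = X \<zeta>\<close> and \<open>u = U \<zeta>\<close>. The real
  Moebius map \<open>U\<close> preserves the unit circle and takes the circle \<open>|\<zeta>| =
  1/m\<close> to \<open>|u + 1| = R\<close>; the pole \<open>-1/m\<^sup>2\<close> lies outside
  both.
\<close>

definition X :: "complex \<Rightarrow> complex" where
  "X \<zeta> = of_real (1 + m\<^sup>2) * (1 + \<zeta>) / (1 + of_real (m\<^sup>2) * \<zeta>)"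

definition U :: "complex \<Rightarrow> complex" where
  "U \<zeta> = (\<zeta> + of_real (m\<^sup>2)) / (1 + of_real (m\<^sup>2) * \<zeta>)"

definition X' :: "complex \<Rightarrow> complex" where
  "X' \<zeta> = of_real ((1 + m\<^sup>2) * (1 - m\<^sup>2)) / (1 + of_real (m\<^sup>2) * \<zeta>)\<^sup>2"

lemma den_nz: "cmod \<zeta> < 1 / m\<^sup>2 \<Longrightarrow> 1 + of_real (m\<^sup>2) * \<zeta> \<noteq> 0"
proof
  assume z: "cmod \<zeta> < 1 / m\<^sup>2" and "1 + of_real (m\<^sup>2) * \<zeta> = 0"
  hence "of_real (m\<^sup>2) * \<zeta> = - 1" by (metis add.commute add_eq_0_iff)
  hence "cmod (of_real (m\<^sup>2) * \<zeta>) = 1" by simp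
  hence "m\<^sup>2 * cmod \<zeta> = 1" using m_pos by (simp add: norm_mult norm_power)
  thus False using z m2 by (simp add: field_simps)
qed

lemma inv_m_less: "1 < 1 / m" "1 / m < 1 / m\<^sup>2"
  using m_pos m_less_1 m2 by (simp_all only: less_divide_eq_1_pos divide_strict_left_mono mult_pos_pos zero_less_one)

lemma one_plus_m2_pos: "1 + m\<^sup>2 > 0"
  by (rule add_pos_nonneg) auto

lemma X_eq_U: "cmod \<zeta> < 1 / m\<^sup>2 \<Longrightarrow> X \<zeta> = U \<zeta> + 1"
  using den_nz[of \<zeta>] unfolding X_def U_def by (simp add: field_simps)

lemma X_norm_sq:
  "(cmod (X \<zeta>))\<^sup>2 = (1 + m\<^sup>2)\<^sup>2 * ((1 + 2 * Re \<zeta> + (cmod \<zeta>)\<^sup>2) / (1 + 2 * m\<^sup>2 * Re \<zeta> + m ^ 4 * (cmod \<zeta>)\<^sup>2))"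
proof -
  have n1: "cmod (complex_of_real (1 + m\<^sup>2)) = 1 + m\<^sup>2"
    using one_plus_m2_pos by (simp only: norm_of_real abs_of_pos)
  have n2: "(cmod (1 + \<zeta>))\<^sup>2 = 1 + 2 * Re \<zeta> + (cmod \<zeta>)\<^sup>2"
    using cmod_one_plus_sq[of 1 \<zeta>] by simp
  have n3: "(cmod (1 + of_real (m\<^sup>2) * \<zeta>))\<^sup>2 = 1 + 2 * m\<^sup>2 * Re \<zeta> + m ^ 4 * (cmod \<zeta>)\<^sup>2"
    using cmod_one_plus_sq[of "m\<^sup>2" \<zeta>] by (simp add: power_mult[symmetric] del: of_real_power)
  have "cmod (X \<zeta>) = (1 + m\<^sup>2) * cmod (1 + \<zeta>) / cmod (1 + of_real (m\<^sup>2) * \<zeta>)"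
    unfolding X_def norm_divide norm_mult n1 ..
  thus ?thesis
    by (simp only: power_divide power_mult_distrib n2 n3 times_divide_eq_right)
qed

lemma den_sq_pos:
  assumes "cmod \<zeta> < 1 / m\<^sup>2"
  shows "1 + 2 * m\<^sup>2 * Re \<zeta> + m ^ 4 * (cmod \<zeta>)\<^sup>2 > 0"
proof -
  have "(cmod (1 + of_real (m\<^sup>2) * \<zeta>))\<^sup>2 > 0" using den_nz[OF assms] by simp
  thus ?thesis unfolding cmod_one_plus_sq by (simp add: power_mult[symmetric])
qed

lemma X_less_R_iff:
  assumes "cmod \<zeta> < 1 / m\<^sup>2"
  shows "cmod (X \<zeta>) < R \<longleftrightarrow> cmod \<zeta> < 1 / m"
proof -
  let ?a = "Re \<zeta>" and ?b = "(cmod \<zeta>)\<^sup>2"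
  let ?D = "1 + 2 * m\<^sup>2 * ?a + m ^ 4 * ?b"
  note D = den_sq_pos[OF assms]
  have "cmod (X \<zeta>) < R \<longleftrightarrow> (cmod (X \<zeta>))\<^sup>2 < R\<^sup>2"
    by (rule abs_less_iff_sq) (use R_gt_2 in auto)
  also have "\<dots> \<longleftrightarrow> (1 + m\<^sup>2)\<^sup>2 * ((1 + 2 * ?a + ?b) / ?D) < (1 + m\<^sup>2)\<^sup>2 * (1 / m\<^sup>2)"
    unfolding X_norm_sq R_sq by simp
  also have "\<dots> \<longleftrightarrow> (1 + 2 * ?a + ?b) / ?D < 1 / m\<^sup>2"
    using one_plus_m2_pos by (intro mult_less_cancel_left_pos zero_less_power)
  also have "\<dots> \<longleftrightarrow> m\<^sup>2 * (1 + 2 * ?a + ?b) < ?D"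
    using D m2 by (simp add: field_simps)
  also have "\<dots> \<longleftrightarrow> 0 < (1 - m\<^sup>2) * (1 - m\<^sup>2 * ?b)"
    by (simp add: algebra_simps power2_eq_square power4_eq_xxxx)
  also have "\<dots> \<longleftrightarrow> m\<^sup>2 * ?b < 1"
    using m2 by (simp add: zero_less_mult_iff)
  also have "\<dots> \<longleftrightarrow> (m * cmod \<zeta>)\<^sup>2 < 1\<^sup>2" by (simp add: power_mult_distrib)
  also have "\<dots> \<longleftrightarrow> m * cmod \<zeta> < 1"
    by (rule abs_less_iff_sq[symmetric]) (use m_pos in auto)
  finally show ?thesis using m_pos by (simp add: field_simps)
qed

lemma U_norm_sq_diff:
  "(cmod (\<zeta> + of_real (m\<^sup>2)))\<^sup>2 - (cmod (1 + of_real (m\<^sup>2) * \<zeta>))\<^sup>2 = ((cmod \<zeta>)\<^sup>2 - 1) * (1 - m ^ 4)"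
  unfolding cmod_power2 by (simp add: power2_eq_square power4_eq_xxxx algebra_simps)

lemma U_ge_1_iff:
  assumes "cmod \<zeta> < 1 / m\<^sup>2"
  shows "1 \<le> cmod (U \<zeta>) \<longleftrightarrow> 1 \<le> cmod \<zeta>"
proof -
  have "1 \<le> cmod (U \<zeta>) \<longleftrightarrow> cmod (1 + of_real (m\<^sup>2) * \<zeta>) \<le> cmod (\<zeta> + of_real (m\<^sup>2))"
    using den_nz[OF assms] by (simp add: U_def norm_divide field_simps)
  also have "\<dots> \<longleftrightarrow> (cmod (1 + of_real (m\<^sup>2) * \<zeta>))\<^sup>2 \<le> (cmod (\<zeta> + of_real (m\<^sup>2)))\<^sup>2"
    by simp
  also have "\<dots> \<longleftrightarrow> 0 \<le> ((cmod \<zeta>)\<^sup>2 - 1) * (1 - m ^ 4)"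
    unfolding U_norm_sq_diff[symmetric] by linarith
  also have "\<dots> \<longleftrightarrow> 1\<^sup>2 \<le> (cmod \<zeta>)\<^sup>2" using m4 by (simp add: zero_le_mult_iff)
  also have "\<dots> \<longleftrightarrow> 1 \<le> cmod \<zeta>" by (rule power2_le_iff_abs_le[THEN trans]) auto
  finally show ?thesis .
qed

text \<open>
  \<open>U\<close> is a real Moebius map preserving the unit circle, so it commutes with the
  inversion.
\<close>

lemma U_inverse: "\<zeta> \<noteq> 0 \<Longrightarrow> U (inverse \<zeta>) = inverse (U \<zeta>)"
proof -
  assume z: "\<zeta> \<noteq> 0"
  have "U (inverse \<zeta>) = ((inverse \<zeta> + of_real (m\<^sup>2)) * \<zeta>) / ((1 + of_real (m\<^sup>2) * inverse \<zeta>) * \<zeta>)"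
    using z by (simp add: U_def)
  also have "\<dots> = (1 + of_real (m\<^sup>2) * \<zeta>) / (\<zeta> + of_real (m\<^sup>2))"
    using z by (simp add: algebra_simps)
  also have "\<dots> = inverse (U \<zeta>)" by (simp add: U_def)
  finally show ?thesis .
qed

lemma U_inj: "inj_on U {\<zeta>. cmod \<zeta> < 1 / m\<^sup>2}"
proof (rule inj_onI)
  fix a b assume a: "a \<in> {\<zeta>. cmod \<zeta> < 1 / m\<^sup>2}" and b: "b \<in> {\<zeta>. cmod \<zeta> < 1 / m\<^sup>2}" and eq: "U a = U b"
  have na: "1 + of_real (m\<^sup>2) * a \<noteq> 0" and nb: "1 + of_real (m\<^sup>2) * b \<noteq> 0"
    using a b by (auto intro!: den_nz simp del: of_real_power)
  have "(a + of_real (m\<^sup>2)) * (1 + of_real (m\<^sup>2) * b) = (b + of_real (m\<^sup>2)) * (1 + of_real (m\<^sup>2) * a)"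
    using eq unfolding U_def frac_eq_eq[OF na nb] .
  hence "(a - b) * of_real (1 - m ^ 4) = 0"
    by (simp add: algebra_simps power2_eq_square power4_eq_xxxx)
  hence "a - b = 0 \<or> complex_of_real (1 - m ^ 4) = 0" by (simp only: mult_eq_0_iff)
  moreover have "complex_of_real (1 - m ^ 4) \<noteq> 0" using m4 by (metis of_real_eq_0_iff less_irrefl diff_gt_0_iff_gt)
  ultimately show "a = b" by simp
qed

lemma U_surj:
  assumes "cmod (u + 1) \<le> R"
  obtains \<zeta> where "cmod \<zeta> \<le> 1 / m" "U \<zeta> = u"
proof -
  define M where "M = complex_of_real (m\<^sup>2)"
  define \<zeta> where "\<zeta> = (u - M) / (1 - M * u)"
  have RM: "R < 1 / m\<^sup>2 + 1"
  proof -
    have "m * (1 + m\<^sup>2) < 1 * (1 + m\<^sup>2)"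
      using one_plus_m2_pos m_less_1 by (rule mult_strict_right_mono[rotated])
    moreover have "m\<^sup>2 * R = m * (m\<^sup>2 + 1)" unfolding m_quadratic by (simp add: power2_eq_square)
    ultimately have "m\<^sup>2 * R < 1 + m\<^sup>2" by (simp add: add.commute)
    thus ?thesis using m2 by (simp add: field_simps)
  qed
  have nz: "1 - M * u \<noteq> 0"
  proof
    assume "1 - M * u = 0"
    hence "u = of_real (1 / m\<^sup>2)" using m2 by (simp add: M_def field_simps)
    hence "u + 1 = of_real (1 / m\<^sup>2 + 1)" by simp
    hence "cmod (u + 1) = \<bar>1 / m\<^sup>2 + 1\<bar>" by (simp only: norm_of_real)
    hence "cmod (u + 1) = 1 / m\<^sup>2 + 1" using m2 by simp
    thus False using assms RM by linarith
  qed
  have M4: "1 - M * M \<noteq> 0"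
  proof
    assume "1 - M * M = 0"
    hence "complex_of_real (m ^ 4) = of_real 1" by (simp add: M_def power2_eq_square power4_eq_xxxx mult.assoc)
    thus False using m4 by (metis of_real_eq_iff less_irrefl)
  qed
  have e1: "1 + M * \<zeta> = (1 - M * M) / (1 - M * u)" using nz by (simp add: \<zeta>_def field_simps)
  have e2: "\<zeta> + M = u * (1 - M * M) / (1 - M * u)" using nz by (simp add: \<zeta>_def field_simps)
  have Uz: "U \<zeta> = u" unfolding U_def M_def[symmetric] e1 e2 using nz M4 by simp
  have norm: "(cmod (u - M))\<^sup>2 * m\<^sup>2 \<le> (cmod (1 - M * u))\<^sup>2"
  proof -
    have "(cmod (u + 1))\<^sup>2 \<le> R\<^sup>2" using assms R_gt_2 by (intro power_mono) auto
    moreover have "(cmod (1 - M * u))\<^sup>2 - (cmod (u - M))\<^sup>2 * m\<^sup>2 = (1 - m\<^sup>2) * ((1 + m\<^sup>2)\<^sup>2 - m\<^sup>2 * (cmod (u + 1))\<^sup>2)"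
      unfolding cmod_power2 M_def by (simp add: power2_eq_square algebra_simps)
    moreover have "m\<^sup>2 * R\<^sup>2 = (1 + m\<^sup>2)\<^sup>2" using m_quadratic by (metis add.commute mult.commute power_mult_distrib)
    ultimately show ?thesis using m2
      by (smt (verit) mult_left_mono mult_nonneg_nonneg)
  qed
  have "cmod (u - M) * m \<le> cmod (1 - M * u)"
    by (rule power2_le_imp_le) (use norm in \<open>auto simp: power_mult_distrib\<close>)
  hence "cmod \<zeta> \<le> 1 / m" using nz m_pos by (simp add: \<zeta>_def norm_divide field_simps)
  thus ?thesis using Uz that by blast
qed

lemma X_has_deriv:
  assumes "cmod \<zeta> < 1 / m\<^sup>2"
  shows "(X has_field_derivative X' \<zeta>) (at \<zeta>)"
proof -
  have nz: "1 + of_real (m\<^sup>2) * \<zeta> \<noteq> 0" using den_nz[OF assms] .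
  show ?thesis unfolding X_def X'_def
    by (rule derivative_eq_intros refl nz)+
       (use nz in \<open>simp add: field_simps power2_eq_square\<close>)
qed

lemma U_has_deriv:
  assumes "cmod \<zeta> < 1 / m\<^sup>2"
  shows "(U has_field_derivative X' \<zeta>) (at \<zeta>)"
proof -
  have nz: "1 + of_real (m\<^sup>2) * \<zeta> \<noteq> 0" using den_nz[OF assms] .
  show ?thesis unfolding U_def X'_def
    by (rule derivative_eq_intros refl nz)+
       (use nz in \<open>simp add: field_simps power2_eq_square\<close>)
qed

lemma X'_nz: "cmod \<zeta> < 1 / m\<^sup>2 \<Longrightarrow> X' \<zeta> \<noteq> 0"
proof -
  assume "cmod \<zeta> < 1 / m\<^sup>2"
  moreover have "(1 + m\<^sup>2) * (1 - m\<^sup>2) \<noteq> 0" using m2 one_plus_m2_pos by simp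
  ultimately show ?thesis using den_nz[of \<zeta>] unfolding X'_def
    by (simp del: of_real_mult of_real_power)
qed

text \<open>
  The contraction \<open>\<zeta> \<mapsto> m^4 \<zeta>\<close> is the composition of the
  inversions in \<open>|\<zeta>| = 1\<close> and \<open>|\<zeta>| = 1/m\<close>, applied twice. In
  the coordinate \<open>x = X \<zeta>\<close> it becomes the Moebius map \<open>x \<mapsto> 1 + 1
  / (R\<^sup>2 - 1 - x)\<close>; the second identity is its derivative.
\<close>

lemma X_scaled:
  assumes "cmod \<zeta> < 1 / m\<^sup>2"
  shows "X (of_real (m ^ 4) * \<zeta>) * (of_real (R\<^sup>2 - 1) - X \<zeta>) = of_real (R\<^sup>2) - X \<zeta>"
        "of_real (m ^ 4) * X' (of_real (m ^ 4) * \<zeta>) * (of_real (R\<^sup>2 - 1) - X \<zeta>)\<^sup>2 = X' \<zeta>"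
        "of_real (R\<^sup>2 - 1) - X \<zeta> \<noteq> 0"
proof -
  define M where "M = complex_of_real m"
  define \<xi> where "\<xi> = of_real (m ^ 4) * \<zeta>"
  have "cmod \<xi> = m ^ 4 * cmod \<zeta>" using m_pos by (simp add: \<xi>_def norm_mult norm_power)
  also have "\<dots> \<le> cmod \<zeta>" using m4 by (simp add: mult_left_le_one_le)
  finally have c: "cmod \<xi> < 1 / m\<^sup>2" using assms by linarith
  have n1: "1 + M\<^sup>2 * \<zeta> \<noteq> 0" using den_nz[OF assms] by (simp add: M_def)
  have n2: "1 + M\<^sup>2 * (M ^ 4 * \<zeta>) \<noteq> 0" using den_nz[OF c] by (simp add: M_def \<xi>_def)
  have M0: "M \<noteq> 0" using m_pos by (simp add: M_def)
  have RM: "complex_of_real R = (1 + M\<^sup>2) / M" 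
  proof -
    have "complex_of_real R * M = 1 + M\<^sup>2"
      using arg_cong[OF m_quadratic, of complex_of_real] by (simp add: M_def add.commute)
    thus ?thesis using M0 by (simp add: field_simps)
  qed
  have e0: "of_real (R\<^sup>2 - 1) - X \<zeta> = (1 + M\<^sup>2 + M ^ 4) / M\<^sup>2 - (1 + M\<^sup>2) * (1 + \<zeta>) / (1 + M\<^sup>2 * \<zeta>)"
    using M0 by (simp add: RM X_def M_def[symmetric] field_simps power4_eq_xxxx power2_eq_square)
  also have "\<dots> = (1 + M\<^sup>2 * (M ^ 4 * \<zeta>)) / (M\<^sup>2 * (1 + M\<^sup>2 * \<zeta>))"
    using M0 n1 by (simp add: field_simps power2_eq_square power4_eq_xxxx)
  finally have e1: "of_real (R\<^sup>2 - 1) - X \<zeta> = (1 + M\<^sup>2 * (M ^ 4 * \<zeta>)) / (M\<^sup>2 * (1 + M\<^sup>2 * \<zeta>))" .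
  show "of_real (R\<^sup>2 - 1) - X \<zeta> \<noteq> 0" unfolding e1 using n1 n2 M0 by simp
  have "of_real (R\<^sup>2) - X \<zeta> = 1 + (of_real (R\<^sup>2 - 1) - X \<zeta>)" by simp
  also have "\<dots> = (1 + M\<^sup>2) * (1 + M ^ 4 * \<zeta>) / (M\<^sup>2 * (1 + M\<^sup>2 * \<zeta>))"
  proof -
    have D: "M\<^sup>2 * (1 + M\<^sup>2 * \<zeta>) \<noteq> 0" using n1 M0 by simp
    have "M\<^sup>2 * (1 + M\<^sup>2 * \<zeta>) + (1 + M\<^sup>2 * (M ^ 4 * \<zeta>)) = (1 + M\<^sup>2) * (1 + M ^ 4 * \<zeta>)"
      by algebra
    thus ?thesis unfolding e1 using D by (metis add_divide_distrib divide_self)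
  qed
  finally have e2: "of_real (R\<^sup>2) - X \<zeta> = (1 + M\<^sup>2) * (1 + M ^ 4 * \<zeta>) / (M\<^sup>2 * (1 + M\<^sup>2 * \<zeta>))" .
  have e3: "X \<xi> = (1 + M\<^sup>2) * (1 + M ^ 4 * \<zeta>) / (1 + M\<^sup>2 * (M ^ 4 * \<zeta>))"
    by (simp add: X_def M_def \<xi>_def)
  show "X (of_real (m ^ 4) * \<zeta>) * (of_real (R\<^sup>2 - 1) - X \<zeta>) = of_real (R\<^sup>2) - X \<zeta>"
    unfolding \<xi>_def[symmetric] e1 e2 e3 using n2 by simp
  have e4: "X' \<xi> = (1 + M\<^sup>2) * (1 - M\<^sup>2) / (1 + M\<^sup>2 * (M ^ 4 * \<zeta>))\<^sup>2"
    by (simp add: X'_def M_def \<xi>_def)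
  have e5: "X' \<zeta> = (1 + M\<^sup>2) * (1 - M\<^sup>2) / (1 + M\<^sup>2 * \<zeta>)\<^sup>2"
    by (simp add: X'_def M_def)
  have e6: "complex_of_real (m ^ 4) = M ^ 4" by (simp add: M_def)
  have M40: "M ^ 4 = (M\<^sup>2)\<^sup>2" by simp
  show "of_real (m ^ 4) * X' (of_real (m ^ 4) * \<zeta>) * (of_real (R\<^sup>2 - 1) - X \<zeta>)\<^sup>2 = X' \<zeta>"
    unfolding \<xi>_def[symmetric] unfolding e1 e4 e5 e6 using n2 M0
    by (simp add: power_divide power_mult_distrib)
qed

end

section \<open>Normalised derivatives of Faber polynomials\<close>

text \<open>
  \<open>faber j\<close> is \<open>F' / (j + 1)\<close> for \<open>F (J u) = (1 + u)^(j+1) + (1 +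
  1/u)^(j+1)\<close>, which is up to scaling and an additive constant the Faber polynomial of
  degree \<open>j + 1\<close> of the domain.
\<close>

fun faber :: "nat \<Rightarrow> complex poly" where
  "faber 0 = 1"
| "faber (Suc 0) = [:1, 1:]"
| "faber (Suc (Suc j)) = [:2, 1:] * (faber (Suc j) - faber j)"

lemma degree_faber: "degree (faber j) = j \<and> lead_coeff (faber j) = 1"
proof (induction j rule: faber.induct)
  case (3 j)
  have d: "degree (faber (Suc j) - faber j) = Suc j"
    using 3 degree_add_eq_left[of "- faber j" "faber (Suc j)"] by simp
  hence l: "lead_coeff (faber (Suc j) - faber j) = 1"
    using 3 by (simp add: coeff_eq_0) (metis)
  have nz: "faber (Suc j) - faber j \<noteq> 0" using d by (metis degree_0 nat.distinct(1))
  have "degree ([:2, 1::complex:] * (faber (Suc j) - faber j)) = degree [:2, 1::complex:] + degree (faber (Suc j) - faber j)"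
    by (rule degree_mult_eq) (use nz in auto)
  moreover have "lead_coeff ([:2, 1::complex:] * (faber (Suc j) - faber j)) = 1"
    unfolding lead_coeff_mult l by simp
  ultimately show ?case using d by simp
qed auto

text \<open>
  Both \<open>1 + u\<close> and \<open>1 + 1/u\<close> are roots of \<open>x\<^sup>2 = (z + 2) (x
  - 1)\<close> with \<open>z = jouk u\<close>, so both terms on the right satisfy the recurrence
  that defines \<open>faber\<close>.
\<close>

lemma faber_jouk:
  assumes "u \<noteq> 0"
  shows "poly (faber j) (jouk u) * (1 - 1 / u\<^sup>2) = (1 + u) ^ j - (1 + 1 / u) ^ j / u\<^sup>2"
proof (induction j rule: faber.induct)
  case 2
  show ?case using assms by (simp add: jouk_def field_simps power2_eq_square)
next
  case (3 j)
  have c: "2 + jouk u = (1 + u) * (1 + 1 / u)" "2 + jouk u = (1 + u) + (1 + 1 / u)"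
    using assms by (simp_all add: jouk_def field_simps)
  have gen: "k * ((a - b / s) - (c - d / s)) = k * (a - c) - k * (b - d) / s" for k a b c d s :: complex
    by (simp add: algebra_simps diff_divide_distrib)
  have rec: "(2 + jouk u) * (a ^ Suc j - a ^ j) = a ^ Suc (Suc j)" if "a = 1 + u \<or> a = 1 + 1 / u" for a
  proof -
    have "(2 + jouk u) * (1 + u - 1) = (1 + u)\<^sup>2" "(2 + jouk u) * (1 + 1 / u - 1) = (1 + 1 / u)\<^sup>2"
      using assms by (simp_all add: jouk_def field_simps power2_eq_square)
    hence "(2 + jouk u) * (a - 1) = a\<^sup>2" using that by metis
    hence "(2 + jouk u) * (a - 1) * a ^ j = a\<^sup>2 * a ^ j" by simp
    thus ?thesis by (simp add: algebra_simps power2_eq_square)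
  qed
  have "poly (faber (Suc (Suc j))) (jouk u) * (1 - 1 / u\<^sup>2) =
     (2 + jouk u) * (poly (faber (Suc j)) (jouk u) * (1 - 1 / u\<^sup>2) - poly (faber j) (jouk u) * (1 - 1 / u\<^sup>2))"
    by (simp only: faber.simps poly_mult poly_diff left_diff_distrib right_diff_distrib mult.assoc)
       (simp add: add.commute)
  also have "\<dots> = (2 + jouk u) * (((1 + u) ^ Suc j - (1 + 1 / u) ^ Suc j / u\<^sup>2) - ((1 + u) ^ j - (1 + 1 / u) ^ j / u\<^sup>2))"
    unfolding 3 ..
  also have "\<dots> = (2 + jouk u) * ((1 + u) ^ Suc j - (1 + u) ^ j) - (2 + jouk u) * ((1 + 1 / u) ^ Suc j - (1 + 1 / u) ^ j) / u\<^sup>2"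
    by (rule gen)
  also have "\<dots> = (1 + u) ^ Suc (Suc j) - (1 + 1 / u) ^ Suc (Suc j) / u\<^sup>2"
    using rec[of "1 + u"] rec[of "1 + 1 / u"] by simp
  finally show ?case .
qed simp

lemma poly_graded_basis:
  fixes b :: "nat \<Rightarrow> 'a :: field poly"
  assumes b: "\<And>j. degree (b j) = j" "\<And>j. b j \<noteq> 0" and p: "degree p \<le> n"
  shows "\<exists>c. p = (\<Sum>j\<le>n. smult (c j) (b j))"
  using p
proof (induction n arbitrary: p)
  case 0
  then obtain a where a: "p = [:a:]" by (metis degree_eq_zeroE le_zero_eq)
  obtain d where d: "b 0 = [:d:]" using b(1)[of 0] by (metis degree_eq_zeroE)
  have "d \<noteq> 0" using b(2)[of 0] d by auto
  hence "p = smult (a / d) (b 0)" using a d by simp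
  thus ?case by (intro exI[of _ "\<lambda>_. a / d"]) simp
next
  case (Suc n)
  define a where "a = coeff p (Suc n) / coeff (b (Suc n)) (Suc n)"
  have lc: "coeff (b (Suc n)) (Suc n) \<noteq> 0" using b by (metis leading_coeff_0_iff)
  define q where "q = p - smult a (b (Suc n))"
  have "coeff q (Suc n) = 0" using lc by (simp add: q_def a_def)
  moreover have "degree q \<le> Suc n" unfolding q_def
    using Suc.prems b(1)[of "Suc n"] by (intro degree_diff_le) (auto intro: order.trans[OF degree_smult_le])
  ultimately have "degree q \<le> n"
    by (metis le_Suc_eq leading_coeff_0_iff degree_0 zero_le)
  then obtain c where c: "q = (\<Sum>j\<le>n. smult (c j) (b j))" using Suc.IH by blast
  have "p = (\<Sum>j\<le>Suc n. smult ((c(Suc n := a)) j) (b j))"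
  proof -
    have "(\<Sum>j\<le>n. smult ((c(Suc n := a)) j) (b j)) = q" unfolding c by (intro sum.cong) auto
    thus ?thesis by (simp add: q_def)
  qed
  thus ?case by blast
qed

definition faber_comb :: "(nat \<Rightarrow> complex) \<Rightarrow> nat \<Rightarrow> complex poly" where
  "faber_comb c n = (\<Sum>j\<le>n. smult (c j) (faber j))"

text \<open>
  The representation used for all polynomials in the sequel: a polynomial \<open>k\<close> in
  \<open>x\<close>, evaluated at the two preimages \<open>x = 1 + u\<close> and \<open>x = 1 +
  1/u\<close> of the point.
\<close>

lemma faber_comb_jouk:
  assumes "u \<noteq> 0"
  shows "poly (faber_comb c n) (jouk u) * (1 - 1 / u\<^sup>2) =
     (\<Sum>j\<le>n. c j * (1 + u) ^ j) - (\<Sum>j\<le>n. c j * (1 + 1 / u) ^ j) / u\<^sup>2"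
proof -
  have "poly (faber_comb c n) (jouk u) * (1 - 1 / u\<^sup>2) = (\<Sum>j\<le>n. c j * (poly (faber j) (jouk u) * (1 - 1 / u\<^sup>2)))"
    by (simp add: faber_comb_def poly_sum sum_distrib_right mult.assoc)
  also have "\<dots> = (\<Sum>j\<le>n. c j * (1 + u) ^ j - c j * (1 + 1 / u) ^ j / u\<^sup>2)"
    unfolding faber_jouk[OF assms] by (simp add: algebra_simps)
  also have "\<dots> = (\<Sum>j\<le>n. c j * (1 + u) ^ j) - (\<Sum>j\<le>n. c j * (1 + 1 / u) ^ j) / u\<^sup>2"
    by (simp only: sum_subtractf sum_divide_distrib)
  finally show ?thesis .
qed

lemma faber_comb_surj:
  assumes "degree p = n"
  obtains c where "p = faber_comb c n" "c n = lead_coeff p"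
proof -
  have nz: "faber j \<noteq> 0" for j using degree_faber[of j] by auto
  obtain c where c: "p = (\<Sum>j\<le>n. smult (c j) (faber j))"
    using poly_graded_basis[of faber p n] degree_faber nz assms by blast
  have "coeff p n = (\<Sum>j\<le>n. c j * coeff (faber j) n)" by (simp add: c coeff_sum)
  also have "\<dots> = (\<Sum>j\<in>{n}. c j * coeff (faber j) n)"
    by (rule sum.mono_neutral_right) (use degree_faber in \<open>auto simp: coeff_eq_0 le_neq_implies_less\<close>)
  also have "\<dots> = c n"
  proof -
    have "coeff (faber n) n = 1" using degree_faber[of n] by metis
    thus ?thesis by simp
  qed
  finally show ?thesis using that c assms by (simp add: faber_comb_def)
qed

section \<open>Integrals of orthogonal series\<close>

text \<open>
  Parseval's identity for two series in orthogonal functions that converge uniformly; dominated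
  convergence interchanges integral and sum. Orthogonality is stated for the indices with nonzero
  coefficients, because the functions \<open>\<zeta>^k - \<zeta>^(-k)\<close> to which this is
  applied vanish for \<open>k = 0\<close>, where the formula for their norms reads
  \<open>0/0\<close>.
\<close>

lemma orthogonal_series_sums:
  fixes a :: "nat \<Rightarrow> 'x \<Rightarrow> complex" and A :: "nat \<Rightarrow> real"
  assumes M: "finite_measure M"
    and meas: "\<And>k. a k \<in> borel_measurable M"
    and bnd: "\<And>k x. x \<in> space M \<Longrightarrow> cmod (a k x) \<le> A k"
    and orth: "\<And>j k. v j \<noteq> 0 \<Longrightarrow> w k \<noteq> 0 \<Longrightarrow> (LINT x|M. a j x * cnj (a k x)) = (if j = k then c k else 0)"
    and sv: "summable (\<lambda>k. cmod (v k) * A k)" and sw: "summable (\<lambda>k. cmod (w k) * A k)"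
  shows "(\<lambda>k. v k * cnj (w k) * c k) sums
           (LINT x|M. (\<Sum>k. v k * a k x) * cnj (\<Sum>k. w k * a k x))"
proof -
  interpret finite_measure M by (rule M)
  have cnjm: "cnj \<in> borel_measurable borel"
    by (intro borel_measurable_continuous_onI continuous_intros)
  define S where "S = (\<lambda>v n x. \<Sum>k<n. v k * a k x)"
  have sm: "summable (\<lambda>k. v k * a k x)" and lim: "(\<lambda>n. S v n x) \<longlonglongrightarrow> (\<Sum>k. v k * a k x)"
    and Sb: "cmod (S v n x) \<le> (\<Sum>k. cmod (v k) * A k)"
    if x: "x \<in> space M" and sv: "summable (\<lambda>k. cmod (v k) * A k)" for v x n
  proof -
    have le: "cmod (v k * a k x) \<le> cmod (v k) * A k" for k
      using bnd[OF x] by (simp add: norm_mult mult_left_mono)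
    have A0: "0 \<le> cmod (v k) * A k" for k using le[of k] norm_ge_zero order.trans by blast
    show "summable (\<lambda>k. v k * a k x)"
      by (rule summable_comparison_test'[OF sv, of 0]) (use le in auto)
    thus "(\<lambda>n. S v n x) \<longlonglongrightarrow> (\<Sum>k. v k * a k x)" unfolding S_def
      by (rule summable_LIMSEQ)
    have "cmod (S v n x) \<le> (\<Sum>k<n. cmod (v k) * A k)" unfolding S_def
      by (rule sum_norm_le) (rule le)
    also have "\<dots> \<le> (\<Sum>k. cmod (v k) * A k)" by (rule sum_le_suminf[OF sv]) (use A0 in auto)
    finally show "cmod (S v n x) \<le> (\<Sum>k. cmod (v k) * A k)" .
  qed
  have Sm: "S v n \<in> borel_measurable M" for v n unfolding S_def using meas by measurable
  have intjk: "integrable M (\<lambda>x. a j x * cnj (a k x))" for j k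
  proof (rule integrable_const_bound[of _ "A j * A k"])
    show "AE x in M. cmod (a j x * cnj (a k x)) \<le> A j * A k"
    proof (intro AE_I2)
      fix x assume x: "x \<in> space M"
      show "cmod (a j x * cnj (a k x)) \<le> A j * A k"
        unfolding norm_mult complex_mod_cnj
        using bnd[OF x, of j] bnd[OF x, of k] norm_ge_zero[of "a j x"]
        by (intro mult_mono) (auto intro: order.trans[OF norm_ge_zero])
    qed
    show "(\<lambda>x. a j x * cnj (a k x)) \<in> borel_measurable M"
      by (intro borel_measurable_times meas measurable_compose[OF _ cnjm])
  qed
  have fin: "(LINT x|M. S v n x * cnj (S w n x)) = (\<Sum>k<n. v k * cnj (w k) * c k)" for n
  proof -
    have "(LINT x|M. S v n x * cnj (S w n x)) =
          (LINT x|M. (\<Sum>j<n. \<Sum>k<n. v j * cnj (w k) * (a j x * cnj (a k x))))"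
      unfolding S_def by (simp add: sum_product mult_ac)
    also have "\<dots> = (\<Sum>j<n. \<Sum>k<n. v j * cnj (w k) * (LINT x|M. a j x * cnj (a k x)))"
      using intjk by (simp add: Bochner_Integration.integral_sum)
    also have "\<dots> = (\<Sum>j<n. \<Sum>k<n. if j = k then v k * cnj (w k) * c k else 0)"
    proof (intro sum.cong refl)
      fix j k
      show "v j * cnj (w k) * (LINT x|M. a j x * cnj (a k x)) = (if j = k then v k * cnj (w k) * c k else 0)"
        by (cases "v j = 0"; cases "w k = 0") (auto simp: orth)
    qed
    also have "\<dots> = (\<Sum>k<n. v k * cnj (w k) * c k)"
      by (simp add: sum.delta)
    finally show ?thesis .
  qed
  let ?b = "(\<Sum>k. cmod (v k) * A k) * (\<Sum>k. cmod (w k) * A k)"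
  have "(\<lambda>n. LINT x|M. S v n x * cnj (S w n x)) \<longlonglongrightarrow>
           (LINT x|M. (\<Sum>k. v k * a k x) * cnj (\<Sum>k. w k * a k x))"
  proof (rule integral_dominated_convergence[where w = "\<lambda>_. ?b"])
    have meas_sum: "(\<lambda>x. \<Sum>k. v k * a k x) \<in> borel_measurable M" if "summable (\<lambda>k. cmod (v k) * A k)" for v
      by (rule borel_measurable_LIMSEQ_metric[OF Sm[of v] lim]) (use that in auto)
    show "(\<lambda>x. (\<Sum>k. v k * a k x) * cnj (\<Sum>k. w k * a k x)) \<in> borel_measurable M"
      by (intro borel_measurable_times meas_sum sv measurable_compose[OF _ cnjm] sw)
    show "(\<lambda>x. S v n x * cnj (S w n x)) \<in> borel_measurable M" for n
      by (intro borel_measurable_times Sm measurable_compose[OF _ cnjm])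
    show "AE x in M. (\<lambda>n. S v n x * cnj (S w n x)) \<longlonglongrightarrow> (\<Sum>k. v k * a k x) * cnj (\<Sum>k. w k * a k x)"
      by (intro AE_I2 tendsto_mult tendsto_cnj lim sv sw)
    show "AE x in M. cmod (S v n x * cnj (S w n x)) \<le> ?b" for n
      unfolding norm_mult complex_mod_cnj
      by (intro AE_I2 mult_mono Sb sv sw norm_ge_zero order.trans[OF norm_ge_zero Sb[of _ v]])
  qed simp
  thus ?thesis unfolding fin sums_def .
qed

lemma integral_exp_circle:
  fixes n :: int
  shows "((\<lambda>\<theta>. exp (\<i> * of_int n * of_real \<theta>)) has_integral (if n = 0 then 2 * of_real pi else 0)) {a..a + 2 * pi}"
proof (cases "n = 0")
  case True
  have "((\<lambda>\<theta>. 1 :: complex) has_integral (of_real (2 * pi) * 1)) {a..a + 2 * pi}"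
    using has_integral_const_real[of "1::complex" a "a + 2 * pi"] pi_ge_zero by (simp add: scaleR_conv_of_real)
  thus ?thesis using True by simp
next
  case False
  define c where "c = \<i> * of_int n"
  have c: "c \<noteq> 0" using False by (simp add: c_def)
  have "((\<lambda>\<theta>. exp (c * of_real \<theta>)) has_integral (exp (c * of_real (a + 2 * pi)) / c - exp (c * of_real a) / c)) {a..a + 2 * pi}"
  proof (rule fundamental_theorem_of_calculus)
    fix x assume "x \<in> {a..a + 2 * pi}"
    have "((\<lambda>z. exp (c * z) / c) has_field_derivative exp (c * of_real x)) (at (of_real x))"
      using c by (auto intro!: derivative_eq_intros)
    thus "((\<lambda>\<theta>. exp (c * of_real \<theta>) / c) has_vector_derivative exp (c * of_real x)) (at x within {a..a + 2 * pi})"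
      by (rule has_vector_derivative_real_field[THEN has_vector_derivative_at_within])
  qed simp
  moreover have "exp (c * of_real (a + 2 * pi)) = exp (c * of_real a)"
    unfolding exp_eq by (intro exI[of _ n]) (simp add: c_def algebra_simps)
  ultimately show ?thesis using False by (simp add: c_def mult.assoc)
qed

text \<open>
  Planar Lebesgue measure is a product measure, which makes iterated integration available.
\<close>

lemma lborel_complex_pair:
  "distr (lborel \<Otimes>\<^sub>M lborel) borel (\<lambda>(x, y). Complex x y) = lborel"
proof (rule lborel_eqI [symmetric])
  have cont: "continuous_on UNIV (\<lambda>(x, y). Complex x y)"
    unfolding case_prod_beta Complex_eq by (intro continuous_intros)
  hence meas: "(\<lambda>(x, y). Complex x y) \<in> borel_measurable borel" by (rule borel_measurable_continuous_onI)
  fix l u :: complex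
  assume le: "\<And>b. b \<in> Basis \<Longrightarrow> l \<bullet> b \<le> u \<bullet> b"
  have "(\<lambda>(x, y). Complex x y) -` box l u = {Re l<..<Re u} \<times> {Im l<..<Im u}"
    by (auto simp: box_def Basis_complex_def inner_complex_def)
  hence "emeasure (distr (lborel \<Otimes>\<^sub>M lborel) borel (\<lambda>(x, y). Complex x y)) (box l u)
      = emeasure (lborel \<Otimes>\<^sub>M lborel) ({Re l<..<Re u} \<times> {Im l<..<Im u})"
    using meas by (simp add: emeasure_distr lborel_prod)
  also have "\<dots> = emeasure lborel {Re l<..<Re u} * emeasure lborel {Im l<..<Im u}"
    by (intro lborel.emeasure_pair_measure_Times) auto
  also have "\<dots> = (\<Prod>b\<in>Basis. (u - l) \<bullet> b)"
    using le[of 1] le[of \<i>] by (simp add: Basis_complex_def inner_complex_def ennreal_mult)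
  finally show "emeasure (distr (lborel \<Otimes>\<^sub>M lborel) borel (\<lambda>(x, y). Complex x y)) (box l u)
      = (\<Prod>b\<in>Basis. (u - l) \<bullet> b)" .
qed simp

lemma integral_complex_fubini:
  fixes f :: "complex \<Rightarrow> complex"
  assumes f: "integrable lborel f"
  shows "(LINT z|lborel. f z) = (LINT x|lborel. LINT y|lborel. f (Complex x y))"
proof -
  have cont: "continuous_on UNIV (\<lambda>(x, y). Complex x y)"
    unfolding case_prod_beta Complex_eq by (intro continuous_intros)
  hence meas: "(\<lambda>(x, y). Complex x y) \<in> lborel \<Otimes>\<^sub>M lborel \<rightarrow>\<^sub>M borel"
    by (metis borel_measurable_continuous_onI lborel_prod measurable_lborel2)
  have fm: "f \<in> borel_measurable borel" using f by auto
  have i: "integrable (lborel \<Otimes>\<^sub>M lborel) (\<lambda>(x, y). f (Complex x y))"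
    using integrable_distr_eq[OF meas fm, unfolded lborel_complex_pair] f by (simp add: case_prod_unfold)
  have "(LINT z|lborel. f z) = (LINT p|(lborel \<Otimes>\<^sub>M lborel). f (case p of (x, y) \<Rightarrow> Complex x y))"
    using integral_distr[OF meas fm, unfolded lborel_complex_pair] .
  also have "\<dots> = (LINT x|lborel. LINT y|lborel. f (Complex x y))"
    using lborel_pair.integral_fst'[OF i] by (simp add: case_prod_unfold)
  finally show ?thesis .
qed

section \<open>Area integrals over an annulus as circle integrals\<close>

definition taylor_coeff :: "(complex \<Rightarrow> complex) \<Rightarrow> nat \<Rightarrow> complex" where
  "taylor_coeff f k = (deriv ^^ k) f 0 / fact k"

lemma taylor_coeff_sums:
  assumes "f holomorphic_on ball 0 r'" "cmod \<zeta> < r'"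
  shows "(\<lambda>k. taylor_coeff f k * \<zeta> ^ k) sums f \<zeta>"
  using holomorphic_power_series[OF assms(1), of \<zeta>] assms(2) by (simp add: taylor_coeff_def)

lemma taylor_coeff_summable:
  assumes "f holomorphic_on ball 0 r'" "0 \<le> r" "r < r'"
  shows "summable (\<lambda>k. cmod (taylor_coeff f k) * r ^ k)"
proof -
  define s where "s = (r + r') / 2"
  have s: "r < s" "s < r'" using assms by (auto simp: s_def)
  have "summable (\<lambda>k. taylor_coeff f k * (of_real s) ^ k)"
    using taylor_coeff_sums[OF assms(1), of "of_real s"] s assms by (auto simp: sums_iff)
  hence "summable (\<lambda>k. norm (taylor_coeff f k * (of_real r) ^ k))"
    by (rule powser_insidea) (use s assms in auto)
  thus ?thesis using assms by (simp add: norm_mult norm_power)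
qed

lemma taylor_coeff_unique:
  assumes "f holomorphic_on ball 0 r'" "0 < r'" "\<And>\<zeta>. cmod \<zeta> < r' \<Longrightarrow> (\<lambda>k. a k * \<zeta> ^ k) sums f \<zeta>"
  shows "taylor_coeff f k = a k"
proof -
  have "f has_fps_expansion Abs_fps a"
  proof (rule has_fps_expansionI)
    have "eventually (\<lambda>u. u \<in> ball 0 r') (nhds (0::complex))"
      using assms(2) by (intro eventually_nhds_in_open) auto
    thus "eventually (\<lambda>u. (\<lambda>n. fps_nth (Abs_fps a) n * u ^ n) sums f u) (nhds 0)"
      by eventually_elim (use assms(3) in auto)
  qed
  from fps_nth_fps_expansion[OF this, of k] show ?thesis by (simp add: taylor_coeff_def)
qed

lemma taylor_coeff_0: "taylor_coeff f 0 = f 0" by (simp add: taylor_coeff_def)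

text \<open>
  The operator \<open>\<zeta> d/d\<zeta>\<close> multiplies the \<open>k\<close>-th coefficient by
  \<open>k\<close>. This is how a primitive enters the circle integrals below.
\<close>

lemma taylor_coeff_Euler:
  assumes "f holomorphic_on ball 0 r'" "0 < r'"
  shows "taylor_coeff (\<lambda>\<zeta>. \<zeta> * deriv f \<zeta>) k = of_nat k * taylor_coeff f k"
proof (rule taylor_coeff_unique[OF _ assms(2)])
  show "(\<lambda>\<zeta>. \<zeta> * deriv f \<zeta>) holomorphic_on ball 0 r'"
    using assms by (intro holomorphic_intros holomorphic_deriv) auto
  fix \<zeta> :: complex assume z: "cmod \<zeta> < r'"
  have "(\<lambda>k. taylor_coeff (deriv f) k * \<zeta> ^ k) sums deriv f \<zeta>"
    using assms z by (intro taylor_coeff_sums[of _ r'] holomorphic_deriv) auto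
  hence "(\<lambda>k. \<zeta> * (taylor_coeff (deriv f) k * \<zeta> ^ k)) sums (\<zeta> * deriv f \<zeta>)" by (rule sums_mult)
  moreover have "\<zeta> * (taylor_coeff (deriv f) k * \<zeta> ^ k) = of_nat (Suc k) * taylor_coeff f (Suc k) * \<zeta> ^ Suc k" for k
    by (simp add: taylor_coeff_def funpow_Suc_right del: funpow.simps of_nat_Suc)
  ultimately have "(\<lambda>k. of_nat (Suc k) * taylor_coeff f (Suc k) * \<zeta> ^ Suc k) sums (\<zeta> * deriv f \<zeta>)" by simp
  thus "(\<lambda>k. of_nat k * taylor_coeff f k * \<zeta> ^ k) sums (\<zeta> * deriv f \<zeta>)"
    by (subst (asm) sums_Suc_iff) simp
qed

lemma taylor_coeff_scale:
  assumes "f holomorphic_on ball 0 r'" "0 < r'" "cmod s \<le> 1"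
  shows "taylor_coeff (\<lambda>\<zeta>. f (s * \<zeta>)) k = s ^ k * taylor_coeff f k"
proof (rule taylor_coeff_unique[OF _ assms(2)])
  have le: "cmod (s * \<zeta>) \<le> cmod \<zeta>" for \<zeta>
    using assms(3) by (simp add: norm_mult mult_left_le_one_le)
  have "(\<lambda>\<zeta>. s * \<zeta>) ` ball 0 r' \<subseteq> ball 0 r'" using le by (force intro: le_less_trans[OF le])
  hence "(f \<circ> (\<lambda>\<zeta>. s * \<zeta>)) holomorphic_on ball 0 r'"
    by (intro holomorphic_on_compose_gen[OF _ assms(1)] holomorphic_intros)
  thus "(\<lambda>\<zeta>. f (s * \<zeta>)) holomorphic_on ball 0 r'" by (simp add: o_def)
  fix \<zeta> :: complex assume z: "cmod \<zeta> < r'"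
  have "(\<lambda>k. taylor_coeff f k * (s * \<zeta>) ^ k) sums f (s * \<zeta>)"
    using le[of \<zeta>] z by (intro taylor_coeff_sums[OF assms(1)]) linarith
  thus "(\<lambda>k. s ^ k * taylor_coeff f k * \<zeta> ^ k) sums f (s * \<zeta>)"
    by (simp add: power_mult_distrib mult_ac)
qed

lemma LINT_open_interval:
  fixes f :: "real \<Rightarrow> complex"
  assumes "continuous_on {a..b} f" "(f has_integral I) {a..b}"
  shows "(LINT x:{a<..<b}|lborel. f x) = I" "(LINT x:{a..b}|lborel. f x) = I"
proof -
  have i: "set_integrable lborel {a..b} f" using assms(1) by (rule borel_integrable_atLeastAtMost')
  hence o: "set_integrable lborel {a<..<b} f" by (rule set_integrable_subset) auto
  show "(LINT x:{a..b}|lborel. f x) = I"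
    using set_borel_integral_eq_integral(2)[OF i] assms(2) by (simp add: integral_unique)
  show "(LINT x:{a<..<b}|lborel. f x) = I"
    using set_borel_integral_eq_integral(2)[OF o] assms(2) integral_open_interval_real[of a b f]
    by (simp add: integral_unique)
qed

lemma circle_series_sums:
  assumes V: "V holomorphic_on ball 0 r'" and H: "H holomorphic_on ball 0 r'" and r: "0 < r" "r < r'"
  shows "(\<lambda>k. taylor_coeff V k * cnj (taylor_coeff H k) * of_real (2 * pi * r ^ (2 * k))) sums
     (LINT \<theta>:{0..2 * pi}|lborel. V (of_real r * cis \<theta>) * cnj (H (of_real r * cis \<theta>)))"
proof -
  define M where "M = restrict_space lborel {0..2 * pi}"
  define a where "a = (\<lambda>k \<theta>. (of_real r * cis \<theta>) ^ k)"
  have sp: "space M = {0..2 * pi}" by (simp add: M_def space_restrict_space)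
  have am: "a k \<in> borel_measurable M" for k
  proof -
    have "a k \<in> borel_measurable borel" unfolding a_def
      by (intro borel_measurable_continuous_onI continuous_intros)
    thus ?thesis by (simp add: M_def measurable_restrict_space1)
  qed
  have li: "(LINT \<theta>|M. f \<theta>) = (LINT \<theta>:{0..2 * pi}|lborel. f \<theta>)" for f :: "real \<Rightarrow> complex"
    unfolding M_def set_lebesgue_integral_def by (subst integral_restrict_space) auto
  have "(\<lambda>k. taylor_coeff V k * cnj (taylor_coeff H k) * of_real (2 * pi * r ^ (2 * k))) sums
     (LINT \<theta>|M. (\<Sum>k. taylor_coeff V k * a k \<theta>) * cnj (\<Sum>k. taylor_coeff H k * a k \<theta>))"
  proof (rule orthogonal_series_sums[where A = "\<lambda>k. r ^ k"])
    show "finite_measure M" unfolding M_def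
      by (intro finite_measureI) (simp add: emeasure_restrict_space space_restrict_space emeasure_lborel_Icc_eq)
    show "a k \<in> borel_measurable M" for k by (rule am)
    show "cmod (a k x) \<le> r ^ k" for k x using r by (simp add: a_def norm_mult norm_power)
    show "summable (\<lambda>k. cmod (taylor_coeff V k) * r ^ k)" "summable (\<lambda>k. cmod (taylor_coeff H k) * r ^ k)"
      using taylor_coeff_summable V H r by auto
    fix j k
    have e: "a j \<theta> * cnj (a k \<theta>) = of_real (r ^ (j + k)) * exp (\<i> * of_int (int j - int k) * of_real \<theta>)" for \<theta>
    proof -
      have "a j \<theta> * cnj (a k \<theta>) = of_real (r ^ (j + k)) * (cis (real j * \<theta>) * cis (- (real k * \<theta>)))"
        by (simp add: a_def power_mult_distrib Complex.DeMoivre cis_cnj power_add)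
      thus ?thesis by (simp only: cis_mult) (simp add: cis_conv_exp algebra_simps)
    qed
    have "((\<lambda>\<theta>. of_real (r ^ (j + k)) * exp (\<i> * of_int (int j - int k) * of_real \<theta>)) has_integral
        of_real (r ^ (j + k)) * (if int j - int k = 0 then 2 * of_real pi else 0)) {0..2 * pi}"
      by (intro has_integral_mult_right integral_exp_circle[of _ 0, simplified])
    hence "(LINT \<theta>:{0..2 * pi}|lborel. a j \<theta> * cnj (a k \<theta>)) = of_real (r ^ (j + k)) * (if int j - int k = 0 then 2 * of_real pi else 0)"
      unfolding e by (intro LINT_open_interval continuous_intros) auto
    thus "(LINT x|M. a j x * cnj (a k x)) = (if j = k then of_real (2 * pi * r ^ (2 * k)) else 0)"
      by (cases "j = k") (simp_all add: li flip: mult_2)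
  qed
  also have "(LINT \<theta>|M. (\<Sum>k. taylor_coeff V k * a k \<theta>) * cnj (\<Sum>k. taylor_coeff H k * a k \<theta>)) =
     (LINT \<theta>|M. V (of_real r * cis \<theta>) * cnj (H (of_real r * cis \<theta>)))"
  proof -
    have "(\<Sum>k. taylor_coeff V k * a k \<theta>) = V (of_real r * cis \<theta>)" "(\<Sum>k. taylor_coeff H k * a k \<theta>) = H (of_real r * cis \<theta>)" for \<theta>
      using taylor_coeff_sums[OF V, of "of_real r * cis \<theta>"] taylor_coeff_sums[OF H, of "of_real r * cis \<theta>"] r
      by (auto simp: a_def sums_iff norm_mult)
    thus ?thesis by simp
  qed
  finally show ?thesis unfolding li .
qed

text \<open>
  The exponential function maps this rectangle bijectively onto the points of the annulus \<open>1
  < |\<zeta>| < r\<close> that do not lie on the negative real axis.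
\<close>

definition log_rect :: "real \<Rightarrow> complex set" where
  "log_rect r = {w. 0 < Re w \<and> Re w < ln r \<and> - pi < Im w \<and> Im w < pi}"

lemma log_rect_eq_box: "log_rect r = box (Complex 0 (- pi)) (Complex (ln r) pi)"
  by (auto simp: log_rect_def box_def Basis_complex_def inner_complex_def)

lemma open_log_rect: "open (log_rect r)"
  unfolding log_rect_eq_box by (rule open_box)

text \<open>
  The functions \<open>exp (k w) - exp (- k w)\<close> are orthogonal on the rectangle: in the
  imaginary direction only equal frequencies survive, and there \<open>2 cosh (2 k x)\<close> is
  left for the real direction; the mixed terms integrate to zero because both frequencies are
  positive.
\<close>

lemma integral_folded_exp:
  assumes r: "1 < r" and jk: "0 < j" "0 < k"
  shows "(LINT w:log_rect r|lborel. (exp w ^ j - exp (- w) ^ j) * cnj (exp w ^ k - exp (- w) ^ k))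
    = (if j = k then of_real (pi * (r ^ (2 * k) - 1 / r ^ (2 * k)) / real k) else 0)"
proof -
  define f where "f = (\<lambda>w::complex. (exp w ^ j - exp (- w) ^ j) * cnj (exp w ^ k - exp (- w) ^ k))"
  define F where "F = (\<lambda>w. indicator (log_rect r) w *\<^sub>R f w)"
  define L where "L = ln r"
  have L: "L > 0" using r by (simp add: L_def)
  have cf: "continuous_on S f" for S unfolding f_def by (intro continuous_intros)
  have "set_integrable lborel (cbox (Complex 0 (- pi)) (Complex (ln r) pi)) f"
    using cf by (intro borel_integrable_compact[unfolded set_integrable_def[symmetric]] compact_cbox
        | simp add: set_integrable_def borel_integrable_compact)+
  hence "set_integrable lborel (log_rect r) f"
    by (rule set_integrable_subset) (auto simp: log_rect_eq_box box_subset_cbox)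
  hence Fi: "integrable lborel F" by (simp add: F_def set_integrable_def)
  have fe: "f (Complex s t) = of_real (exp ((real j + real k) * s)) * exp (\<i> * of_int (int j - int k) * of_real t)
      - of_real (exp ((real j - real k) * s)) * exp (\<i> * of_int (int j + int k) * of_real t)
      - of_real (exp ((real k - real j) * s)) * exp (\<i> * of_int (- int j - int k) * of_real t)
      + of_real (exp (- (real j + real k) * s)) * exp (\<i> * of_int (int k - int j) * of_real t)" for s t
  proof -
    have c: "cnj (exp w ^ n) = exp (of_nat n * cnj w)" for w n
      by (simp add: exp_cnj exp_of_nat_mult)
    have "f (Complex s t) = (exp (of_nat j * Complex s t) - exp (of_nat j * - Complex s t)) *
      (exp (of_nat k * Complex s (- t)) - exp (of_nat k * - Complex s (- t)))"
      unfolding f_def complex_cnj_diff c unfolding exp_of_nat_mult[symmetric] by (simp add: complex_cnj)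
    also have "\<dots> = exp (of_nat j * Complex s t + of_nat k * Complex s (- t)) - exp (of_nat j * Complex s t + of_nat k * - Complex s (- t))
       - exp (of_nat j * - Complex s t + of_nat k * Complex s (- t)) + exp (of_nat j * - Complex s t + of_nat k * - Complex s (- t))"
      by (simp only: exp_add) (simp only: algebra_simps)
    finally show ?thesis
      by (simp add: exp_add[symmetric] exp_of_real[symmetric] Complex_eq algebra_simps of_real_def[symmetric])
  qed
  define g where "g = (\<lambda>s. if j = k then 2 * of_real pi * of_real (exp (2 * real k * s) + exp (- (2 * real k * s))) else (0::complex))"
  have inner: "(LINT t:{-pi<..<pi}|lborel. f (Complex s t)) = g s" for s
  proof (rule LINT_open_interval(1))
    show "continuous_on {- pi..pi} (\<lambda>t. f (Complex s t))"
      unfolding fe by (intro continuous_intros)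
    have "((\<lambda>t. f (Complex s t)) has_integral
       (of_real (exp ((real j + real k) * s)) * (if int j - int k = 0 then 2 * of_real pi else 0)
      - of_real (exp ((real j - real k) * s)) * (if int j + int k = 0 then 2 * of_real pi else 0)
      - of_real (exp ((real k - real j) * s)) * (if - int j - int k = 0 then 2 * of_real pi else 0)
      + of_real (exp (- (real j + real k) * s)) * (if int k - int j = 0 then 2 * of_real pi else 0))) {-pi..pi}"
      unfolding fe by (intro has_integral_add has_integral_diff has_integral_mult_right
          integral_exp_circle[of _ "- pi", simplified])
    moreover have "(of_real (exp ((real j + real k) * s)) * (if int j - int k = 0 then 2 * of_real pi else 0)
      - of_real (exp ((real j - real k) * s)) * (if int j + int k = 0 then 2 * of_real pi else 0)
      - of_real (exp ((real k - real j) * s)) * (if - int j - int k = 0 then 2 * of_real pi else 0)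
      + of_real (exp (- (real j + real k) * s)) * (if int k - int j = 0 then 2 * of_real pi else 0)) = g s"
      using jk by (auto simp: g_def algebra_simps)
    ultimately show "((\<lambda>t. f (Complex s t)) has_integral g s) {-pi..pi}" by simp
  qed
  have "(LINT w:log_rect r|lborel. f w) = (LINT w|lborel. F w)"
    by (simp add: set_lebesgue_integral_def F_def)
  also have "\<dots> = (LINT s|lborel. LINT t|lborel. F (Complex s t))"
    by (rule integral_complex_fubini[OF Fi])
  also have "\<dots> = (LINT s|lborel. indicator {0<..<L} s *\<^sub>R (LINT t:{-pi<..<pi}|lborel. f (Complex s t)))"
  proof (intro Bochner_Integration.integral_cong refl)
    fix s
    have "F (Complex s t) = indicator {0<..<L} s *\<^sub>R (indicator {-pi<..<pi} t *\<^sub>R f (Complex s t))" for t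
      by (auto simp: F_def log_rect_def L_def indicator_def)
    thus "(LINT t|lborel. F (Complex s t)) = indicator {0<..<L} s *\<^sub>R (LINT t:{-pi<..<pi}|lborel. f (Complex s t))"
      unfolding set_lebesgue_integral_def by (simp only: integral_scaleR_right)
  qed
  also have "\<dots> = (LINT s:{0<..<L}|lborel. g s)"
    by (simp only: inner) (simp add: set_lebesgue_integral_def)
  also have "\<dots> = (if j = k then of_real (pi * (r ^ (2 * k) - 1 / r ^ (2 * k)) / real k) else 0)"
  proof (rule LINT_open_interval(1))
    show "continuous_on {0..L} g" unfolding g_def by (cases "j = k") (auto intro!: continuous_intros)
    show "(g has_integral (if j = k then of_real (pi * (r ^ (2 * k) - 1 / r ^ (2 * k)) / real k) else 0)) {0..L}"
    proof (cases "j = k")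
      case True
      have "((\<lambda>s. exp (2 * real k * s) + exp (- (2 * real k * s))) has_integral
        ((exp (2 * real k * L) - exp (- (2 * real k * L))) / (2 * real k) - (exp (2 * real k * 0) - exp (- (2 * real k * 0))) / (2 * real k))) {0..L}"
        using L jk by (intro fundamental_theorem_of_calculus)
          (auto intro!: derivative_eq_intros simp flip: has_real_derivative_iff_has_vector_derivative simp: field_simps)
      moreover have "exp (2 * real k * L) = r ^ (2 * k)"
        using r exp_of_nat_mult[of "2 * k" "ln r"] by (simp add: L_def)
      ultimately have "((\<lambda>s. exp (2 * real k * s) + exp (- (2 * real k * s))) has_integral
        ((r ^ (2 * k) - 1 / r ^ (2 * k)) / (2 * real k))) {0..L}"
        by (simp add: exp_minus inverse_eq_divide)
      hence "((\<lambda>s. 2 * pi * (exp (2 * real k * s) + exp (- (2 * real k * s)))) has_integral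
        (2 * pi * ((r ^ (2 * k) - 1 / r ^ (2 * k)) / (2 * real k)))) {0..L}"
        by (rule has_integral_mult_right)
      hence "((\<lambda>s. complex_of_real (2 * pi * (exp (2 * real k * s) + exp (- (2 * real k * s))))) has_integral
        of_real (2 * pi * ((r ^ (2 * k) - 1 / r ^ (2 * k)) / (2 * real k)))) {0..L}"
        by (rule has_integral_of_real)
      moreover have "2 * pi * ((r ^ (2 * k) - 1 / r ^ (2 * k)) / (2 * real k)) = pi * (r ^ (2 * k) - 1 / r ^ (2 * k)) / real k"
        by simp
      ultimately show ?thesis using True by (simp add: g_def)
    qed (simp add: g_def)
  qed
  finally show ?thesis by (simp add: f_def)
qed

text \<open>
  Expand \<open>V\<close> and \<open>W\<close> at the origin and use the orthogonality of
  \<open>\<zeta>^k - \<zeta>^(-k)\<close> in \<open>\<zeta> = exp w\<close>.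
\<close>

lemma annulus_series_sums:
  assumes V: "V holomorphic_on ball 0 r'" "V 0 = 0" and W: "W holomorphic_on ball 0 r'" "W 0 = 0"
    and r: "1 < r" "r < r'"
  shows "(\<lambda>k. taylor_coeff V k * cnj (taylor_coeff W k) * of_real (pi * (r ^ (2 * k) - 1 / r ^ (2 * k)) / real k)) sums
     (LINT w:log_rect r|lborel. (V (exp w) - V (exp (- w))) * cnj (W (exp w) - W (exp (- w))))"
proof -
  define M where "M = restrict_space lborel (log_rect r)"
  define a where "a = (\<lambda>k w. exp w ^ k - exp (- w) ^ k :: complex)"
  have sp: "space M = log_rect r" by (simp add: M_def space_restrict_space)
  have Bs: "log_rect r \<in> sets borel" using open_log_rect by auto
  have am: "a k \<in> borel_measurable M" for k
  proof -
    have "a k \<in> borel_measurable borel" unfolding a_def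
      by (intro borel_measurable_continuous_onI continuous_intros)
    thus ?thesis by (simp add: M_def measurable_restrict_space1)
  qed
  have li: "(LINT \<theta>|M. f \<theta>) = (LINT \<theta>:log_rect r|lborel. f \<theta>)" for f :: "complex \<Rightarrow> complex"
    unfolding M_def set_lebesgue_integral_def by (subst integral_restrict_space) (use Bs in auto)
  have e1: "cmod (exp w) < r" "cmod (exp (- w)) \<le> r" if "w \<in> log_rect r" for w
  proof -
    have "exp (Re w) < exp (ln r)" using that by (auto simp: log_rect_def)
    thus "cmod (exp w) < r" using r by (simp add: norm_exp_eq_Re)
    have "exp (- Re w) \<le> 1" using that by (simp add: log_rect_def)
    hence "cmod (exp (- w)) \<le> 1" by (simp only: norm_exp_eq_Re uminus_complex.sel)
    thus "cmod (exp (- w)) \<le> r" using r by linarith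
  qed
  have "(\<lambda>k. taylor_coeff V k * cnj (taylor_coeff W k) * of_real (pi * (r ^ (2 * k) - 1 / r ^ (2 * k)) / real k)) sums
     (LINT w|M. (\<Sum>k. taylor_coeff V k * a k w) * cnj (\<Sum>k. taylor_coeff W k * a k w))"
  proof (rule orthogonal_series_sums[where A = "\<lambda>k. 2 * r ^ k"])
    show "finite_measure M" unfolding M_def
      by (intro finite_measureI)
         (simp add: emeasure_restrict_space space_restrict_space log_rect_eq_box emeasure_lborel_box_eq)
    show "a k \<in> borel_measurable M" for k by (rule am)
    show "cmod (a k w) \<le> 2 * r ^ k" if "w \<in> space M" for k w
    proof -
      have "cmod (a k w) \<le> cmod (exp w) ^ k + cmod (exp (- w)) ^ k"
        unfolding a_def norm_power[symmetric] by (rule norm_triangle_ineq4)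
      also have "\<dots> \<le> r ^ k + r ^ k"
        using e1[of w] that sp by (intro add_mono power_mono) auto
      finally show ?thesis by simp
    qed
    show "summable (\<lambda>k. cmod (taylor_coeff V k) * (2 * r ^ k))" "summable (\<lambda>k. cmod (taylor_coeff W k) * (2 * r ^ k))"
      using summable_mult[OF taylor_coeff_summable[OF V(1), of r], of 2] summable_mult[OF taylor_coeff_summable[OF W(1), of r], of 2] r
      by (auto simp: mult_ac)
    fix j k assume "taylor_coeff V j \<noteq> 0" "taylor_coeff W k \<noteq> 0"
    hence "j > 0" "k > 0" using V(2) W(2) taylor_coeff_0[of V] taylor_coeff_0[of W] by (metis gr0I)+
    thus "(LINT x|M. a j x * cnj (a k x)) = (if j = k then of_real (pi * (r ^ (2 * k) - 1 / r ^ (2 * k)) / real k) else 0)"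
      unfolding li a_def using integral_folded_exp[OF r(1)] by blast
  qed
  also have "(LINT w|M. (\<Sum>k. taylor_coeff V k * a k w) * cnj (\<Sum>k. taylor_coeff W k * a k w)) =
     (LINT w|M. (V (exp w) - V (exp (- w))) * cnj (W (exp w) - W (exp (- w))))"
  proof (intro Bochner_Integration.integral_cong refl)
    fix w assume "w \<in> space M"
    hence w: "cmod (exp w) < r'" "cmod (exp (- w)) < r'" using e1[of w] sp r by auto
    have "(\<Sum>k. taylor_coeff f k * a k w) = f (exp w) - f (exp (- w))" if "f holomorphic_on ball 0 r'" for f
      using sums_diff[OF taylor_coeff_sums[OF that w(1)] taylor_coeff_sums[OF that w(2)]]
      by (simp add: a_def sums_iff right_diff_distrib)
    thus "(\<Sum>k. taylor_coeff V k * a k w) * cnj (\<Sum>k. taylor_coeff W k * a k w) = (V (exp w) - V (exp (- w))) * cnj (W (exp w) - W (exp (- w)))"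
      using V W by simp
  qed
  finally show ?thesis unfolding li .
qed

text \<open>
  A discrete form of Green's formula. Compare coefficients on both sides: the norm \<open>r^(2 k)
  - r^(- 2 k) = (1 - r^(- 4 k)) r^(2 k)\<close> is the circle norm \<open>r^(2 k)\<close> after
  subtracting from \<open>V\<close> its composition with the scaling by \<open>1 / r^4\<close>.
  This is where that contraction comes from.
\<close>

lemma annulus_integral_eq_circle_integral:
  assumes V: "V holomorphic_on ball 0 r'" "V 0 = 0" and H: "H holomorphic_on ball 0 r'"
    and r: "1 < r" "r < r'"
  shows "(LINT w:log_rect r|lborel. (V (exp w) - V (exp (- w))) *
            cnj (exp w * deriv H (exp w) - exp (- w) * deriv H (exp (- w))))
     = 1 / 2 * (LINT \<theta>:{0..2 * pi}|lborel. (V (of_real r * cis \<theta>) - V (of_real (1 / r ^ 4) * (of_real r * cis \<theta>)))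
          * cnj (H (of_real r * cis \<theta>)))"
proof -
  define W where "W = (\<lambda>\<zeta>. \<zeta> * deriv H \<zeta>)"
  define D where "D = (\<lambda>\<zeta>. V \<zeta> - V (of_real (1 / r ^ 4) * \<zeta>))"
  have r': "0 < r'" using r by linarith
  have s1: "cmod (of_real (1 / r ^ 4)) \<le> 1" using r by (simp add: norm_divide norm_power field_simps)
  have "(\<lambda>\<zeta>. of_real (1 / r ^ 4) * \<zeta>) ` ball (0::complex) r' \<subseteq> ball 0 r'"
  proof -
    have le: "cmod (of_real (1 / r ^ 4) * \<zeta>) \<le> cmod \<zeta>" for \<zeta>
      unfolding norm_mult by (rule mult_left_le_one_le[OF _ _ s1]) auto
    show ?thesis
    proof (rule image_subsetI)
      fix x :: complex assume "x \<in> ball 0 r'"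
      thus "of_real (1 / r ^ 4) * x \<in> ball 0 r'" using le[of x] unfolding mem_ball_0 by linarith
    qed
  qed
  hence "(V \<circ> (\<lambda>\<zeta>. of_real (1 / r ^ 4) * \<zeta>)) holomorphic_on ball 0 r'"
    by (intro holomorphic_on_compose_gen[OF _ V(1)] holomorphic_intros)
  hence Vs: "(\<lambda>\<zeta>. V (of_real (1 / r ^ 4) * \<zeta>)) holomorphic_on ball 0 r'" by (simp add: o_def)
  have D: "D holomorphic_on ball 0 r'" unfolding D_def by (intro holomorphic_intros V Vs)
  have tD: "taylor_coeff D k = (1 - of_real (1 / r ^ (4 * k))) * taylor_coeff V k" for k
  proof (rule taylor_coeff_unique[OF D r'])
    fix \<zeta> :: complex assume z: "cmod \<zeta> < r'"
    have "(\<lambda>k. taylor_coeff V k * \<zeta> ^ k - taylor_coeff (\<lambda>\<zeta>. V (of_real (1 / r ^ 4) * \<zeta>)) k * \<zeta> ^ k) sums D \<zeta>"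
      unfolding D_def by (intro sums_diff taylor_coeff_sums[OF V(1) z] taylor_coeff_sums[OF Vs z])
    moreover have "complex_of_real (1 / r ^ (4 * k)) = of_real (1 / r ^ 4) ^ k" for k
      unfolding of_real_power[symmetric] by (simp add: power_mult power_one_over)
    ultimately show "(\<lambda>k. (1 - of_real (1 / r ^ (4 * k))) * taylor_coeff V k * \<zeta> ^ k) sums D \<zeta>"
      unfolding taylor_coeff_scale[OF V(1) r' s1] by (simp only: left_diff_distrib mult_1)
  qed
  have W: "W holomorphic_on ball 0 r'" "W 0 = 0" unfolding W_def
    using H by (auto intro!: holomorphic_intros holomorphic_deriv)
  have tW: "taylor_coeff W k = of_nat k * taylor_coeff H k" for k
    unfolding W_def using H r' by (rule taylor_coeff_Euler)
  have s1: "(\<lambda>k. taylor_coeff V k * cnj (taylor_coeff W k) * of_real (pi * (r ^ (2 * k) - 1 / r ^ (2 * k)) / real k)) sums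
     (LINT w:log_rect r|lborel. (V (exp w) - V (exp (- w))) * cnj (W (exp w) - W (exp (- w))))"
    by (rule annulus_series_sums[OF V W r])
  have "(\<lambda>k. taylor_coeff D k * cnj (taylor_coeff H k) * of_real (2 * pi * r ^ (2 * k))) sums
     (LINT \<theta>:{0..2 * pi}|lborel. D (of_real r * cis \<theta>) * cnj (H (of_real r * cis \<theta>)))"
    using r by (intro circle_series_sums[OF D H]) auto
  hence s2: "(\<lambda>k. 1 / 2 * (taylor_coeff D k * cnj (taylor_coeff H k) * of_real (2 * pi * r ^ (2 * k)))) sums
     (1 / 2 * (LINT \<theta>:{0..2 * pi}|lborel. D (of_real r * cis \<theta>) * cnj (H (of_real r * cis \<theta>))))"
    by (rule sums_mult)
  have "taylor_coeff V k * cnj (taylor_coeff W k) * of_real (pi * (r ^ (2 * k) - 1 / r ^ (2 * k)) / real k)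
     = 1 / 2 * (taylor_coeff D k * cnj (taylor_coeff H k) * of_real (2 * pi * r ^ (2 * k)))" for k
  proof (cases "k = 0")
    case True
    thus ?thesis using taylor_coeff_0[of V] V by (simp add: tD)
  next
    case False
    have "r ^ (2 * k) - 1 / r ^ (2 * k) = (1 - 1 / r ^ (4 * k)) * r ^ (2 * k)"
      using r by (simp add: field_simps flip: power_add)
    hence e: "pi * (r ^ (2 * k) - 1 / r ^ (2 * k)) / real k * real k = (1 - 1 / r ^ (4 * k)) * (pi * r ^ (2 * k))"
      using False by simp
    have "taylor_coeff V k * cnj (taylor_coeff W k) * of_real (pi * (r ^ (2 * k) - 1 / r ^ (2 * k)) / real k)
      = taylor_coeff V k * cnj (taylor_coeff H k) * of_real (pi * (r ^ (2 * k) - 1 / r ^ (2 * k)) / real k * real k)"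
      by (simp add: tW)
    thus ?thesis unfolding e tD by simp
  qed
  with s1 have "(\<lambda>k. 1 / 2 * (taylor_coeff D k * cnj (taylor_coeff H k) * of_real (2 * pi * r ^ (2 * k)))) sums
     (LINT w:log_rect r|lborel. (V (exp w) - V (exp (- w))) * cnj (W (exp w) - W (exp (- w))))"
    by simp
  from sums_unique2[OF this s2] show ?thesis by (simp add: W_def D_def)
qed

text \<open>
  Coefficientwise this is \<open>1 - r^(- 4 k) \<ge> 1 - r^(- 4)\<close> for \<open>k \<ge>
  1\<close>: the folding \<open>V \<zeta> - V (1/\<zeta>)\<close> loses at most a fixed proportion
  of the energy.
\<close>

lemma energy_on_annulus_ge:
  assumes H: "H holomorphic_on ball 0 r'" and r: "1 < r" "r < r'"
  defines "V \<equiv> (\<lambda>\<zeta>. \<zeta> * deriv H \<zeta>)"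
  shows "(1 - 1 / r ^ 4) * Re (1 / 2 * (LINT \<theta>:{0..2 * pi}|lborel. V (of_real r * cis \<theta>) * cnj (H (of_real r * cis \<theta>))))
     \<le> Re (LINT w:log_rect r|lborel. (V (exp w) - V (exp (- w))) * cnj (V (exp w) - V (exp (- w))))"
proof -
  have r': "0 < r'" using r by linarith
  have V: "V holomorphic_on ball 0 r'" "V 0 = 0" unfolding V_def
    using H by (auto intro!: holomorphic_intros holomorphic_deriv)
  have tV: "taylor_coeff V k = of_nat k * taylor_coeff H k" for k
    unfolding V_def using H r' by (rule taylor_coeff_Euler)
  define h where "h = (\<lambda>k. (cmod (taylor_coeff H k))\<^sup>2)"
  have e: "taylor_coeff H k * cnj (taylor_coeff H k) = of_real (h k)" for k unfolding h_def by (rule complex_norm_square[symmetric])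
  have eq1: "taylor_coeff V k * cnj (taylor_coeff V k) * of_real (pi * (r ^ (2 * k) - 1 / r ^ (2 * k)) / real k)
     = of_real (pi * real k * h k * (r ^ (2 * k) - 1 / r ^ (2 * k)))" for k
  proof -
    have "taylor_coeff V k * cnj (taylor_coeff V k) * of_real (pi * (r ^ (2 * k) - 1 / r ^ (2 * k)) / real k)
       = (taylor_coeff H k * cnj (taylor_coeff H k)) * of_real (real k * real k * (pi * (r ^ (2 * k) - 1 / r ^ (2 * k)) / real k))"
      unfolding tV by simp
    also have "real k * real k * (pi * (r ^ (2 * k) - 1 / r ^ (2 * k)) / real k) = pi * real k * (r ^ (2 * k) - 1 / r ^ (2 * k))"
      by simp
    finally show ?thesis unfolding e by simp
  qed
  have eq2: "1 / 2 * (taylor_coeff V k * cnj (taylor_coeff H k) * of_real (2 * pi * r ^ (2 * k))) = of_real (pi * real k * h k * r ^ (2 * k))" for k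
  proof -
    have "1 / 2 * (taylor_coeff V k * cnj (taylor_coeff H k) * of_real (2 * pi * r ^ (2 * k))) = (taylor_coeff H k * cnj (taylor_coeff H k)) * of_real (pi * real k * r ^ (2 * k))"
      unfolding tV by simp
    also have "\<dots> = of_real (pi * real k * h k * r ^ (2 * k))" unfolding e by simp
    finally show ?thesis .
  qed
  have "(\<lambda>k. of_real (pi * real k * h k * (r ^ (2 * k) - 1 / r ^ (2 * k)))) sums
     (LINT w:log_rect r|lborel. (V (exp w) - V (exp (- w))) * cnj (V (exp w) - V (exp (- w))))"
    using annulus_series_sums[OF V V r] unfolding eq1 .
  hence s1: "(\<lambda>k. pi * real k * h k * (r ^ (2 * k) - 1 / r ^ (2 * k))) sums
     Re (LINT w:log_rect r|lborel. (V (exp w) - V (exp (- w))) * cnj (V (exp w) - V (exp (- w))))"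
    using sums_Re by fastforce
  have "(\<lambda>k. 1 / 2 * (taylor_coeff V k * cnj (taylor_coeff H k) * of_real (2 * pi * r ^ (2 * k)))) sums
     (1 / 2 * (LINT \<theta>:{0..2 * pi}|lborel. V (of_real r * cis \<theta>) * cnj (H (of_real r * cis \<theta>))))"
    using r by (intro sums_mult circle_series_sums[OF V(1) H]) auto
  hence "(\<lambda>k. pi * real k * h k * r ^ (2 * k)) sums
     Re (1 / 2 * (LINT \<theta>:{0..2 * pi}|lborel. V (of_real r * cis \<theta>) * cnj (H (of_real r * cis \<theta>))))"
    unfolding eq2 using sums_Re by fastforce
  hence s2: "(\<lambda>k. (1 - 1 / r ^ 4) * (pi * real k * h k * r ^ (2 * k))) sums
     ((1 - 1 / r ^ 4) * Re (1 / 2 * (LINT \<theta>:{0..2 * pi}|lborel. V (of_real r * cis \<theta>) * cnj (H (of_real r * cis \<theta>)))))"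
    by (rule sums_mult)
  show ?thesis
  proof (rule sums_le[OF _ s2 s1])
    fix k
    show "(1 - 1 / r ^ 4) * (pi * real k * h k * r ^ (2 * k)) \<le> pi * real k * h k * (r ^ (2 * k) - 1 / r ^ (2 * k))"
    proof (cases "k = 0")
      case False
      have "r ^ 4 \<le> r ^ (4 * k)" using r False by (intro power_increasing) auto
      hence "1 / r ^ (4 * k) \<le> 1 / r ^ 4" using r by (intro divide_left_mono) auto
      hence "(1 - 1 / r ^ 4) * r ^ (2 * k) \<le> (1 - 1 / r ^ (4 * k)) * r ^ (2 * k)"
        using r by (intro mult_right_mono) auto
      also have "\<dots> = r ^ (2 * k) - 1 / r ^ (2 * k)"
        using r by (simp add: field_simps flip: power_add)
      finally have "(pi * real k * h k) * ((1 - 1 / r ^ 4) * r ^ (2 * k)) \<le> (pi * real k * h k) * (r ^ (2 * k) - 1 / r ^ (2 * k))"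
        by (rule mult_left_mono) (simp add: h_def)
      thus ?thesis by (simp only: mult_ac)
    qed simp
  qed
qed

section \<open>Pulling the area integral over the domain back to a rectangle\<close>

context outer_radius
begin

lemma X_holo: "X holomorphic_on ball 0 (1 / m\<^sup>2)"
  unfolding holomorphic_on_open[OF open_ball] by (intro ballI exI, rule X_has_deriv, simp)

lemma X'_eq_deriv: "cmod \<zeta> < 1 / m\<^sup>2 \<Longrightarrow> deriv X \<zeta> = X' \<zeta>"
  using X_has_deriv by (rule DERIV_imp_deriv)

lemma X'_holo: "X' holomorphic_on ball 0 (1 / m\<^sup>2)"
  unfolding X'_def by (intro holomorphic_intros) (use den_nz in \<open>auto simp del: of_real_power\<close>)

text \<open>
  A conformal coordinate on the domain minus the segment \<open>[-2, 2]\<close> and a slit on the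
  real axis.
\<close>

definition fold_coord :: "complex \<Rightarrow> complex" where
  "fold_coord w = jouk (U (exp w))"

lemma exp_log_rect:
  assumes "w \<in> log_rect (1 / m)"
  shows "1 < cmod (exp w)" "cmod (exp w) < 1 / m" "cmod (exp w) < 1 / m\<^sup>2" "cmod (exp (- w)) < 1 / m\<^sup>2"
proof -
  have "exp 0 < exp (Re w)" "exp (Re w) < exp (ln (1 / m))" using assms by (auto simp: log_rect_def)
  thus 1: "1 < cmod (exp w)" "cmod (exp w) < 1 / m" using m_pos by (simp_all add: norm_exp_eq_Re)
  thus "cmod (exp w) < 1 / m\<^sup>2" using inv_m_less by linarith
  have "cmod (exp (- w)) = inverse (cmod (exp w))" by (simp add: exp_minus norm_inverse)
  also have "\<dots> < 1" using 1(1) by (simp add: inverse_less_1_iff)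
  finally show "cmod (exp (- w)) < 1 / m\<^sup>2" using inv_m_less by linarith
qed

lemma U_gt_1: "cmod \<zeta> < 1 / m\<^sup>2 \<Longrightarrow> 1 < cmod \<zeta> \<Longrightarrow> 1 < cmod (U \<zeta>)"
proof -
  assume a: "cmod \<zeta> < 1 / m\<^sup>2" "1 < cmod \<zeta>"
  hence z: "\<zeta> \<noteq> 0" by auto
  have i: "cmod (inverse \<zeta>) < 1" using a by (simp add: norm_inverse inverse_less_1_iff)
  hence "cmod (inverse \<zeta>) < 1 / m\<^sup>2" using inv_m_less by linarith
  hence "\<not> 1 \<le> cmod (U (inverse \<zeta>))" using U_ge_1_iff[of "inverse \<zeta>"] i by linarith
  hence "cmod (inverse (U \<zeta>)) < 1" using U_inverse[OF z] by simp
  moreover have ge: "1 \<le> cmod (U \<zeta>)" using U_ge_1_iff a by simp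
  moreover have "U \<zeta> \<noteq> 0" using ge by auto
  ultimately show ?thesis by (simp add: norm_inverse inverse_less_1_iff)
qed

text \<open>
  Only real points are missed, so the image has full measure in the domain.
\<close>

lemma fold_coord_image:
  "fold_coord ` log_rect (1 / m) \<subseteq> G1 R" "G1 R - fold_coord ` log_rect (1 / m) \<subseteq> {z. Im z = 0}"
proof -
  show "fold_coord ` log_rect (1 / m) \<subseteq> G1 R"
  proof (rule image_subsetI)
    fix w assume w: "w \<in> log_rect (1 / m)"
    note e = exp_log_rect[OF w]
    have "cmod (U (exp w) + 1) < R" using X_eq_U[OF e(3)] X_less_R_iff[OF e(3)] e(2) by simp
    moreover have "1 \<le> cmod (U (exp w))" using U_gt_1[OF e(3) e(1)] by simp
    ultimately show "fold_coord w \<in> G1 R"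
      unfolding G1_eq[OF R_gt_2] fold_coord_def by blast
  qed
  show "G1 R - fold_coord ` log_rect (1 / m) \<subseteq> {z. Im z = 0}"
  proof
    fix z assume z: "z \<in> G1 R - fold_coord ` log_rect (1 / m)"
    then obtain u where u: "1 \<le> cmod u" "cmod (u + 1) < R" "z = jouk u"
      unfolding G1_eq[OF R_gt_2] by blast
    obtain \<zeta> where \<zeta>: "cmod \<zeta> \<le> 1 / m" "U \<zeta> = u" using U_surj[of u] u by auto
    have lt2: "cmod \<zeta> < 1 / m\<^sup>2" using \<zeta>(1) inv_m_less by linarith
    have lt: "cmod \<zeta> < 1 / m" using X_less_R_iff[OF lt2] X_eq_U[OF lt2] u \<zeta> by simp
    have ge: "1 \<le> cmod \<zeta>" using U_ge_1_iff[OF lt2] u \<zeta> by simp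
    hence nz: "\<zeta> \<noteq> 0" by auto
    have "cmod \<zeta> = 1 \<or> Im \<zeta> = 0"
    proof (rule ccontr)
      assume n: "\<not> (cmod \<zeta> = 1 \<or> Im \<zeta> = 0)"
      have "Ln \<zeta> \<in> log_rect (1 / m)"
      proof -
        have "0 < ln (cmod \<zeta>)" by (rule ln_gt_zero) (use n ge in linarith)
        moreover have "ln (cmod \<zeta>) < ln (1 / m)" using lt ge m_pos by (subst ln_less_cancel_iff) auto
        moreover have "Im (Ln \<zeta>) \<noteq> pi" using n Im_Ln_eq_pi[OF nz] by simp
        ultimately show ?thesis
          using mpi_less_Im_Ln[OF nz] Im_Ln_le_pi[OF nz] nz by (simp add: log_rect_def Re_Ln)
      qed
      moreover have "fold_coord (Ln \<zeta>) = z" using nz \<zeta> u by (simp add: fold_coord_def)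
      ultimately show False using z by blast
    qed
    thus "z \<in> {z. Im z = 0}"
    proof
      assume "Im \<zeta> = 0"
      hence "\<zeta> = of_real (Re \<zeta>)" by (simp add: complex_eq_iff)
      then obtain x where "\<zeta> = of_real x" by blast
      hence "u = of_real ((x + m\<^sup>2) / (1 + m\<^sup>2 * x))"
        using \<zeta>(2) by (simp add: U_def)
      then obtain y where "u = of_real y" by blast
      hence "z = of_real (y + inverse y)" using u(3) by (simp add: jouk_def)
      thus ?thesis by (simp only: mem_Collect_eq Im_complex_of_real)
    next
      assume c: "cmod \<zeta> = 1"
      have "cmod (inverse \<zeta>) < 1 / m\<^sup>2" using c inv_m_less by (simp add: norm_inverse)
      hence "1 \<le> cmod (U (inverse \<zeta>))" using U_ge_1_iff c by (simp add: norm_inverse)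
      hence "1 \<le> cmod (inverse u)" using U_inverse[OF nz] \<zeta> by simp
      moreover have "cmod (inverse u) * cmod u = 1" 
      proof -
        have "cmod u \<noteq> 0" using u(1) by linarith
        thus ?thesis by (simp add: norm_inverse)
      qed
      ultimately have "cmod u = 1" using u(1)
        by (smt (verit) mult_le_cancel_right1 mult_less_cancel_right2 norm_ge_zero)
      hence "u * cnj u = 1" using complex_norm_square[of u] by simp
      hence "inverse u = cnj u" by (rule inverse_unique)
      thus ?thesis using u(3) by (simp add: jouk_def)
    qed
  qed
qed

lemma fold_coord_has_deriv:
  assumes w: "w \<in> log_rect (1 / m)"
  shows "(fold_coord has_field_derivative ((1 - 1 / (U (exp w))\<^sup>2) * (X' (exp w) * exp w))) (at w)"
proof -
  note e = exp_log_rect[OF w]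
  have nz: "U (exp w) \<noteq> 0" using U_gt_1[OF e(3) e(1)] by auto
  have "((\<lambda>w. U (exp w)) has_field_derivative (X' (exp w) * exp w)) (at w)"
    by (rule DERIV_chain2[OF U_has_deriv[OF e(3)] DERIV_exp])
  moreover have "(jouk has_field_derivative (1 - 1 / (U (exp w))\<^sup>2)) (at (U (exp w)))"
    unfolding jouk_def using nz
    by (auto intro!: derivative_eq_intros simp: power2_eq_square inverse_eq_divide)
  ultimately show ?thesis unfolding fold_coord_def by (rule DERIV_chain2[rotated])
qed

lemma inj_on_fold_coord: "inj_on fold_coord (log_rect (1 / m))"
proof (rule inj_onI)
  fix w v assume w: "w \<in> log_rect (1 / m)" and v: "v \<in> log_rect (1 / m)" and eq: "fold_coord w = fold_coord v"
  note ew = exp_log_rect[OF w] and ev = exp_log_rect[OF v]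
  have gt: "1 < cmod (U (exp w))" "1 < cmod (U (exp v))" using U_gt_1 ew ev by auto
  hence nz: "U (exp w) \<noteq> 0" "U (exp v) \<noteq> 0" by auto
  have "U (exp w) * U (exp v) \<noteq> 1"
  proof
    assume "U (exp w) * U (exp v) = 1"
    hence "cmod (U (exp w)) * cmod (U (exp v)) = 1" by (metis norm_mult norm_one)
    moreover have "1 * 1 < cmod (U (exp w)) * cmod (U (exp v))"
      by (rule mult_strict_mono) (use gt in auto)
    ultimately show False by simp
  qed
  hence "U (exp w) = U (exp v)" using eq jouk_eq_iff[OF nz] by (simp add: fold_coord_def)
  hence "exp w = exp v" using U_inj ew(3) ev(3) by (auto simp: inj_on_def)
  hence "Ln (exp w) = Ln (exp v)" by simp
  thus "w = v" using w v by (simp add: log_rect_def Ln_exp)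
qed

text \<open>
  The coefficient of the differential \<open>k (x) dx\<close> with \<open>x = X \<zeta>\<close>,
  expressed in \<open>log \<zeta>\<close>.
\<close>

definition lift :: "(complex \<Rightarrow> complex) \<Rightarrow> complex \<Rightarrow> complex" where
  "lift k \<zeta> = \<zeta> * X' \<zeta> * k (X \<zeta>)"

text \<open>
  The differential \<open>p (z) dz\<close> is the sum of \<open>k (x) dx\<close> at the two
  preimages \<open>x = X \<zeta>\<close> and \<open>x = X (1/\<zeta>)\<close>; the minus sign is
  the derivative of \<open>- w\<close>.
\<close>

lemma lift_fold:
  assumes w: "w \<in> log_rect (1 / m)"
  and q: "\<And>u. u \<noteq> 0 \<Longrightarrow> poly p (jouk u) * (1 - 1 / u\<^sup>2) = k (1 + u) - k (1 + 1 / u) / u\<^sup>2"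
  shows "poly p (fold_coord w) * deriv fold_coord w = lift k (exp w) - lift k (exp (- w))"
proof -
  note e = exp_log_rect[OF w]
  define \<zeta> where "\<zeta> = exp w"
  define M where "M = complex_of_real (m\<^sup>2)"
  have z0: "\<zeta> \<noteq> 0" and em: "exp (- w) = inverse \<zeta>" by (simp_all add: \<zeta>_def exp_minus)
  have nz: "U \<zeta> \<noteq> 0" using U_gt_1[OF e(3) e(1)] by (auto simp: \<zeta>_def)
  have d: "deriv fold_coord w = (1 - 1 / (U \<zeta>)\<^sup>2) * (X' \<zeta> * \<zeta>)"
    using DERIV_imp_deriv[OF fold_coord_has_deriv[OF w]] by (simp add: \<zeta>_def)
  have X1: "1 + U \<zeta> = X \<zeta>" using X_eq_U[OF e(3)] by (simp add: \<zeta>_def)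
  have X2: "1 + 1 / U \<zeta> = X (inverse \<zeta>)"
    using X_eq_U[OF e(4)[unfolded em]] U_inverse[OF z0] by (simp add: inverse_eq_divide)
  have n1: "1 + M * \<zeta> \<noteq> 0" using den_nz[OF e(3)] by (simp add: \<zeta>_def M_def)
  have n2: "1 + M * inverse \<zeta> \<noteq> 0" using den_nz[OF e(4)[unfolded em]] by (simp add: M_def)
  have n3: "\<zeta> + M \<noteq> 0" using n2 z0 by (auto simp: field_simps)
  have "X' \<zeta> * \<zeta> / (U \<zeta>)\<^sup>2 = inverse \<zeta> * X' (inverse \<zeta>)"
  proof -
    define C where "C = complex_of_real ((1 + m\<^sup>2) * (1 - m\<^sup>2))"
    have "X' \<zeta> * \<zeta> / (U \<zeta>)\<^sup>2 = C * \<zeta> / (\<zeta> + M)\<^sup>2"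
      unfolding X'_def U_def M_def[symmetric] C_def[symmetric] using n1 n3 by (simp add: power_divide)
    also have "1 + M * inverse \<zeta> = (\<zeta> + M) / \<zeta>" using z0 by (simp add: field_simps)
    hence "C * \<zeta> / (\<zeta> + M)\<^sup>2 = inverse \<zeta> * (C / (1 + M * inverse \<zeta>)\<^sup>2)"
      using z0 n3 by (simp add: power_divide power2_eq_square)
    finally show ?thesis unfolding X'_def M_def[symmetric] C_def[symmetric] .
  qed
  note X3 = this
  have "poly p (fold_coord w) * deriv fold_coord w = (poly p (jouk (U \<zeta>)) * (1 - 1 / (U \<zeta>)\<^sup>2)) * (X' \<zeta> * \<zeta>)"
    by (simp add: d fold_coord_def \<zeta>_def)
  also have "\<dots> = k (X \<zeta>) * (X' \<zeta> * \<zeta>) - k (X (inverse \<zeta>)) * (X' \<zeta> * \<zeta> / (U \<zeta>)\<^sup>2)"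
    unfolding q[OF nz] X1 X2 by (simp add: left_diff_distrib)
  also have "\<dots> = lift k \<zeta> - lift k (inverse \<zeta>)"
    unfolding X3 lift_def by (simp only: mult_ac)
  finally show ?thesis by (simp only: em \<zeta>_def)
qed

lemma open_G1: "open (G1 R)" and bounded_G1: "bounded (G1 R)"
proof -
  have comp: "compact (L1 R)"
  proof -
    have "compact {u. cmod (u + 1) = R}"
    proof -
      have "{u. cmod (u + 1) = R} = sphere (-1) R"
        by (auto simp: dist_norm) (metis norm_minus_commute diff_minus_eq_add)+
      thus ?thesis by simp
    qed
    moreover have "continuous_on {u. cmod (u + 1) = R} jouk"
      by (rule continuous_on_jouk) (use R_gt_2 in auto)
    ultimately show ?thesis unfolding L1_eq by (intro compact_continuous_image)
  qed
  show "open (G1 R)" unfolding G1_def using comp by (intro open_inside compact_imp_closed)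
  have "compact {u. 1 \<le> cmod u \<and> cmod (u + 1) \<le> R}"
  proof -
    have "bounded {u. 1 \<le> cmod u \<and> cmod (u + 1) \<le> R}"
    proof (rule boundedI)
      fix u assume "u \<in> {u. 1 \<le> cmod u \<and> cmod (u + 1) \<le> R}"
      thus "cmod u \<le> R + 1" using norm_triangle_ineq4[of "u + 1" 1] by simp
    qed
    moreover have "closed {u. 1 \<le> cmod u \<and> cmod (u + 1) \<le> R}"
      by (intro closed_Collect_conj closed_Collect_le continuous_intros)
    ultimately show ?thesis by (simp only: compact_eq_bounded_closed)
  qed
  hence "compact (jouk ` {u. 1 \<le> cmod u \<and> cmod (u + 1) \<le> R})"
    by (intro compact_continuous_image continuous_on_jouk) auto
  hence "bounded (jouk ` {u. 1 \<le> cmod u \<and> cmod (u + 1) \<le> R})" by (rule compact_imp_bounded)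
  moreover have "G1 R \<subseteq> jouk ` {u. 1 \<le> cmod u \<and> cmod (u + 1) \<le> R}"
    unfolding G1_eq[OF R_gt_2] by (intro image_mono) auto
  ultimately show "bounded (G1 R)" using bounded_subset by blast
qed

lemma G1_integrable:
  fixes f :: "complex \<Rightarrow> complex"
  assumes "continuous_on UNIV f"
  shows "set_integrable lborel (G1 R) f"
proof -
  have "compact (closure (G1 R))" using bounded_G1 by (simp add: compact_closure)
  hence "set_integrable lborel (closure (G1 R)) f"
    unfolding set_integrable_def using assms
    by (intro borel_integrable_compact continuous_on_subset[OF assms]) auto
  thus ?thesis
    by (rule set_integrable_subset) (use open_G1 closure_subset in auto)
qed

text \<open>
  The change of variables \<open>z = fold_coord w\<close>, up to the null set of real points.
\<close>

theorem area_integral_pullback: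
  assumes p: "\<And>u. u \<noteq> 0 \<Longrightarrow> poly p (jouk u) * (1 - 1 / u\<^sup>2) = k (1 + u) - k (1 + 1 / u) / u\<^sup>2"
    and q: "\<And>u. u \<noteq> 0 \<Longrightarrow> poly q (jouk u) * (1 - 1 / u\<^sup>2) = l (1 + u) - l (1 + 1 / u) / u\<^sup>2"
  shows "(LINT z:G1 R|lborel. poly p z * cnj (poly q z)) =
    (LINT w:log_rect (1 / m)|lborel. (lift k (exp w) - lift k (exp (- w))) * cnj (lift l (exp w) - lift l (exp (- w))))"
proof -
  let ?B = "log_rect (1 / m)"
  define f where "f = (\<lambda>z. poly p z * cnj (poly q z))"
  have cf: "continuous_on UNIV f" unfolding f_def by (intro continuous_intros)
  have holo: "fold_coord holomorphic_on ?B"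
    unfolding holomorphic_on_open[OF open_log_rect] using fold_coord_has_deriv by blast
  have op: "open (fold_coord ` ?B)"
    by (rule open_mapping_thm3[OF holo open_log_rect inj_on_fold_coord])
  hence Zs: "fold_coord ` ?B \<in> sets borel" by simp
  have int: "set_integrable lborel (fold_coord ` ?B) f"
    by (rule set_integrable_subset[OF G1_integrable[OF cf]]) (use fold_coord_image Zs in auto)
  have null: "{z. Im z = 0} \<in> null_sets lborel"
  proof -
    have "negligible {z::complex. \<i> \<bullet> z = 0}" by (rule negligible_hyperplane) simp
    hence "negligible {z. Im z = 0}" by (simp add: inner_complex_def)
    moreover have "{z. Im z = 0} \<in> sets borel"
      by (intro borel_closed closed_Collect_eq continuous_intros)
    ultimately show ?thesis
      by (simp add: negligible_iff_null_sets null_sets_completion_iff)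
  qed
  have "(LINT z:G1 R|lborel. f z) = (LINT z:fold_coord ` ?B|lborel. f z)"
  proof (rule set_integral_cong_set[symmetric])
    show "set_borel_measurable lborel (G1 R) f"
      using G1_integrable[OF cf] by (simp add: set_integrable_def set_borel_measurable_def)
    show "set_borel_measurable lborel (fold_coord ` ?B) f"
      using int by (simp add: set_integrable_def set_borel_measurable_def)
    show "AE z in lborel. (z \<in> G1 R) = (z \<in> fold_coord ` ?B)"
      using AE_not_in[OF null] by eventually_elim (use fold_coord_image in blast)
  qed
  also have "\<dots> = (LINT w:?B|lborel. of_real ((cmod (deriv fold_coord w))\<^sup>2) * f (fold_coord w))"
    by (rule holomorphic_change_of_variables[OF open_log_rect holo inj_on_fold_coord int Zs])
       (use cf in \<open>rule borel_measurable_continuous_onI\<close>)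
  also have "\<dots> = (LINT w:?B|lborel. (lift k (exp w) - lift k (exp (- w))) * cnj (lift l (exp w) - lift l (exp (- w))))"
  proof (rule set_lebesgue_integral_cong)
    show "?B \<in> sets lborel" using open_log_rect by auto
    show "\<forall>w. w \<in> ?B \<longrightarrow> of_real ((cmod (deriv fold_coord w))\<^sup>2) * f (fold_coord w)
       = (lift k (exp w) - lift k (exp (- w))) * cnj (lift l (exp w) - lift l (exp (- w)))"
    proof (intro allI impI)
      fix w assume w: "w \<in> ?B"
      show "of_real ((cmod (deriv fold_coord w))\<^sup>2) * f (fold_coord w)
       = (lift k (exp w) - lift k (exp (- w))) * cnj (lift l (exp w) - lift l (exp (- w)))"
      proof -
        have e1: "lift k (exp w) - lift k (exp (- w)) = poly p (fold_coord w) * deriv fold_coord w"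
          by (rule lift_fold[OF w p, symmetric])
        have e2: "lift l (exp w) - lift l (exp (- w)) = poly q (fold_coord w) * deriv fold_coord w"
          by (rule lift_fold[OF w q, symmetric])
        show ?thesis unfolding e1 e2 complex_norm_square f_def complex_cnj_mult by (simp only: mult_ac)
      qed
    qed
  qed
  finally show ?thesis unfolding f_def .
qed

lemma X_cnj: "cnj (X \<zeta>) = X (cnj \<zeta>)"
  by (simp add: X_def)

lemma circle_props:
  assumes "cmod \<zeta> = 1 / m"
  shows "cmod \<zeta> < 1 / m\<^sup>2" "cmod (X \<zeta>) = R" "cnj (X \<zeta>) = of_real (R\<^sup>2) / X \<zeta>" "X \<zeta> \<noteq> 0"
proof -
  show lt: "cmod \<zeta> < 1 / m\<^sup>2" using assms inv_m_less by simp
  have D: "1 + 2 * m\<^sup>2 * Re \<zeta> + m ^ 4 * (cmod \<zeta>)\<^sup>2 = m\<^sup>2 * (1 + 2 * Re \<zeta> + (cmod \<zeta>)\<^sup>2)"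
    using m_pos by (simp add: assms power_divide field_simps power4_eq_xxxx power2_eq_square)
  have "1 + 2 * Re \<zeta> + (cmod \<zeta>)\<^sup>2 \<noteq> 0" using den_sq_pos[OF lt] D by auto
  hence "(cmod (X \<zeta>))\<^sup>2 = R\<^sup>2"
    unfolding X_norm_sq D R_sq by simp
  thus c: "cmod (X \<zeta>) = R" using R_gt_2 by (simp add: power2_eq_iff_nonneg)
  thus nz: "X \<zeta> \<noteq> 0" using R_gt_2 by auto
  have "X \<zeta> * cnj (X \<zeta>) = of_real (R\<^sup>2)" using c by (metis complex_norm_square)
  thus "cnj (X \<zeta>) = of_real (R\<^sup>2) / X \<zeta>" using nz by (simp add: field_simps)
qed

text \<open>
  On the circle \<open>|\<zeta>| = 1/m\<close> we have \<open>|X| = R\<close>, so that \<open>cnj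
  X = R\<^sup>2 / X\<close>. The integral becomes a contour integral of \<open>k (x) /
  x^(j+1)\<close>, whose value is a Taylor coefficient of \<open>k\<close>.
\<close>

lemma circle_moment:
  assumes k: "k holomorphic_on ball 0 r'" and r': "R < r'"
  shows "(LINT \<theta>:{0..2 * pi}|lborel. lift k (of_real (1 / m) * cis \<theta>) * cnj (X (of_real (1 / m) * cis \<theta>) ^ Suc j / of_nat (Suc j)))
     = of_real (2 * pi * R ^ (2 * Suc j) / real (Suc j)) * taylor_coeff k j"
proof -
  define \<gamma> where "\<gamma> = circlepath 0 (1 / m)"
  define S where "S = ball (0::complex) (1 / m\<^sup>2)"
  define f where "f = (\<lambda>x. k x / x ^ Suc j)"
  define c where "c = complex_of_real (R ^ (2 * Suc j) / real (Suc j))"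
  have im: "path_image \<gamma> = sphere 0 (1 / m)" using m_pos by (simp add: \<gamma>_def)
  have sub: "path_image \<gamma> \<subseteq> S" unfolding im S_def using inv_m_less by auto
  have Xan: "X analytic_on S" using X_holo by (simp add: analytic_on_open S_def)
  have vp: "valid_path \<gamma>" by (simp add: \<gamma>_def)
  have vpX: "valid_path (X \<circ> \<gamma>)" by (rule valid_path_compose_analytic[OF vp Xan sub])
  have imX: "path_image (X \<circ> \<gamma>) \<subseteq> sphere 0 R"
    using circle_props(2) by (auto simp: path_image_compose im)
  have loop: "pathfinish (X \<circ> \<gamma>) = pathstart (X \<circ> \<gamma>)"
    by (simp add: pathfinish_compose pathstart_compose \<gamma>_def)
  have wind: "winding_number (X \<circ> \<gamma>) 0 = 1"
  proof -
    have n0: "0 \<notin> path_image (X \<circ> \<gamma>)" using imX R_gt_2 by auto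
    have "winding_number (X \<circ> \<gamma>) 0 = 1 / (2 * pi * \<i>) * contour_integral (X \<circ> \<gamma>) (\<lambda>w. 1 / (w - 0))"
      by (rule winding_number_valid_path[OF vpX n0])
    also have "contour_integral (X \<circ> \<gamma>) (\<lambda>w. 1 / (w - 0)) = contour_integral \<gamma> (\<lambda>w. deriv X w * (1 / (X w - 0)))"
      by (rule contour_integral_comp_analyticW[OF Xan vp sub])
    also have "\<dots> = 2 * of_real pi * \<i>"
    proof (rule contour_integral_unique)
      have "-1 \<notin> path_image \<gamma>" using im inv_m_less by auto
      hence "((\<lambda>w. 1 / (w - (-1))) has_contour_integral (2 * of_real pi * \<i> * winding_number \<gamma> (-1))) \<gamma>"
        using has_contour_integral_winding_number[OF vp, of "-1"] by simp
      moreover have "winding_number \<gamma> (-1) = 1"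
        unfolding \<gamma>_def by (rule winding_number_circlepath) (use inv_m_less in auto)
      ultimately have A: "((\<lambda>w. 1 / (w - (-1))) has_contour_integral (2 * of_real pi * \<i>)) \<gamma>" by simp
      have B: "((\<lambda>w. of_real (m\<^sup>2) / (1 + of_real (m\<^sup>2) * w)) has_contour_integral 0) \<gamma>"
      proof (rule Cauchy_theorem_disc_simple[of _ 0 "1 / m\<^sup>2"])
        show "(\<lambda>w. of_real (m\<^sup>2) / (1 + of_real (m\<^sup>2) * w)) holomorphic_on ball 0 (1 / m\<^sup>2)"
          by (intro holomorphic_intros) (use den_nz in \<open>auto simp del: of_real_power\<close>)
      qed (use vp sub in \<open>auto simp: S_def \<gamma>_def\<close>)
      have "((\<lambda>w. 1 / (w - (-1)) - of_real (m\<^sup>2) / (1 + of_real (m\<^sup>2) * w)) has_contour_integral (2 * of_real pi * \<i> - 0)) \<gamma>"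
        by (rule has_contour_integral_diff[OF A B])
      thus "((\<lambda>w. deriv X w * (1 / (X w - 0))) has_contour_integral (2 * of_real pi * \<i>)) \<gamma>"
      proof -
        assume A: "((\<lambda>w. 1 / (w - (-1)) - of_real (m\<^sup>2) / (1 + of_real (m\<^sup>2) * w)) has_contour_integral (2 * of_real pi * \<i> - 0)) \<gamma>"
        have e: "1 / (w - (-1)) - of_real (m\<^sup>2) / (1 + of_real (m\<^sup>2) * w) = deriv X w * (1 / (X w - 0))"
          if "w \<in> path_image \<gamma>" for w
        proof -
          have cw: "cmod w = 1 / m" using that im by simp
          define M where "M = complex_of_real (m\<^sup>2)"
          have n1: "1 + M * w \<noteq> 0" using den_nz[OF circle_props(1)[OF cw]] by (simp add: M_def)
          have n2: "1 + w \<noteq> 0" using circle_props(4)[OF cw] by (auto simp: X_def)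
          have n3: "1 + M \<noteq> 0" using one_plus_m2_pos unfolding M_def
            by (metis of_real_1 of_real_add of_real_eq_0_iff less_irrefl)
          have "deriv X w = (1 + M) * (1 - M) / (1 + M * w)\<^sup>2"
            using X'_eq_deriv[OF circle_props(1)[OF cw]] by (simp add: X'_def M_def)
          moreover have "X w = (1 + M) * (1 + w) / (1 + M * w)" by (simp add: X_def M_def)
          ultimately have "deriv X w * (1 / (X w - 0)) = (1 - M) / ((1 + M * w) * (1 + w))"
            using n1 n2 n3 by (simp add: power2_eq_square)
          also have "\<dots> = 1 / (1 + w) - M / (1 + M * w)"
            using n1 n2 by (simp add: field_simps)
          finally show ?thesis unfolding M_def by (simp add: add.commute)
        qed
        show ?thesis
          using has_contour_integral_eq[OF A e] by simp
      qed
    qed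
    also have "1 / (complex_of_real (2 * pi) * \<i>) * (2 * of_real pi * \<i>) = 1" by simp
    finally show ?thesis .
  qed
  have fh: "f holomorphic_on ball 0 r' - {0}"
    unfolding f_def by (intro holomorphic_intros holomorphic_on_subset[OF k]) auto
  have "contour_integral (X \<circ> \<gamma>) f = 2 * pi * \<i> * (\<Sum>p\<in>{0}. winding_number (X \<circ> \<gamma>) p * residue f p)"
  proof (rule Residue_theorem[OF _ _ _ fh vpX loop])
    show "path_image (X \<circ> \<gamma>) \<subseteq> ball 0 r' - {0}" using imX r' R_gt_2 by auto
    show "\<forall>z. z \<notin> ball 0 r' \<longrightarrow> winding_number (X \<circ> \<gamma>) z = 0"
      using imX r' loop vpX by (intro allI impI winding_number_zero_outside[of _ "ball 0 r'"])
         (auto simp: valid_path_imp_path)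
  qed auto
  also have "residue f 0 = taylor_coeff k j"
    unfolding f_def taylor_coeff_def using k r' R_gt_2 by (intro residue_holomorphic_over_power'[of "ball 0 r'"]) auto
  hence "2 * pi * \<i> * (\<Sum>p\<in>{0}. winding_number (X \<circ> \<gamma>) p * residue f p) = 2 * pi * \<i> * taylor_coeff k j"
    by (simp add: wind)
  finally have ci: "contour_integral \<gamma> (\<lambda>w. deriv X w * f (X w)) = 2 * pi * \<i> * taylor_coeff k j"
    using contour_integral_comp_analyticW[OF Xan vp sub, of f] by simp
  define g where "g = (\<lambda>w. deriv X w * f (X w))"
  have gc: "continuous_on (sphere 0 (1 / m)) g"
  proof -
    have sphere_sub: "sphere 0 (1 / m) \<subseteq> ball (0::complex) (1 / m\<^sup>2)" using inv_m_less by auto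
    have cX: "continuous_on (sphere 0 (1 / m)) X"
      using X_holo sphere_sub by (meson continuous_on_subset holomorphic_on_imp_continuous_on)
    have cd: "continuous_on (sphere 0 (1 / m)) (deriv X)"
      using holomorphic_deriv[OF X_holo open_ball] sphere_sub by (meson continuous_on_subset holomorphic_on_imp_continuous_on)
    have ck: "continuous_on (sphere 0 (1 / m)) (\<lambda>w. k (X w))"
    proof (rule continuous_on_compose2[OF holomorphic_on_imp_continuous_on[OF k] cX])
      show "X ` sphere 0 (1 / m) \<subseteq> ball 0 r'" using circle_props(2) r' by auto
    qed
    show ?thesis unfolding g_def f_def
      by (intro continuous_intros cd ck cX) (use circle_props(4) in auto)
  qed
  have "(g has_contour_integral (2 * pi * \<i> * taylor_coeff k j)) \<gamma>"
  proof -
    have "g contour_integrable_on \<gamma>" unfolding \<gamma>_def circlepath_def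
      by (rule contour_integrable_continuous_part_circlepath)
         (use gc im \<gamma>_def in \<open>simp add: circlepath_def\<close>)
    thus ?thesis using ci unfolding g_def[symmetric] by (metis has_contour_integral_integral)
  qed
  hence "((\<lambda>t. g (0 + of_real (1 / m) * cis t) * of_real (1 / m) * \<i> * cis t) has_integral (2 * pi * \<i> * taylor_coeff k j)) {0..2 * pi}"
    unfolding \<gamma>_def circlepath_def by (subst (asm) has_contour_integral_part_circlepath_iff) auto
  hence "((\<lambda>t. (c / \<i>) * (g (0 + of_real (1 / m) * cis t) * of_real (1 / m) * \<i> * cis t)) has_integral ((c / \<i>) * (2 * pi * \<i> * taylor_coeff k j))) {0..2 * pi}"
    by (rule has_integral_mult_right)
  moreover have "(c / \<i>) * (g (0 + of_real (1 / m) * cis t) * of_real (1 / m) * \<i> * cis t) =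
     lift k (of_real (1 / m) * cis t) * cnj (X (of_real (1 / m) * cis t) ^ Suc j / of_nat (Suc j))" for t
  proof -
    define \<zeta> where "\<zeta> = of_real (1 / m) * cis t"
    have cz: "cmod \<zeta> = 1 / m" using m_pos by (simp add: \<zeta>_def norm_mult norm_divide)
    have "cnj (X \<zeta> ^ Suc j / of_nat (Suc j)) = cnj (X \<zeta>) ^ Suc j / of_nat (Suc j)"
      by (simp del: of_nat_Suc)
    also have "\<dots> = of_real (R\<^sup>2) ^ Suc j / X \<zeta> ^ Suc j / of_nat (Suc j)"
      unfolding circle_props(3)[OF cz] power_divide ..
    also have "of_real (R\<^sup>2) ^ Suc j / X \<zeta> ^ Suc j / of_nat (Suc j) = c / X \<zeta> ^ Suc j"
    proof -
      have "of_real (R\<^sup>2) ^ Suc j = complex_of_real (R ^ (2 * Suc j))"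
        by (simp only: power_mult of_real_power)
      thus ?thesis unfolding c_def of_real_divide of_real_of_nat_eq
        by (simp only: divide_divide_eq_left mult.commute)
    qed
    finally have "lift k \<zeta> * cnj (X \<zeta> ^ Suc j / of_nat (Suc j)) = c * (\<zeta> * g \<zeta>)"
      unfolding lift_def g_def f_def X'_eq_deriv[OF circle_props(1)[OF cz], symmetric] by simp
    moreover have "(c / \<i>) * (g (0 + \<zeta>) * of_real (1 / m) * \<i> * cis t) = c * (\<zeta> * g \<zeta>)"
      by (simp add: \<zeta>_def field_simps)
    ultimately show ?thesis unfolding \<zeta>_def[symmetric] by (metis (no_types) \<zeta>_def)
  qed
  ultimately have hi: "((\<lambda>t. lift k (of_real (1 / m) * cis t) * cnj (X (of_real (1 / m) * cis t) ^ Suc j / of_nat (Suc j)))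
      has_integral ((c / \<i>) * (2 * pi * \<i> * taylor_coeff k j))) {0..2 * pi}" by simp
  have "continuous_on {0..2 * pi} (\<lambda>t. (c / \<i>) * (g (of_real (1 / m) * cis t) * of_real (1 / m) * \<i> * cis t))"
  proof (intro continuous_intros continuous_on_compose2[OF gc])
    show "(\<lambda>t. complex_of_real (1 / m) * cis t) ` {0..2 * pi} \<subseteq> sphere 0 (1 / m)"
      using m_pos by (auto simp: norm_mult norm_divide)
  qed
  hence co: "continuous_on {0..2 * pi} (\<lambda>t. lift k (of_real (1 / m) * cis t) * cnj (X (of_real (1 / m) * cis t) ^ Suc j / of_nat (Suc j)))"
    using \<open>\<And>t. (c / \<i>) * (g (0 + of_real (1 / m) * cis t) * of_real (1 / m) * \<i> * cis t) =
     lift k (of_real (1 / m) * cis t) * cnj (X (of_real (1 / m) * cis t) ^ Suc j / of_nat (Suc j))\<close>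
    by simp
  show ?thesis using LINT_open_interval(2)[OF co hi] by (simp add: c_def mult_ac)
qed

end

section \<open>The Gram matrix and its twist\<close>

context outer_radius
begin

lemma R2_gt: "R < R\<^sup>2 - 1" "1 < R\<^sup>2 - R" "R < R\<^sup>2 - R" "R\<^sup>2 - R < R\<^sup>2 - 1"
proof -
  have "2 * R < R * R" using R_gt_2 by (intro mult_strict_right_mono) auto
  thus "R < R\<^sup>2 - 1" "1 < R\<^sup>2 - R" "R < R\<^sup>2 - R" "R\<^sup>2 - R < R\<^sup>2 - 1"
    unfolding power2_eq_square using R_gt_2 by linarith+
qed

text \<open>
  The pullback of the differential \<open>k (x) dx\<close> under the contraction \<open>\<zeta>
  \<mapsto> m^4 \<zeta>\<close>, which acts on \<open>x = X \<zeta>\<close> as \<open>x \<mapsto>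
  1 + 1 / (R\<^sup>2 - 1 - x)\<close>.
\<close>

definition twist :: "(complex \<Rightarrow> complex) \<Rightarrow> complex \<Rightarrow> complex" where
  "twist k x = k (1 + 1 / (of_real (R\<^sup>2 - 1) - x)) / (of_real (R\<^sup>2 - 1) - x)\<^sup>2"

lemma twist_den_nz: "x \<in> ball 0 (R\<^sup>2 - 1) \<Longrightarrow> of_real (R\<^sup>2 - 1) - x \<noteq> (0::complex)"
proof
  assume x: "x \<in> ball 0 (R\<^sup>2 - 1)" and "of_real (R\<^sup>2 - 1) - x = 0"
  hence "cmod x = \<bar>R\<^sup>2 - 1\<bar>" by (metis eq_iff_diff_eq_0 norm_of_real)
  thus False using x R2_gt R_gt_2 by simp
qed

lemma twist_holo:
  assumes "k holomorphic_on UNIV"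
  shows "twist k holomorphic_on ball 0 (R\<^sup>2 - 1)"
proof -
  have "(k \<circ> (\<lambda>x. 1 + 1 / (of_real (R\<^sup>2 - 1) - x))) holomorphic_on ball 0 (R\<^sup>2 - 1)"
    by (rule holomorphic_on_compose_gen[OF _ assms])
       (use twist_den_nz in \<open>auto intro!: holomorphic_intros simp del: of_real_diff of_real_power\<close>)
  thus ?thesis unfolding twist_def o_def
    by (intro holomorphic_intros) (use twist_den_nz in \<open>auto simp del: of_real_diff of_real_power\<close>)
qed

lemma lift_scale:
  assumes "cmod \<zeta> < 1 / m\<^sup>2"
  shows "lift k (of_real (m ^ 4) * \<zeta>) = lift (twist k) \<zeta>"
proof -
  define d where "d = of_real (R\<^sup>2 - 1) - X \<zeta>"
  define \<xi> where "\<xi> = of_real (m ^ 4) * \<zeta>"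
  note s = X_scaled[OF assms, folded d_def \<xi>_def]
  have "X \<xi> * d = d + 1" using s(1) by (simp add: d_def)
  hence X: "X \<xi> = 1 + 1 / d" using s(3) by (simp add: field_simps)
  have X': "of_real (m ^ 4) * X' \<xi> = X' \<zeta> / d\<^sup>2" using s(2,3) by (simp add: field_simps)
  have "lift k \<xi> = \<zeta> * (of_real (m ^ 4) * X' \<xi>) * k (X \<xi>)"
    by (simp only: lift_def \<xi>_def mult_ac)
  also have "\<dots> = lift (twist k) \<zeta>"
    unfolding X X' lift_def twist_def d_def[symmetric] by simp
  finally show ?thesis unfolding \<xi>_def .
qed

lemma lift_holo:
  assumes "k holomorphic_on UNIV"
  shows "lift k holomorphic_on ball 0 (1 / m\<^sup>2)"
proof -
  have "(k \<circ> X) holomorphic_on ball 0 (1 / m\<^sup>2)"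
    by (rule holomorphic_on_compose_gen[OF X_holo assms]) auto
  thus ?thesis unfolding lift_def o_def by (intro holomorphic_intros X'_holo)
qed

lemma lift_eq_Euler:
  assumes h: "\<And>x. (h has_field_derivative l x) (at x)" and z: "cmod \<zeta> < 1 / m\<^sup>2"
  shows "\<zeta> * deriv (\<lambda>\<zeta>. h (X \<zeta>)) \<zeta> = lift l \<zeta>"
proof -
  have "((\<lambda>\<zeta>. h (X \<zeta>)) has_field_derivative (l (X \<zeta>) * X' \<zeta>)) (at \<zeta>)"
    by (rule DERIV_chain2[OF h X_has_deriv[OF z]])
  thus ?thesis by (simp add: DERIV_imp_deriv lift_def)
qed

lemma power_antideriv:
  "((\<lambda>x. x ^ Suc j / of_nat (Suc j)) has_field_derivative x ^ j) (at (x::complex))"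
proof -
  have "((\<lambda>x. x ^ Suc j) has_field_derivative (of_nat (Suc j) * x ^ j)) (at x)"
    by (rule DERIV_cong[OF DERIV_power[OF DERIV_ident]]) simp
  from DERIV_cdivide[OF this, of "of_nat (Suc j)"] show ?thesis by (simp del: of_nat_Suc power_Suc)
qed

lemma set_integral_finite_sum:
  fixes f :: "'i \<Rightarrow> 'a \<Rightarrow> complex"
  assumes "\<And>i. i \<in> I \<Longrightarrow> set_integrable M A (f i)"
  shows "(LINT x:A|M. (\<Sum>i\<in>I. f i x)) = (\<Sum>i\<in>I. LINT x:A|M. f i x)"
  using assms unfolding set_lebesgue_integral_def set_integrable_def scaleR_sum_right
  by (rule Bochner_Integration.integral_sum)

text \<open>
  Green's formula from above with \<open>r = 1/m\<close>; the scaling by \<open>1/r^4 =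
  m^4\<close> turns \<open>k\<close> into \<open>twist k\<close>.
\<close>

lemma energy_eq_circle:
  assumes k: "k holomorphic_on UNIV" and h: "\<And>x. (h has_field_derivative l x) (at x)"
  shows "(LINT w:log_rect (1 / m)|lborel. (lift k (exp w) - lift k (exp (- w))) * cnj (lift l (exp w) - lift l (exp (- w))))
    = 1 / 2 * (LINT \<theta>:{0..2 * pi}|lborel. lift (\<lambda>x. k x - twist k x) (of_real (1 / m) * cis \<theta>)
          * cnj (h (X (of_real (1 / m) * cis \<theta>))))"
proof -
  define H where "H = (\<lambda>\<zeta>. h (X \<zeta>))"
  have "h holomorphic_on UNIV" using h holomorphic_on_open[OF open_UNIV] by blast
  hence "(h \<circ> X) holomorphic_on ball 0 (1 / m\<^sup>2)"
    by (intro holomorphic_on_compose_gen[OF X_holo]) auto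
  hence H: "H holomorphic_on ball 0 (1 / m\<^sup>2)" by (simp add: H_def o_def)
  have V0: "lift k 0 = 0" by (simp add: lift_def)
  have "(LINT w:log_rect (1 / m)|lborel. (lift k (exp w) - lift k (exp (- w))) * cnj (lift l (exp w) - lift l (exp (- w))))
     = (LINT w:log_rect (1 / m)|lborel. (lift k (exp w) - lift k (exp (- w))) *
            cnj (exp w * deriv H (exp w) - exp (- w) * deriv H (exp (- w))))"
  proof (rule set_lebesgue_integral_cong)
    show "log_rect (1 / m) \<in> sets lborel" using open_log_rect by auto
    show "\<forall>w. w \<in> log_rect (1 / m) \<longrightarrow>
        (lift k (exp w) - lift k (exp (- w))) * cnj (lift l (exp w) - lift l (exp (- w)))
      = (lift k (exp w) - lift k (exp (- w))) * cnj (exp w * deriv H (exp w) - exp (- w) * deriv H (exp (- w)))"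
      unfolding H_def using lift_eq_Euler[OF h] exp_log_rect(3,4) by metis
  qed
  also have "\<dots> = 1 / 2 * (LINT \<theta>:{0..2 * pi}|lborel. (lift k (of_real (1 / m) * cis \<theta>) - lift k (of_real (1 / (1 / m) ^ 4) * (of_real (1 / m) * cis \<theta>)))
          * cnj (H (of_real (1 / m) * cis \<theta>)))"
    by (rule annulus_integral_eq_circle_integral[OF lift_holo[OF k] V0 H inv_m_less])
  also have "(LINT \<theta>:{0..2 * pi}|lborel. (lift k (of_real (1 / m) * cis \<theta>) - lift k (of_real (1 / (1 / m) ^ 4) * (of_real (1 / m) * cis \<theta>)))
          * cnj (H (of_real (1 / m) * cis \<theta>)))
     = (LINT \<theta>:{0..2 * pi}|lborel. lift (\<lambda>x. k x - twist k x) (of_real (1 / m) * cis \<theta>)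
          * cnj (h (X (of_real (1 / m) * cis \<theta>))))"
  proof (rule set_lebesgue_integral_cong)
    show "\<forall>\<theta>. \<theta> \<in> {0..2 * pi} \<longrightarrow>
       (lift k (of_real (1 / m) * cis \<theta>) - lift k (of_real (1 / (1 / m) ^ 4) * (of_real (1 / m) * cis \<theta>))) * cnj (H (of_real (1 / m) * cis \<theta>))
      = lift (\<lambda>x. k x - twist k x) (of_real (1 / m) * cis \<theta>) * cnj (h (X (of_real (1 / m) * cis \<theta>)))"
    proof (intro allI impI)
      fix \<theta>
      define \<zeta> where "\<zeta> = of_real (1 / m) * cis \<theta>"
      have "cmod \<zeta> = 1 / m" using m_pos by (simp add: \<zeta>_def norm_mult norm_divide)
      hence z: "cmod \<zeta> < 1 / m\<^sup>2" using inv_m_less by simp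
      have e: "1 / (1 / m) ^ 4 = m ^ 4" by (simp add: power_one_over)
      have "lift k \<zeta> - lift k (of_real (1 / (1 / m) ^ 4) * \<zeta>) = lift (\<lambda>x. k x - twist k x) \<zeta>"
        unfolding e lift_scale[OF z] by (simp add: lift_def right_diff_distrib)
      thus "(lift k (of_real (1 / m) * cis \<theta>) - lift k (of_real (1 / (1 / m) ^ 4) * (of_real (1 / m) * cis \<theta>))) * cnj (H (of_real (1 / m) * cis \<theta>))
      = lift (\<lambda>x. k x - twist k x) (of_real (1 / m) * cis \<theta>) * cnj (h (X (of_real (1 / m) * cis \<theta>)))"
        by (simp only: \<zeta>_def H_def)
    qed
  qed simp
  finally show ?thesis .
qed

definition cpoly :: "(nat \<Rightarrow> complex) \<Rightarrow> nat \<Rightarrow> complex \<Rightarrow> complex" where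
  "cpoly c n x = (\<Sum>j\<le>n. c j * x ^ j)"

lemma cpoly_holo: "cpoly c n holomorphic_on S"
  unfolding cpoly_def by (intro holomorphic_intros)

lemma taylor_coeff_cpoly: "taylor_coeff (cpoly c n) j = (if j \<le> n then c j else 0)"
proof (rule taylor_coeff_unique[OF cpoly_holo zero_less_one])
  fix \<zeta> :: complex
  have "(\<lambda>j. (if j \<le> n then c j else 0) * \<zeta> ^ j) sums (\<Sum>j\<le>n. (if j \<le> n then c j else 0) * \<zeta> ^ j)"
    by (rule sums_finite) auto
  thus "(\<lambda>j. (if j \<le> n then c j else 0) * \<zeta> ^ j) sums cpoly c n \<zeta>"
    by (simp add: cpoly_def)
qed

lemma taylor_coeff_diff:
  assumes "f holomorphic_on ball 0 r" "g holomorphic_on ball 0 r" "0 < r"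
  shows "taylor_coeff (\<lambda>x. f x - g x) j = taylor_coeff f j - taylor_coeff g j"
proof (rule taylor_coeff_unique[OF _ assms(3)])
  show "(\<lambda>x. f x - g x) holomorphic_on ball 0 r" by (intro holomorphic_intros assms)
  fix \<zeta> :: complex assume z: "cmod \<zeta> < r"
  show "(\<lambda>k. (taylor_coeff f k - taylor_coeff g k) * \<zeta> ^ k) sums (f \<zeta> - g \<zeta>)"
    using sums_diff[OF taylor_coeff_sums[OF assms(1) z] taylor_coeff_sums[OF assms(2) z]] by (simp add: algebra_simps)
qed

text \<open>
  Take \<open>l (x) = x^j\<close>, with primitive \<open>x^(j+1) / (j+1)\<close>, in the circle
  formula; the moment on the circle picks out the \<open>j\<close>-th coefficient of \<open>k -
  twist k\<close>.
\<close>

theorem gram_faber: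
  "(LINT z:G1 R|lborel. poly (faber_comb c n) z * cnj (poly (faber j) z)) =
     of_real (pi * R ^ (2 * Suc j) / real (Suc j)) * (taylor_coeff (cpoly c n) j - taylor_coeff (twist (cpoly c n)) j)"
proof -
  have r: "0 < R\<^sup>2 - 1" using R2_gt R_gt_2 by linarith
  have k: "(\<lambda>x. cpoly c n x - twist (cpoly c n) x) holomorphic_on ball 0 (R\<^sup>2 - 1)"
    by (intro holomorphic_intros cpoly_holo twist_holo)
  have "(LINT z:G1 R|lborel. poly (faber_comb c n) z * cnj (poly (faber j) z)) =
    (LINT w:log_rect (1 / m)|lborel. (lift (cpoly c n) (exp w) - lift (cpoly c n) (exp (- w)))
       * cnj (lift (\<lambda>x. x ^ j) (exp w) - lift (\<lambda>x. x ^ j) (exp (- w))))"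
    by (rule area_integral_pullback; (unfold cpoly_def)?; rule faber_comb_jouk faber_jouk; assumption)
  also have "\<dots> = 1 / 2 * (LINT \<theta>:{0..2 * pi}|lborel. lift (\<lambda>x. cpoly c n x - twist (cpoly c n) x) (of_real (1 / m) * cis \<theta>)
          * cnj (X (of_real (1 / m) * cis \<theta>) ^ Suc j / of_nat (Suc j)))"
    by (rule energy_eq_circle[OF cpoly_holo power_antideriv])
  also have "\<dots> = 1 / 2 * (of_real (2 * pi * R ^ (2 * Suc j) / real (Suc j)) * taylor_coeff (\<lambda>x. cpoly c n x - twist (cpoly c n) x) j)"
    unfolding circle_moment[OF k R2_gt(1)] ..
  also have "\<dots> = of_real (pi * R ^ (2 * Suc j) / real (Suc j)) * taylor_coeff (\<lambda>x. cpoly c n x - twist (cpoly c n) x) j"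
    by (simp del: of_nat_Suc power_Suc)
  finally show ?thesis unfolding taylor_coeff_diff[OF cpoly_holo twist_holo[OF cpoly_holo] r] .
qed

text \<open>
  The Gram matrix is bounded below by a diagonal one. This is the a priori bound on the
  coefficients of the orthonormal polynomials.
\<close>

theorem gram_lower_bound:
  "(1 - m ^ 4) * (\<Sum>j\<le>n. pi * R ^ (2 * Suc j) / real (Suc j) * (cmod (c j))\<^sup>2)
     \<le> Re (LINT z:G1 R|lborel. poly (faber_comb c n) z * cnj (poly (faber_comb c n) z))"
proof -
  let ?\<zeta> = "\<lambda>\<theta>. of_real (1 / m) * cis \<theta>"
  define h where "h = (\<lambda>x::complex. \<Sum>j\<le>n. c j * (x ^ Suc j / of_nat (Suc j)))"
  define H where "H = (\<lambda>\<zeta>. h (X \<zeta>))"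
  have h: "(h has_field_derivative cpoly c n x) (at x)" for x
    unfolding h_def cpoly_def by (intro DERIV_sum DERIV_cmult power_antideriv)
  have "h holomorphic_on UNIV" using h holomorphic_on_open[OF open_UNIV] by blast
  hence "(h \<circ> X) holomorphic_on ball 0 (1 / m\<^sup>2)"
    by (intro holomorphic_on_compose_gen[OF X_holo]) auto
  hence H: "H holomorphic_on ball 0 (1 / m\<^sup>2)" by (simp add: H_def o_def)
  have lE: "\<zeta> * deriv H \<zeta> = lift (cpoly c n) \<zeta>" if "cmod \<zeta> < 1 / m\<^sup>2" for \<zeta>
    unfolding H_def by (rule lift_eq_Euler[OF h that])
  have zc: "cmod (?\<zeta> \<theta>) < 1 / m\<^sup>2" "cmod (?\<zeta> \<theta>) = 1 / m" for \<theta>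
    using m_pos inv_m_less by (simp_all add: norm_mult norm_divide)
  have int: "set_integrable lborel {0..2 * pi} (\<lambda>\<theta>. lift (cpoly c n) (?\<zeta> \<theta>) * cnj (X (?\<zeta> \<theta>) ^ Suc j / of_nat (Suc j)))" for j
  proof (rule borel_integrable_atLeastAtMost')
    have im: "?\<zeta> ` {0..2 * pi} \<subseteq> ball 0 (1 / m\<^sup>2)" using zc by auto
    have 1: "continuous_on {0..2 * pi} (\<lambda>\<theta>. lift (cpoly c n) (?\<zeta> \<theta>))"
      by (rule continuous_on_compose2[OF holomorphic_on_imp_continuous_on[OF lift_holo[OF cpoly_holo]] _ im])
         (intro continuous_intros)
    have 2: "continuous_on {0..2 * pi} (\<lambda>\<theta>. X (?\<zeta> \<theta>))"
      by (rule continuous_on_compose2[OF holomorphic_on_imp_continuous_on[OF X_holo] _ im])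
         (intro continuous_intros)
    show "continuous_on {0..2 * pi} (\<lambda>\<theta>. lift (cpoly c n) (?\<zeta> \<theta>) * cnj (X (?\<zeta> \<theta>) ^ Suc j / of_nat (Suc j)))"
      by (intro continuous_intros 1 2) (simp del: of_nat_Suc)
  qed
  have "(LINT \<theta>:{0..2 * pi}|lborel. lift (cpoly c n) (?\<zeta> \<theta>) * cnj (H (?\<zeta> \<theta>)))
     = (LINT \<theta>:{0..2 * pi}|lborel. (\<Sum>j\<le>n. cnj (c j) * (lift (cpoly c n) (?\<zeta> \<theta>) * cnj (X (?\<zeta> \<theta>) ^ Suc j / of_nat (Suc j)))))"
    by (simp only: H_def h_def cnj_sum complex_cnj_mult sum_distrib_left mult.left_commute)
  also have "\<dots> = (\<Sum>j\<le>n. LINT \<theta>:{0..2 * pi}|lborel. cnj (c j) * (lift (cpoly c n) (?\<zeta> \<theta>) * cnj (X (?\<zeta> \<theta>) ^ Suc j / of_nat (Suc j))))"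
    by (intro set_integral_finite_sum set_integrable_mult_right int)
  also have "\<dots> = (\<Sum>j\<le>n. cnj (c j) * (LINT \<theta>:{0..2 * pi}|lborel. lift (cpoly c n) (?\<zeta> \<theta>) * cnj (X (?\<zeta> \<theta>) ^ Suc j / of_nat (Suc j))))"
    by simp
  also have "\<dots> = (\<Sum>j\<le>n. cnj (c j) * (of_real (2 * pi * R ^ (2 * Suc j) / real (Suc j)) * c j))"
    unfolding circle_moment[OF cpoly_holo R2_gt(1)] by (intro sum.cong refl) (simp add: taylor_coeff_cpoly)
  also have "\<dots> = of_real (\<Sum>j\<le>n. 2 * (pi * R ^ (2 * Suc j) / real (Suc j) * (cmod (c j))\<^sup>2))"
    unfolding of_real_sum
  proof (intro sum.cong refl)
    fix j
    have "cnj (c j) * (of_real (2 * pi * R ^ (2 * Suc j) / real (Suc j)) * c j) = of_real (2 * pi * R ^ (2 * Suc j) / real (Suc j)) * (c j * cnj (c j))"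
      by (simp only: mult_ac)
    also have "\<dots> = of_real (2 * pi * R ^ (2 * Suc j) / real (Suc j) * (cmod (c j))\<^sup>2)"
      unfolding complex_norm_square[symmetric] of_real_mult ..
    finally show "cnj (c j) * (of_real (2 * pi * R ^ (2 * Suc j) / real (Suc j)) * c j) = of_real (2 * (pi * R ^ (2 * Suc j) / real (Suc j) * (cmod (c j))\<^sup>2))"
      by (simp only: mult.assoc times_divide_eq_left times_divide_eq_right)
  qed
  finally have circ: "1 / 2 * (LINT \<theta>:{0..2 * pi}|lborel. lift (cpoly c n) (?\<zeta> \<theta>) * cnj (H (?\<zeta> \<theta>)))
     = of_real (\<Sum>j\<le>n. pi * R ^ (2 * Suc j) / real (Suc j) * (cmod (c j))\<^sup>2)"
    unfolding sum_distrib_left[symmetric] of_real_mult by simp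
  have circ': "(LINT \<theta>:{0..2 * pi}|lborel. ?\<zeta> \<theta> * deriv H (?\<zeta> \<theta>) * cnj (H (?\<zeta> \<theta>)))
     = (LINT \<theta>:{0..2 * pi}|lborel. lift (cpoly c n) (?\<zeta> \<theta>) * cnj (H (?\<zeta> \<theta>)))"
    using lE[OF zc(1)] by simp
  have "(LINT z:G1 R|lborel. poly (faber_comb c n) z * cnj (poly (faber_comb c n) z)) =
    (LINT w:log_rect (1 / m)|lborel. (lift (cpoly c n) (exp w) - lift (cpoly c n) (exp (- w)))
       * cnj (lift (cpoly c n) (exp w) - lift (cpoly c n) (exp (- w))))"
    by (rule area_integral_pullback; unfold cpoly_def; rule faber_comb_jouk; assumption)
  also have "\<dots> = (LINT w:log_rect (1 / m)|lborel. (exp w * deriv H (exp w) - exp (- w) * deriv H (exp (- w)))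
       * cnj (exp w * deriv H (exp w) - exp (- w) * deriv H (exp (- w))))"
  proof (rule set_lebesgue_integral_cong)
    show "log_rect (1 / m) \<in> sets lborel" using open_log_rect by auto
  qed (use lE exp_log_rect(3,4) in metis)
  finally have area: "(LINT z:G1 R|lborel. poly (faber_comb c n) z * cnj (poly (faber_comb c n) z)) =
    (LINT w:log_rect (1 / m)|lborel. (exp w * deriv H (exp w) - exp (- w) * deriv H (exp (- w)))
       * cnj (exp w * deriv H (exp w) - exp (- w) * deriv H (exp (- w))))" .
  have "1 - 1 / (1 / m) ^ 4 = 1 - m ^ 4" by (simp add: power_one_over)
  with energy_on_annulus_ge[OF H inv_m_less] show ?thesis
    unfolding area circ' circ by simp
qed

end

section \<open>Coefficients of the orthonormal polynomials\<close>

lemma norm_le_of_LIMSEQ_0: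
  assumes "\<And>K::nat. x \<le> b + f K" "f \<longlonglongrightarrow> (0::real)"
  shows "x \<le> b"
proof (rule LIMSEQ_le_const)
  show "(\<lambda>K. b + f K) \<longlonglongrightarrow> b" using tendsto_add[OF tendsto_const assms(2), of b] by simp
  show "\<exists>N. \<forall>n\<ge>N. x \<le> b + f n" using assms(1) by blast
qed

lemma square_times_power_bounded:
  fixes q :: real
  assumes q: "0 < q" "q < 1"
  obtains C where "0 < C" "\<And>n. (real n + 1)\<^sup>2 * q ^ n \<le> C"
proof -
  define h where "h = 1 / sqrt q - 1"
  have h: "0 < h" using q by (simp add: h_def field_simps real_less_lsqrt real_sqrt_lt_1_iff)
  have q_eq: "q = 1 / (1 + h)\<^sup>2" using q by (simp add: h_def power_divide)
  show ?thesis
  proof (rule that)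
    show "0 < (1 + h)\<^sup>2 / h\<^sup>2" using h by simp
    fix n
    have "1 + real (Suc n) * h \<le> (1 + h) ^ Suc n"
      using h by (intro Bernoulli_inequality) linarith
    moreover have "(real n + 1) * h = real (Suc n) * h" by (simp add: add.commute)
    ultimately have "(real n + 1) * h \<le> (1 + h) ^ Suc n" by linarith
    hence "((real n + 1) * h)\<^sup>2 \<le> ((1 + h) ^ Suc n)\<^sup>2" using h by (intro power_mono) auto
    moreover have "((1 + h) ^ Suc n)\<^sup>2 = ((1 + h)\<^sup>2) ^ Suc n" by (metis power_mult mult.commute)
    ultimately have "(real n + 1)\<^sup>2 * h\<^sup>2 \<le> ((1 + h)\<^sup>2) ^ Suc n" by (simp only: power_mult_distrib)
    hence "(real n + 1)\<^sup>2 \<le> ((1 + h)\<^sup>2) ^ Suc n / h\<^sup>2" using h by (simp add: pos_le_divide_eq)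
    hence "(real n + 1)\<^sup>2 * q ^ n \<le> ((1 + h)\<^sup>2) ^ Suc n / h\<^sup>2 * q ^ n"
      using q by (intro mult_right_mono) auto
    also have "\<dots> = (1 + h)\<^sup>2 / h\<^sup>2" using h by (simp add: q_eq power_one_over field_simps)
    finally show "(real n + 1)\<^sup>2 * q ^ n \<le> (1 + h)\<^sup>2 / h\<^sup>2" .
  qed
qed

lemma geometric_le_reciprocal:
  fixes q :: real
  assumes q: "0 < q" "q < 1"
  obtains C where "0 < C" "\<And>n. 0 < n \<Longrightarrow> q ^ n \<le> C / real n"
proof (rule square_times_power_bounded[OF q])
  fix C assume C: "0 < C" and b: "\<And>n. (real n + 1)\<^sup>2 * q ^ n \<le> C"
  show ?thesis
  proof (rule that[OF C])
    fix n :: nat assume n: "0 < n"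
    have "real n \<le> (real n + 1)\<^sup>2" by (simp add: power2_eq_square algebra_simps)
    hence "real n * q ^ n \<le> (real n + 1)\<^sup>2 * q ^ n" using q by (intro mult_right_mono) auto
    hence "real n * q ^ n \<le> C" using b[of n] by linarith
    thus "q ^ n \<le> C / real n" using n by (simp add: field_simps)
  qed
qed

context outer_radius
begin

lemma area_orthogonality:
  assumes "area_orthonormal_polys (G1 R) p"
  shows "j < n \<Longrightarrow> (LINT z:G1 R|lborel. poly (p n) z * cnj (poly (faber j) z)) = 0"
    and "(LINT z:G1 R|lborel. poly (p n) z * cnj (poly (p n) z)) = of_real pi"
proof -
  have deg: "degree (p i) = i" and pos: "0 < Re (lead_coeff (p i))" for i
    using assms unfolding area_orthonormal_polys_def by blast+
  have ip: "(LINT z:G1 R|lborel. poly (p n) z * cnj (poly (p i) z)) = (if n = i then of_real pi else 0)" for n i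
  proof -
    have "1 / of_real pi * (LINT z:G1 R|lborel. poly (p n) z * cnj (poly (p i) z)) = (if n = i then 1 else 0)"
      using assms by (simp add: area_orthonormal_polys_def)
    hence "of_real pi * (1 / of_real pi * (LINT z:G1 R|lborel. poly (p n) z * cnj (poly (p i) z))) = of_real pi * (if n = i then 1 else 0)"
      by (rule arg_cong)
    thus ?thesis by (auto split: if_splits)
  qed
  show "(LINT z:G1 R|lborel. poly (p n) z * cnj (poly (p n) z)) = of_real pi" using ip[of n n] by simp
  assume jn: "j < n"
  have nz: "p i \<noteq> 0" for i using pos[of i] by auto
  have "degree (faber j) \<le> j" using degree_faber[of j] by simp
  then obtain d where d: "faber j = (\<Sum>i\<le>j. smult (d i) (p i))"
    using poly_graded_basis[of p "faber j" j] deg nz by blast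
  have int: "set_integrable lborel (G1 R) (\<lambda>z. poly (p n) z * cnj (poly (p i) z))" for i
    by (intro G1_integrable continuous_intros)
  have "(LINT z:G1 R|lborel. poly (p n) z * cnj (poly (faber j) z))
      = (LINT z:G1 R|lborel. (\<Sum>i\<le>j. cnj (d i) * (poly (p n) z * cnj (poly (p i) z))))"
    by (simp only: d poly_sum poly_smult cnj_sum complex_cnj_mult sum_distrib_left mult.left_commute)
  also have "\<dots> = (\<Sum>i\<le>j. LINT z:G1 R|lborel. cnj (d i) * (poly (p n) z * cnj (poly (p i) z)))"
    by (intro set_integral_finite_sum set_integrable_mult_right int)
  also have "\<dots> = 0" using jn by (simp add: ip)
  finally show "(LINT z:G1 R|lborel. poly (p n) z * cnj (poly (faber j) z)) = 0" .
qed

text \<open>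
  Orthogonality to \<open>faber j\<close> for \<open>j < n\<close> says that \<open>k\<close> and
  \<open>twist k\<close> have the same coefficients below degree \<open>n\<close>. Norm one
  determines the coefficient of degree \<open>n\<close> of their difference, and bounds all
  coefficients.
\<close>

lemma orthonormal_coefficients:
  assumes orth: "area_orthonormal_polys (G1 R) p"
  obtains c a where "p n = faber_comb c n" "c n = of_real a" "0 < a"
    "\<And>j. j < n \<Longrightarrow> c j = taylor_coeff (twist (cpoly c n)) j"
    "of_real a * (c n - taylor_coeff (twist (cpoly c n)) n) = of_real ((real n + 1) / R ^ (2 * Suc n))"
    "\<And>j. j \<le> n \<Longrightarrow> cmod (c j) * R ^ j \<le> 1 / sqrt (1 - m ^ 4) * (real n + 1)"
proof -
  have deg: "degree (p n) = n" and real: "lead_coeff (p n) \<in> \<real>" and pos: "0 < Re (lead_coeff (p n))"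
    using orth unfolding area_orthonormal_polys_def by blast+
  obtain c where c: "p n = faber_comb c n" "c n = lead_coeff (p n)"
    using faber_comb_surj[OF deg] by blast
  define a where "a = Re (lead_coeff (p n))"
  have ca: "c n = of_real a" using real c(2) by (simp add: a_def)
  define w where "w = (\<lambda>j. pi * R ^ (2 * Suc j) / real (Suc j))"
  have w: "0 < w j" for j using R_gt_2 by (simp add: w_def)
  have ip: "(LINT z:G1 R|lborel. poly (p n) z * cnj (poly (faber j) z)) = of_real (w j) * (c j - taylor_coeff (twist (cpoly c n)) j)"
    if "j \<le> n" for j unfolding c(1) gram_faber w_def using that by (simp only: taylor_coeff_cpoly if_True)
  have low: "c j = taylor_coeff (twist (cpoly c n)) j" if "j < n" for j
    using area_orthogonality(1)[OF orth that] ip[of j] that w[of j] by simp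
  have int: "set_integrable lborel (G1 R) (\<lambda>z. poly (p n) z * cnj (poly (faber i) z))" for i
    by (intro G1_integrable continuous_intros)
  have "of_real pi = (LINT z:G1 R|lborel. poly (p n) z * cnj (poly (p n) z))"
    using area_orthogonality(2)[OF orth] by simp
  also have "\<dots> = (LINT z:G1 R|lborel. (\<Sum>i\<le>n. cnj (c i) * (poly (p n) z * cnj (poly (faber i) z))))"
  proof -
    have "cnj (poly (p n) z) = (\<Sum>i\<le>n. cnj (c i) * cnj (poly (faber i) z))" for z
      by (simp add: c(1) faber_comb_def poly_sum)
    thus ?thesis by (simp only: sum_distrib_left mult.left_commute)
  qed
  also have "\<dots> = (\<Sum>i\<le>n. LINT z:G1 R|lborel. cnj (c i) * (poly (p n) z * cnj (poly (faber i) z)))"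
    by (intro set_integral_finite_sum set_integrable_mult_right int)
  also have "\<dots> = (\<Sum>i\<le>n. cnj (c i) * (LINT z:G1 R|lborel. poly (p n) z * cnj (poly (faber i) z)))"
    by simp
  also have "\<dots> = (\<Sum>i\<in>{n}. cnj (c i) * (LINT z:G1 R|lborel. poly (p n) z * cnj (poly (faber i) z)))"
    by (rule sum.mono_neutral_right) (auto simp: area_orthogonality(1)[OF orth])
  also have "\<dots> = of_real a * (of_real (w n) * (c n - taylor_coeff (twist (cpoly c n)) n))"
    using ip[of n] ca by simp
  finally have top: "of_real pi = of_real a * (of_real (w n) * (c n - taylor_coeff (twist (cpoly c n)) n))" .
  have "of_real a * (c n - taylor_coeff (twist (cpoly c n)) n) = of_real (pi / w n)"
    using top w[of n] by (simp add: field_simps)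
  also have "pi / w n = (real n + 1) / R ^ (2 * Suc n)" by (simp add: w_def add.commute del: power_Suc)
  finally have top': "of_real a * (c n - taylor_coeff (twist (cpoly c n)) n) = of_real ((real n + 1) / R ^ (2 * Suc n))" .
  have "(1 - m ^ 4) * (\<Sum>j\<le>n. w j * (cmod (c j))\<^sup>2) \<le> pi"
    using gram_lower_bound[where c=c and n=n] area_orthogonality(2)[OF orth, of n] by (simp add: c(1)[symmetric] w_def)
  hence sum: "(\<Sum>j\<le>n. w j * (cmod (c j))\<^sup>2) \<le> pi / (1 - m ^ 4)" using m4 by (simp add: field_simps)
  have bnd: "cmod (c j) * R ^ j \<le> 1 / sqrt (1 - m ^ 4) * (real n + 1)" if j: "j \<le> n" for j
  proof -
    have "w j * (cmod (c j))\<^sup>2 \<le> (\<Sum>j\<le>n. w j * (cmod (c j))\<^sup>2)"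
      using j w by (intro member_le_sum) (auto simp: less_imp_le)
    also note sum
    finally have "R ^ (2 * Suc j) * (cmod (c j))\<^sup>2 * pi \<le> real (Suc j) / (1 - m ^ 4) * pi"
      by (simp add: w_def field_simps)
    hence 1: "R ^ (2 * Suc j) * (cmod (c j))\<^sup>2 \<le> real (Suc j) / (1 - m ^ 4)" by (rule mult_right_le_imp_le) simp
    have "(cmod (c j) * R ^ j)\<^sup>2 = R ^ (2 * j) * (cmod (c j))\<^sup>2" by (simp add: power_mult_distrib power_mult[symmetric] mult.commute)
    also have "\<dots> \<le> R ^ (2 * Suc j) * (cmod (c j))\<^sup>2"
      using R_gt_2 by (intro mult_right_mono power_increasing) auto
    also note 1
    also have "real (Suc j) / (1 - m ^ 4) \<le> (real n + 1)\<^sup>2 / (1 - m ^ 4)"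
    proof (intro divide_right_mono)
      have "real (Suc j) \<le> (real n + 1) * 1" using j by simp
      also have "\<dots> \<le> (real n + 1) * (real n + 1)" by (intro mult_left_mono) auto
      finally show "real (Suc j) \<le> (real n + 1)\<^sup>2" by (simp add: power2_eq_square)
    qed (use m4 in simp)
    also have "\<dots> = (1 / sqrt (1 - m ^ 4) * (real n + 1))\<^sup>2" using m4 by (simp add: power_mult_distrib power_divide)
    finally show ?thesis by (rule power2_le_imp_le) (use m4 in auto)
  qed
  show ?thesis using that[OF c(1) ca _ low top' bnd] pos by (simp add: a_def)
qed

lemma X'_ratio:
  assumes z: "cmod \<zeta> \<le> 1 / m" and s: "0 \<le> s" "s \<le> 1"
  shows "cmod (X' (of_real s * \<zeta>)) \<le> ((1 + m) / (1 - m))\<^sup>2 * cmod (X' \<zeta>)"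
proof -
  define N where "N = complex_of_real ((1 + m\<^sup>2) * (1 - m\<^sup>2))"
  define D where "D = (\<lambda>\<zeta>. cmod (1 + of_real (m\<^sup>2) * \<zeta>))"
  have b: "cmod (of_real (m\<^sup>2) * \<xi>) \<le> m" if "cmod \<xi> \<le> 1 / m" for \<xi>
  proof -
    have "cmod (of_real (m\<^sup>2) * \<xi>) = m\<^sup>2 * cmod \<xi>" by (simp add: norm_mult norm_power)
    also have "\<dots> \<le> m\<^sup>2 * (1 / m)" using that by (intro mult_left_mono) auto
    finally show ?thesis using m_pos by (simp add: power2_eq_square)
  qed
  have sz: "cmod (of_real s * \<zeta>) \<le> 1 / m"
    using z s mult_left_le_one_le[of "cmod \<zeta>" s] by (simp add: norm_mult)
  have up: "D \<zeta> \<le> 1 + m" unfolding D_def using norm_triangle_ineq[of 1 "of_real (m\<^sup>2) * \<zeta>"] b[OF z] by simp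
  have lo: "1 - m \<le> D (of_real s * \<zeta>)"
    unfolding D_def using norm_diff_ineq[of 1 "of_real (m\<^sup>2) * (of_real s * \<zeta>)"] b[OF sz] by simp
  have Dp: "0 < D \<zeta>" unfolding D_def using den_nz[of \<zeta>] z inv_m_less by simp
  have e: "cmod (X' \<xi>) = cmod N / (D \<xi>)\<^sup>2" for \<xi>
    by (simp add: X'_def N_def D_def norm_divide norm_power)
  have "cmod N / (D (of_real s * \<zeta>))\<^sup>2 \<le> cmod N / (1 - m)\<^sup>2"
    using lo m_less_1 by (intro divide_left_mono power_mono mult_pos_pos) auto
  also have "\<dots> = ((1 + m) / (1 - m))\<^sup>2 * (cmod N / (1 + m)\<^sup>2)" using m_pos by (simp add: power_divide)
  also have "\<dots> \<le> ((1 + m) / (1 - m))\<^sup>2 * (cmod N / (D \<zeta>)\<^sup>2)"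
    using up Dp by (intro mult_left_mono divide_left_mono power_mono mult_pos_pos) auto
  finally show ?thesis unfolding e .
qed

text \<open>
  For \<open>|x| \<le> R\<^sup>2 - R\<close> the point \<open>1 + 1 / (R\<^sup>2 - 1 - x)\<close>
  still lies in \<open>|y| \<le> 2 \<le> R\<close>.
\<close>

lemma twist_bound:
  assumes B: "\<And>y. cmod y \<le> R \<Longrightarrow> cmod (k y) \<le> B" and x: "cmod x \<le> R\<^sup>2 - R"
  shows "cmod (twist k x) \<le> B"
proof -
  define d where "d = of_real (R\<^sup>2 - 1) - x"
  have r: "cmod (complex_of_real (R\<^sup>2 - 1)) = R\<^sup>2 - 1"
    using R2_gt R_gt_2 by (simp only: norm_of_real)
  have dR: "R - 1 \<le> cmod d"
    using norm_triangle_ineq2[of "of_real (R\<^sup>2 - 1)" x] x unfolding d_def r by linarith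
  hence d1: "1 \<le> cmod d" using R_gt_2 by linarith
  have "cmod (1 + 1 / d) \<le> 1 + 1 / cmod d"
    using norm_triangle_ineq[of 1 "1 / d"] by (simp add: norm_divide)
  also have "\<dots> \<le> 1 + 1 / 1" using d1 by (intro add_left_mono divide_left_mono) auto
  also have "\<dots> \<le> R" using R_gt_2 by simp
  finally have "cmod (k (1 + 1 / d)) \<le> B" by (rule B)
  moreover have "1 \<le> (cmod d)\<^sup>2" using d1 by simp
  hence "cmod (k (1 + 1 / d)) / (cmod d)\<^sup>2 \<le> cmod (k (1 + 1 / d)) / 1"
    by (intro divide_left_mono) auto
  ultimately show ?thesis unfolding twist_def d_def[symmetric] norm_divide norm_power by simp
qed

lemma twist_coeff_bound:
  assumes k: "k holomorphic_on UNIV" and B: "\<And>y. cmod y \<le> R \<Longrightarrow> cmod (k y) \<le> B"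
  shows "cmod (taylor_coeff (twist k) j) \<le> B / (R\<^sup>2 - R) ^ j"
proof -
  have r: "0 < R\<^sup>2 - R" using R2_gt by linarith
  have sub: "cball 0 (R\<^sup>2 - R) \<subseteq> ball (0::complex) (R\<^sup>2 - 1)" using R2_gt by auto
  have "cmod ((deriv ^^ j) (twist k) 0) \<le> fact j * B / (R\<^sup>2 - R) ^ j"
  proof (rule Cauchy_inequality[OF _ _ r])
    show "twist k holomorphic_on ball 0 (R\<^sup>2 - R)"
      by (rule holomorphic_on_subset[OF twist_holo[OF k]]) (use sub in auto)
    show "continuous_on (cball 0 (R\<^sup>2 - R)) (twist k)"
      by (rule continuous_on_subset[OF holomorphic_on_imp_continuous_on[OF twist_holo[OF k]] sub])
    show "cmod (twist k x) \<le> B" if "cmod (0 - x) = R\<^sup>2 - R" for x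
      by (rule twist_bound[OF B]) (use that in auto)
  qed
  hence "cmod ((deriv ^^ j) (twist k) 0) / fact j \<le> (fact j * B / (R\<^sup>2 - R) ^ j) / fact j"
    by (intro divide_right_mono) auto
  thus ?thesis by (simp add: taylor_coeff_def norm_divide)
qed

text \<open>
  What is left of \<open>k - twist k\<close> after the term of degree \<open>n\<close> is the tail
  of the series of \<open>twist k\<close>. It is controlled by Cauchy's estimate on \<open>|x| =
  R\<^sup>2 - R\<close>, a circle larger than \<open>|x| = R\<close> by the factor \<open>R - 1 >
  1\<close>.
\<close>

lemma tail_bound:
  assumes low: "\<And>j. j < n \<Longrightarrow> c j = taylor_coeff (twist (cpoly c n)) j"
    and B: "\<And>y. cmod y \<le> R \<Longrightarrow> cmod (cpoly c n y) \<le> B" and B0: "0 \<le> B" and x: "cmod x \<le> R"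
  shows "cmod ((c n - taylor_coeff (twist (cpoly c n)) n) * x ^ n - (cpoly c n x - twist (cpoly c n) x))
     \<le> B * (cmod x / (R\<^sup>2 - R)) ^ Suc n / (1 - 1 / (R - 1))"
proof -
  define k where "k = cpoly c n"
  define y where "y = cmod x / (R\<^sup>2 - R)"
  have r: "0 < R\<^sup>2 - R" using R2_gt by linarith
  have RR: "R\<^sup>2 - R = R * (R - 1)" by (simp add: power2_eq_square algebra_simps)
  have "cmod x / (R * (R - 1)) \<le> R / (R * (R - 1))" using x R_gt_2 by (intro divide_right_mono) auto
  hence y: "0 \<le> y" "y \<le> 1 / (R - 1)" unfolding y_def RR using R_gt_2 by simp_all
  have k1: "1 / (R - 1) < 1" using R_gt_2 by simp
  have xr: "cmod x < R\<^sup>2 - 1" using x R2_gt by linarith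
  have "(\<lambda>j. taylor_coeff k j * x ^ j - taylor_coeff (twist k) j * x ^ j) sums (k x - twist k x)"
    by (intro sums_diff taylor_coeff_sums[OF _ xr] twist_holo) (simp_all add: k_def cpoly_holo)
  moreover have "(\<lambda>j. if j = n then (c n - taylor_coeff (twist k) n) * x ^ n else 0) sums ((c n - taylor_coeff (twist k) n) * x ^ n)"
    by (rule sums_single)
  ultimately have "(\<lambda>j. (if j = n then (c n - taylor_coeff (twist k) n) * x ^ n else 0) - (taylor_coeff k j * x ^ j - taylor_coeff (twist k) j * x ^ j))
     sums ((c n - taylor_coeff (twist k) n) * x ^ n - (k x - twist k x))"
    by (rule sums_diff[rotated])
  moreover have "(if j = n then (c n - taylor_coeff (twist k) n) * x ^ n else 0) - (taylor_coeff k j * x ^ j - taylor_coeff (twist k) j * x ^ j)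
      = (if j \<le> n then 0 else taylor_coeff (twist k) j * x ^ j)" for j
    using low[of j] by (auto simp: k_def taylor_coeff_cpoly algebra_simps le_less)
  ultimately have s: "(\<lambda>j. if j \<le> n then 0 else taylor_coeff (twist k) j * x ^ j) sums ((c n - taylor_coeff (twist k) n) * x ^ n - (k x - twist k x))"
    by simp
  hence s': "(\<lambda>j. if j + Suc n \<le> n then 0 else taylor_coeff (twist k) (j + Suc n) * x ^ (j + Suc n)) sums ((c n - taylor_coeff (twist k) n) * x ^ n - (k x - twist k x))"
    by (subst sums_iff_shift) (simp add: sum.neutral)
  have g: "(\<lambda>j. B * y ^ Suc n * y ^ j) sums (B * y ^ Suc n * (1 / (1 - y)))"
    using y k1 by (intro sums_mult geometric_sums) auto
  have "cmod ((c n - taylor_coeff (twist k) n) * x ^ n - (k x - twist k x)) \<le> B * y ^ Suc n * (1 / (1 - y))"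
  proof (rule norm_sums_le[OF s' g])
    fix j
    have "cmod (taylor_coeff (twist k) (j + Suc n) * x ^ (j + Suc n)) \<le> B / (R\<^sup>2 - R) ^ (j + Suc n) * cmod x ^ (j + Suc n)"
      unfolding norm_mult norm_power
      by (intro mult_right_mono twist_coeff_bound) (auto simp: k_def cpoly_holo B)
    also have "\<dots> = B * y ^ (j + Suc n)" by (simp only: y_def power_divide) simp
    also have "\<dots> = B * y ^ Suc n * y ^ j" by (simp only: power_add mult_ac)
    finally show "cmod (if j + Suc n \<le> n then 0 else taylor_coeff (twist k) (j + Suc n) * x ^ (j + Suc n)) \<le> B * y ^ Suc n * y ^ j"
      by simp
  qed
  also have "\<dots> \<le> B * y ^ Suc n * (1 / (1 - 1 / (R - 1)))"
    using y k1 B0 by (intro mult_left_mono divide_left_mono mult_pos_pos mult_nonneg_nonneg zero_le_power) auto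
  finally show ?thesis by (simp add: k_def y_def)
qed

text \<open>
  Since \<open>lift k (m^4 \<zeta>) = lift (twist k) \<zeta>\<close>, the values of \<open>lift (k
  - twist k)\<close> along the orbit \<open>m^(4 i) \<zeta>\<close> telescope to \<open>lift k
  \<zeta>\<close>. Each of them carries the factor \<open>m^(4 i)\<close> from
  \<open>lift\<close>; the one with \<open>i = 0\<close> contains the leading term \<open>g
  x^n\<close>.
\<close>

lemma lift_iteration_bound:
  assumes k: "k holomorphic_on UNIV"
    and B: "\<And>y. cmod y \<le> R \<Longrightarrow> cmod (k y) \<le> B" and B0: "0 \<le> B"
    and q: "\<And>y. cmod y \<le> P \<Longrightarrow> cmod (g * y ^ n - (k y - twist k y)) \<le> Q"
    and z: "\<zeta> \<noteq> 0" "cmod \<zeta> \<le> 1 / m"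
    and XP: "\<And>i. cmod (X (of_real ((m ^ 4) ^ i) * \<zeta>)) \<le> P" and PR: "P \<le> R"
    and T: "\<And>K. (\<Sum>i=1..<K. (m ^ 4) ^ i * cmod (X (of_real ((m ^ 4) ^ i) * \<zeta>)) ^ n) \<le> T"
  defines "\<rho> \<equiv> ((1 + m) / (1 - m))\<^sup>2"
  shows "cmod (k (X \<zeta>) - g * X \<zeta> ^ n) \<le> Q * (1 + \<rho> / (1 - m ^ 4)) + \<rho> * cmod g * T"
proof -
  define l where "l = m ^ 4"
  have l: "0 < l" "l < 1" using m4 by (auto simp: l_def)
  define s where "s = (\<lambda>i. l ^ i)"
  have s: "0 \<le> s i" "s i \<le> 1" "s 0 = 1" "s (Suc i) = l * s i" for i
    using l by (auto simp: s_def power_le_one)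
  have \<rho>0: "0 \<le> \<rho>" by (simp add: \<rho>_def)
  have Q0: "0 \<le> Q" using q[of 0] XP[of 0] norm_ge_zero order.trans by (metis norm_zero)
  have z2: "cmod \<zeta> < 1 / m\<^sup>2" using z inv_m_less by linarith
  \<comment> \<open>Division by E turns values of lift at the starting point into values of k.\<close>
  define E where "E = \<zeta> * X' \<zeta>"
  have E: "E \<noteq> 0" using z X'_nz[OF z2] by (simp add: E_def)
  have lb: "cmod (lift f (of_real (s i) * \<zeta>) / E) \<le> s i * (\<rho> * b)"
    if "cmod (f (X (of_real (s i) * \<zeta>))) \<le> b" for f i b
  proof -
    have "cmod (lift f (of_real (s i) * \<zeta>)) = s i * cmod \<zeta> * cmod (X' (of_real (s i) * \<zeta>)) * cmod (f (X (of_real (s i) * \<zeta>)))"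
      using s(1)[of i] by (simp add: lift_def norm_mult)
    also have "\<dots> \<le> s i * cmod \<zeta> * (\<rho> * cmod (X' \<zeta>)) * b"
      unfolding \<rho>_def using that s X'_ratio[OF z(2), of "s i"] by (intro mult_mono mult_left_mono mult_nonneg_nonneg) auto
    also have "\<dots> = s i * (\<rho> * b) * cmod E" by (simp add: E_def norm_mult)
    finally show ?thesis using E by (simp add: norm_divide pos_divide_le_eq)
  qed
  define W where "W = (\<lambda>i. lift k (of_real (s i) * \<zeta>) / E)"
  define h where "h = (\<lambda>i. lift (\<lambda>x. k x - twist k x) (of_real (s i) * \<zeta>) / E)"
  have zs: "cmod (of_real (s i) * \<zeta>) < 1 / m\<^sup>2" for i
    using z2 s(1,2)[of i] mult_left_le_one_le[of "cmod \<zeta>" "s i"] by (simp add: norm_mult)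
  have step: "W i - W (Suc i) = h i" for i
  proof -
    have "lift k (of_real (s (Suc i)) * \<zeta>) = lift (twist k) (of_real (s i) * \<zeta>)"
      using lift_scale[OF zs, of k i] by (simp add: s l_def mult.assoc)
    thus ?thesis by (simp add: W_def h_def lift_def diff_divide_distrib right_diff_distrib)
  qed
  have tel: "W 0 - W (Suc K) = (\<Sum>i\<le>K. h i)" for K
    by (induction K) (simp_all add: step[symmetric] diff_eq_eq)
  have W0: "W 0 = k (X \<zeta>)" using E by (simp add: W_def s lift_def E_def)
  have h0: "h 0 = k (X \<zeta>) - twist k (X \<zeta>)" using E by (simp add: h_def s lift_def E_def)
  have Xs: "cmod (X (of_real (s i) * \<zeta>)) \<le> P" for i using XP[of i] by (simp add: s_def l_def)
  have h0b: "cmod (h 0 - g * X \<zeta> ^ n) \<le> Q"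
    using q[OF Xs[of 0]] by (simp add: s h0 norm_minus_commute)
  have hb: "cmod (h i) \<le> s i * (\<rho> * (cmod g * cmod (X (of_real (s i) * \<zeta>)) ^ n + Q))" for i
    unfolding h_def
  proof (rule lb)
    let ?x = "X (of_real (s i) * \<zeta>)"
    have "cmod (k ?x - twist k ?x) = cmod (g * ?x ^ n - (g * ?x ^ n - (k ?x - twist k ?x)))" by simp
    also have "\<dots> \<le> cmod (g * ?x ^ n) + cmod (g * ?x ^ n - (k ?x - twist k ?x))" by (rule norm_triangle_ineq4)
    also have "\<dots> \<le> cmod g * cmod ?x ^ n + Q" using q[OF Xs] by (simp add: norm_mult norm_power)
    finally show "cmod (k ?x - twist k ?x) \<le> cmod g * cmod ?x ^ n + Q" .
  qed
  have Wb: "cmod (W i) \<le> s i * (\<rho> * B)" for i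
    unfolding W_def by (rule lb) (use B Xs[of i] PR in auto)
  have geo: "(\<Sum>i=1..<K. s i) \<le> 1 / (1 - l)" for K
  proof -
    have "(\<Sum>i=1..<K. s i) \<le> (\<Sum>i. s i)" unfolding s_def
      using l by (intro sum_le_suminf summable_geometric) auto
    thus ?thesis using l by (simp add: s_def suminf_geometric)
  qed
  \<comment> \<open>The last summand is the remainder of the telescoping sum after K + 1 steps.\<close>
  have main: "cmod (k (X \<zeta>) - g * X \<zeta> ^ n) \<le> Q * (1 + \<rho> / (1 - l)) + \<rho> * cmod g * T + s (Suc K) * (\<rho> * B)" for K
  proof -
    have "k (X \<zeta>) - g * X \<zeta> ^ n = W (Suc K) + (\<Sum>i\<le>K. h i) - g * X \<zeta> ^ n"
      using tel[of K] W0 by (simp add: algebra_simps)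
    also have "(\<Sum>i\<le>K. h i) = h 0 + (\<Sum>i=1..<Suc K. h i)"
      by (simp add: lessThan_Suc_atMost[symmetric] atLeast0LessThan[symmetric] sum.atLeast_Suc_lessThan del: sum.lessThan_Suc sum.op_ivl_Suc)
    finally have "k (X \<zeta>) - g * X \<zeta> ^ n = W (Suc K) + ((h 0 - g * X \<zeta> ^ n) + (\<Sum>i=1..<Suc K. h i))"
      by (simp add: algebra_simps)
    hence "cmod (k (X \<zeta>) - g * X \<zeta> ^ n) \<le> cmod (W (Suc K)) + (cmod (h 0 - g * X \<zeta> ^ n) + cmod (\<Sum>i=1..<Suc K. h i))"
      by (metis (no_types, lifting) add_left_mono norm_triangle_ineq order.trans)
    also have "cmod (\<Sum>i=1..<Suc K. h i) \<le> (\<Sum>i=1..<Suc K. s i * (\<rho> * (cmod g * cmod (X (of_real (s i) * \<zeta>)) ^ n + Q)))"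
      by (intro sum_norm_le hb)
    also have "\<dots> = \<rho> * cmod g * (\<Sum>i=1..<Suc K. s i * cmod (X (of_real (s i) * \<zeta>)) ^ n) + \<rho> * Q * (\<Sum>i=1..<Suc K. s i)"
      unfolding sum_distrib_left sum.distrib[symmetric] by (intro sum.cong refl) (simp add: algebra_simps)
    also have "\<dots> \<le> \<rho> * cmod g * T + \<rho> * Q * (1 / (1 - l))"
      using T[of "Suc K"] geo[of "Suc K"] \<rho>0 Q0 unfolding s_def l_def by (intro add_mono mult_left_mono) auto
    finally show ?thesis using h0b Wb[of "Suc K"] by (simp add: algebra_simps)
  qed
  have lim: "(\<lambda>K. s (Suc K) * (\<rho> * B)) \<longlonglongrightarrow> 0"
  proof -
    have "(\<lambda>K. l ^ Suc K) \<longlonglongrightarrow> 0" using l by (intro LIMSEQ_Suc LIMSEQ_realpow_zero) auto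
    from tendsto_mult_right[OF this, of "\<rho> * B"] show ?thesis by (simp add: s_def)
  qed
  show ?thesis using norm_le_of_LIMSEQ_0[OF main lim] by (simp add: l_def)
qed

end

section \<open>Decay along the orbits of the contraction\<close>

context outer_radius
begin

text \<open>
  \<open>|X \<zeta>|\<^sup>2\<close>, normalised to be \<open>1\<close> at the fixed point
  \<open>\<zeta> = 0\<close> of the contraction.
\<close>

definition norm_ratio :: "complex \<Rightarrow> real" where
  "norm_ratio \<zeta> = (1 + 2 * Re \<zeta> + (cmod \<zeta>)\<^sup>2) / (1 + 2 * m\<^sup>2 * Re \<zeta> + m ^ 4 * (cmod \<zeta>)\<^sup>2)"

lemma X_sq_norm_ratio: "(cmod (X \<zeta>))\<^sup>2 = (R * m)\<^sup>2 * norm_ratio \<zeta>"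
  unfolding X_norm_sq norm_ratio_def m_quadratic[symmetric] by (simp add: add.commute)

lemma Re_bounds:
  assumes "cmod \<zeta> \<le> 1 / m"
  shows "0 \<le> m * (1 + m\<^sup>2 + 2 * m\<^sup>2 * Re \<zeta>) - m * (1 - m)\<^sup>2"
        "1 + 2 * m\<^sup>2 * Re \<zeta> + m ^ 4 * (cmod \<zeta>)\<^sup>2 \<le> 4"
        "0 < 1 + 2 * m\<^sup>2 * Re \<zeta> + m ^ 4 * (cmod \<zeta>)\<^sup>2"
proof -
  have b: "m * cmod \<zeta> \<le> 1" using assms m_pos by (simp add: field_simps)
  have "m * \<bar>Re \<zeta>\<bar> \<le> m * cmod \<zeta>" using abs_Re_le_cmod[of \<zeta>] m_pos by (intro mult_left_mono) auto
  with b have "m * \<bar>Re \<zeta>\<bar> \<le> 1" by linarith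
  hence a: "\<bar>m * Re \<zeta>\<bar> \<le> 1" using m_pos by (simp add: abs_mult)
  have 1: "m\<^sup>2 * (m * Re \<zeta>) \<ge> m\<^sup>2 * (- 1)" using a by (intro mult_left_mono) auto
  have "m * (m * Re \<zeta>) \<le> m * 1" using a m_pos by (intro mult_left_mono) auto
  hence 2: "m * (m * Re \<zeta>) \<le> 1 * 1" using m_less_1 by simp
  show "0 \<le> m * (1 + m\<^sup>2 + 2 * m\<^sup>2 * Re \<zeta>) - m * (1 - m)\<^sup>2"
    using 1 by (simp add: power2_eq_square algebra_simps)
  have "m ^ 4 * (cmod \<zeta>)\<^sup>2 = (m * (m * cmod \<zeta>))\<^sup>2" by (simp add: power_mult_distrib flip: power_mult)
  moreover have "m * (m * cmod \<zeta>) \<le> 1 * 1" using b m_pos m_less_1 by (intro mult_mono) auto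
  hence "(m * (m * cmod \<zeta>))\<^sup>2 \<le> 1\<^sup>2" using m_pos by (intro power_mono) auto
  moreover have "2 * m\<^sup>2 * Re \<zeta> \<le> 2" using 2 by (simp add: power2_eq_square)
  ultimately show "1 + 2 * m\<^sup>2 * Re \<zeta> + m ^ 4 * (cmod \<zeta>)\<^sup>2 \<le> 4" by simp
  show "0 < 1 + 2 * m\<^sup>2 * Re \<zeta> + m ^ 4 * (cmod \<zeta>)\<^sup>2"
    using assms inv_m_less by (intro den_sq_pos) simp
qed

text \<open>
  The key identity for the dynamics. \<open>N \<ge> 0\<close> means \<open>|X \<zeta>| \<ge> R
  m\<close>, and then \<open>|X|\<close> decreases when \<open>\<zeta>\<close> is scaled down; the
  second summand of the numerator shows that it does so even on the critical circle \<open>N =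
  0\<close>, at a rate proportional to \<open>s\<close>.
\<close>

lemma norm_ratio_scale:
  fixes s :: real
  assumes z: "cmod \<zeta> \<le> 1 / m" and s: "0 \<le> s" "s \<le> 1"
  defines "N \<equiv> 2 * Re \<zeta> + (1 + m\<^sup>2) * (cmod \<zeta>)\<^sup>2"
  defines "D1 \<equiv> 1 + 2 * m\<^sup>2 * Re \<zeta> + m ^ 4 * (cmod \<zeta>)\<^sup>2"
  defines "Ds \<equiv> 1 + 2 * m\<^sup>2 * (s * Re \<zeta>) + m ^ 4 * (s * cmod \<zeta>)\<^sup>2"
  shows "norm_ratio \<zeta> - norm_ratio (of_real s * \<zeta>) =
      (1 - m\<^sup>2) * ((1 - s) * (N + s * (cmod \<zeta>)\<^sup>2 * (1 + m\<^sup>2 + 2 * m\<^sup>2 * Re \<zeta>))) / (D1 * Ds)"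
    and "norm_ratio \<zeta> - 1 = (1 - m\<^sup>2) * N / D1" and "0 < D1" "0 < Ds" "D1 \<le> 4" "Ds \<le> 4"
proof -
  have sz: "cmod (of_real s * \<zeta>) = s * cmod \<zeta>" "Re (of_real s * \<zeta>) = s * Re \<zeta>"
    using s by (simp_all add: norm_mult)
  have "s * cmod \<zeta> \<le> 1 * cmod \<zeta>" using s by (intro mult_right_mono) auto
  hence szl: "cmod (of_real s * \<zeta>) \<le> 1 / m" using z sz by simp
  show D1: "0 < D1" "D1 \<le> 4" unfolding D1_def using Re_bounds[OF z] by auto
  show Ds: "0 < Ds" "Ds \<le> 4" unfolding Ds_def using Re_bounds[OF szl] unfolding sz by auto
  show "norm_ratio \<zeta> - 1 = (1 - m\<^sup>2) * N / D1"
    using D1(1) unfolding norm_ratio_def D1_def N_def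
    by (simp add: field_simps)
  have "norm_ratio \<zeta> - norm_ratio (of_real s * \<zeta>) =
    ((1 + 2 * Re \<zeta> + (cmod \<zeta>)\<^sup>2) * Ds - (1 + 2 * (s * Re \<zeta>) + (s * cmod \<zeta>)\<^sup>2) * D1) / (D1 * Ds)"
    unfolding norm_ratio_def sz D1_def[symmetric] Ds_def[symmetric]
    using D1(1) Ds(1) by (simp add: diff_frac_eq mult.commute)
  also have "(1 + 2 * Re \<zeta> + (cmod \<zeta>)\<^sup>2) * Ds - (1 + 2 * (s * Re \<zeta>) + (s * cmod \<zeta>)\<^sup>2) * D1
     = (1 - m\<^sup>2) * ((1 - s) * (N + s * (cmod \<zeta>)\<^sup>2 * (1 + m\<^sup>2 + 2 * m\<^sup>2 * Re \<zeta>)))"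
    unfolding D1_def Ds_def N_def by algebra
  finally show "norm_ratio \<zeta> - norm_ratio (of_real s * \<zeta>) =
      (1 - m\<^sup>2) * ((1 - s) * (N + s * (cmod \<zeta>)\<^sup>2 * (1 + m\<^sup>2 + 2 * m\<^sup>2 * Re \<zeta>))) / (D1 * Ds)" .
qed

lemma Rm_pos: "0 < R * m" "R * m < R" using m_pos R_gt_2 m_less_1 by auto

lemma lower_factor:
  assumes "cmod \<zeta> \<le> 1 / m"
  shows "(1 - m)\<^sup>2 \<le> 1 + m\<^sup>2 + 2 * m\<^sup>2 * Re \<zeta>"
  using Re_bounds(1)[OF assms] m_pos by (simp add: right_diff_distrib[symmetric] zero_le_mult_iff)

lemma lower_factor_nonneg:
  assumes "cmod \<zeta> \<le> 1 / m"
  shows "0 \<le> 1 + m\<^sup>2 + 2 * m\<^sup>2 * Re \<zeta>"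
  using lower_factor[OF assms] zero_le_power2[of "1 - m"] by linarith

lemma X_le_R: "cmod \<zeta> \<le> 1 / m \<Longrightarrow> cmod (X \<zeta>) \<le> R"
  using circle_props(2)[of \<zeta>] X_less_R_iff[of \<zeta>] inv_m_less by (cases "cmod \<zeta> = 1 / m") auto

text \<open>
  If \<open>|X \<zeta>| \<ge> R m\<close>, the modulus decreases along the segment to
  \<open>0\<close>; otherwise it does not exceed \<open>R m\<close> there.
\<close>

lemma X_scale_le:
  assumes z: "cmod \<zeta> \<le> 1 / m" and s: "0 \<le> s" "s \<le> 1" and P: "R * m \<le> P" "cmod (X \<zeta>) \<le> P"
  shows "cmod (X (of_real s * \<zeta>)) \<le> P"
proof -
  define N where "N = 2 * Re \<zeta> + (1 + m\<^sup>2) * (cmod \<zeta>)\<^sup>2"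
  note ps = norm_ratio_scale[OF z s, folded N_def]
  have P0: "0 \<le> P" using P Rm_pos by linarith
  have "(cmod (X (of_real s * \<zeta>)))\<^sup>2 \<le> P\<^sup>2"
  proof (cases "N \<ge> 0")
    case True
    have "0 \<le> N + s * (cmod \<zeta>)\<^sup>2 * (1 + m\<^sup>2 + 2 * m\<^sup>2 * Re \<zeta>)"
      by (rule add_nonneg_nonneg[OF True mult_nonneg_nonneg[OF mult_nonneg_nonneg[OF s(1) zero_le_power2] lower_factor_nonneg[OF z]]])
    hence "0 \<le> (1 - m\<^sup>2) * ((1 - s) * (N + s * (cmod \<zeta>)\<^sup>2 * (1 + m\<^sup>2 + 2 * m\<^sup>2 * Re \<zeta>)))"
      using m2 s by simp
    hence "0 \<le> norm_ratio \<zeta> - norm_ratio (of_real s * \<zeta>)"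
      unfolding ps(1) by (rule divide_nonneg_pos) (rule mult_pos_pos[OF ps(3,4)])
    hence "(cmod (X (of_real s * \<zeta>)))\<^sup>2 \<le> (cmod (X \<zeta>))\<^sup>2"
      unfolding X_sq_norm_ratio by (intro mult_left_mono) auto
    also have "\<dots> \<le> P\<^sup>2" using P by (intro power_mono) auto
    finally show ?thesis .
  next
    case False
    have sz: "cmod (of_real s * \<zeta>) = s * cmod \<zeta>" "Re (of_real s * \<zeta>) = s * Re \<zeta>"
      using s by (simp_all add: norm_mult)
    have "s * cmod \<zeta> \<le> 1 * cmod \<zeta>" using s by (intro mult_right_mono) auto
    hence szl: "cmod (of_real s * \<zeta>) \<le> 1 / m" using z sz by simp
    note ps2 = norm_ratio_scale[OF szl s, unfolded sz]
    have "s * (s * ((1 + m\<^sup>2) * (cmod \<zeta>)\<^sup>2)) \<le> s * (1 * ((1 + m\<^sup>2) * (cmod \<zeta>)\<^sup>2))"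
      using s by (intro mult_left_mono mult_right_mono) auto
    hence "2 * (s * Re \<zeta>) + (1 + m\<^sup>2) * (s * cmod \<zeta>)\<^sup>2 \<le> s * N"
      by (simp add: N_def power_mult_distrib power2_eq_square algebra_simps)
    also have "\<dots> \<le> 0" using s False by (simp add: mult_nonneg_nonpos)
    finally have "norm_ratio (of_real s * \<zeta>) - 1 \<le> 0"
      unfolding ps2(2) using m2 ps2(3) by (intro divide_nonpos_pos mult_nonneg_nonpos) auto
    hence "(cmod (X (of_real s * \<zeta>)))\<^sup>2 \<le> (R * m)\<^sup>2 * 1"
      unfolding X_sq_norm_ratio by (intro mult_left_mono) auto
    also have "\<dots> \<le> P\<^sup>2" using P Rm_pos by simp
    finally show ?thesis .
  qed
  thus ?thesis using P0 by (simp add: power2_le_iff_abs_le)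
qed

text \<open>
  This estimate holds up to the critical circle \<open>|X \<zeta>| = R m\<close>; there the decay
  comes only from the term with the factor \<open>s |\<zeta>|\<^sup>2\<close>.
\<close>

lemma X_orbit_decay:
  obtains d where "0 < d" "d < 1"
   "\<And>\<zeta> s. 1 \<le> cmod \<zeta> \<Longrightarrow> cmod \<zeta> \<le> 1 / m \<Longrightarrow> R * m \<le> cmod (X \<zeta>) \<Longrightarrow> 0 \<le> s \<Longrightarrow> s \<le> m ^ 4 \<Longrightarrow>
      cmod (X (of_real s * \<zeta>)) \<le> cmod (X \<zeta>) * exp (- d * s)"
proof -
  \<comment> \<open>The denominators D1 and Ds are at most 4, whence the 16; the other factors are lower bounds for the numerator.\<close>
  define d0 where "d0 = (1 - m\<^sup>2) * ((1 - m ^ 4) * (1 - m)\<^sup>2) / 16"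
  define d where "d = m\<^sup>2 * d0 / 2"
  have "(1 - m)\<^sup>2 \<le> 1" using m_pos m_less_1 by (intro power_le_one) auto
  hence b: "(1 - m ^ 4) * (1 - m)\<^sup>2 \<le> 1" using m4 by (intro mult_le_one) auto
  have a: "0 \<le> (1 - m ^ 4) * (1 - m)\<^sup>2" using m4 by simp
  have p1: "(1 - m\<^sup>2) * ((1 - m ^ 4) * (1 - m)\<^sup>2) \<le> 1"
    by (rule mult_le_one[OF _ a b]) (use m2 in linarith)
  have p0: "0 < (1 - m\<^sup>2) * ((1 - m ^ 4) * (1 - m)\<^sup>2)"
    using m2 m4 m_less_1 by (intro mult_pos_pos zero_less_power) linarith+
  have d0: "0 < d0" "d0 \<le> 1" unfolding d0_def using p0 p1 by simp_all
  have "m\<^sup>2 * d0 \<le> 1" using m2 d0 by (intro mult_le_one) linarith+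
  moreover have "0 < m\<^sup>2 * d0" using m2 d0 by (intro mult_pos_pos) linarith+
  ultimately have d: "0 < d" "d < 1" unfolding d_def by simp_all
  show ?thesis
  proof (rule that[OF d])
    fix \<zeta> s assume z1: "1 \<le> cmod \<zeta>" and z: "cmod \<zeta> \<le> 1 / m" and P: "R * m \<le> cmod (X \<zeta>)" and s: "0 \<le> s" "s \<le> m ^ 4"
    have s1: "s \<le> 1" using s m4 by linarith
    define N where "N = 2 * Re \<zeta> + (1 + m\<^sup>2) * (cmod \<zeta>)\<^sup>2"
    define D1 where "D1 = 1 + 2 * m\<^sup>2 * Re \<zeta> + m ^ 4 * (cmod \<zeta>)\<^sup>2"
    define Ds where "Ds = 1 + 2 * m\<^sup>2 * (s * Re \<zeta>) + m ^ 4 * (s * cmod \<zeta>)\<^sup>2"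
    note ps = norm_ratio_scale[OF z s(1) s1, folded N_def D1_def Ds_def]
    have XR: "cmod (X \<zeta>) \<le> R" by (rule X_le_R[OF z])
    have "(R * m)\<^sup>2 \<le> (R * m)\<^sup>2 * norm_ratio \<zeta>" unfolding X_sq_norm_ratio[symmetric]
      using P Rm_pos by (intro power_mono) auto
    hence "1 \<le> norm_ratio \<zeta>" using Rm_pos m_pos by (simp add: mult_le_cancel_left1)
    hence "0 \<le> (1 - m\<^sup>2) * N / D1" using ps(2) by simp
    hence N0: "0 \<le> N" using ps(3) m2 by (simp add: zero_le_divide_iff zero_le_mult_iff)
    have b1: "1 \<le> (cmod \<zeta>)\<^sup>2" using z1 by simp
    have num: "(1 - m\<^sup>2) * ((1 - m ^ 4) * (s * (1 - m)\<^sup>2)) \<le>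
       (1 - m\<^sup>2) * ((1 - s) * (N + s * (cmod \<zeta>)\<^sup>2 * (1 + m\<^sup>2 + 2 * m\<^sup>2 * Re \<zeta>)))"
    proof (intro mult_left_mono mult_mono)
      have "s * (1 - m)\<^sup>2 = 0 + s * 1 * (1 - m)\<^sup>2" by simp
      also have "\<dots> \<le> N + s * (cmod \<zeta>)\<^sup>2 * (1 + m\<^sup>2 + 2 * m\<^sup>2 * Re \<zeta>)"
        using N0 s b1 lower_factor[OF z] by (intro add_mono mult_mono[of "s * 1" _ "(1 - m)\<^sup>2"] mult_left_mono) auto
      finally show "s * (1 - m)\<^sup>2 \<le> N + s * (cmod \<zeta>)\<^sup>2 * (1 + m\<^sup>2 + 2 * m\<^sup>2 * Re \<zeta>)" .
    qed (use s s1 m4 m2 in auto)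
    have DD: "D1 * Ds \<le> 4 * 4" using ps by (intro mult_mono) auto
    have "d0 * s = (1 - m\<^sup>2) * ((1 - m ^ 4) * (s * (1 - m)\<^sup>2)) / 16" by (simp add: d0_def)
    also have "\<dots> \<le> (1 - m\<^sup>2) * ((1 - m ^ 4) * (s * (1 - m)\<^sup>2)) / (D1 * Ds)"
      using DD ps(3,4) s m2 m4 by (intro divide_left_mono mult_nonneg_nonneg mult_pos_pos) auto
    also have "\<dots> \<le> norm_ratio \<zeta> - norm_ratio (of_real s * \<zeta>)"
      unfolding ps(1) using num ps(3,4) by (intro divide_right_mono) (auto intro: less_imp_le mult_pos_pos)
    finally have g: "norm_ratio (of_real s * \<zeta>) \<le> norm_ratio \<zeta> - d0 * s" by simp
    have "(cmod (X (of_real s * \<zeta>)))\<^sup>2 \<le> (R * m)\<^sup>2 * (norm_ratio \<zeta> - d0 * s)"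
      unfolding X_sq_norm_ratio by (intro mult_left_mono g) auto
    also have "\<dots> = (cmod (X \<zeta>))\<^sup>2 - R\<^sup>2 * (m\<^sup>2 * d0 * s)"
      unfolding X_sq_norm_ratio by (simp add: algebra_simps power_mult_distrib)
    also have "\<dots> \<le> (cmod (X \<zeta>))\<^sup>2 - (cmod (X \<zeta>))\<^sup>2 * (m\<^sup>2 * d0 * s)"
      using XR d0 s R_gt_2 by (intro diff_left_mono mult_right_mono power_mono) auto
    also have "\<dots> = (cmod (X \<zeta>))\<^sup>2 * (1 + - (2 * d * s))" by (simp add: d_def algebra_simps)
    also have "\<dots> \<le> (cmod (X \<zeta>))\<^sup>2 * exp (- (2 * d * s))"
      by (intro mult_left_mono exp_ge_add_one_self) auto
    also have "\<dots> = (cmod (X \<zeta>) * exp (- d * s))\<^sup>2"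
      by (simp add: power_mult_distrib exp_double[symmetric] mult_ac)
    finally show "cmod (X (of_real s * \<zeta>)) \<le> cmod (X \<zeta>) * exp (- d * s)"
      by (rule power2_le_imp_le) auto
  qed
qed

text \<open>
  Away from the critical circle the scaling decreases \<open>|X|\<close> by a fixed factor, since
  \<open>N\<close> is bounded below.
\<close>

lemma X_orbit_contract:
  assumes \<delta>: "0 < \<delta>"
  obtains c where "0 < c" "c < 1"
   "\<And>\<zeta> s. cmod \<zeta> \<le> 1 / m \<Longrightarrow> R * m + \<delta> \<le> cmod (X \<zeta>) \<Longrightarrow> cmod (X \<zeta>) \<le> R \<Longrightarrow> 0 \<le> s \<Longrightarrow> s \<le> m ^ 4 \<Longrightarrow>
      cmod (X (of_real s * \<zeta>)) \<le> c * cmod (X \<zeta>)"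
proof -
  define \<eta> where "\<eta> = (1 - m ^ 4) * (((R * m + \<delta>)\<^sup>2 - (R * m)\<^sup>2) / (4 * R\<^sup>2))"
  have pos: "(R * m)\<^sup>2 < (R * m + \<delta>)\<^sup>2" using Rm_pos \<delta> by (intro power_strict_mono) auto
  have \<eta>0: "0 < \<eta>" unfolding \<eta>_def using m4 pos R_gt_2 by (intro mult_pos_pos divide_pos_pos) auto
  \<comment> \<open>The maximum only serves to keep c positive.\<close>
  define c where "c = sqrt (max (1 / 4) (1 - \<eta>))"
  have "max (1 / 4) (1 - \<eta>) < 1" using \<eta>0 by simp
  hence c: "0 < c" "c < 1" unfolding c_def by (auto simp: real_sqrt_lt_1_iff less_max_iff_disj)
  show ?thesis
  proof (rule that[OF c])
    fix \<zeta> s assume z: "cmod \<zeta> \<le> 1 / m" and P: "R * m + \<delta> \<le> cmod (X \<zeta>)" and XR: "cmod (X \<zeta>) \<le> R" and s: "0 \<le> s" "s \<le> m ^ 4"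
    have s1: "s \<le> 1" using s m4 by linarith
    define N where "N = 2 * Re \<zeta> + (1 + m\<^sup>2) * (cmod \<zeta>)\<^sup>2"
    define D1 where "D1 = 1 + 2 * m\<^sup>2 * Re \<zeta> + m ^ 4 * (cmod \<zeta>)\<^sup>2"
    define Ds where "Ds = 1 + 2 * m\<^sup>2 * (s * Re \<zeta>) + m ^ 4 * (s * cmod \<zeta>)\<^sup>2"
    note ps = norm_ratio_scale[OF z s(1) s1, folded N_def D1_def Ds_def]
    have sq: "(R * m + \<delta>)\<^sup>2 \<le> (cmod (X \<zeta>))\<^sup>2"
      using P Rm_pos \<delta> by (intro power_mono) auto
    have "(R * m)\<^sup>2 * (norm_ratio \<zeta> - 1) \<ge> (R * m + \<delta>)\<^sup>2 - (R * m)\<^sup>2"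
      using sq unfolding X_sq_norm_ratio by (simp add: algebra_simps)
    hence ph: "(R * m)\<^sup>2 * ((1 - m\<^sup>2) * N / D1) \<ge> (R * m + \<delta>)\<^sup>2 - (R * m)\<^sup>2" unfolding ps(2) .
    hence "0 < (R * m)\<^sup>2 * ((1 - m\<^sup>2) * N / D1)" using pos by linarith
    hence N0: "0 < N" using ps(3) m2 by (simp add: zero_less_mult_iff zero_less_divide_iff)
    have "(1 - m ^ 4) * ((1 - m\<^sup>2) * N / (D1 * 4)) \<le> (1 - s) * ((1 - m\<^sup>2) * (N + s * (cmod \<zeta>)\<^sup>2 * (1 + m\<^sup>2 + 2 * m\<^sup>2 * Re \<zeta>)) / (D1 * Ds))"
    proof (intro mult_mono frac_le mult_left_mono)
      show "N \<le> N + s * (cmod \<zeta>)\<^sup>2 * (1 + m\<^sup>2 + 2 * m\<^sup>2 * Re \<zeta>)"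
        using mult_nonneg_nonneg[OF mult_nonneg_nonneg[OF s(1) zero_le_power2[of "cmod \<zeta>"]] lower_factor_nonneg[OF z]] by linarith
      show "0 \<le> (1 - m\<^sup>2) * (N + s * (cmod \<zeta>)\<^sup>2 * (1 + m\<^sup>2 + 2 * m\<^sup>2 * Re \<zeta>))"
        using mult_nonneg_nonneg[OF mult_nonneg_nonneg[OF s(1) zero_le_power2[of "cmod \<zeta>"]] lower_factor_nonneg[OF z]] N0 m2
        by (intro mult_nonneg_nonneg[of "1 - m\<^sup>2"]) linarith+
    qed (use s s1 m2 m4 ps N0 in \<open>auto intro: mult_nonneg_nonneg\<close>)
    hence "(R * m)\<^sup>2 * (norm_ratio \<zeta> - norm_ratio (of_real s * \<zeta>)) \<ge> (R * m)\<^sup>2 * ((1 - m ^ 4) * ((1 - m\<^sup>2) * N / (D1 * 4)))"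
      unfolding ps(1) by (intro mult_left_mono) (auto simp: mult_ac)
    moreover have "(R * m)\<^sup>2 * ((1 - m ^ 4) * ((1 - m\<^sup>2) * N / (D1 * 4))) = (1 - m ^ 4) * ((R * m)\<^sup>2 * ((1 - m\<^sup>2) * N / D1) / 4)"
      by simp
    moreover have "(1 - m ^ 4) * ((R * m)\<^sup>2 * ((1 - m\<^sup>2) * N / D1) / 4) \<ge> (1 - m ^ 4) * (((R * m + \<delta>)\<^sup>2 - (R * m)\<^sup>2) / 4)"
      using ph m4 by (intro mult_left_mono divide_right_mono) auto
    moreover have "(1 - m ^ 4) * (((R * m + \<delta>)\<^sup>2 - (R * m)\<^sup>2) / 4) = R\<^sup>2 * \<eta>"
      using R_gt_2 by (simp add: \<eta>_def)
    ultimately have "(R * m)\<^sup>2 * (norm_ratio \<zeta> - norm_ratio (of_real s * \<zeta>)) \<ge> R\<^sup>2 * \<eta>" by linarith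
    hence "(cmod (X (of_real s * \<zeta>)))\<^sup>2 \<le> (cmod (X \<zeta>))\<^sup>2 - R\<^sup>2 * \<eta>"
      unfolding X_sq_norm_ratio right_diff_distrib by linarith
    also have "\<dots> \<le> (cmod (X \<zeta>))\<^sup>2 - (cmod (X \<zeta>))\<^sup>2 * \<eta>"
      using XR \<eta>0 R_gt_2 by (intro diff_left_mono mult_right_mono power_mono) auto
    also have "\<dots> = (cmod (X \<zeta>))\<^sup>2 * (1 - \<eta>)" by (simp add: algebra_simps)
    also have "\<dots> \<le> (cmod (X \<zeta>))\<^sup>2 * max (1 / 4) (1 - \<eta>)" by (intro mult_left_mono) auto
    also have "\<dots> = (c * cmod (X \<zeta>))\<^sup>2" by (simp add: c_def power_mult_distrib)
    finally show "cmod (X (of_real s * \<zeta>)) \<le> c * cmod (X \<zeta>)"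
      by (rule power2_le_imp_le) (use c in auto)
  qed
qed

end

text \<open>
  Up to the factor \<open>1 - q\<close> this is a Riemann sum for the integral of \<open>exp (- d
  n t)\<close>: \<open>1 + x \<le> exp x\<close> bounds each term by a difference of consecutive
  exponentials, and these telescope.
\<close>

lemma sum_geometric_exp_bound:
  fixes q d :: real
  assumes q: "0 < q" "q < 1" and d: "0 < d" and n: "0 < n"
  shows "(\<Sum>i=1..<K. q ^ i * exp (- (d * real n * q ^ i))) \<le> 1 / (d * (1 - q) * real n)"
proof -
  define f where "f = (\<lambda>i. exp (- (d * real n * q ^ i)))"
  have step: "d * (1 - q) * real n * (q ^ i * f i) \<le> f (Suc i) - f i" for i
  proof -
    have "f i * (1 + d * real n * q ^ i * (1 - q)) \<le> f i * exp (d * real n * q ^ i * (1 - q))"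
      by (intro mult_left_mono exp_ge_add_one_self) (simp add: f_def)
    also have "\<dots> = f (Suc i)"
      by (simp add: f_def exp_add[symmetric] algebra_simps)
    finally show ?thesis by (simp add: algebra_simps)
  qed
  have pos: "0 < d * (1 - q) * real n" using q d n by simp
  have "d * (1 - q) * real n * (\<Sum>i=1..<K. q ^ i * f i) \<le> (\<Sum>i=1..<K. f (Suc i) - f i)"
    unfolding sum_distrib_left by (intro sum_mono step)
  also have "\<dots> \<le> 1"
  proof (cases "1 \<le> K")
    case True
    have "(\<Sum>i=1..<K. f (Suc i) - f i) = f K - f 1" by (rule sum_Suc_diff'[OF True])
    also have "\<dots> \<le> 1 - 0" unfolding f_def using q d by (intro diff_mono) auto
    finally show ?thesis by simp
  qed simp
  finally show ?thesis using pos by (simp add: f_def field_simps)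
qed

section \<open>Distance of the orthonormal polynomials from their leading term\<close>

context outer_radius
begin

text \<open>
  The factor that makes \<open>p_n\<close> comparable with \<open>faber n\<close>; it is
  asymptotically the reciprocal of the leading coefficient of \<open>p_n\<close>.
\<close>

definition norming :: "nat \<Rightarrow> real" where
  "norming n = R ^ Suc n / sqrt (real n + 1)"

lemma norming_pos: "0 < norming n" using R_gt_2 by (simp add: norming_def)

lemma norming_le: "norming n \<le> R ^ Suc n"
proof -
  have "R ^ Suc n / sqrt (real n + 1) \<le> R ^ Suc n / 1"
    using R_gt_2 by (intro divide_left_mono) auto
  thus ?thesis by (simp add: norming_def)
qed

lemma norming_sq: "norming n * norming n * ((real n + 1) / R ^ (2 * Suc n)) = 1"
proof -
  have "R ^ Suc n * R ^ Suc n = R ^ (2 * Suc n)" by (simp only: power_add[symmetric] mult_2)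
  moreover have "sqrt (real n + 1) * sqrt (real n + 1) = real n + 1" by simp
  ultimately have "norming n * norming n = R ^ (2 * Suc n) / (real n + 1)" by (simp only: norming_def times_divide_times_eq)
  thus ?thesis using R_gt_2 by (simp del: power_Suc)
qed

lemma abs_diff_one_le_of_inverse: "0 < (a::real) \<Longrightarrow> a * b = 1 \<Longrightarrow> \<bar>b - 1\<bar> \<le> \<bar>a - b\<bar>"
proof -
  assume a: "0 < a" and ab: "a * b = 1"
  have b: "0 < b" using a ab by (metis zero_less_mult_pos zero_less_one)
  show ?thesis
  proof (cases "1 \<le> a")
    case True
    hence "1 * b \<le> a * b" using b by (intro mult_right_mono) auto
    thus ?thesis using True ab by simp
  next
    case False
    hence "a * b \<le> 1 * b" using b by (intro mult_right_mono) auto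
    thus ?thesis using False ab by simp
  qed
qed

text \<open>
  The Neumann series of \<open>1 - twist\<close> applied to \<open>k - twist k \<approx> g
  x^n\<close>. The norming makes \<open>g\<close> equal to \<open>1\<close> up to a geometrically
  small error, because \<open>g\<close> and the leading coefficient differ by the coefficient
  \<open>t\<close> of \<open>twist k\<close>, and their product is known. The polynomial factors
  in the bounds for the coefficients are absorbed by passing from \<open>1 / (R - 1)\<close> to
  its square root \<open>\<kappa>\<close>.
\<close>

lemma main_error:
  assumes orth: "area_orthonormal_polys (G1 R) p"
  obtains k :: "nat \<Rightarrow> complex \<Rightarrow> complex" and C \<kappa> :: real where "0 < C" "0 < \<kappa>" "\<kappa> < 1"
    "\<And>n u. u \<noteq> 0 \<Longrightarrow> poly (p n) (jouk u) * (1 - 1 / u\<^sup>2) = k n (1 + u) - k n (1 + 1 / u) / u\<^sup>2"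
    "\<And>n \<zeta> P T. \<zeta> \<noteq> 0 \<Longrightarrow> cmod \<zeta> \<le> 1 / m \<Longrightarrow> R * m \<le> P \<Longrightarrow> cmod (X \<zeta>) \<le> P \<Longrightarrow> P \<le> R \<Longrightarrow>
       (\<And>K. (\<Sum>i=1..<K. (m ^ 4) ^ i * cmod (X (of_real ((m ^ 4) ^ i) * \<zeta>)) ^ n) \<le> T) \<Longrightarrow>
       cmod (of_real (norming n) * k n (X \<zeta>) - X \<zeta> ^ n) \<le> C * (T + \<kappa> ^ n * P ^ n)"
proof -
  have "\<forall>n. \<exists>c a. p n = faber_comb c n \<and> c n = of_real a \<and> 0 < a \<and>
    (\<forall>j<n. c j = taylor_coeff (twist (cpoly c n)) j) \<and>
    of_real a * (c n - taylor_coeff (twist (cpoly c n)) n) = of_real ((real n + 1) / R ^ (2 * Suc n)) \<and>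
    (\<forall>j\<le>n. cmod (c j) * R ^ j \<le> 1 / sqrt (1 - m ^ 4) * (real n + 1))"
    using orthonormal_coefficients[OF orth] by (metis (no_types, lifting))
  then obtain c a where c: "\<And>n. p n = faber_comb (c n) n" "\<And>n. c n n = of_real (a n)" "\<And>n. 0 < a n"
    "\<And>n j. j < n \<Longrightarrow> c n j = taylor_coeff (twist (cpoly (c n) n)) j"
    "\<And>n. of_real (a n) * (c n n - taylor_coeff (twist (cpoly (c n) n)) n) = of_real ((real n + 1) / R ^ (2 * Suc n))"
    "\<And>n j. j \<le> n \<Longrightarrow> cmod (c n j) * R ^ j \<le> 1 / sqrt (1 - m ^ 4) * (real n + 1)"
    by metis
  define A where "A = 1 / sqrt (1 - m ^ 4)"
  have A: "0 < A" using m4 by (simp add: A_def)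
  define k where "k = (\<lambda>n. cpoly (c n) n)"
  define B where "B = (\<lambda>n. A * (real n + 1)\<^sup>2)"
  have B0: "0 \<le> B n" for n using A by (simp add: B_def)
  have kB: "cmod (k n y) \<le> B n" if "cmod y \<le> R" for n y
  proof -
    have "cmod (k n y) \<le> (\<Sum>j\<le>n. A * (real n + 1))"
      unfolding k_def cpoly_def
    proof (rule sum_norm_le)
      fix j assume j: "j \<in> {..n}"
      have "cmod (c n j * y ^ j) \<le> cmod (c n j) * R ^ j"
        unfolding norm_mult norm_power using that by (intro mult_left_mono power_mono) auto
      thus "cmod (c n j * y ^ j) \<le> A * (real n + 1)" using c(6)[of j n] j by (simp add: A_def)
    qed
    also have "\<dots> = B n" by (simp add: B_def power2_eq_square algebra_simps)
    finally show ?thesis .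
  qed
  define \<kappa>0 where "\<kappa>0 = 1 / (R - 1)"
  have \<kappa>0: "0 < \<kappa>0" "\<kappa>0 < 1" using R_gt_2 by (auto simp: \<kappa>0_def)
  define r where "r = R\<^sup>2 - R"
  have r: "0 < r" using R2_gt by (simp add: r_def)
  have Rr: "R / r = \<kappa>0" using R_gt_2 by (simp add: r_def \<kappa>0_def power2_eq_square field_simps)
  \<comment> \<open>One factor of the square root absorbs the polynomial growth of B, the other one remains.\<close>
  define \<kappa> where "\<kappa> = sqrt \<kappa>0"
  have \<kappa>: "0 < \<kappa>" "\<kappa> < 1" "\<kappa> * \<kappa> = \<kappa>0" using \<kappa>0 by (auto simp: \<kappa>_def real_sqrt_lt_1_iff)
  obtain C0 where C0: "0 < C0" "\<And>n. (real n + 1)\<^sup>2 * \<kappa> ^ n \<le> C0"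
    using square_times_power_bounded[OF \<kappa>(1,2)] by blast
  define D where "D = R * A * C0"
  have D: "0 < D" using R_gt_2 A C0 by (simp add: D_def)
  have \<delta>: "R * B n * \<kappa>0 ^ n \<le> D * \<kappa> ^ n" for n
  proof -
    have "R * B n * \<kappa>0 ^ n = R * A * ((real n + 1)\<^sup>2 * \<kappa> ^ n) * \<kappa> ^ n"
      by (simp add: B_def \<kappa>(3)[symmetric] power_mult_distrib)
    also have "\<dots> \<le> R * A * C0 * \<kappa> ^ n"
      using C0(2)[of n] R_gt_2 A \<kappa> by (intro mult_right_mono mult_left_mono) auto
    finally show ?thesis by (simp add: D_def)
  qed
  define \<rho> where "\<rho> = ((1 + m) / (1 - m))\<^sup>2"
  have \<rho>: "0 \<le> \<rho>" by (simp add: \<rho>_def)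
  define F where "F = 1 + \<rho> / (1 - m ^ 4)"
  have F: "0 < F" using \<rho> m4 by (simp add: F_def add_pos_nonneg)
  define C where "C = \<rho> * (1 + D) + D * (1 + F / (1 - \<kappa>0))"
  have C: "0 < C" unfolding C_def using \<rho> D F \<kappa>0 by (intro add_nonneg_pos mult_nonneg_nonneg mult_pos_pos add_pos_pos divide_pos_pos) auto
  show ?thesis
  proof (rule that[OF C \<kappa>(1,2)])
    show "poly (p n) (jouk u) * (1 - 1 / u\<^sup>2) = k n (1 + u) - k n (1 + 1 / u) / u\<^sup>2" if "u \<noteq> 0" for n u
      unfolding c(1) k_def cpoly_def using that by (rule faber_comb_jouk)
    fix n \<zeta> P T
    assume z: "\<zeta> \<noteq> 0" "cmod \<zeta> \<le> 1 / m" and P: "R * m \<le> P" "cmod (X \<zeta>) \<le> P" "P \<le> R"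
      and T: "\<And>K. (\<Sum>i=1..<K. (m ^ 4) ^ i * cmod (X (of_real ((m ^ 4) ^ i) * \<zeta>)) ^ n) \<le> T"
    have P0: "0 \<le> P" using P(1) Rm_pos by linarith
    have T0: "0 \<le> T" using T[of 0] by simp
    \<comment> \<open>The difference between the leading coefficient and g.\<close>
    define t where "t = taylor_coeff (twist (k n)) n"
    define g where "g = c n n - t"
    define g' where "g' = ((real n + 1) / R ^ (2 * Suc n)) / a n"
    have an: "0 < a n" by (rule c(3))
    have g: "g = of_real g'"
    proof -
      have "of_real (a n) * g = of_real ((real n + 1) / R ^ (2 * Suc n))"
        using c(5)[of n] by (simp only: g_def t_def k_def)
      hence "g = of_real ((real n + 1) / R ^ (2 * Suc n)) / of_real (a n)"
        using an by (metis less_irrefl nonzero_mult_div_cancel_left of_real_eq_0_iff)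
      thus ?thesis by (simp only: g'_def of_real_divide)
    qed
    \<comment> \<open>Two numbers with product 1 that are close to each other are both close to 1.\<close>
    have prod: "(norming n * a n) * (norming n * g') = 1"
    proof -
      have "(norming n * a n) * (norming n * g') = norming n * norming n * ((real n + 1) / R ^ (2 * Suc n))"
        using an by (simp add: g'_def)
      thus ?thesis unfolding norming_sq .
    qed
    have tb: "norming n * cmod t \<le> D * \<kappa> ^ n"
    proof -
      have "cmod t \<le> B n / r ^ n" unfolding t_def r_def
        by (rule twist_coeff_bound) (use kB in \<open>auto simp: k_def cpoly_holo\<close>)
      hence "norming n * cmod t \<le> R ^ Suc n * (B n / r ^ n)"
        using norming_le[of n] R_gt_2 by (intro mult_mono) auto
      also have "\<dots> = R * B n * \<kappa>0 ^ n" by (simp add: Rr[symmetric] power_divide)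
      also note \<delta>
      finally show ?thesis .
    qed
    have "cmod t = \<bar>a n - g'\<bar>"
    proof -
      have "t = of_real (a n - g')" using g c(2)[of n] by (simp add: g_def algebra_simps)
      thus ?thesis by (simp only: norm_of_real)
    qed
    hence "\<bar>norming n * a n - norming n * g'\<bar> \<le> D * \<kappa> ^ n"
      using tb norming_pos[of n] by (simp add: right_diff_distrib[symmetric] abs_mult)
    with abs_diff_one_le_of_inverse[OF _ prod] have g1: "\<bar>norming n * g' - 1\<bar> \<le> D * \<kappa> ^ n"
      using norming_pos[of n] an by fastforce
    have Dk: "D * \<kappa> ^ n \<le> D" using D \<kappa> by (simp add: mult_left_le power_le_one)
    have g2: "norming n * cmod g \<le> 1 + D"
    proof -
      have "norming n * cmod g = \<bar>norming n * g'\<bar>" using norming_pos[of n] by (simp add: g abs_mult)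
      thus ?thesis using g1 Dk by linarith
    qed
    define Q where "Q = B n * (P / r) ^ Suc n / (1 - \<kappa>0)"
    have q: "cmod (g * y ^ n - (k n y - twist (k n) y)) \<le> Q" if y: "cmod y \<le> P" for y
    proof -
      have "cmod (g * y ^ n - (k n y - twist (k n) y)) \<le> B n * (cmod y / r) ^ Suc n / (1 - \<kappa>0)"
        unfolding g_def t_def k_def r_def \<kappa>0_def
        by (rule tail_bound[OF c(4) kB[unfolded k_def] B0]) (use y P in auto)
      also have "\<dots> \<le> Q" unfolding Q_def
        using y r B0 \<kappa>0 by (intro divide_right_mono mult_left_mono power_mono) auto
      finally show ?thesis .
    qed
    have sQ: "norming n * Q \<le> D * \<kappa> ^ n * P ^ n / (1 - \<kappa>0)"
    proof -
      have "norming n * Q \<le> R ^ Suc n * Q" unfolding Q_def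
        using norming_le[of n] B0 P0 r \<kappa>0 by (intro mult_right_mono divide_nonneg_nonneg mult_nonneg_nonneg zero_le_power) auto
      also have "\<dots> = (R * B n * \<kappa>0 ^ n) * (P ^ n * (P / r)) / (1 - \<kappa>0)"
        by (simp add: Q_def Rr[symmetric] power_divide mult_ac)
      also have "\<dots> \<le> (D * \<kappa> ^ n) * (P ^ n * 1) / (1 - \<kappa>0)"
      proof (rule divide_right_mono, rule mult_mono[OF \<delta>])
        have "P / r \<le> R / r" using P r by (intro divide_right_mono) auto
        hence "P / r \<le> 1" using Rr \<kappa>0 by simp
        thus "P ^ n * (P / r) \<le> P ^ n * 1" using P0 by (intro mult_left_mono) auto
      qed (use P0 r \<kappa>0 \<kappa> D in auto)
      finally show ?thesis by simp
    qed
    have XP: "cmod (X (of_real ((m ^ 4) ^ i) * \<zeta>)) \<le> P" for i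
      by (rule X_scale_le[OF z(2) _ _ P(1,2)]) (use m4 in \<open>auto simp: power_le_one\<close>)
    have "cmod (k n (X \<zeta>) - g * X \<zeta> ^ n) \<le> Q * F + \<rho> * cmod g * T"
      unfolding F_def \<rho>_def
      by (rule lift_iteration_bound[OF _ kB B0 q z XP P(3) T]) (simp add: k_def cpoly_holo)
    hence "norming n * cmod (k n (X \<zeta>) - g * X \<zeta> ^ n) \<le> norming n * (Q * F + \<rho> * cmod g * T)"
      using norming_pos[of n] by (intro mult_left_mono) auto
    also have "\<dots> = (norming n * Q) * F + \<rho> * (norming n * cmod g) * T" by (simp add: algebra_simps)
    also have "\<dots> \<le> (D * \<kappa> ^ n * P ^ n / (1 - \<kappa>0)) * F + \<rho> * (1 + D) * T"
      using sQ g2 F \<rho> T0 by (intro add_mono mult_right_mono mult_left_mono) auto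
    finally have 1: "cmod (of_real (norming n) * (k n (X \<zeta>) - g * X \<zeta> ^ n)) \<le> (D * \<kappa> ^ n * P ^ n / (1 - \<kappa>0)) * F + \<rho> * (1 + D) * T"
      using norming_pos[of n] by (simp add: norm_mult)
    have "cmod (of_real (norming n * g' - 1) * X \<zeta> ^ n) = \<bar>norming n * g' - 1\<bar> * cmod (X \<zeta>) ^ n"
      unfolding norm_mult norm_of_real norm_power ..
    also have "\<dots> \<le> D * \<kappa> ^ n * P ^ n"
      using g1 P by (intro mult_mono power_mono) auto
    finally have 2: "cmod (of_real (norming n * g' - 1) * X \<zeta> ^ n) \<le> D * \<kappa> ^ n * P ^ n" .
    have "of_real (norming n) * k n (X \<zeta>) - X \<zeta> ^ n
        = of_real (norming n) * (k n (X \<zeta>) - g * X \<zeta> ^ n) + of_real (norming n * g' - 1) * X \<zeta> ^ n"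
      by (simp add: g algebra_simps)
    hence "cmod (of_real (norming n) * k n (X \<zeta>) - X \<zeta> ^ n)
        \<le> cmod (of_real (norming n) * (k n (X \<zeta>) - g * X \<zeta> ^ n)) + cmod (of_real (norming n * g' - 1) * X \<zeta> ^ n)"
      by (simp only: norm_triangle_ineq)
    also have "\<dots> \<le> ((D * \<kappa> ^ n * P ^ n / (1 - \<kappa>0)) * F + \<rho> * (1 + D) * T) + D * \<kappa> ^ n * P ^ n"
      by (rule add_mono[OF 1 2])
    also have "\<dots> = (\<rho> * (1 + D)) * T + (D * (1 + F / (1 - \<kappa>0))) * (\<kappa> ^ n * P ^ n)"
      by (simp add: algebra_simps)
    also have "\<dots> \<le> C * T + C * (\<kappa> ^ n * P ^ n)"
      using \<rho> D F \<kappa>0 \<kappa> T0 P0 unfolding C_def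
      by (intro add_mono mult_right_mono) (auto intro!: mult_nonneg_nonneg add_nonneg_nonneg divide_nonneg_nonneg)
    also have "\<dots> = C * (T + \<kappa> ^ n * P ^ n)" by (simp add: algebra_simps)
    finally show "cmod (of_real (norming n) * k n (X \<zeta>) - X \<zeta> ^ n) \<le> C * (T + \<kappa> ^ n * P ^ n)" .
  qed
qed

lemma m4_power: "0 \<le> (m ^ 4) ^ i" "(m ^ 4) ^ i \<le> 1" "1 \<le> i \<Longrightarrow> (m ^ 4) ^ i \<le> m ^ 4"
  using m4 power_decreasing[of 1 i "m ^ 4"] by (auto simp: power_le_one)

text \<open>
  The second bound concerns the other preimage \<open>1/\<zeta>\<close>, which is the complex
  conjugate of \<open>\<zeta> / |\<zeta>|\<^sup>2\<close>; the orbit of \<open>1/\<zeta>\<close>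
  is thus a further scaling of \<open>\<zeta>\<close>.
\<close>

lemma orbit_sum_decay:
  obtains C where "0 < C"
    "\<And>n \<zeta> K. 0 < n \<Longrightarrow> 1 \<le> cmod \<zeta> \<Longrightarrow> cmod \<zeta> \<le> 1 / m \<Longrightarrow> R * m \<le> cmod (X \<zeta>) \<Longrightarrow>
       (\<Sum>i=1..<K. (m ^ 4) ^ i * cmod (X (of_real ((m ^ 4) ^ i) * \<zeta>)) ^ n) \<le> C / real n * cmod (X \<zeta>) ^ n"
    "\<And>n \<zeta> K. 0 < n \<Longrightarrow> 1 \<le> cmod \<zeta> \<Longrightarrow> cmod \<zeta> \<le> 1 / m \<Longrightarrow> R * m \<le> cmod (X \<zeta>) \<Longrightarrow>
       (\<Sum>i=1..<K. (m ^ 4) ^ i * cmod (X (of_real ((m ^ 4) ^ i) * inverse \<zeta>)) ^ n) \<le> C / real n * cmod (X \<zeta>) ^ n"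
proof -
  obtain d where d: "0 < d" "d < 1" and dec:
   "\<And>\<zeta> s. 1 \<le> cmod \<zeta> \<Longrightarrow> cmod \<zeta> \<le> 1 / m \<Longrightarrow> R * m \<le> cmod (X \<zeta>) \<Longrightarrow> 0 \<le> s \<Longrightarrow> s \<le> m ^ 4 \<Longrightarrow>
      cmod (X (of_real s * \<zeta>)) \<le> cmod (X \<zeta>) * exp (- d * s)"
    using X_orbit_decay by blast
  define d' where "d' = d * m\<^sup>2"
  have d': "0 < d'" using d m2 by (simp add: d'_def)
  define C where "C = 1 / (d' * (1 - m ^ 4))"
  have C: "0 < C" using d' m4 by (simp add: C_def)
  have sum: "(\<Sum>i=1..<K. (m ^ 4) ^ i * f i ^ n) \<le> C / real n * P ^ n"
    if n: "0 < n" and f: "\<And>i. 1 \<le> i \<Longrightarrow> f i \<le> P * exp (- (d' * (m ^ 4) ^ i))" "\<And>i. 0 \<le> f i" and P: "0 \<le> P"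
    for f P n K
  proof -
    have "(\<Sum>i=1..<K. (m ^ 4) ^ i * f i ^ n) \<le> (\<Sum>i=1..<K. P ^ n * ((m ^ 4) ^ i * exp (- (d' * real n * (m ^ 4) ^ i))))"
    proof (rule sum_mono)
      fix i assume i: "i \<in> {1..<K}"
      have "f i ^ n \<le> (P * exp (- (d' * (m ^ 4) ^ i))) ^ n" using f i by (intro power_mono) auto
      also have "\<dots> = P ^ n * exp (- (d' * real n * (m ^ 4) ^ i))"
        by (simp add: power_mult_distrib exp_of_nat_mult[symmetric] mult_ac)
      finally have "(m ^ 4) ^ i * f i ^ n \<le> (m ^ 4) ^ i * (P ^ n * exp (- (d' * real n * (m ^ 4) ^ i)))"
        by (intro mult_left_mono m4_power)
      thus "(m ^ 4) ^ i * f i ^ n \<le> P ^ n * ((m ^ 4) ^ i * exp (- (d' * real n * (m ^ 4) ^ i)))"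
        by (simp only: mult.left_commute)
    qed
    also have "\<dots> = P ^ n * (\<Sum>i=1..<K. (m ^ 4) ^ i * exp (- (d' * real n * (m ^ 4) ^ i)))"
      by (simp only: sum_distrib_left)
    also have "\<dots> \<le> P ^ n * (1 / (d' * (1 - m ^ 4) * real n))"
      using P m4 d' n by (intro mult_left_mono sum_geometric_exp_bound) auto
    also have "\<dots> = C / real n * P ^ n" by (simp add: C_def)
    finally show ?thesis .
  qed
  show ?thesis
  proof (rule that[OF C])
    fix n K \<zeta> assume n: "0 < (n::nat)" and z: "1 \<le> cmod \<zeta>" "cmod \<zeta> \<le> 1 / m" "R * m \<le> cmod (X \<zeta>)"
    show "(\<Sum>i=1..<K. (m ^ 4) ^ i * cmod (X (of_real ((m ^ 4) ^ i) * \<zeta>)) ^ n) \<le> C / real n * cmod (X \<zeta>) ^ n"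
    proof (rule sum[OF n])
      fix i :: nat assume i: "1 \<le> i"
      have "cmod (X (of_real ((m ^ 4) ^ i) * \<zeta>)) \<le> cmod (X \<zeta>) * exp (- d * (m ^ 4) ^ i)"
        using i by (intro dec z m4_power)
      also have "\<dots> \<le> cmod (X \<zeta>) * exp (- (d' * (m ^ 4) ^ i))"
      proof -
        have "d' \<le> d" using d m2 by (simp add: d'_def mult_left_le)
        hence "d' * (m ^ 4) ^ i \<le> d * (m ^ 4) ^ i" by (intro mult_right_mono m4_power)
        thus ?thesis by (intro mult_left_mono) auto
      qed
      finally show "cmod (X (of_real ((m ^ 4) ^ i) * \<zeta>)) \<le> cmod (X \<zeta>) * exp (- (d' * (m ^ 4) ^ i))" .
    qed auto
    show "(\<Sum>i=1..<K. (m ^ 4) ^ i * cmod (X (of_real ((m ^ 4) ^ i) * inverse \<zeta>)) ^ n) \<le> C / real n * cmod (X \<zeta>) ^ n"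
    proof (rule sum[OF n])
      fix i :: nat assume i: "1 \<le> i"
      define s where "s = (m ^ 4) ^ i / (cmod \<zeta>)\<^sup>2"
      have z1: "1 \<le> (cmod \<zeta>)\<^sup>2" using z by simp
      have z0: "\<zeta> \<noteq> 0" using z by auto
      have "of_real ((m ^ 4) ^ i) * inverse \<zeta> = cnj (of_real s * \<zeta>)"
      proof -
        have "inverse \<zeta> = cnj \<zeta> / of_real ((cmod \<zeta>)\<^sup>2)"
          using z0 by (simp only: complex_norm_square) (simp add: field_simps)
        thus ?thesis by (simp add: s_def)
      qed
      hence "cmod (X (of_real ((m ^ 4) ^ i) * inverse \<zeta>)) = cmod (X (of_real s * \<zeta>))"
        by (simp only: X_cnj[symmetric] complex_mod_cnj)
      also have "\<dots> \<le> cmod (X \<zeta>) * exp (- d * s)"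
      proof (intro dec z)
        show "0 \<le> s" by (simp add: s_def m4_power)
        have "s \<le> (m ^ 4) ^ i / 1" unfolding s_def using z1 m4_power by (intro divide_left_mono) auto
        thus "s \<le> m ^ 4" using m4_power(3)[OF i] by linarith
      qed
      also have "\<dots> \<le> cmod (X \<zeta>) * exp (- (d' * (m ^ 4) ^ i))"
      proof -
        have "(cmod \<zeta>)\<^sup>2 \<le> (1 / m)\<^sup>2" using z by (intro power_mono) auto
        hence "m\<^sup>2 * (cmod \<zeta>)\<^sup>2 \<le> 1" using m_pos by (simp add: power_divide field_simps)
        hence "m\<^sup>2 \<le> 1 / (cmod \<zeta>)\<^sup>2" using z0 by (simp add: field_simps)
        hence "d * (m ^ 4) ^ i * m\<^sup>2 \<le> d * (m ^ 4) ^ i * (1 / (cmod \<zeta>)\<^sup>2)"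
          using d by (intro mult_left_mono mult_nonneg_nonneg m4_power) auto
        hence "d' * (m ^ 4) ^ i \<le> d * s" by (simp add: d'_def s_def mult_ac)
        thus ?thesis by (intro mult_left_mono) auto
      qed
      finally show "cmod (X (of_real ((m ^ 4) ^ i) * inverse \<zeta>)) \<le> cmod (X \<zeta>) * exp (- (d' * (m ^ 4) ^ i))" .
    qed auto
  qed
qed

lemma orbit_sum_contract:
  assumes "0 < \<delta>"
  obtains c where "0 < c" "c < 1"
   "\<And>n \<zeta> K. cmod \<zeta> \<le> 1 / m \<Longrightarrow> R * m + \<delta> \<le> cmod (X \<zeta>) \<Longrightarrow>
      (\<Sum>i=1..<K. (m ^ 4) ^ i * cmod (X (of_real ((m ^ 4) ^ i) * \<zeta>)) ^ n) \<le> 1 / (1 - m ^ 4) * (c ^ n * cmod (X \<zeta>) ^ n)"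
proof -
  obtain c where c: "0 < c" "c < 1"
   "\<And>\<zeta> s. cmod \<zeta> \<le> 1 / m \<Longrightarrow> R * m + \<delta> \<le> cmod (X \<zeta>) \<Longrightarrow> cmod (X \<zeta>) \<le> R \<Longrightarrow> 0 \<le> s \<Longrightarrow> s \<le> m ^ 4 \<Longrightarrow>
      cmod (X (of_real s * \<zeta>)) \<le> c * cmod (X \<zeta>)"
    using X_orbit_contract[OF assms] by blast
  show ?thesis
  proof (rule that[OF c(1,2)])
    fix n K \<zeta> assume z: "cmod \<zeta> \<le> 1 / m" "R * m + \<delta> \<le> cmod (X \<zeta>)"
    have "(\<Sum>i=1..<K. (m ^ 4) ^ i * cmod (X (of_real ((m ^ 4) ^ i) * \<zeta>)) ^ n)
       \<le> (\<Sum>i=1..<K. (m ^ 4) ^ i * (c * cmod (X \<zeta>)) ^ n)"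
      by (intro sum_mono mult_left_mono power_mono c(3) z X_le_R m4_power) auto
    also have "\<dots> = (\<Sum>i=1..<K. (m ^ 4) ^ i) * (c ^ n * cmod (X \<zeta>) ^ n)"
      by (simp only: sum_distrib_right power_mult_distrib)
    also have "\<dots> \<le> 1 / (1 - m ^ 4) * (c ^ n * cmod (X \<zeta>) ^ n)"
    proof (rule mult_right_mono)
      have "(\<Sum>i=1..<K. (m ^ 4) ^ i) \<le> (\<Sum>i. (m ^ 4) ^ i)"
        using m4 by (intro sum_le_suminf summable_geometric) auto
      thus "(\<Sum>i=1..<K. (m ^ 4) ^ i) \<le> 1 / (1 - m ^ 4)" using m4 by (simp add: suminf_geometric)
    qed (use c in simp)
    finally show "(\<Sum>i=1..<K. (m ^ 4) ^ i * cmod (X (of_real ((m ^ 4) ^ i) * \<zeta>)) ^ n) \<le> 1 / (1 - m ^ 4) * (c ^ n * cmod (X \<zeta>) ^ n)" .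
  qed
qed

end

section \<open>Asymptotics off the segment\<close>

context outer_radius
begin

lemma jouk_coordinate:
  assumes "cmod (u + 1) \<le> R"
  obtains \<zeta> where "cmod \<zeta> \<le> 1 / m" "U \<zeta> = u" "X \<zeta> = 1 + u" "cmod \<zeta> < 1 / m\<^sup>2"
proof -
  obtain \<zeta> where z: "cmod \<zeta> \<le> 1 / m" "U \<zeta> = u" using U_surj[OF assms] by blast
  have "cmod \<zeta> < 1 / m\<^sup>2" using z inv_m_less by linarith
  thus ?thesis using that z X_eq_U by (simp add: add.commute)
qed

lemma X_0: "cmod (X 0) = R * m"
proof -
  have "X 0 = of_real (1 + m\<^sup>2)" by (simp add: X_def)
  hence "cmod (X 0) = \<bar>1 + m\<^sup>2\<bar>" by (simp only: norm_of_real)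
  thus ?thesis using one_plus_m2_pos m_quadratic by simp
qed

lemma combine_errors:
  assumes "cmod a \<le> A" "cmod b \<le> B"
  shows "cmod (a - b / u\<^sup>2) \<le> A + B / (cmod u)\<^sup>2"
proof -
  have "cmod (a - b / u\<^sup>2) \<le> cmod a + cmod (b / u\<^sup>2)" by (rule norm_triangle_ineq4)
  also have "cmod (b / u\<^sup>2) = cmod b / (cmod u)\<^sup>2" by (simp add: norm_divide norm_power)
  also have "cmod a + cmod b / (cmod u)\<^sup>2 \<le> A + B / (cmod u)\<^sup>2"
    using assms by (intro add_mono divide_right_mono) auto
  finally show ?thesis .
qed

text \<open>
  The bound \<open>O(1/n)\<close> for the orbit sums, used at the two preimages \<open>x = 1 +
  u\<close> and \<open>x = 1 + 1/u\<close>.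
\<close>

theorem uniform_error:
  assumes orth: "area_orthonormal_polys (G1 R) p"
  obtains C where "0 < C"
   "\<And>n u. 0 < n \<Longrightarrow> 1 \<le> cmod u \<Longrightarrow> R * m \<le> cmod (1 + u) \<Longrightarrow> cmod (1 + u) \<le> R \<Longrightarrow>
     cmod (of_real (norming n) * (poly (p n) (jouk u) * (1 - 1 / u\<^sup>2)) - ((1 + u) ^ n - (1 + 1 / u) ^ n / u\<^sup>2))
       \<le> C / real n * cmod (1 + u) ^ n"
proof (rule main_error[OF orth])
  fix k :: "nat \<Rightarrow> complex \<Rightarrow> complex" and C \<kappa> :: real
  assume C: "0 < C" "0 < \<kappa>" "\<kappa> < 1"
    and rep: "\<And>n u. u \<noteq> 0 \<Longrightarrow> poly (p n) (jouk u) * (1 - 1 / u\<^sup>2) = k n (1 + u) - k n (1 + 1 / u) / u\<^sup>2"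
    and err: "\<And>n \<zeta> P T. \<zeta> \<noteq> 0 \<Longrightarrow> cmod \<zeta> \<le> 1 / m \<Longrightarrow> R * m \<le> P \<Longrightarrow> cmod (X \<zeta>) \<le> P \<Longrightarrow> P \<le> R \<Longrightarrow>
       (\<And>K. (\<Sum>i=1..<K. (m ^ 4) ^ i * cmod (X (of_real ((m ^ 4) ^ i) * \<zeta>)) ^ n) \<le> T) \<Longrightarrow>
       cmod (of_real (norming n) * k n (X \<zeta>) - X \<zeta> ^ n) \<le> C * (T + \<kappa> ^ n * P ^ n)"
  obtain C1 where C1: "0 < C1" 
    and T1: "\<And>n \<zeta> K. 0 < n \<Longrightarrow> 1 \<le> cmod \<zeta> \<Longrightarrow> cmod \<zeta> \<le> 1 / m \<Longrightarrow> R * m \<le> cmod (X \<zeta>) \<Longrightarrow>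
       (\<Sum>i=1..<K. (m ^ 4) ^ i * cmod (X (of_real ((m ^ 4) ^ i) * \<zeta>)) ^ n) \<le> C1 / real n * cmod (X \<zeta>) ^ n"
    and T2: "\<And>n \<zeta> K. 0 < n \<Longrightarrow> 1 \<le> cmod \<zeta> \<Longrightarrow> cmod \<zeta> \<le> 1 / m \<Longrightarrow> R * m \<le> cmod (X \<zeta>) \<Longrightarrow>
       (\<Sum>i=1..<K. (m ^ 4) ^ i * cmod (X (of_real ((m ^ 4) ^ i) * inverse \<zeta>)) ^ n) \<le> C1 / real n * cmod (X \<zeta>) ^ n"
    by (rule orbit_sum_decay; rule that; assumption)
  obtain C0 where C0: "0 < C0" and kn: "\<And>n. 0 < n \<Longrightarrow> \<kappa> ^ n \<le> C0 / real n"
    by (rule geometric_le_reciprocal[OF C(2,3)]; rule that; assumption)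
  show ?thesis
  proof (rule that[of "2 * (C * (C1 + C0))"])
    show "0 < 2 * (C * (C1 + C0))" using C C1 C0 by simp
    fix n u assume n: "0 < (n::nat)" and u: "1 \<le> cmod u" "R * m \<le> cmod (1 + u)" "cmod (1 + u) \<le> R"
    define P where "P = cmod (1 + u)"
    have P0: "0 \<le> P" by (simp add: P_def)
    have u0: "u \<noteq> 0" using u by auto
    obtain \<zeta> where z: "cmod \<zeta> \<le> 1 / m" "U \<zeta> = u" "X \<zeta> = 1 + u" "cmod \<zeta> < 1 / m\<^sup>2"
      using jouk_coordinate[of u] u by (auto simp: add.commute)
    have z1: "1 \<le> cmod \<zeta>" using U_ge_1_iff[OF z(4)] z u by simp
    have z0: "\<zeta> \<noteq> 0" using z1 by auto
    have i1: "cmod (inverse \<zeta>) \<le> 1" using z1 by (simp add: norm_inverse inverse_le_1_iff)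
    have i2: "cmod (inverse \<zeta>) \<le> 1 / m" "cmod (inverse \<zeta>) < 1 / m\<^sup>2" using i1 inv_m_less by linarith+
    have iX: "X (inverse \<zeta>) = 1 + 1 / u"
      using X_eq_U[OF i2(2)] U_inverse[OF z0] z by (simp add: add.commute inverse_eq_divide)
    have "1 + 1 / u = (1 + u) / u" using u0 by (simp add: field_simps)
    hence "cmod (1 + 1 / u) = P / cmod u" by (simp add: P_def norm_divide)
    also have "\<dots> \<le> P / 1" using u P0 by (intro divide_left_mono) auto
    finally have iP: "cmod (X (inverse \<zeta>)) \<le> P" by (simp add: iX)
    have bound: "C * (C1 / real n * P ^ n + \<kappa> ^ n * P ^ n) \<le> C * (C1 + C0) / real n * P ^ n"
    proof -
      have "C1 / real n * P ^ n + \<kappa> ^ n * P ^ n \<le> C1 / real n * P ^ n + C0 / real n * P ^ n"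
        using kn[OF n] P0 by (intro add_left_mono mult_right_mono) auto
      also have "\<dots> = (C1 + C0) / real n * P ^ n" by (simp add: add_divide_distrib distrib_right)
      finally have "C * (C1 / real n * P ^ n + \<kappa> ^ n * P ^ n) \<le> C * ((C1 + C0) / real n * P ^ n)"
        using C by (intro mult_left_mono) auto
      thus ?thesis by simp
    qed
    have 1: "cmod (of_real (norming n) * k n (1 + u) - (1 + u) ^ n) \<le> C * (C1 + C0) / real n * P ^ n"
      using order.trans[OF err[OF z0 z(1), of P n "C1 / real n * P ^ n"] bound] T1[OF n z1 z(1)] u
      by (simp add: z(3) P_def)
    have 2: "cmod (of_real (norming n) * k n (1 + 1 / u) - (1 + 1 / u) ^ n) \<le> C * (C1 + C0) / real n * P ^ n"
      using order.trans[OF err[OF _ i2(1) _ iP, of n "C1 / real n * P ^ n"] bound] T2[OF n z1 z(1)] u z0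
      by (simp add: z(3) iX P_def)
    have eq: "of_real (norming n) * (poly (p n) (jouk u) * (1 - 1 / u\<^sup>2)) - ((1 + u) ^ n - (1 + 1 / u) ^ n / u\<^sup>2)
      = (of_real (norming n) * k n (1 + u) - (1 + u) ^ n) - (of_real (norming n) * k n (1 + 1 / u) - (1 + 1 / u) ^ n) / u\<^sup>2"
      unfolding rep[OF u0] by (simp add: algebra_simps diff_divide_distrib)
    have "cmod ((of_real (norming n) * k n (1 + u) - (1 + u) ^ n) - (of_real (norming n) * k n (1 + 1 / u) - (1 + 1 / u) ^ n) / u\<^sup>2)
      \<le> C * (C1 + C0) / real n * P ^ n + C * (C1 + C0) / real n * P ^ n / (cmod u)\<^sup>2"
      by (rule combine_errors[OF 1 2])
    also have "\<dots> \<le> C * (C1 + C0) / real n * P ^ n + C * (C1 + C0) / real n * P ^ n / 1"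
      using u P0 C C1 C0 by (intro add_left_mono divide_left_mono) (auto intro!: mult_nonneg_nonneg divide_nonneg_nonneg)
    also have "\<dots> = 2 * (C * (C1 + C0)) / real n * P ^ n" by simp
    finally show "cmod (of_real (norming n) * (poly (p n) (jouk u) * (1 - 1 / u\<^sup>2)) - ((1 + u) ^ n - (1 + 1 / u) ^ n / u\<^sup>2))
       \<le> 2 * (C * (C1 + C0)) / real n * cmod (1 + u) ^ n"
      unfolding eq P_def .
  qed
qed

text \<open>
  Both preimages stay away from the critical circle, so both orbit sums are geometrically small.
\<close>

theorem geometric_error:
  assumes orth: "area_orthonormal_polys (G1 R) p" and \<delta>: "0 < \<delta>"
  obtains C c where "0 < C" "0 < c" "c < 1"
   "\<And>n u. u \<noteq> 0 \<Longrightarrow> R * m + \<delta> \<le> cmod (1 + u) \<Longrightarrow> cmod (1 + u) \<le> R \<Longrightarrow>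
      R * m + \<delta> \<le> cmod (1 + 1 / u) \<Longrightarrow> cmod (1 + 1 / u) \<le> R \<Longrightarrow>
     cmod (of_real (norming n) * (poly (p n) (jouk u) * (1 - 1 / u\<^sup>2)) - ((1 + u) ^ n - (1 + 1 / u) ^ n / u\<^sup>2))
       \<le> C * c ^ n * (cmod (1 + u) ^ n + cmod (1 + 1 / u) ^ n / (cmod u)\<^sup>2)"
proof (rule main_error[OF orth])
  fix k :: "nat \<Rightarrow> complex \<Rightarrow> complex" and C \<kappa> :: real
  assume C: "0 < C" "0 < \<kappa>" "\<kappa> < 1"
    and rep: "\<And>n u. u \<noteq> 0 \<Longrightarrow> poly (p n) (jouk u) * (1 - 1 / u\<^sup>2) = k n (1 + u) - k n (1 + 1 / u) / u\<^sup>2"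
    and err: "\<And>n \<zeta> P T. \<zeta> \<noteq> 0 \<Longrightarrow> cmod \<zeta> \<le> 1 / m \<Longrightarrow> R * m \<le> P \<Longrightarrow> cmod (X \<zeta>) \<le> P \<Longrightarrow> P \<le> R \<Longrightarrow>
       (\<And>K. (\<Sum>i=1..<K. (m ^ 4) ^ i * cmod (X (of_real ((m ^ 4) ^ i) * \<zeta>)) ^ n) \<le> T) \<Longrightarrow>
       cmod (of_real (norming n) * k n (X \<zeta>) - X \<zeta> ^ n) \<le> C * (T + \<kappa> ^ n * P ^ n)"
  obtain c' where c': "0 < c'" "c' < 1"
    and T: "\<And>n \<zeta> K. cmod \<zeta> \<le> 1 / m \<Longrightarrow> R * m + \<delta> \<le> cmod (X \<zeta>) \<Longrightarrow>
      (\<Sum>i=1..<K. (m ^ 4) ^ i * cmod (X (of_real ((m ^ 4) ^ i) * \<zeta>)) ^ n) \<le> 1 / (1 - m ^ 4) * (c' ^ n * cmod (X \<zeta>) ^ n)"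
    by (rule orbit_sum_contract[OF \<delta>]; rule that; assumption)
  define c where "c = max c' \<kappa>"
  have c: "0 < c" "c < 1" using c' C by (auto simp: c_def)
  define D where "D = C * (1 / (1 - m ^ 4) + 1)"
  have D: "0 < D" using C m4 by (simp add: D_def add_pos_pos)
  have one: "cmod (of_real (norming n) * k n x - x ^ n) \<le> D * c ^ n * cmod x ^ n"
    if x: "R * m + \<delta> \<le> cmod x" "cmod x \<le> R" for n x
  proof -
    obtain \<zeta> where z: "cmod \<zeta> \<le> 1 / m" "X \<zeta> = x"
      using jouk_coordinate[of "x - 1"] x(2) by auto
    have z0: "\<zeta> \<noteq> 0" using X_0 z x \<delta> by auto
    have "cmod (of_real (norming n) * k n x - x ^ n) \<le> C * (1 / (1 - m ^ 4) * (c' ^ n * cmod x ^ n) + \<kappa> ^ n * cmod x ^ n)"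
      using err[OF z0 z(1), of "cmod x" n "1 / (1 - m ^ 4) * (c' ^ n * cmod x ^ n)"] T[OF z(1)] z(2) x \<delta> by simp
    also have "\<dots> \<le> C * (1 / (1 - m ^ 4) * (c ^ n * cmod x ^ n) + c ^ n * cmod x ^ n)"
      using C c' m4 unfolding c_def
      by (intro mult_left_mono add_mono mult_right_mono power_mono) auto
    also have "\<dots> = D * c ^ n * cmod x ^ n" by (simp add: D_def algebra_simps)
    finally show ?thesis .
  qed
  show ?thesis
  proof (rule that[OF D c])
    fix n u assume u0: "u \<noteq> 0" and u: "R * m + \<delta> \<le> cmod (1 + u)" "cmod (1 + u) \<le> R"
      "R * m + \<delta> \<le> cmod (1 + 1 / u)" "cmod (1 + 1 / u) \<le> R"
    have eq: "of_real (norming n) * (poly (p n) (jouk u) * (1 - 1 / u\<^sup>2)) - ((1 + u) ^ n - (1 + 1 / u) ^ n / u\<^sup>2)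
      = (of_real (norming n) * k n (1 + u) - (1 + u) ^ n) - (of_real (norming n) * k n (1 + 1 / u) - (1 + 1 / u) ^ n) / u\<^sup>2"
      unfolding rep[OF u0] by (simp add: algebra_simps diff_divide_distrib)
    have "cmod ((of_real (norming n) * k n (1 + u) - (1 + u) ^ n) - (of_real (norming n) * k n (1 + 1 / u) - (1 + 1 / u) ^ n) / u\<^sup>2)
      \<le> D * c ^ n * cmod (1 + u) ^ n + D * c ^ n * cmod (1 + 1 / u) ^ n / (cmod u)\<^sup>2"
      by (rule combine_errors[OF one[OF u(1,2)] one[OF u(3,4)]])
    also have "\<dots> = D * c ^ n * (cmod (1 + u) ^ n + cmod (1 + 1 / u) ^ n / (cmod u)\<^sup>2)"
      by (simp add: algebra_simps)
    finally show "cmod (of_real (norming n) * (poly (p n) (jouk u) * (1 - 1 / u\<^sup>2)) - ((1 + u) ^ n - (1 + 1 / u) ^ n / u\<^sup>2))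
       \<le> D * c ^ n * (cmod (1 + u) ^ n + cmod (1 + 1 / u) ^ n / (cmod u)\<^sup>2)"
      unfolding eq .
  qed
qed

end

text \<open>
  Put \<open>t = (u - 1) / (u + 1)\<close>. Then \<open>(z - 2) / (z + 2) = t\<^sup>2\<close>, and
  \<open>Re t > 0\<close> for \<open>|u| > 1\<close>, so \<open>t\<close> is the principal root.
\<close>

lemma sqrt4_jouk:
  assumes u: "1 < cmod u"
  shows "sqrt4 (jouk u) = u - 1 / u"
proof -
  have u0: "u \<noteq> 0" using u by auto
  have u1: "u + 1 \<noteq> 0" using u by (metis add_eq_0_iff norm_minus_cancel norm_one less_irrefl add.commute)
  have a: "jouk u + 2 = (u + 1)\<^sup>2 / u" and b: "jouk u - 2 = (u - 1)\<^sup>2 / u"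
    using u0 by (simp_all add: jouk_def field_simps power2_eq_square)
  have q: "(jouk u - 2) / (jouk u + 2) = ((u - 1) / (u + 1))\<^sup>2"
    unfolding a b using u0 u1 by (simp add: power_divide)
  have "(u - 1) / (u + 1) = (u - 1) * cnj (u + 1) / of_real ((cmod (u + 1))\<^sup>2)"
  proof -
    have "cnj (u + 1) \<noteq> 0" using u1 by (simp only: complex_cnj_zero_iff not_False_eq_True)
    thus ?thesis unfolding complex_norm_square by (rule nonzero_mult_divide_mult_cancel_right[symmetric])
  qed
  hence "Re ((u - 1) / (u + 1)) = Re ((u - 1) * cnj (u + 1)) / (cmod (u + 1))\<^sup>2"
    by (simp only: Re_divide_of_real)
  also have "Re ((u - 1) * cnj (u + 1)) = (cmod u)\<^sup>2 - 1"
    unfolding cmod_power2 by (simp add: algebra_simps power2_eq_square)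
  finally have "0 < Re ((u - 1) / (u + 1))"
    using u u1 by simp
  hence "csqrt (((u - 1) / (u + 1))\<^sup>2) = (u - 1) / (u + 1)" by (intro csqrt_square) auto
  hence "sqrt4 (jouk u) = (u + 1)\<^sup>2 / u * ((u - 1) / (u + 1))"
    unfolding sqrt4_def q by (simp only: a)
  also have "\<dots> = (u + 1) * (u - 1) / u" using u1 by (simp add: power2_eq_square)
  also have "\<dots> = u - 1 / u" using u0 by (simp add: field_simps)
  finally show ?thesis .
qed

lemma jouk_not_segment:
  assumes "1 < cmod u"
  shows "jouk u \<notin> of_real ` {-2..2}"
proof
  assume "jouk u \<in> of_real ` {-2..2}"
  then obtain x where x: "-2 \<le> x" "x \<le> 2" "jouk u = of_real x" by auto
  define \<theta> where "\<theta> = arccos (x / 2)"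
  have c: "cos \<theta> = x / 2" using x by (simp add: \<theta>_def cos_arccos)
  have "jouk (cis \<theta>) = of_real x"
    using c by (simp add: jouk_def complex_eq_iff)
  hence "jouk u = jouk (cis \<theta>)" using x by simp
  moreover have "u \<noteq> 0" "cis \<theta> \<noteq> 0" using assms by auto
  ultimately have "u = cis \<theta> \<or> u * cis \<theta> = 1" by (simp add: jouk_eq_iff)
  hence "cmod u = 1" by (metis norm_cis norm_mult mult.right_neutral norm_one)
  thus False using assms by simp
qed

context outer_radius
begin

text \<open>
  Here \<open>z + sqrt4 z = 2 u\<close> and \<open>z + 2 + sqrt4 z = 2 (1 + u)\<close>. By
  compactness \<open>|u|\<close> is bounded away from \<open>1\<close>, so the term with \<open>(1
  + 1/u)^n\<close> is geometrically small relative to \<open>(1 + u)^n\<close>.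
\<close>

theorem exterior_asymptotics:
  assumes orth: "area_orthonormal_polys (G1 R) p"
    and K: "compact K" "\<And>z. z \<in> K \<Longrightarrow> \<exists>u. z = jouk u \<and> 1 < cmod u \<and> R * m \<le> cmod (1 + u) \<and> cmod (1 + u) \<le> R"
  shows "\<exists>C. \<forall>\<^sub>F n in sequentially. \<forall>z\<in>K.
               cmod (of_real ((2 * R) ^ (n + 1)) * poly (p n) z /
                       (of_real (sqrt (real n + 1)) * (z + 2 + sqrt4 z) ^ n)
                     - (z + sqrt4 z) / sqrt4 z) \<le> C / real n"
proof -
  obtain C where C: "0 < C" and err:
   "\<And>n u. 0 < n \<Longrightarrow> 1 \<le> cmod u \<Longrightarrow> R * m \<le> cmod (1 + u) \<Longrightarrow> cmod (1 + u) \<le> R \<Longrightarrow>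
     cmod (of_real (norming n) * (poly (p n) (jouk u) * (1 - 1 / u\<^sup>2)) - ((1 + u) ^ n - (1 + 1 / u) ^ n / u\<^sup>2))
       \<le> C / real n * cmod (1 + u) ^ n"
    by (rule uniform_error[OF orth]; rule that; assumption)
  \<comment> \<open>The modulus of u is the continuous function |z + sqrt4 z| / 2 of z, which attains its minimum on K.\<close>
  have "\<exists>r>1. \<forall>z\<in>K. \<forall>u. z = jouk u \<and> 1 < cmod u \<longrightarrow> r \<le> cmod u"
  proof (cases "K = {}")
    case True thus ?thesis by (intro exI[of _ 2]) auto
  next
    case False
    define f where "f = (\<lambda>z. cmod ((z + sqrt4 z) / 2))"
    have fu: "f (jouk u) = cmod u" if "1 < cmod u" for u
    proof -
      have "jouk u + sqrt4 (jouk u) = 2 * u" unfolding sqrt4_jouk[OF that] by (simp add: jouk_def inverse_eq_divide)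
      thus ?thesis by (simp add: f_def)
    qed
    have "K \<subseteq> - of_real ` {-2..2}" using K(2) jouk_not_segment by (metis ComplI subsetI)
    hence "continuous_on K sqrt4"
      using sqrt4_holomorphic holomorphic_on_imp_continuous_on continuous_on_subset by blast
    hence "continuous_on K f" unfolding f_def by (intro continuous_intros) auto
    then obtain z0 where z0: "z0 \<in> K" "\<And>z. z \<in> K \<Longrightarrow> f z0 \<le> f z"
      using continuous_attains_inf[OF K(1) False] by blast
    obtain u0 where u0: "z0 = jouk u0" "1 < cmod u0" using K(2)[OF z0(1)] by blast
    show ?thesis
    proof (intro exI[of _ "f z0"] conjI ballI allI impI)
      show "1 < f z0" using u0 fu by simp
      fix z u assume "z \<in> K" and "z = jouk u \<and> 1 < cmod u"
      thus "f z0 \<le> cmod u" using z0(2)[of z] fu[of u] by simp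
    qed
  qed
  then obtain r where r: "1 < r" "\<And>u. jouk u \<in> K \<Longrightarrow> 1 < cmod u \<Longrightarrow> r \<le> cmod u" by blast
  define q where "q = 1 / r"
  have q: "0 < q" "q < 1" using r by (auto simp: q_def)
  obtain C0 where C0: "0 < C0" and qn: "\<And>n. 0 < n \<Longrightarrow> q ^ n \<le> C0 / real n"
    by (rule geometric_le_reciprocal[OF q]; rule that; assumption)
  define d where "d = 1 - q\<^sup>2"
  have d: "0 < d" using q by (simp add: d_def power_less_one_iff)
  define D where "D = 2 * (C + C0) / d"
  show ?thesis
  proof (intro exI[of _ D] eventually_sequentiallyI[of 1] ballI)
    fix n z assume n1: "1 \<le> (n::nat)" and z: "z \<in> K"
    hence n: "0 < n" by simp
    obtain u where u: "z = jouk u" "1 < cmod u" "R * m \<le> cmod (1 + u)" "cmod (1 + u) \<le> R"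
      using K(2)[OF z] by blast
    have ru: "r \<le> cmod u" using r(2)[of u] z u by simp
    have u0: "u \<noteq> 0" using u by auto
    have P0: "0 < cmod (1 + u)" using u(3) Rm_pos by linarith
    hence u1: "1 + u \<noteq> 0" by auto
    define w where "w = 1 - 1 / u\<^sup>2"
    have iu: "1 / cmod u \<le> q" using ru r by (simp add: q_def frac_le)
    have wd: "d \<le> cmod w"
    proof -
      have "cmod (1 / u\<^sup>2) = (1 / cmod u)\<^sup>2" by (simp add: norm_divide norm_power power_divide)
      also have "\<dots> \<le> q\<^sup>2" using iu by (intro power_mono) auto
      finally show ?thesis using norm_triangle_ineq2[of 1 "1 / u\<^sup>2"] by (simp add: w_def d_def)
    qed
    hence w0: "w \<noteq> 0" using d by auto
    have s1: "z + 2 + sqrt4 z = 2 * (1 + u)" and s2: "(z + sqrt4 z) / sqrt4 z = 2 / w"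
    proof -
      show "z + 2 + sqrt4 z = 2 * (1 + u)" unfolding u(1) sqrt4_jouk[OF u(2)] by (simp add: jouk_def inverse_eq_divide)
      have a: "z + sqrt4 z = 2 * u" unfolding u(1) sqrt4_jouk[OF u(2)] by (simp add: jouk_def inverse_eq_divide)
      have b: "sqrt4 z = u * w" unfolding u(1) sqrt4_jouk[OF u(2)] w_def using u0 by (simp add: field_simps power2_eq_square)
      have "(z + sqrt4 z) / sqrt4 z = 2 * u / (u * w)" by (simp only: a) (simp only: b)
      thus "(z + sqrt4 z) / sqrt4 z = 2 / w" using u0 by simp
    qed
    have s3: "of_real ((2 * R) ^ (n + 1)) * poly (p n) z / (of_real (sqrt (real n + 1)) * (z + 2 + sqrt4 z) ^ n)
       = 2 * (of_real (norming n) * poly (p n) z / (1 + u) ^ n)"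
    proof -
      define v where "v = 1 + u"
      have "v \<noteq> 0" using u1 by (simp add: v_def)
      thus ?thesis unfolding s1 v_def[symmetric] by (simp add: norming_def power_mult_distrib)
    qed
    define e where "e = of_real (norming n) * (poly (p n) z * w) - ((1 + u) ^ n - (1 + 1 / u) ^ n / u\<^sup>2)"
    have eb: "cmod e \<le> C / real n * cmod (1 + u) ^ n"
      unfolding e_def w_def u(1) using err[OF n _ u(3,4)] u(2) by simp
    have fb: "cmod ((1 + 1 / u) ^ n / u\<^sup>2) \<le> C0 / real n * cmod (1 + u) ^ n"
    proof -
      have "1 + 1 / u = (1 + u) / u" using u0 by (simp add: field_simps)
      hence "cmod ((1 + 1 / u) ^ n / u\<^sup>2) = cmod (1 + u) ^ n * (1 / cmod u) ^ n * (1 / cmod u)\<^sup>2"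
        by (simp add: norm_divide norm_power norm_mult power_divide)
      also have "\<dots> \<le> cmod (1 + u) ^ n * q ^ n * 1"
        using iu u q by (intro mult_mono mult_left_mono power_mono) (auto simp: power_le_one)
      also have "\<dots> \<le> cmod (1 + u) ^ n * (C0 / real n)"
        using mult_left_mono[OF qn[OF n], of "cmod (1 + u) ^ n"] by simp
      finally show ?thesis by (simp add: mult.commute)
    qed
    have "2 * (of_real (norming n) * poly (p n) z / (1 + u) ^ n) - 2 / w = 2 * ((e - (1 + 1 / u) ^ n / u\<^sup>2) / (w * (1 + u) ^ n))"
      unfolding e_def using w0 u1 by (simp add: field_simps)
    hence "cmod (2 * (of_real (norming n) * poly (p n) z / (1 + u) ^ n) - 2 / w)
       = 2 * (cmod (e - (1 + 1 / u) ^ n / u\<^sup>2) / (cmod w * cmod (1 + u) ^ n))"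
      by (simp only: norm_mult norm_divide norm_power norm_numeral)
    also have "\<dots> \<le> 2 * ((C / real n * cmod (1 + u) ^ n + C0 / real n * cmod (1 + u) ^ n) / (d * cmod (1 + u) ^ n))"
    proof (intro mult_left_mono frac_le)
      show "cmod (e - (1 + 1 / u) ^ n / u\<^sup>2) \<le> C / real n * cmod (1 + u) ^ n + C0 / real n * cmod (1 + u) ^ n"
        using norm_triangle_ineq4[of e "(1 + 1 / u) ^ n / u\<^sup>2"] eb fb by linarith
      show "d * cmod (1 + u) ^ n \<le> cmod w * cmod (1 + u) ^ n" using wd by (intro mult_right_mono) auto
    qed (use d P0 C C0 in \<open>auto intro!: mult_pos_pos add_nonneg_nonneg mult_nonneg_nonneg\<close>)
    also have "\<dots> = D / real n"
      using P0 d n by (simp add: D_def field_simps)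
    finally show "cmod (of_real ((2 * R) ^ (n + 1)) * poly (p n) z / (of_real (sqrt (real n + 1)) * (z + 2 + sqrt4 z) ^ n)
                     - (z + sqrt4 z) / sqrt4 z) \<le> D / real n"
      unfolding s3 s2 .
  qed
qed

end

section \<open>Asymptotics on the interval\<close>

lemma faber_at_2: "poly (faber n) 2 = 2 ^ n * (of_nat n + 2) / 2"
proof (induction n rule: faber.induct)
  case (3 j)
  have "poly (faber (Suc (Suc j))) 2 = 4 * (poly (faber (Suc j)) 2 - poly (faber j) 2)" by simp
  also have "\<dots> = 4 * (2 ^ Suc j * (of_nat (Suc j) + 2) / 2 - 2 ^ j * (of_nat j + 2) / 2)" by (simp only: 3)
  also have "\<dots> = 2 ^ Suc (Suc j) * (of_nat (Suc (Suc j)) + 2) / 2" by (simp add: field_simps)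
  finally show ?case .
qed auto

lemma faber_cos_aux:
  assumes "sin \<theta> \<noteq> 0"
  shows "poly (faber n) (of_real (2 * cos \<theta>)) = of_real ((2 * cos (\<theta> / 2)) ^ n * sin ((real n + 2) * (\<theta> / 2)) / sin \<theta>)"
proof -
  define t where "t = \<theta> / 2"
  have th: "\<theta> = 2 * t" by (simp add: t_def)
  have s: "sin (2 * t) \<noteq> 0" using assms by (simp add: th)
  have rec: "sin ((real j + 4) * t) = 2 * cos t * sin ((real j + 3) * t) - sin ((real j + 2) * t)" for j
  proof -
    have "sin ((real j + 4) * t) + sin ((real j + 2) * t) = 2 * sin ((real j + 3) * t) * cos t"
      using sin_plus_sin[of "(real j + 4) * t" "(real j + 2) * t"] by (simp add: algebra_simps add_divide_distrib)
    thus ?thesis by (simp add: algebra_simps)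
  qed
  have c: "2 + 2 * cos (2 * t) = (2 * cos t)\<^sup>2" by (simp add: cos_double_cos power2_eq_square)
  have "poly (faber n) (of_real (2 * cos (2 * t))) = of_real ((2 * cos t) ^ n * sin ((real n + 2) * t) / sin (2 * t))"
  proof (induction n rule: faber.induct)
    case 1
    show ?case using s by simp
  next
    case 2
    have "sin (4 * t) = 2 * sin (2 * t) * cos (2 * t)" using sin_double[of "2 * t"] by simp
    hence "2 * cos t * sin (3 * t) = sin (2 * t) * (1 + 2 * cos (2 * t))"
      using rec[of 0] by (simp add: algebra_simps)
    hence "2 * cos t * sin (3 * t) / sin (2 * t) = 1 + 2 * cos (2 * t)" using s by simp
    thus ?case by (simp add: add.commute)
  next
    case (3 j)
    have "poly (faber (Suc (Suc j))) (of_real (2 * cos (2 * t))) =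
      of_real (2 + 2 * cos (2 * t)) * (poly (faber (Suc j)) (of_real (2 * cos (2 * t))) - poly (faber j) (of_real (2 * cos (2 * t))))"
      by (simp add: algebra_simps)
    also have "\<dots> = of_real ((2 * cos t)\<^sup>2 * ((2 * cos t) ^ Suc j * sin ((real (Suc j) + 2) * t) / sin (2 * t) - (2 * cos t) ^ j * sin ((real j + 2) * t) / sin (2 * t)))"
      unfolding 3 c by (simp only: of_real_mult of_real_diff)
    also have "(2 * cos t)\<^sup>2 * ((2 * cos t) ^ Suc j * sin ((real (Suc j) + 2) * t) / sin (2 * t) - (2 * cos t) ^ j * sin ((real j + 2) * t) / sin (2 * t))
       = (2 * cos t) ^ Suc (Suc j) * (2 * cos t * sin ((real j + 3) * t) - sin ((real j + 2) * t)) / sin (2 * t)"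
    proof -
      have e: "real (Suc j) + 2 = real j + 3" by simp
      show ?thesis unfolding e by (simp add: power2_eq_square right_diff_distrib diff_divide_distrib mult_ac del: of_nat_Suc)
    qed
    also have "\<dots> = (2 * cos t) ^ Suc (Suc j) * sin ((real (Suc (Suc j)) + 2) * t) / sin (2 * t)"
    proof -
      have e: "real (Suc (Suc j)) + 2 = real j + 4" by simp
      show ?thesis by (simp only: e rec)
    qed
    finally show ?case .
  qed
  thus ?thesis by (simp only: th) simp
qed

text \<open>
  For \<open>u = e^(i \<theta>)\<close> we have \<open>1 + u = 2 cos (\<theta>/2) e^(i
  \<theta>/2)\<close>, so the two terms are complex conjugates up to a common factor.
\<close>

lemma faber_cos:
  assumes "0 \<le> \<theta>" "\<theta> < pi"
  shows "poly (faber n) (of_real (2 * cos \<theta>)) = of_real (2 * (2 * cos (\<theta> / 2)) ^ n * sine_quotient n \<theta>)"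
proof (cases "\<theta> = 0")
  case True
  thus ?thesis by (simp add: sine_quotient_0 faber_at_2)
next
  case False
  have "sin \<theta> \<noteq> 0" using sin_gt_zero[of \<theta>] assms False by simp
  from faber_cos_aux[OF this, of n] show ?thesis
    using False by (simp add: sine_quotient_def)
qed

context outer_radius
begin

lemma x_mu_props: "x_mu m = (R * m)\<^sup>2 - 2" "-1 < x_mu m" "x_mu m < 2" "R * m < 2" "1 < R * m"
proof -
  have e: "R * m = 1 + m\<^sup>2" using m_quadratic by simp
  thus "x_mu m = (R * m)\<^sup>2 - 2" by (simp add: x_mu_def)
  show b: "R * m < 2" "1 < R * m" using e m2 by auto
  have "1\<^sup>2 < (R * m)\<^sup>2" "(R * m)\<^sup>2 < 2\<^sup>2" using b by (intro power_strict_mono; simp)+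
  thus "-1 < x_mu m" "x_mu m < 2" unfolding \<open>x_mu m = (R * m)\<^sup>2 - 2\<close> by simp_all
qed

definition poly_err :: "(nat \<Rightarrow> complex poly) \<Rightarrow> nat \<Rightarrow> complex \<Rightarrow> complex" where
  "poly_err p n z = of_real (norming n) * poly (p n) z - poly (faber n) z"

lemma poly_err_jouk:
  "u \<noteq> 0 \<Longrightarrow> poly_err p n (jouk u) * (1 - 1 / u\<^sup>2) =
     of_real (norming n) * (poly (p n) (jouk u) * (1 - 1 / u\<^sup>2)) - ((1 + u) ^ n - (1 + 1 / u) ^ n / u\<^sup>2)"
  unfolding poly_err_def faber_jouk[symmetric] by (simp add: left_diff_distrib mult.assoc)

lemma arccos_coordinate:
  fixes x :: real
  assumes x: "x_mu m \<le> x" "x \<le> 2"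
  defines "\<theta> \<equiv> arccos (x / 2)"
  shows "0 \<le> \<theta>" "\<theta> < pi" "2 * cos \<theta> = x" "jouk (cis \<theta>) = of_real x"
    "cmod (1 + cis \<theta>) = sqrt (2 + x)" "cmod (1 + 1 / cis \<theta>) = sqrt (2 + x)" "2 * cos (\<theta> / 2) = sqrt (2 + x)"
    "cmod (1 - 1 / (cis \<theta>)\<^sup>2) = 2 * sqrt (1 - x\<^sup>2 / 4)" "(cmod (cis \<theta> - 1))\<^sup>2 = 2 - x"
    "R * m \<le> sqrt (2 + x)" "sqrt (2 + x) \<le> R"
proof -
  have b: "-1 \<le> x / 2" "x / 2 \<le> 1" "-1 < x / 2" using x x_mu_props(2) by auto
  show t: "0 \<le> \<theta>" unfolding \<theta>_def using b by (intro arccos_lbound)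
  have c: "cos \<theta> = x / 2" unfolding \<theta>_def using b by (intro cos_arccos)
  show t2: "\<theta> < pi" using arccos_ubound[OF b(1,2)] c b unfolding \<theta>_def[symmetric]
    by (metis cos_pi less_eq_real_def less_irrefl)
  show "2 * cos \<theta> = x" using c by simp
  have s: "sin \<theta> = sqrt (1 - x\<^sup>2 / 4)"
    unfolding \<theta>_def using sin_arccos[OF b(1,2)] by (simp add: power_divide)
  show "jouk (cis \<theta>) = of_real x" using c by (simp add: jouk_def complex_eq_iff)
  have h: "2 * cos (\<theta> / 2) = sqrt (2 + x)"
  proof (rule real_sqrt_unique[symmetric])
    have "cos \<theta> = 2 * (cos (\<theta> / 2))\<^sup>2 - 1" using cos_double_cos[of "\<theta> / 2"] by simp
    thus "(2 * cos (\<theta> / 2))\<^sup>2 = 2 + x" using c by (simp add: power_mult_distrib)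
    show "0 \<le> 2 * cos (\<theta> / 2)" using t t2 cos_gt_zero_pi[of "\<theta> / 2"] by simp
  qed
  thus "2 * cos (\<theta> / 2) = sqrt (2 + x)" .
  have sc: "(sin \<theta>)\<^sup>2 + (cos \<theta>)\<^sup>2 = 1" by simp
  have "(cmod (1 + cis \<theta>))\<^sup>2 = 2 + x"
    unfolding cmod_power2 using sc c by (simp add: power2_eq_square algebra_simps)
  thus n1: "cmod (1 + cis \<theta>) = sqrt (2 + x)" by (metis norm_ge_zero real_sqrt_unique)
  have "1 / cis \<theta> = cnj (cis \<theta>)" by (simp add: cis_cnj cis_inverse[symmetric] inverse_eq_divide)
  hence "1 + 1 / cis \<theta> = cnj (1 + cis \<theta>)" by simp
  thus "cmod (1 + 1 / cis \<theta>) = sqrt (2 + x)" using n1 by (simp only: complex_mod_cnj)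
  have "1 - 1 / (cis \<theta>)\<^sup>2 = (cis \<theta> - 1 / cis \<theta>) / cis \<theta>"
    by (simp add: diff_divide_distrib power2_eq_square)
  also have "cis \<theta> - 1 / cis \<theta> = 2 * \<i> * of_real (sin \<theta>)"
    unfolding \<open>1 / cis \<theta> = cnj (cis \<theta>)\<close> by (simp add: complex_eq_iff)
  finally have "cmod (1 - 1 / (cis \<theta>)\<^sup>2) = 2 * \<bar>sin \<theta>\<bar>" by (simp add: norm_divide norm_mult)
  thus "cmod (1 - 1 / (cis \<theta>)\<^sup>2) = 2 * sqrt (1 - x\<^sup>2 / 4)" using s t t2 sin_ge_zero[of \<theta>] by simp
  show "(cmod (cis \<theta> - 1))\<^sup>2 = 2 - x"
    unfolding cmod_power2 using sc c by (simp add: power2_eq_square algebra_simps)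
  have "(R * m)\<^sup>2 \<le> 2 + x" using x x_mu_props(1) by simp
  thus "R * m \<le> sqrt (2 + x)" by (rule real_le_rsqrt)
  have "sqrt (2 + x) \<le> sqrt (2\<^sup>2)" using x by (intro real_sqrt_le_mono) simp
  thus "sqrt (2 + x) \<le> R" using R_gt_2 by simp
qed

text \<open>
  The representation of \<open>p_n (jouk u)\<close> determines the error only after division by
  \<open>1 - 1/u\<^sup>2\<close>, which vanishes at \<open>u = 1\<close>. On the circle \<open>|u
  - 1| = r\<close> this factor is bounded below, and the error as a function of \<open>u\<close>
  is holomorphic inside; so the maximum principle carries the bound over. On the circle \<open>|1
  + u|\<close> and \<open>|1 + 1/u|\<close> may be as large as \<open>(2 + r) / (1 - r)\<close>,
  whereas \<open>|1 + u|\<close> may be as small as \<open>2 - r\<close> inside; for small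
  \<open>r\<close> the \<open>n\<close>-th power of this quotient is outweighed by
  \<open>c^n\<close>.
\<close>

lemma poly_err_near_2:
  assumes orth: "area_orthonormal_polys (G1 R) p"
  obtains \<eta> D c where "0 < \<eta>" "\<eta> < 1" "0 < D" "0 < c" "c < 1"
    "\<And>n x. 2 - \<eta> \<le> x \<Longrightarrow> x_mu m \<le> x \<Longrightarrow> x \<le> 2 \<Longrightarrow> cmod (poly_err p n (of_real x)) \<le> D * c ^ n * sqrt (2 + x) ^ n"
proof -
  define \<delta> where "\<delta> = (2 - R * m) / 2"
  have \<delta>: "0 < \<delta>" "R * m + \<delta> < 2" using x_mu_props(4) by (auto simp: \<delta>_def field_simps)
  show ?thesis
  proof (rule geometric_error[OF orth \<delta>(1)])
    fix C c assume C: "0 < C" "0 < c" "c < 1"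
      and err: "\<And>n u. u \<noteq> 0 \<Longrightarrow> R * m + \<delta> \<le> cmod (1 + u) \<Longrightarrow> cmod (1 + u) \<le> R \<Longrightarrow>
      R * m + \<delta> \<le> cmod (1 + 1 / u) \<Longrightarrow> cmod (1 + 1 / u) \<le> R \<Longrightarrow>
     cmod (of_real (norming n) * (poly (p n) (jouk u) * (1 - 1 / u\<^sup>2)) - ((1 + u) ^ n - (1 + 1 / u) ^ n / u\<^sup>2))
       \<le> C * c ^ n * (cmod (1 + u) ^ n + cmod (1 + 1 / u) ^ n / (cmod u)\<^sup>2)"
    have "((\<lambda>r::real. (2 - r) / (1 + r)) \<longlongrightarrow> (2 - 0) / (1 + 0)) (at_right 0)"
      by (intro tendsto_intros) auto
    hence e1: "\<forall>\<^sub>F r in at_right (0::real). R * m + \<delta> < (2 - r) / (1 + r)"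
      by (rule order_tendstoD(1)) (use \<delta> in simp)
    have "((\<lambda>r::real. (2 + r) / (1 - r)) \<longlongrightarrow> (2 + 0) / (1 - 0)) (at_right 0)"
      by (intro tendsto_intros) auto
    hence e2: "\<forall>\<^sub>F r in at_right (0::real). (2 + r) / (1 - r) < R"
      by (rule order_tendstoD(2)) (use R_gt_2 in simp)
    have "((\<lambda>r::real. c * ((2 + r) / (1 - r)) / (2 - r)) \<longlongrightarrow> c * ((2 + 0) / (1 - 0)) / (2 - 0)) (at_right 0)"
      by (intro tendsto_intros) auto
    hence e3: "\<forall>\<^sub>F r in at_right (0::real). c * ((2 + r) / (1 - r)) / (2 - r) < 1"
      by (rule order_tendstoD(2)) (use C in simp)
    have e4: "\<forall>\<^sub>F r in at_right (0::real). r < 1 / 2" by (rule order_tendstoD(2)[OF tendsto_ident_at]) simp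
    have e5: "\<forall>\<^sub>F r in at_right (0::real). 0 < r" by (simp add: eventually_at_right_less)
    have "\<forall>\<^sub>F r in at_right (0::real). R * m + \<delta> < (2 - r) / (1 + r) \<and> (2 + r) / (1 - r) < R \<and> c * ((2 + r) / (1 - r)) / (2 - r) < 1 \<and> r < 1 / 2 \<and> 0 < r"
      by (intro eventually_conj e1 e2 e3 e4 e5)
    then have "\<exists>r::real. R * m + \<delta> < (2 - r) / (1 + r) \<and> (2 + r) / (1 - r) < R \<and> c * ((2 + r) / (1 - r)) / (2 - r) < 1 \<and> r < 1 / 2 \<and> 0 < r"
      by (rule eventually_happens'[OF trivial_limit_at_right_real])
    then obtain r where r: "R * m + \<delta> < (2 - r) / (1 + r)" "(2 + r) / (1 - r) < R" "c * ((2 + r) / (1 - r)) / (2 - r) < 1" "r < 1 / 2" "0 < r"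
      by blast
    \<comment> \<open>An upper bound for |1 + u| and |1 + 1/u| on the circle |u - 1| = r.\<close>
    define Y where "Y = (2 + r) / (1 - r)"
    have Y: "0 < Y" "2 + r \<le> Y" using r by (auto simp: Y_def field_simps)
    \<comment> \<open>A lower bound for |1 - 1/u^2| on the circle |u - 1| = r.\<close>
    define w0 where "w0 = r * (2 - r) / (1 + r)\<^sup>2"
    have w0: "0 < w0" using r by (simp add: w0_def)
    define D where "D = C * (1 + 1 / (1 - r)\<^sup>2) / w0"
    have D: "0 < D" using C w0 r by (auto simp: D_def intro!: divide_pos_pos mult_pos_pos add_pos_nonneg)
    define c2 where "c2 = c * Y / (2 - r)"
    have c2: "0 < c2" "c2 < 1" using C Y r by (auto simp: c2_def Y_def)
    have near: "cmod (poly_err p n (jouk u)) \<le> D * (c * Y) ^ n" if u: "cmod (u - 1) \<le> r" for n u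
    proof (rule maximum_modulus_frontier[of "\<lambda>u. poly_err p n (jouk u)" "cball 1 r"])
      have nz: "v \<noteq> 0" if "v \<in> cball 1 r" for v :: complex using that r by (auto simp: dist_norm)
      have ho: "(\<lambda>u. poly_err p n (jouk u)) holomorphic_on cball 1 r"
        unfolding poly_err_def jouk_def
        using nz by (intro holomorphic_intros holomorphic_on_compose_gen[unfolded o_def, where t = UNIV]) auto
      show "(\<lambda>u. poly_err p n (jouk u)) holomorphic_on interior (cball 1 r)"
        by (rule holomorphic_on_subset[OF ho interior_subset])
      show "continuous_on (closure (cball 1 r)) (\<lambda>u. poly_err p n (jouk u))"
        using holomorphic_on_imp_continuous_on[OF ho] by simp
      show "u \<in> cball 1 r" using u by (simp add: dist_norm norm_minus_commute)
      fix v :: complex assume "v \<in> frontier (cball 1 r)"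
      hence v: "cmod (v - 1) = r" using r by (simp add: dist_norm norm_minus_commute)
      have v0: "v \<noteq> 0" using v r by auto
      have vn: "1 - r \<le> cmod v" "cmod v \<le> 1 + r"
        using norm_triangle_ineq4[of v "v - 1"] norm_triangle_ineq[of "v - 1" 1] v by auto
      have pn: "2 - r \<le> cmod (1 + v)" "cmod (1 + v) \<le> 2 + r"
        using norm_triangle_ineq4[of "1 + v" "v - 1"] norm_triangle_ineq[of "v - 1" 2] v by (auto simp: add.commute)
      have ip: "cmod (1 + 1 / v) = cmod (1 + v) / cmod v"
      proof -
        have "1 + 1 / v = (1 + v) / v" using v0 by (simp add: field_simps)
        thus ?thesis by (simp add: norm_divide)
      qed
      have i1: "(2 - r) / (1 + r) \<le> cmod (1 + 1 / v)" and i2: "cmod (1 + 1 / v) \<le> Y"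
        unfolding ip Y_def using vn pn r v0 by (intro frac_le; simp)+
      have w: "w0 \<le> cmod (1 - 1 / v\<^sup>2)"
      proof -
        have "1 - 1 / v\<^sup>2 = (v - 1) * (1 + v) / v\<^sup>2" using v0 by (simp add: field_simps power2_eq_square)
        hence "cmod (1 - 1 / v\<^sup>2) = r * cmod (1 + v) / (cmod v)\<^sup>2" by (simp add: norm_mult norm_divide norm_power v)
        moreover have "w0 \<le> r * cmod (1 + v) / (cmod v)\<^sup>2" unfolding w0_def
          using r pn vn v0 by (intro frac_le mult_left_mono power_mono) auto
        ultimately show ?thesis by simp
      qed
      have "cmod (poly_err p n (jouk v)) * w0 \<le> cmod (poly_err p n (jouk v) * (1 - 1 / v\<^sup>2))"
        unfolding norm_mult using w by (intro mult_left_mono) auto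
      also have "\<dots> \<le> C * c ^ n * (cmod (1 + v) ^ n + cmod (1 + 1 / v) ^ n / (cmod v)\<^sup>2)"
        unfolding poly_err_jouk[OF v0]
      proof (rule err[OF v0])
        have "(2 - r) / (1 + r) \<le> 2 - r" using r by (simp add: field_simps)
        thus "R * m + \<delta> \<le> cmod (1 + v)" using r(1) pn by linarith
        show "cmod (1 + v) \<le> R" using pn Y r(2) by (simp add: Y_def)
        show "R * m + \<delta> \<le> cmod (1 + 1 / v)" using i1 r(1) by linarith
        show "cmod (1 + 1 / v) \<le> R" using i2 r(2) by (simp add: Y_def)
      qed
      also have "\<dots> \<le> C * c ^ n * (Y ^ n + Y ^ n / (1 - r)\<^sup>2)"
        using C pn Y i2 vn r by (intro mult_left_mono add_mono power_mono frac_le) auto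
      also have "\<dots> = (C * (1 + 1 / (1 - r)\<^sup>2)) * (c * Y) ^ n" by (simp add: power_mult_distrib algebra_simps)
      also have "C * (1 + 1 / (1 - r)\<^sup>2) = D * w0" using w0 by (simp add: D_def)
      also have "D * w0 * (c * Y) ^ n = D * (c * Y) ^ n * w0" by simp
      finally show "cmod (poly_err p n (jouk v)) \<le> D * (c * Y) ^ n" using w0 by simp
    qed simp
    show ?thesis
    proof (rule that[of "r\<^sup>2" D c2])
      show "0 < r\<^sup>2" "r\<^sup>2 < 1" using r by (auto simp: power_less_one_iff)
      show "0 < D" "0 < c2" "c2 < 1" by fact+
      fix n x assume x: "2 - r\<^sup>2 \<le> x" "x_mu m \<le> x" "x \<le> 2"
      define \<theta> where "\<theta> = arccos (x / 2)"
      note t = arccos_coordinate[OF x(2,3), folded \<theta>_def]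
      have "(cmod (cis \<theta> - 1))\<^sup>2 \<le> r\<^sup>2" using t(9) x(1) by simp
      hence ur: "cmod (cis \<theta> - 1) \<le> r" by (rule power2_le_imp_le) (use r in simp)
      have "2 - r \<le> cmod (1 + cis \<theta>)"
        using norm_triangle_ineq4[of "1 + cis \<theta>" "cis \<theta> - 1"] ur by simp
      hence h: "2 - r \<le> sqrt (2 + x)" unfolding t(5) .
      have "cmod (poly_err p n (of_real x)) \<le> D * (c * Y) ^ n" using near[OF ur, of n] unfolding t(4) .
      also have "(c * Y) ^ n = c2 ^ n * (2 - r) ^ n" using r by (simp add: c2_def power_divide)
      also have "D * (c2 ^ n * (2 - r) ^ n) \<le> D * (c2 ^ n * sqrt (2 + x) ^ n)"
        using D c2 h r by (intro mult_left_mono power_mono) auto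
      finally show "cmod (poly_err p n (of_real x)) \<le> D * c2 ^ n * sqrt (2 + x) ^ n" by simp
    qed
  qed
qed

text \<open>
  With \<open>u = e^(i \<theta>)\<close> the prefactor is a constant times \<open>|1 + u|^n = (2 +
  z)^(n/2)\<close>. At distance at least \<open>\<eta>\<close> from \<open>2\<close> the factor
  \<open>1 - 1/u\<^sup>2\<close> is bounded below and the general error bounds apply; the rest of
  the interval is covered by the bound near \<open>2\<close>.
\<close>

theorem interval_asymptotics:
  assumes orth: "area_orthonormal_polys (G1 R) p"
  shows "\<exists>\<epsilon> :: nat \<Rightarrow> real \<Rightarrow> complex.
            (\<forall>n. \<forall>\<theta>. 0 \<le> \<theta> \<and> \<theta> \<le> arccos (x_mu m / 2) \<longrightarrow>
               poly (p n) (of_real (2 * cos \<theta>)) =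
                 of_real (sqrt (real n + 1) * (2 / R) ^ (n + 1) * cos (\<theta> / 2) ^ n) *
                 (of_real (sine_quotient n \<theta>) + \<epsilon> n (2 * cos \<theta>))) \<and>
            (\<forall>K. compact K \<and> K \<subseteq> {x_mu m<..2} \<longrightarrow>
               (\<exists>C>0. \<exists>c. 0 < c \<and> c < 1 \<and>
                  (\<forall>\<^sub>F n in sequentially. \<forall>x\<in>K. cmod (\<epsilon> n x) \<le> C * c ^ n))) \<and>
            (\<exists>C. \<forall>\<^sub>F n in sequentially. \<forall>x\<in>{x_mu m..2}. cmod (\<epsilon> n x) \<le> C / real n)"
proof -
  define \<epsilon> where "\<epsilon> = (\<lambda>n x. poly_err p n (of_real x) / of_real (2 * sqrt (2 + x) ^ n))"
  have hpos: "0 < sqrt (2 + x)" if "x_mu m \<le> x" for x using x_mu_props(2) that by simp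
  have \<epsilon>_norm: "cmod (\<epsilon> n x) = cmod (poly_err p n (of_real x)) / (2 * sqrt (2 + x) ^ n)" if "x_mu m \<le> x" for n x
    using hpos[OF that] by (simp add: \<epsilon>_def norm_divide norm_mult norm_power)
  have eq: "poly (p n) (of_real (2 * cos \<theta>)) =
                 of_real (sqrt (real n + 1) * (2 / R) ^ (n + 1) * cos (\<theta> / 2) ^ n) *
                 (of_real (sine_quotient n \<theta>) + \<epsilon> n (2 * cos \<theta>))"
    if \<theta>: "0 \<le> \<theta>" "\<theta> \<le> arccos (x_mu m / 2)" for n \<theta>
  proof -
    define x where "x = 2 * cos \<theta>"
    have b: "-1 \<le> x_mu m / 2" "x_mu m / 2 \<le> 1" using x_mu_props(2,3) by auto
    have "\<theta> \<le> pi" using \<theta> arccos_ubound[OF b] by linarith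
    have "cos (arccos (x_mu m / 2)) \<le> cos \<theta>"
      using \<theta> arccos_ubound[OF b] by (intro cos_monotone_0_pi_le) auto
    hence x1: "x_mu m \<le> x" using cos_arccos[OF b] by (simp add: x_def)
    have x2: "x \<le> 2" by (simp add: x_def)
    have t: "arccos (x / 2) = \<theta>" using arccos_cos[OF \<theta>(1) \<open>\<theta> \<le> pi\<close>] by (simp add: x_def)
    note a = arccos_coordinate[OF x1 x2, unfolded t]
    have faber: "poly (faber n) (of_real x) = of_real (2 * sqrt (2 + x) ^ n * sine_quotient n \<theta>)"
      using faber_cos[OF a(1,2), of n] unfolding a(7) by (simp add: x_def)
    have pref: "norming n * (sqrt (real n + 1) * (2 / R) ^ (n + 1) * cos (\<theta> / 2) ^ n) = 2 * sqrt (2 + x) ^ n"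
    proof -
      have "norming n * (sqrt (real n + 1) * (2 / R) ^ (n + 1) * cos (\<theta> / 2) ^ n) = 2 * (2 * cos (\<theta> / 2)) ^ n"
        using R_gt_2 by (simp add: norming_def power_divide power_mult_distrib)
      thus ?thesis unfolding a(7) .
    qed
    define H where "H = 2 * sqrt (2 + x) ^ n"
    have H: "H \<noteq> 0" using hpos[OF x1] by (simp add: H_def)
    have "of_real H * (of_real (sine_quotient n \<theta>) + \<epsilon> n x) = of_real (norming n) * poly (p n) (of_real x)"
    proof -
      have "\<epsilon> n x = poly_err p n (of_real x) / of_real H" by (simp only: \<epsilon>_def H_def)
      hence "of_real H * \<epsilon> n x = poly_err p n (of_real x)" using H by simp
      moreover have "poly (faber n) (of_real x) = of_real H * of_real (sine_quotient n \<theta>)"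
        unfolding faber H_def by simp
      ultimately show ?thesis by (simp add: poly_err_def distrib_left)
    qed
    hence "of_real (norming n) * (of_real (sqrt (real n + 1) * (2 / R) ^ (n + 1) * cos (\<theta> / 2) ^ n) * (of_real (sine_quotient n \<theta>) + \<epsilon> n x))
      = of_real (norming n) * poly (p n) (of_real x)"
      unfolding H_def pref[symmetric] of_real_mult mult.assoc .
    moreover have "complex_of_real (norming n) \<noteq> 0" using norming_pos[of n] by simp
    ultimately have "of_real (sqrt (real n + 1) * (2 / R) ^ (n + 1) * cos (\<theta> / 2) ^ n) * (of_real (sine_quotient n \<theta>) + \<epsilon> n x)
      = poly (p n) (of_real x)" by (rule mult_left_cancel[THEN iffD1, rotated])
    thus ?thesis unfolding x_def by (rule sym)
  qed
  have bd: "cmod (\<epsilon> n x) \<le> B / (2 * s)"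
    if x: "x_mu m \<le> x" "x \<le> 2" and s: "0 < s" "s \<le> 2 * sqrt (1 - x\<^sup>2 / 4)"
      and e: "cmod (poly_err p n (jouk (cis (arccos (x / 2)))) * (1 - 1 / (cis (arccos (x / 2)))\<^sup>2)) \<le> B * sqrt (2 + x) ^ n"
    for n x s B
  proof -
    note a = arccos_coordinate[OF x]
    define h where "h = sqrt (2 + x) ^ n"
    have h: "0 < h" using hpos[OF x(1)] by (simp add: h_def)
    have "cmod (poly_err p n (of_real x)) * s \<le> cmod (poly_err p n (of_real x)) * (2 * sqrt (1 - x\<^sup>2 / 4))"
      using s by (intro mult_left_mono) auto
    also have "\<dots> \<le> B * h" using e unfolding norm_mult a(4) a(8) h_def .
    finally have "cmod (poly_err p n (of_real x)) \<le> B * h / s" using s by (simp add: field_simps)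
    hence "cmod (poly_err p n (of_real x)) / (2 * h) \<le> B * h / s / (2 * h)" using h by (intro divide_right_mono) auto
    also have "B * h / s / (2 * h) = B / (2 * s)" using h s by simp
    finally show ?thesis unfolding \<epsilon>_norm[OF x(1)] h_def .
  qed
  have away: "\<exists>s>0. \<forall>x. x_mu m \<le> x \<and> x \<le> 2 - \<eta> \<longrightarrow> s \<le> 2 * sqrt (1 - x\<^sup>2 / 4)" if \<eta>: "0 < \<eta>" "\<eta> < 1" for \<eta>
  proof (intro exI[of _ "2 * sqrt (1 - (2 - \<eta>)\<^sup>2 / 4)"] conjI allI impI)
    have "(2 - \<eta>)\<^sup>2 < 2\<^sup>2" using \<eta> by (intro power_strict_mono) auto
    thus "0 < 2 * sqrt (1 - (2 - \<eta>)\<^sup>2 / 4)" by simp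
    fix x assume x: "x_mu m \<le> x \<and> x \<le> 2 - \<eta>"
    have "\<bar>x\<bar> \<le> \<bar>2 - \<eta>\<bar>" using x x_mu_props(2) \<eta> by linarith
    hence "x\<^sup>2 \<le> (2 - \<eta>)\<^sup>2" by (simp add: abs_le_square_iff)
    thus "2 * sqrt (1 - (2 - \<eta>)\<^sup>2 / 4) \<le> 2 * sqrt (1 - x\<^sup>2 / 4)" by simp
  qed
  show ?thesis
  proof (rule poly_err_near_2[OF orth])
    fix \<eta> D c0 assume \<eta>: "0 < \<eta>" "\<eta> < 1" and D: "0 < D" and c0: "0 < c0" "c0 < 1"
      and near: "\<And>n x. 2 - \<eta> \<le> x \<Longrightarrow> x_mu m \<le> x \<Longrightarrow> x \<le> 2 \<Longrightarrow> cmod (poly_err p n (of_real x)) \<le> D * c0 ^ n * sqrt (2 + x) ^ n"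
    have near': "cmod (\<epsilon> n x) \<le> D * c0 ^ n" if x: "2 - \<eta> \<le> x" "x_mu m \<le> x" "x \<le> 2" for n x
    proof -
      have h: "0 < sqrt (2 + x) ^ n" using hpos[OF x(2)] by simp
      have "cmod (\<epsilon> n x) \<le> D * c0 ^ n * sqrt (2 + x) ^ n / (2 * sqrt (2 + x) ^ n)"
        unfolding \<epsilon>_norm[OF x(2)] using near[OF x, of n] h by (intro divide_right_mono) auto
      also have "\<dots> = D * c0 ^ n / 2"
      proof -
        have "a * k / (2 * k) = a / 2" if "0 < k" for a k :: real using that by simp
        from this[OF h] show ?thesis .
      qed
      also have "\<dots> \<le> D * c0 ^ n" using D c0 by simp
      finally show ?thesis .
    qed
    obtain s where s: "0 < s" "\<And>x. x_mu m \<le> x \<Longrightarrow> x \<le> 2 - \<eta> \<Longrightarrow> s \<le> 2 * sqrt (1 - x\<^sup>2 / 4)"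
      using away[OF \<eta>] by blast
    have geo: "\<exists>C>0. \<exists>c. 0 < c \<and> c < 1 \<and> (\<forall>\<^sub>F n in sequentially. \<forall>x\<in>K. cmod (\<epsilon> n x) \<le> C * c ^ n)"
      if K: "compact K" "K \<subseteq> {x_mu m<..2}" for K
    proof (cases "K = {}")
      case True
      thus ?thesis by (intro exI[of _ 1] conjI exI[of _ "1/2"]) auto
    next
      case False
      obtain a where a: "a \<in> K" "\<And>x. x \<in> K \<Longrightarrow> a \<le> x"
        using compact_attains_inf[OF K(1) False] by blast
      have a1: "x_mu m < a" using a K by auto
      define \<delta> where "\<delta> = sqrt (2 + a) - R * m"
      have "(R * m)\<^sup>2 < 2 + a" using a1 x_mu_props(1) by simp
      hence \<delta>: "0 < \<delta>" unfolding \<delta>_def using real_less_rsqrt by simp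
      show ?thesis
      proof (rule geometric_error[OF orth \<delta>])
        fix C c assume C: "0 < C" "0 < c" "c < 1"
          and err: "\<And>n u. u \<noteq> 0 \<Longrightarrow> R * m + \<delta> \<le> cmod (1 + u) \<Longrightarrow> cmod (1 + u) \<le> R \<Longrightarrow>
      R * m + \<delta> \<le> cmod (1 + 1 / u) \<Longrightarrow> cmod (1 + 1 / u) \<le> R \<Longrightarrow>
     cmod (of_real (norming n) * (poly (p n) (jouk u) * (1 - 1 / u\<^sup>2)) - ((1 + u) ^ n - (1 + 1 / u) ^ n / u\<^sup>2))
       \<le> C * c ^ n * (cmod (1 + u) ^ n + cmod (1 + 1 / u) ^ n / (cmod u)\<^sup>2)"
        define c1 where "c1 = max c c0"
        have c1: "0 < c1" "c1 < 1" using C c0 by (auto simp: c1_def)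
        define C1 where "C1 = C / s + D"
        have C1: "0 < C1" using C s D by (simp add: C1_def add_pos_pos)
        have all: "cmod (\<epsilon> n x) \<le> C1 * c1 ^ n" if x: "x \<in> K" for n x
        proof -
          have xx: "x_mu m \<le> x" "x \<le> 2" "a \<le> x" using x K a by auto
          show ?thesis
          proof (cases "2 - \<eta> \<le> x")
            case True
            have "cmod (\<epsilon> n x) \<le> D * c0 ^ n" by (rule near'[OF True xx(1,2)])
            also have "\<dots> \<le> C1 * c1 ^ n" unfolding C1_def c1_def
              using C s D c0 by (intro mult_mono power_mono) auto
            finally show ?thesis .
          next
            case False
            note ac = arccos_coordinate[OF xx(1,2)]
            let ?u = "cis (arccos (x / 2))"
            have h: "R * m + \<delta> \<le> sqrt (2 + x)" using xx(3) by (simp add: \<delta>_def)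
            have "cmod (poly_err p n (jouk ?u) * (1 - 1 / ?u\<^sup>2)) \<le> C * c ^ n * (cmod (1 + ?u) ^ n + cmod (1 + 1 / ?u) ^ n / (cmod ?u)\<^sup>2)"
              using err[of ?u n] unfolding ac(5,6) poly_err_jouk[OF cis_neq_zero] using h ac(11) by simp
            also have "\<dots> = (2 * (C * c ^ n)) * sqrt (2 + x) ^ n"
              unfolding ac(5,6) by (simp add: algebra_simps)
            finally have "cmod (\<epsilon> n x) \<le> 2 * (C * c ^ n) / (2 * s)"
              using False by (intro bd[OF xx(1,2) s(1) s(2)[OF xx(1)]]) auto
            also have "\<dots> = C / s * c ^ n" by simp
            also have "\<dots> \<le> C1 * c1 ^ n" unfolding C1_def c1_def
              using C s D by (intro mult_mono power_mono) auto
            finally show ?thesis .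
          qed
        qed
        show ?thesis using C1 c1 all by (intro exI[of _ C1] conjI exI[of _ c1] always_eventually allI ballI) auto
      qed
    qed
    have unif: "\<exists>C. \<forall>\<^sub>F n in sequentially. \<forall>x\<in>{x_mu m..2}. cmod (\<epsilon> n x) \<le> C / real n"
    proof (rule uniform_error[OF orth])
      fix C assume C: "0 < C" and err: "\<And>n u. 0 < n \<Longrightarrow> 1 \<le> cmod u \<Longrightarrow> R * m \<le> cmod (1 + u) \<Longrightarrow> cmod (1 + u) \<le> R \<Longrightarrow>
     cmod (of_real (norming n) * (poly (p n) (jouk u) * (1 - 1 / u\<^sup>2)) - ((1 + u) ^ n - (1 + 1 / u) ^ n / u\<^sup>2))
       \<le> C / real n * cmod (1 + u) ^ n"
      obtain C0 where C0: "0 < C0" and kn: "\<And>n. 0 < n \<Longrightarrow> c0 ^ n \<le> C0 / real n"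
        by (rule geometric_le_reciprocal[OF c0]; rule that; assumption)
      show ?thesis
      proof (intro exI[of _ "C / (2 * s) + D * C0"] eventually_sequentiallyI[of 1] ballI)
        fix n :: nat and x assume "1 \<le> n" and x: "x \<in> {x_mu m..2}"
        hence n: "0 < n" by simp
        have xx: "x_mu m \<le> x" "x \<le> 2" using x by auto
        have split: "C / (2 * s) / real n + D * C0 / real n = (C / (2 * s) + D * C0) / real n"
          by (simp only: add_divide_distrib)
        show "cmod (\<epsilon> n x) \<le> (C / (2 * s) + D * C0) / real n"
        proof (cases "2 - \<eta> \<le> x")
          case True
          have "cmod (\<epsilon> n x) \<le> D * c0 ^ n" by (rule near'[OF True xx])
          also have "\<dots> \<le> D * (C0 / real n)" using kn[OF n] D by (intro mult_left_mono) auto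
          also have "\<dots> \<le> C / (2 * s) / real n + D * C0 / real n" using C s n by simp
          finally show ?thesis unfolding split .
        next
          case False
          note ac = arccos_coordinate[OF xx]
          let ?u = "cis (arccos (x / 2))"
          have "cmod (poly_err p n (jouk ?u) * (1 - 1 / ?u\<^sup>2)) \<le> C / real n * sqrt (2 + x) ^ n"
            using err[OF n, of ?u] unfolding ac(5,6) poly_err_jouk[OF cis_neq_zero] using ac(10,11) by simp
          hence "cmod (\<epsilon> n x) \<le> C / real n / (2 * s)"
            using False by (intro bd[OF xx s(1) s(2)[OF xx(1)]]) auto
          also have "\<dots> \<le> C / (2 * s) / real n + D * C0 / real n" using D C0 n by (simp add: mult.commute)
          finally show ?thesis unfolding split .
        qed
      qed
    qed
    show ?thesis using eq geo unif by blast
  qed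
qed

end

section \<open>Nicely meromorphic functions\<close>

lemma nicely_meromorphic_on_cong_nhds:
  assumes f: "f nicely_meromorphic_on {z}" and eq: "eventually (\<lambda>w. f w = g w) (nhds z)"
  shows "g nicely_meromorphic_on {z}"
proof -
  have ev: "eventually (\<lambda>w. f w = g w) (at z)" using eq by (simp add: eventually_at_filter eventually_mono)
  have fz: "f z = g z" using eq by (rule eventually_nhds_x_imp_x)
  have "g meromorphic_on {z}"
    using f meromorphic_on_cong[of "{z}" f g "{z}"] ev unfolding nicely_meromorphic_on_def by blast
  moreover have "is_pole g z \<longleftrightarrow> is_pole f z"
    using is_pole_cong[OF ev refl] by simp
  moreover have "(g \<midarrow>z\<rightarrow> g z) \<longleftrightarrow> (f \<midarrow>z\<rightarrow> f z)"
    unfolding fz by (rule filterlim_cong[OF refl refl, symmetric]) (rule ev)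
  ultimately show ?thesis using f fz by (simp add: nicely_meromorphic_on_def)
qed

lemma nicely_meromorphic_on_pointwise:
  "f nicely_meromorphic_on A \<longleftrightarrow> (\<forall>z\<in>A. f nicely_meromorphic_on {z})"
  unfolding nicely_meromorphic_on_def meromorphic_on_def by blast

lemma nicely_meromorphic_on_compose_inj:
  assumes f: "f nicely_meromorphic_on {g z}" and g: "g analytic_on {z}"
    and inj: "eventually (\<lambda>w. g w \<noteq> g z) (at z)"
  shows "(\<lambda>w. f (g w)) nicely_meromorphic_on {z}"
proof -
  have lim: "g \<midarrow>z\<rightarrow> g z" using g by (simp add: analytic_at_imp_isCont isContD)
  have "(\<lambda>w. f (g w)) meromorphic_on {z}"
    by (rule meromorphic_on_compose[of f "{g z}" g "{z}"])
      (use f g in \<open>simp_all add: nicely_meromorphic_on_def\<close>)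
  moreover have "is_pole (\<lambda>w. f (g w)) z" if "is_pole f (g z)"
    by (rule is_pole_compose[OF that lim inj])
  moreover have "(\<lambda>w. f (g w)) \<midarrow>z\<rightarrow> f (g z)" if "f \<midarrow>g z\<rightarrow> f (g z)"
    using that filterlim_atI[OF lim inj] by (rule filterlim_compose)
  ultimately show ?thesis using f by (auto simp: nicely_meromorphic_on_def)
qed

lemma at_cnj: "filtermap cnj (at z) = at (cnj z)"
proof -
  have "filterlim cnj (at (cnj z)) (at z)" for z
    by (simp add: filterlim_at tendsto_cnj[OF tendsto_ident_at] eventually_at_filter)
  from this[of z] this[of "cnj z"] show ?thesis
    by (intro filtermap_fun_inverse[of cnj]) (auto simp: o_def)
qed

lemma nicely_meromorphic_on_cnj:
  assumes f: "f nicely_meromorphic_on {cnj z}"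
  shows "(\<lambda>w. cnj (f (cnj w))) nicely_meromorphic_on {z}"
proof -
  let ?g = "\<lambda>w. cnj (f (cnj w))"
  have iso: "isolated_singularity_at f (cnj z)" and ness: "not_essential f (cnj z)"
    using f by (auto simp: nicely_meromorphic_on_def meromorphic_at_iff)
  obtain r where r: "r > 0" "f analytic_on ball (cnj z) r - {cnj z}"
    using iso by (auto simp: isolated_singularity_at_def)
  have "?g analytic_on ball z r - {z}"
  proof -
    have "f holomorphic_on cnj ` (ball z r - {z})"
    proof (rule holomorphic_on_subset[OF analytic_imp_holomorphic[OF r(2)]])
      show "cnj ` (ball z r - {z}) \<subseteq> ball (cnj z) r - {cnj z}"
        by (auto simp: dist_norm simp flip: complex_cnj_diff)
    qed
    hence "(cnj \<circ> f \<circ> cnj) holomorphic_on (ball z r - {z})"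
      by (intro holomorphic_on_compose_cnj_cnj) (auto intro: open_delete)
    thus ?thesis by (subst analytic_on_open) (auto simp: o_def intro: open_delete)
  qed
  hence "isolated_singularity_at ?g z"
    using r(1) by (auto simp: isolated_singularity_at_def)
  moreover have pole: "is_pole ?g z" if "is_pole f (cnj z)"
  proof -
    have "is_pole (\<lambda>w. f (cnj w)) z" using that is_pole_compose_iff[OF at_cnj, of f z] by (simp add: o_def)
    thus ?thesis unfolding is_pole_def by (simp add: filterlim_at_infinity_conv_norm_at_top)
  qed
  moreover have lim: "?g \<midarrow>z\<rightarrow> cnj c" if "f \<midarrow>cnj z\<rightarrow> c" for c
  proof -
    have "((\<lambda>w. f (cnj w)) \<longlongrightarrow> c) (at z)" 
      using that unfolding at_cnj[symmetric] by (simp add: filterlim_filtermap)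
    thus ?thesis by (rule tendsto_cnj)
  qed
  moreover have "not_essential ?g z"
    using ness pole lim unfolding not_essential_def by blast
  ultimately show ?thesis using f by (auto simp: nicely_meromorphic_on_def meromorphic_at_iff)
qed

text \<open>
  The identity theorem for equality everywhere, poles included: the difference has only removable
  singularities and vanishes, so both functions have the same limits and the same poles, and
  niceness fixes the values.
\<close>

lemma nicely_meromorphic_identity:
  assumes f: "f nicely_meromorphic_on A" and g: "g nicely_meromorphic_on A"
    and A: "open A" "connected A" and z: "z \<in> A" "frequently (\<lambda>w. f w = g w) (at z)" and w: "w \<in> A"
  shows "f w = g w"
proof -
  let ?d = "\<lambda>v. f v - g v"
  have mf: "f meromorphic_on A" and mg: "g meromorphic_on A" using f g by (auto simp: nicely_meromorphic_on_def)
  hence md: "?d meromorphic_on A" by (intro meromorphic_intros)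
  have ev: "eventually (\<lambda>v. remove_sings ?d v = ?d v) (at v)" if "v \<in> A" for v
  proof (rule eventually_remove_sings_eq_at)
    have "?d meromorphic_on {v}" using md that by (auto intro: meromorphic_on_subset)
    thus "isolated_singularity_at ?d v" by (simp add: meromorphic_at_iff)
  qed
  have "frequently (\<lambda>v. remove_sings ?d v = 0) (at z)"
    by (rule frequently_rev_mp[OF z(2) eventually_mono[OF ev[OF z(1)]]]) simp
  hence zero: "remove_sings ?d v = 0" if "v \<in> A" for v
    using frequently_eq_meromorphic_imp_constant[OF _ remove_sings_nicely_meromorphic[OF md] A z(1), of 0 v] that by simp
  have "eventually (\<lambda>v. v \<in> A) (at w)" using A(1) w by (rule eventually_at_in_open')
  hence eq: "eventually (\<lambda>v. f v = g v) (at w)"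
    using ev[OF w] by eventually_elim (simp add: zero)
  have fw: "is_pole f w \<and> f w = 0 \<or> f \<midarrow>w\<rightarrow> f w" and gw: "is_pole g w \<and> g w = 0 \<or> g \<midarrow>w\<rightarrow> g w"
    using f g w by (auto simp: nicely_meromorphic_on_def)
  have pole: "is_pole f w \<longleftrightarrow> is_pole g w" by (rule is_pole_cong[OF eq refl])
  show ?thesis
  proof (cases "is_pole f w")
    case True
    hence "\<not> f \<midarrow>w\<rightarrow> f w" "\<not> g \<midarrow>w\<rightarrow> g w"
      using pole not_tendsto_and_filterlim_at_infinity[OF at_neq_bot] unfolding is_pole_def by blast+
    thus ?thesis using fw gw by simp
  next
    case False
    hence lf: "f \<midarrow>w\<rightarrow> f w" and lg: "g \<midarrow>w\<rightarrow> g w" using fw gw pole by auto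
    have "f \<midarrow>w\<rightarrow> g w"
      using lg filterlim_cong[OF refl refl eq, of "nhds (g w)"] by simp
    with lf show ?thesis by (rule LIM_unique)
  qed
qed

lemma connected_annulus:
  assumes "0 \<le> r"
  shows "connected {w::complex. r < cmod w \<and> cmod w < s}"
proof -
  have "connected ((\<lambda>(x, t). of_real x * cis t) ` ({r<..<s} \<times> (UNIV :: real set)))"
    by (intro connected_continuous_image connected_Times)
      (auto simp: case_prod_unfold intro!: continuous_intros)
  also have "(\<lambda>(x, t). of_real x * cis t) ` ({r<..<s} \<times> (UNIV :: real set)) = {w::complex. r < cmod w \<and> cmod w < s}"
  proof (intro equalityI subsetI)
    fix w :: complex assume w: "w \<in> {w. r < cmod w \<and> cmod w < s}"
    have "w = of_real (cmod w) * cis (Arg w)"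
      using rcis_cmod_Arg[of w] by (simp add: rcis_def)
    thus "w \<in> (\<lambda>(x, t). of_real x * cis t) ` ({r<..<s} \<times> UNIV)"
      using w by (intro image_eqI[of _ _ "(cmod w, Arg w)"]) auto
  qed (use assms in \<open>auto simp: norm_mult\<close>)
  finally show ?thesis .
qed

lemma open_annulus: "open {w::complex. r < cmod w \<and> cmod w < s}"
  by (intro open_Collect_conj open_Collect_less continuous_intros)

section \<open>Continuing the conformal map by reflection\<close>

context outer_radius begin

text \<open>
  The map \<open>\<sigma>\<close>. The two preimages under \<open>psi R\<close> of the same point,
  \<open>w\<close> and \<open>w / (R w - 1)\<close>, are swapped by \<open>u \<mapsto>
  1/u\<close>; the complex conjugate of \<open>\<sigma> w\<close> is the reflection of the second
  one in the unit circle. The fixed points are \<open>m\<close> and \<open>1/m\<close>.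
\<close>

definition swap_reflect :: "complex \<Rightarrow> complex" where "swap_reflect w = of_real R - inverse w"

lemma swap_reflect_norm_ge: "R - 1 / cmod w \<le> cmod (swap_reflect w)"
  using norm_triangle_ineq2[of "of_real R" "inverse w"] R_gt_2
  by (simp add: swap_reflect_def norm_divide inverse_eq_divide)

lemma swap_reflect_norm_gt:
  assumes r: "0 < r" "r < cmod w"
  shows "R - 1 / r < cmod (swap_reflect w)"
proof -
  have "0 < cmod w * r" using r by (intro mult_pos_pos) linarith+
  hence "1 / cmod w < 1 / r" using r by (intro divide_strict_left_mono) auto
  thus ?thesis using swap_reflect_norm_ge[of w] by linarith
qed

lemma two_over_R: "0 < 2 / R" "2 / R < 1" "1 < R / 2" "R - 1 / (2 / R) = R / 2" "m < 2 / R"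
proof -
  have "m * R < 2" using m_quadratic m2 by (simp add: mult.commute)
  thus "m < 2 / R" using R_gt_2 by (simp add: field_simps)
qed (use R_gt_2 in \<open>auto simp: field_simps\<close>)

lemma swap_reflect_far: "2 / R < cmod w \<Longrightarrow> R / 2 < cmod (swap_reflect w)"
  using swap_reflect_norm_gt[of "2 / R" w] two_over_R by simp

lemma psi_jouk: "psi R w = jouk (of_real R * w - 1)"
  by (simp add: psi_def jouk_def inverse_eq_divide)

lemma swap_reflect_alt: "w \<noteq> 0 \<Longrightarrow> w * swap_reflect w = of_real R * w - 1"
  by (simp add: swap_reflect_def algebra_simps)

lemma psi_swap_reflect:
  assumes "w \<noteq> 0" "swap_reflect w \<noteq> 0"
  shows "psi R (inverse (swap_reflect w)) = psi R w"
proof -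
  have nz: "of_real R * w - 1 \<noteq> 0" using assms by (simp flip: swap_reflect_alt)
  have "of_real R * inverse (swap_reflect w) - 1 = (of_real R * w - w * swap_reflect w) * inverse (w * swap_reflect w)"
    using assms by (simp add: field_simps)
  also have "of_real R * w - w * swap_reflect w = 1" using assms by (simp add: swap_reflect_alt)
  finally have "of_real R * inverse (swap_reflect w) - 1 = inverse (of_real R * w - 1)"
    using assms by (simp add: swap_reflect_alt)
  thus ?thesis by (simp add: psi_jouk)
qed

text \<open>
  One of the two preimages \<open>w\<close> and \<open>1 / \<sigma> w\<close> has \<open>|R w - 1|
  \<ge> 1\<close>, and both are inside the unit disc. So \<open>\<phi> (psi R w)\<close> is
  defined on a region that reaches further inwards than \<open>|w| > 2/R\<close>.
\<close>

lemma psi_in_G1: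
  assumes w: "w \<noteq> 0" "cmod w < 1" "1 < cmod (swap_reflect w)"
  shows "psi R w \<in> G1 R"
proof -
  have *: "psi R v \<in> G1 R" if "cmod v < 1" "1 \<le> cmod (of_real R * v - 1)" for v
  proof -
    have "cmod (of_real R * v - 1 + 1) < R" using that R_gt_2 by (simp add: norm_mult)
    thus ?thesis unfolding G1_eq[OF R_gt_2] psi_jouk using that by blast
  qed
  have snz: "swap_reflect w \<noteq> 0" using w(3) by auto
  show ?thesis
  proof (cases "1 \<le> cmod (of_real R * w - 1)")
    case False
    have "of_real R * inverse (swap_reflect w) - 1 = inverse (of_real R * w - 1)"
    proof -
      have "of_real R * inverse (swap_reflect w) - 1 = (of_real R * w - w * swap_reflect w) * inverse (w * swap_reflect w)"
        using w(1) snz by (simp add: field_simps)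
      thus ?thesis using w(1) by (simp add: swap_reflect_alt)
    qed
    moreover have "of_real R * w - 1 \<noteq> 0" using w(1) snz by (simp flip: swap_reflect_alt)
    ultimately have "1 \<le> cmod (of_real R * inverse (swap_reflect w) - 1)"
      using False by (simp add: norm_inverse one_le_inverse_iff)
    moreover have "cmod (inverse (swap_reflect w)) < 1" using w(3) by (simp add: norm_inverse inverse_less_1_iff)
    ultimately have "psi R (inverse (swap_reflect w)) \<in> G1 R" by (intro *)
    thus ?thesis using psi_swap_reflect[OF w(1) snz] by simp
  qed (use * w in auto)
qed

lemma psi_holomorphic: "psi R holomorphic_on {w. w \<noteq> 0 \<and> swap_reflect w \<noteq> 0}"
proof -
  have "of_real R * w - 1 \<noteq> 0" if "w \<noteq> 0" "swap_reflect w \<noteq> 0" for w using that by (simp flip: swap_reflect_alt)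
  thus ?thesis unfolding psi_def by (intro holomorphic_intros) auto
qed

text \<open>
  The map \<open>w \<mapsto> cnj (\<sigma> w)\<close> is a local homeomorphism, so it transports
  properties of punctured neighbourhoods.
\<close>

lemma eventually_at_flip:
  assumes ev: "eventually P (at w)" and w: "w \<noteq> 0"
  shows "eventually (\<lambda>v. P (inverse (of_real R - cnj v))) (at (cnj (swap_reflect w)))"
proof -
  let ?t = "\<lambda>v. inverse (of_real R - cnj v)"
  have t: "?t (cnj (swap_reflect w)) = w" by (simp add: swap_reflect_def)
  have nz: "of_real R - cnj (cnj (swap_reflect w)) \<noteq> 0" using w by (simp add: swap_reflect_def)
  have "(?t \<longlongrightarrow> ?t (cnj (swap_reflect w))) (at (cnj (swap_reflect w)))"
    by (intro tendsto_intros nz)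
  moreover have "?t v \<noteq> w" if "v \<noteq> cnj (swap_reflect w)" for v
  proof
    assume "?t v = w"
    hence "cnj (swap_reflect w) = v" by (auto simp: swap_reflect_def)
    thus False using that by simp
  qed
  hence "eventually (\<lambda>v. ?t v \<noteq> w) (at (cnj (swap_reflect w)))"
    unfolding eventually_at_filter by (intro always_eventually) blast
  ultimately have "filterlim ?t (at w) (at (cnj (swap_reflect w)))"
    unfolding t by (rule filterlim_atI)
  thus ?thesis using ev by (simp add: filterlim_iff)
qed

lemma open_swap_reflect: "open {w. w \<noteq> 0 \<and> c < cmod (swap_reflect w)}" "open {w. w \<noteq> 0 \<and> cmod (swap_reflect w) < c}"
proof -
  have c: "continuous_on (- {0}) (\<lambda>w. cmod (swap_reflect w))"
    unfolding swap_reflect_def by (intro continuous_intros) auto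
  have *: "open ((\<lambda>w. cmod (swap_reflect w)) -` B \<inter> - {0})" if "open B" for B
    by (subst Int_commute) (rule continuous_open_preimage[OF c _ that], auto)
  have "{w. w \<noteq> 0 \<and> c < cmod (swap_reflect w)} = (\<lambda>w. cmod (swap_reflect w)) -` {c<..} \<inter> - {0}" by auto
  thus "open {w. w \<noteq> 0 \<and> c < cmod (swap_reflect w)}" using *[of "{c<..}"] by simp
  have "{w. w \<noteq> 0 \<and> cmod (swap_reflect w) < c} = (\<lambda>w. cmod (swap_reflect w)) -` {..<c} \<inter> - {0}" by auto
  thus "open {w. w \<noteq> 0 \<and> cmod (swap_reflect w) < c}" using *[of "{..<c}"] by simp
qed

end

lemma frequently_unit_circle_at_1: "frequently (\<lambda>w. cmod w = 1) (at 1)"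
proof -
  define X where "X = (\<lambda>n. cis (1 / real (Suc n)))"
  have "(\<lambda>n. 1 / real (Suc n)) \<longlonglongrightarrow> 0" using LIMSEQ_inverse_real_of_nat by (simp add: inverse_eq_divide)
  hence "X \<longlonglongrightarrow> cis 0" unfolding X_def by (intro tendsto_intros)
  moreover have "X n \<noteq> 1" for n
  proof
    assume "X n = 1"
    hence "sin (1 / real (Suc n)) = 0" by (auto simp: X_def complex_eq_iff)
    moreover have "1 / real (Suc n) \<le> 1" by simp
    hence "1 / real (Suc n) < pi" using pi_gt3 by linarith
    hence "sin (1 / real (Suc n)) > 0" by (intro sin_gt_zero) auto
    ultimately show False by simp
  qed
  ultimately have lim: "filterlim X (at 1) sequentially" by (intro filterlim_atI) auto
  show ?thesis unfolding frequently_def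
  proof
    assume "eventually (\<lambda>w. cmod w \<noteq> 1) (at 1)"
    with lim have "eventually (\<lambda>n. cmod (X n) \<noteq> 1) sequentially"
      unfolding filterlim_iff by blast
    thus False by (simp add: X_def)
  qed
qed

locale interior_map = outer_radius +
  fixes \<phi> :: "complex \<Rightarrow> complex"
  assumes conformal: "conformal_onto_disk (G1 R) \<phi>"
begin

lemma phi_hol: "\<phi> holomorphic_on G1 R" and phi_bij: "bij_betw \<phi> (G1 R) (ball 0 1)"
  using conformal by (auto simp: conformal_onto_disk_def)

lemma phi_inj: "z \<in> G1 R \<Longrightarrow> z' \<in> G1 R \<Longrightarrow> \<phi> z = \<phi> z' \<Longrightarrow> z = z'"
  using phi_bij by (auto simp: bij_betw_def inj_on_def)

lemma phi_norm: "z \<in> G1 R \<Longrightarrow> cmod (\<phi> z) < 1"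
  using phi_bij by (auto simp: bij_betw_def)

lemma phi_psi_holomorphic:
  "(\<lambda>w. \<phi> (psi R w)) holomorphic_on {w. w \<noteq> 0 \<and> cmod w < 1 \<and> 1 < cmod (swap_reflect w)}"
proof -
  let ?V = "{w. w \<noteq> 0 \<and> cmod w < 1 \<and> 1 < cmod (swap_reflect w)}"
  have sub: "?V \<subseteq> {w. w \<noteq> 0 \<and> swap_reflect w \<noteq> 0}" by auto
  have "psi R ` ?V \<subseteq> G1 R" using psi_in_G1 by blast
  hence "(\<phi> \<circ> psi R) holomorphic_on ?V"
    by (intro holomorphic_on_compose_gen[OF holomorphic_on_subset[OF psi_holomorphic sub] phi_hol])
  thus ?thesis by (simp add: o_def)
qed

lemma open_V1: "open {w. w \<noteq> 0 \<and> cmod w < 1 \<and> 1 < cmod (swap_reflect w)}"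
proof -
  have "{w. w \<noteq> 0 \<and> cmod w < 1 \<and> 1 < cmod (swap_reflect w)} = {w. w \<noteq> 0 \<and> 1 < cmod (swap_reflect w)} \<inter> ball 0 1"
    by auto
  thus ?thesis using open_swap_reflect(1)[of 1] by (auto intro: open_Int)
qed

lemma inner_psi_in_G1: "2 / R < cmod w \<Longrightarrow> cmod w < 1 \<Longrightarrow> psi R w \<in> G1 R"
proof (rule psi_in_G1)
  assume w: "2 / R < cmod w"
  show "w \<noteq> 0" using less_trans[OF two_over_R(1) w] by auto
  show "1 < cmod (swap_reflect w)" using swap_reflect_far[OF w] two_over_R(3) by linarith
qed

lemma mero_iff:
  "mero_continuation R \<phi> r h \<longleftrightarrow>
     h nicely_meromorphic_on {w. r < cmod w \<and> cmod w < R / 2} \<and>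
     (\<forall>w. 2 / R < cmod w \<and> cmod w < 1 \<longrightarrow> h w = \<phi> (psi R w))"
  by (simp add: mero_continuation_def rho_def)

lemma mero_restrict: "mero_continuation R \<phi> r h \<Longrightarrow> r \<le> s \<Longrightarrow> mero_continuation R \<phi> s h"
  unfolding mero_iff by (auto elim!: nicely_meromorphic_on_subset)

lemma mero_at:
  "mero_continuation R \<phi> r h \<Longrightarrow> r < cmod w \<Longrightarrow> cmod w < R / 2 \<Longrightarrow> h nicely_meromorphic_on {w}"
  unfolding mero_iff by (auto elim!: nicely_meromorphic_on_subset)

lemma mero_agree:
  "mero_continuation R \<phi> r h \<Longrightarrow> 2 / R < cmod w \<Longrightarrow> cmod w < 1 \<Longrightarrow> h w = \<phi> (psi R w)"
  unfolding mero_iff by blast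

lemma mero_norm:
  "mero_continuation R \<phi> r h \<Longrightarrow> 2 / R < cmod w \<Longrightarrow> cmod w < 1 \<Longrightarrow> cmod (h w) < 1"
  using mero_agree phi_norm[OF inner_psi_in_G1] by simp

lemma mero_unique:
  assumes f: "mero_continuation R \<phi> r f" and g: "mero_continuation R \<phi> r g"
    and r: "0 \<le> r" "r \<le> 2 / R" and w: "r < cmod w" "cmod w < R / 2"
  shows "f w = g w"
proof -
  let ?A = "{w. r < cmod w \<and> cmod w < R / 2}"
  define c where "c = complex_of_real ((2 / R + 1) / 2)"
  have c: "2 / R < cmod c" "cmod c < 1"
  proof -
    define q where "q = 2 / R"
    have q: "0 < q" "q < 1" using two_over_R(1,2) by (simp_all only: q_def)
    have "cmod c = (q + 1) / 2" unfolding c_def norm_of_real q_def[symmetric] using q by simp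
    thus "2 / R < cmod c" "cmod c < 1" unfolding q_def[symmetric] using q by simp_all
  qed
  show ?thesis
  proof (rule nicely_meromorphic_identity[of f ?A g])
    show "connected ?A" using r(1) by (rule connected_annulus)
    have "eventually (\<lambda>w. w \<in> {w. 2 / R < cmod w \<and> cmod w < 1}) (at c)"
      using c by (intro eventually_at_in_open' open_annulus) auto
    hence "eventually (\<lambda>w. f w = g w) (at c)"
      by eventually_elim (simp add: mero_agree[OF f] mero_agree[OF g])
    thus "frequently (\<lambda>w. f w = g w) (at c)" by (intro eventually_frequently) auto
    show "c \<in> ?A" using c r two_over_R(3) by simp
  qed (use f g w open_annulus in \<open>auto simp only: mero_iff mem_Collect_eq\<close>)
qed

text \<open>
  A conformal map onto the disc is proper: as \<open>w\<close> tends to the unit circle from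
  inside, \<open>psi R w\<close> tends to the boundary curve. Were \<open>|h| < 1\<close> at a
  limit point, continuity of the inverse of \<open>\<phi>\<close> would place that boundary point
  inside the domain.
\<close>

lemma mero_boundary:
  assumes h: "mero_continuation R \<phi> r h" and r: "r \<le> 2 / R" and w: "cmod w = 1"
  shows "h analytic_on {w}" "cmod (h w) = 1"
proof -
  \<comment> \<open>A radial sequence inside the annulus on which h is given by the conformal map.\<close>
  define v where "v = (\<lambda>n. of_real (1 - (1 - 2 / R) / real (Suc (Suc n))) * w)"
  have vn: "2 / R < cmod (v n)" "cmod (v n) < 1" for n
  proof -
    define d where "d = (1 - 2 / R) / real (Suc (Suc n))"
    have pos: "0 < 1 - 2 / R" using two_over_R(2) by linarith
    have "0 < d" unfolding d_def using pos by (rule divide_pos_pos) simp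
    moreover have "d < (1 - 2 / R) / 1"
      unfolding d_def using pos by (intro divide_strict_left_mono) auto
    ultimately have "0 < d" "d < 1 - 2 / R" by simp_all
    moreover from this have "\<bar>1 - d\<bar> = 1 - d" using two_over_R(1) by linarith
    hence "cmod (v n) = 1 - d"
      unfolding v_def d_def[symmetric] norm_mult norm_of_real w by simp
    ultimately show "2 / R < cmod (v n)" "cmod (v n) < 1" by linarith+
  qed
  have vlim: "v \<longlonglongrightarrow> w"
  proof -
    have "(\<lambda>n. 1 / real (Suc (Suc n))) \<longlonglongrightarrow> 0"
      using LIMSEQ_Suc[OF LIMSEQ_inverse_real_of_nat] by (simp add: inverse_eq_divide)
    hence "(\<lambda>n. of_real (1 - (1 - 2 / R) * (1 / real (Suc (Suc n)))) * w) \<longlonglongrightarrow> of_real (1 - (1 - 2 / R) * 0) * w"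
      by (intro tendsto_intros)
    thus ?thesis by (simp add: v_def)
  qed
  have "v n \<noteq> w" for n using vn(2)[of n] w by auto
  hence vat: "filterlim v (at w) sequentially" using vlim by (intro filterlim_atI) auto
  have hv: "cmod (h (v n)) < 1" for n using mero_norm[OF h vn] .
  have nice: "h nicely_meromorphic_on {w}" 
  proof (rule mero_at[OF h])
    show "r < cmod w" "cmod w < R / 2" unfolding w using r two_over_R(2,3) by linarith+
  qed
  have np: "\<not> is_pole h w"
  proof
    assume "is_pole h w"
    hence "filterlim (\<lambda>n. h (v n)) at_infinity sequentially"
      unfolding is_pole_def using vat by (rule filterlim_compose)
    hence "filterlim (\<lambda>n. cmod (h (v n))) at_top sequentially"
      by (simp add: filterlim_at_infinity_conv_norm_at_top)
    hence "eventually (\<lambda>n. 1 < cmod (h (v n))) sequentially"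
      by (simp add: filterlim_at_top_dense)
    thus False using hv by (metis (lifting) eventually_sequentially linorder_not_less order.asym order_refl)
  qed
  show an: "h analytic_on {w}"
    using nicely_meromorphic_on_imp_analytic_at[OF nice _ np] by simp
  have "isCont h w" using an by (rule analytic_at_imp_isCont)
  hence lim: "(\<lambda>n. h (v n)) \<longlonglongrightarrow> h w" using vlim by (rule isCont_tendsto_compose)
  have "cmod (h w) \<le> 1"
    by (rule LIMSEQ_le_const2[OF tendsto_norm[OF lim]]) (use hv in \<open>auto intro: less_imp_le\<close>)
  moreover have "\<not> cmod (h w) < 1"
  proof
    assume lt: "cmod (h w) < 1"
    obtain g where g: "g holomorphic_on \<phi> ` G1 R" "\<And>z. z \<in> G1 R \<Longrightarrow> g (\<phi> z) = z"
    proof (rule holomorphic_has_inverse[OF phi_hol open_G1 bij_betw_imp_inj_on[OF phi_bij]])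
      fix g assume "g holomorphic_on \<phi> ` G1 R" "\<And>z. z \<in> G1 R \<Longrightarrow> g (\<phi> z) = z"
      thus thesis by (rule that)
    qed
    have im: "\<phi> ` G1 R = ball 0 1" using phi_bij by (simp add: bij_betw_def)
    have "continuous_on (ball 0 1) g" using g(1) unfolding im by (rule holomorphic_on_imp_continuous_on)
    hence "isCont g (h w)" using lt by (simp add: continuous_on_eq_continuous_at)
    hence "(\<lambda>n. g (h (v n))) \<longlonglongrightarrow> g (h w)" using lim by (rule isCont_tendsto_compose)
    moreover have "g (h (v n)) = psi R (v n)" for n
      using mero_agree[OF h vn] g(2)[OF inner_psi_in_G1[OF vn]] by simp
    ultimately have l1: "(\<lambda>n. psi R (v n)) \<longlonglongrightarrow> g (h w)" by simp
    have "cmod (of_real R * w) = R" using w R_gt_2 by (simp add: norm_mult)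
    hence "of_real R * w \<noteq> 1" using R_gt_2 by auto
    hence "of_real R * w - 1 \<noteq> 0" by simp
    hence "(\<lambda>n. psi R (v n)) \<longlonglongrightarrow> psi R w" 
      unfolding psi_def by (intro tendsto_intros vlim)
    with l1 have eq: "g (h w) = psi R w" by (rule LIMSEQ_unique)
    have "h w \<in> \<phi> ` G1 R" using lt unfolding im by simp
    hence "g (h w) \<in> G1 R" using g(2) by auto
    moreover have "psi R w \<in> L1 R"
      unfolding L1_eq psi_jouk using \<open>cmod (of_real R * w) = R\<close> by (intro imageI) simp
    ultimately show False using eq by (auto simp: G1_def inside_def)
  qed
  ultimately show "cmod (h w) = 1" by simp
qed

text \<open>
  By the identity theorem, \<open>h\<close> would otherwise be constant; but \<open>|h| =
  1\<close> on the unit circle and \<open>|h| < 1\<close> inside.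
\<close>

lemma mero_nonconst:
  assumes h: "mero_continuation R \<phi> r h" and r: "0 \<le> r" "r \<le> 2 / R"
    and w: "r < cmod w" "cmod w < R / 2"
  shows "eventually (\<lambda>v. h v \<noteq> c) (at w)"
proof (rule ccontr)
  let ?A = "{w. r < cmod w \<and> cmod w < R / 2}"
  assume "\<not> eventually (\<lambda>v. h v \<noteq> c) (at w)"
  hence freq: "frequently (\<lambda>v. h v = c) (at w)" by (simp add: not_eventually)
  have const: "h v = c" if "v \<in> ?A" for v
  proof (rule frequently_eq_meromorphic_imp_constant[OF freq _ _ _ _ that])
    show "h nicely_meromorphic_on ?A" using h by (simp add: mero_iff)
    show "open ?A" by (rule open_annulus)
    show "connected ?A" using r(1) by (rule connected_annulus)
  qed (use w in simp)
  define q where "q = 2 / R"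
  have q: "0 < q" "q < 1" using two_over_R(1,2) by (simp_all only: q_def)
  define t where "t = complex_of_real ((q + 1) / 2)"
  have ct: "cmod t = (q + 1) / 2" unfolding t_def norm_of_real using q by simp
  hence t: "2 / R < cmod t" "cmod t < 1" unfolding q_def[symmetric] using q by simp_all
  have "t \<in> ?A" "1 \<in> ?A" using t r two_over_R(2,3) by auto
  hence "h t = h 1" using const by metis
  moreover have "cmod (h t) < 1" by (rule mero_norm[OF h t])
  moreover have "cmod (h 1) = 1" using mero_boundary(2)[OF h r(2), of 1] by simp
  ultimately show False by simp
qed

lemma flip_nice:
  assumes "h nicely_meromorphic_on {cnj v}"
  shows "(\<lambda>v. inverse (cnj (h (cnj v)))) nicely_meromorphic_on {v}"
  by (rule nicely_meromorphic_on_inverse[OF nicely_meromorphic_on_cnj[OF assms]])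

text \<open>
  Schwarz reflection: both sides agree on the unit circle.
\<close>

lemma mero_reflect:
  assumes h: "mero_continuation R \<phi> r h" and r: "r \<le> 2 / R" and w: "2 / R < cmod w" "cmod w < R / 2"
  shows "h w = inverse (cnj (h (cnj (inverse w))))"
proof (rule nicely_meromorphic_identity[of h "{w. 2 / R < cmod w \<and> cmod w < R / 2}" _ 1 w])
  let ?A = "{w. 2 / R < cmod w \<and> cmod w < R / 2}"
  show "h nicely_meromorphic_on ?A" using mero_restrict[OF h r] by (simp add: mero_iff)
  show "connected ?A" by (rule connected_annulus) (use two_over_R in auto)
  show "(\<lambda>w. inverse (cnj (h (cnj (inverse w))))) nicely_meromorphic_on ?A"
    unfolding nicely_meromorphic_on_pointwise[of _ ?A]
  proof
    fix z assume z: "z \<in> ?A"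
    hence nz: "z \<noteq> 0" using two_over_R by auto
    have "1 / cmod z < 1 / (2 / R)" "1 / (R / 2) < 1 / cmod z"
      using z two_over_R nz by (intro divide_strict_left_mono; auto)+
    hence "2 / R < cmod (cnj (inverse z))" "cmod (cnj (inverse z)) < R / 2"
      unfolding complex_mod_cnj inverse_eq_divide norm_divide norm_one by simp_all
    hence "h nicely_meromorphic_on {cnj (inverse z)}"
      using mero_at[OF mero_restrict[OF h r]] by simp
    hence "(\<lambda>v. inverse (cnj (h (cnj v)))) nicely_meromorphic_on {inverse z}" by (rule flip_nice)
    moreover have "inverse analytic_on {z}" using nz by (intro analytic_intros) auto
    moreover have "eventually (\<lambda>w. inverse w \<noteq> inverse z) (at z)"
      unfolding eventually_at_filter by (intro always_eventually) auto
    ultimately show "(\<lambda>w. inverse (cnj (h (cnj (inverse w))))) nicely_meromorphic_on {z}"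
      by (rule nicely_meromorphic_on_compose_inj)
  qed
  have "h w = inverse (cnj (h (cnj (inverse w))))" if "cmod w = 1" for w
  proof -
    have "cmod w ^ 2 = 1" using that by simp
    hence "w * cnj w = 1" by (simp add: complex_norm_square[symmetric])
    moreover have "w \<noteq> 0" using that by auto
    ultimately have i: "cnj (inverse w) = w" by (simp add: field_simps)
    have "cmod (h w) ^ 2 = 1" using mero_boundary(2)[OF h r that] by simp
    hence "h w * cnj (h w) = 1" by (simp add: complex_norm_square[symmetric])
    thus ?thesis unfolding i by (metis inverse_unique mult.commute)
  qed
  thus "frequently (\<lambda>w. h w = inverse (cnj (h (cnj (inverse w))))) (at 1)"
    by (intro frequently_elim1[OF frequently_unit_circle_at_1])
  show "1 \<in> ?A" using two_over_R by simp
  show "open ?A" by (rule open_annulus)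
qed (use w in auto)

text \<open>
  The continuation by the functional equation. The domains of the three formulas overlap, and
  there they agree by the reflection principle and by the symmetry of \<open>psi R\<close>.
\<close>

definition continue_inward :: "(complex \<Rightarrow> complex) \<Rightarrow> complex \<Rightarrow> complex" where
  "continue_inward h w = (if 2 / R < cmod w then h w
              else if 1 < cmod (swap_reflect w) then \<phi> (psi R w)
              else inverse (cnj (h (cnj (swap_reflect w)))))"

lemma continue_inward_psi:
  assumes "mero_continuation R \<phi> r h" "cmod w < 1" "1 < cmod (swap_reflect w)"
  shows "continue_inward h w = \<phi> (psi R w)"
  using assms mero_agree by (simp add: continue_inward_def)

text \<open>
  For \<open>|\<sigma> w| > 1\<close> the point \<open>1 / \<sigma> w\<close> has the same image
  as \<open>w\<close> under \<open>psi R\<close>, and Schwarz reflection takes it to \<open>cnj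
  (\<sigma> w)\<close>.
\<close>

lemma continue_inward_flip:
  assumes h: "mero_continuation R \<phi> r h" and r: "r \<le> 2 / R" and w: "w \<noteq> 0" "cmod (swap_reflect w) < R / 2"
  shows "continue_inward h w = inverse (cnj (h (cnj (swap_reflect w))))"
proof -
  have far: "\<not> 2 / R < cmod w" using swap_reflect_far[of w] w by auto
  show ?thesis
  proof (cases "1 < cmod (swap_reflect w)")
    case True
    hence snz: "swap_reflect w \<noteq> 0" by auto
    have "1 / (R / 2) < 1 / cmod (swap_reflect w)"
      using w True R_gt_2 by (intro divide_strict_left_mono mult_pos_pos) linarith+
    hence "2 / R < 1 / cmod (swap_reflect w)" by simp
    moreover have "1 / cmod (swap_reflect w) < 1"
      using True by (simp only: divide_less_eq_1_pos less_trans[OF zero_less_one True])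
    ultimately have b: "2 / R < cmod (inverse (swap_reflect w))" "cmod (inverse (swap_reflect w)) < 1"
      unfolding inverse_eq_divide norm_divide norm_one by blast+
    have "continue_inward h w = \<phi> (psi R (inverse (swap_reflect w)))" using far True psi_swap_reflect[OF w(1) snz] by (simp add: continue_inward_def)
    also have "\<dots> = h (inverse (swap_reflect w))" using mero_agree[OF h b] by simp
    also have "\<dots> = inverse (cnj (h (cnj (swap_reflect w))))"
      using mero_reflect[OF h r b(1)] b(2) two_over_R by simp
    finally show ?thesis .
  qed (use far in \<open>simp add: continue_inward_def\<close>)
qed

text \<open>
  From \<open>|w| > r\<close> follows \<open>|\<sigma> w| > R - 1/r \<ge> r0\<close>, so the old
  continuation is available at \<open>\<sigma> w\<close>.
\<close>

lemma continue_inward_mero: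
  assumes h: "mero_continuation R \<phi> r0 h" and r0: "0 \<le> r0" "r0 \<le> 2 / R" and r: "0 < r" "r0 \<le> R - 1 / r"
  shows "mero_continuation R \<phi> r (continue_inward h)"
  unfolding mero_iff
proof (intro conjI allI impI)
  show "continue_inward h nicely_meromorphic_on {w. r < cmod w \<and> cmod w < R / 2}"
    unfolding nicely_meromorphic_on_pointwise[of _ "{w. r < cmod w \<and> cmod w < R / 2}"]
  proof
    fix w assume "w \<in> {w. r < cmod w \<and> cmod w < R / 2}"
    hence w: "r < cmod w" "cmod w < R / 2" by auto
    hence wnz: "w \<noteq> 0" using r by auto
    \<comment> \<open>In the third case the formula for the last case of the definition holds in a whole neighbourhood, by the overlap lemma.\<close>
    consider "2 / R < cmod w" | "cmod w \<le> 2 / R" "1 < cmod (swap_reflect w)" | "cmod w \<le> 2 / R" "cmod (swap_reflect w) \<le> 1" by linarith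
    thus "continue_inward h nicely_meromorphic_on {w}"
    proof cases
      case 1
      have "eventually (\<lambda>v. v \<in> {v. 2 / R < cmod v \<and> cmod v < R / 2}) (nhds w)"
        using 1 w by (intro eventually_nhds_in_open open_annulus) auto
      hence "eventually (\<lambda>v. h v = continue_inward h v) (nhds w)" by eventually_elim (simp add: continue_inward_def)
      moreover have "h nicely_meromorphic_on {w}" using mero_at[OF h] 1 w r0 by simp
      ultimately show ?thesis by (rule nicely_meromorphic_on_cong_nhds[rotated])
    next
      case 2
      let ?V = "{w. w \<noteq> 0 \<and> cmod w < 1 \<and> 1 < cmod (swap_reflect w)}"
      have wV: "w \<in> ?V" using 2 wnz le_less_trans[OF 2(1) two_over_R(2)] by blast
      have "(\<lambda>w. \<phi> (psi R w)) analytic_on ?V"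
        using phi_psi_holomorphic open_V1 by (simp add: analytic_on_open)
      hence "(\<lambda>w. \<phi> (psi R w)) nicely_meromorphic_on {w}"
        using wV by (intro analytic_on_imp_nicely_meromorphic_on) (auto intro: analytic_on_subset)
      moreover have "eventually (\<lambda>v. v \<in> ?V) (nhds w)"
        using wV by (intro eventually_nhds_in_open open_V1) auto
      hence "eventually (\<lambda>v. \<phi> (psi R v) = continue_inward h v) (nhds w)"
        by eventually_elim (simp add: continue_inward_psi[OF h])
      ultimately show ?thesis by (rule nicely_meromorphic_on_cong_nhds)
    next
      case 3
      have "r0 < cmod (swap_reflect w)" using swap_reflect_norm_gt[OF r(1) w(1)] r(2) by simp
      hence "r0 < cmod (cnj (swap_reflect w))" "cmod (cnj (swap_reflect w)) < R / 2" using 3 two_over_R by simp_all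
      hence "h nicely_meromorphic_on {cnj (swap_reflect w)}" by (rule mero_at[OF h])
      hence "(\<lambda>v. inverse (cnj (h (cnj v)))) nicely_meromorphic_on {swap_reflect w}" by (rule flip_nice)
      moreover have "swap_reflect analytic_on {w}" 
        unfolding swap_reflect_def using wnz by (intro analytic_intros) auto
      moreover have "eventually (\<lambda>v. swap_reflect v \<noteq> swap_reflect w) (at w)"
        unfolding eventually_at_filter by (intro always_eventually) (auto simp: swap_reflect_def)
      ultimately have "(\<lambda>v. inverse (cnj (h (cnj (swap_reflect v))))) nicely_meromorphic_on {w}"
        by (rule nicely_meromorphic_on_compose_inj)
      moreover have "eventually (\<lambda>v. v \<in> {v. v \<noteq> 0 \<and> cmod (swap_reflect v) < R / 2}) (nhds w)"
        using 3 wnz two_over_R by (intro eventually_nhds_in_open open_swap_reflect) auto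
      hence "eventually (\<lambda>v. inverse (cnj (h (cnj (swap_reflect v)))) = continue_inward h v) (nhds w)"
        by eventually_elim (simp add: continue_inward_flip[OF h r0(2)])
      ultimately show ?thesis by (rule nicely_meromorphic_on_cong_nhds)
    qed
  qed
qed (simp add: continue_inward_def mero_agree[OF h])

end

section \<open>The radius of the maximal continuation\<close>

context interior_map begin

text \<open>
  If \<open>\<mu> > m\<close>, one step of the continuation reaches the radius \<open>1 / (R -
  \<mu>)\<close>, which is smaller than \<open>\<mu>\<close> because \<open>\<mu> (R - \<mu>) >
  1\<close> between the roots \<open>m\<close> and \<open>1/m\<close>.
\<close>

lemma maximal_le_m:
  assumes "maximal_mero_continuation R \<phi> \<mu> h"
  shows "\<mu> \<le> m"
proof (rule ccontr)
  assume "\<not> \<mu> \<le> m"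
  hence gt: "m < \<mu>" by simp
  have mu: "0 \<le> \<mu>" "\<mu> \<le> 2 / R" and h: "mero_continuation R \<phi> \<mu> h"
    and least: "\<And>r h'. 0 \<le> r \<Longrightarrow> r \<le> 2 / R \<Longrightarrow> mero_continuation R \<phi> r h' \<Longrightarrow> \<mu> \<le> r"
    using assms by (auto simp: maximal_mero_continuation_def rho_def)
  define r where "r = 1 / (R - \<mu>)"
  have half: "R / 2 \<le> R - \<mu>" using mu(2) two_over_R(2,3) by linarith
  hence pos: "0 < R - \<mu>" using R_gt_2 by linarith
  have "0 < r" using pos by (simp add: r_def)
  moreover have "\<mu> \<le> R - 1 / r" by (simp add: r_def)
  ultimately have "mero_continuation R \<phi> r (continue_inward h)" by (intro continue_inward_mero[OF h mu])
  moreover have "r \<le> 1 / (R / 2)" unfolding r_def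
    using half pos R_gt_2 by (intro divide_left_mono mult_pos_pos) auto
  ultimately have "\<mu> \<le> r" using \<open>0 < r\<close> by (intro least) auto
  hence "\<mu> * (R - \<mu>) \<le> 1" using pos by (simp add: r_def field_simps)
  hence "m * (\<mu> * (R - \<mu>)) \<le> m" using m_pos by simp
  moreover have "m * (\<mu> * (R - \<mu>)) = \<mu> * (m\<^sup>2 + 1) - m * \<mu>\<^sup>2"
    unfolding m_quadratic by (simp add: algebra_simps power2_eq_square)
  ultimately have "(\<mu> - m) * (1 - m * \<mu>) \<le> 0" by (simp add: algebra_simps power2_eq_square)
  moreover have "m * \<mu> < 1 * 1"
    using mu m_pos m_less_1 two_over_R(2) by (intro mult_strict_mono) linarith+
  ultimately show False using gt by (simp add: mult_le_0_iff)
qed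

text \<open>
  For the radius \<open>m\<close>, which satisfies \<open>R - 1/m = m\<close>, the continuation
  step does not change the radius, hence by uniqueness not the function. So \<open>h\<close>
  satisfies both formulas of the definition globally.
\<close>

lemma cont_eq_continue_inward:
  assumes h: "mero_continuation R \<phi> m h" and w: "m < cmod w" "cmod w < R / 2"
  shows "h w = continue_inward h w"
proof (rule mero_unique[OF h _ _ _ w])
  have "R - 1 / m = m" using m_quadratic m_pos by (simp add: field_simps power2_eq_square)
  thus "mero_continuation R \<phi> m (continue_inward h)"
    using m_pos two_over_R(5) by (intro continue_inward_mero[OF h]) auto
qed (use m_pos two_over_R(5) in auto)

lemma cont_psi:
  assumes h: "mero_continuation R \<phi> m h" and w: "m < cmod w" "cmod w < 1" "1 < cmod (swap_reflect w)"
  shows "h w = \<phi> (psi R w)"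
  using cont_eq_continue_inward[OF h w(1)] continue_inward_psi[OF h w(2,3)] w(2) two_over_R(3) by simp

lemma cont_flip:
  assumes h: "mero_continuation R \<phi> m h" and w: "m < cmod w" "cmod (swap_reflect w) < R / 2"
  shows "h w = inverse (cnj (h (cnj (swap_reflect w))))"
proof -
  have "cmod w \<le> 2 / R" using swap_reflect_far[of w] w(2) by linarith
  hence "cmod w < R / 2" using two_over_R(2,3) by linarith
  moreover have "w \<noteq> 0" using w(1) m_pos by auto
  ultimately show ?thesis
    using cont_eq_continue_inward[OF h w(1)] continue_inward_flip[OF h less_imp_le[OF two_over_R(5)] _ w(2)] by simp
qed

text \<open>
  The fixed point \<open>m\<close> is repelling for the moduli as well, uniformly in the argument
  of \<open>w\<close>.
\<close>

lemma swap_reflect_expands: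
  assumes "m < cmod w" "cmod w \<le> 1"
  shows "m < cmod (swap_reflect w)" "(cmod w - m) / m \<le> cmod (swap_reflect w) - m"
proof -
  have p: "0 < cmod w" using assms m_pos by linarith
  have "R - m = 1 / m" using m_quadratic m_pos by (simp add: field_simps power2_eq_square)
  hence "R - 1 / cmod w - m = 1 / m - 1 / cmod w" by linarith
  also have "\<dots> = (cmod w - m) / (m * cmod w)" using m_pos p by (simp add: field_simps)
  finally have "R - 1 / cmod w - m = (cmod w - m) / (m * cmod w)" .
  moreover have "(cmod w - m) / m \<le> (cmod w - m) / (m * cmod w)"
    using assms m_pos p by (intro divide_left_mono) auto
  ultimately show 2: "(cmod w - m) / m \<le> cmod (swap_reflect w) - m" using swap_reflect_norm_ge[of w] by linarith
  have "0 < (cmod w - m) / m" using assms m_pos by simp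
  thus "m < cmod (swap_reflect w)" using 2 by linarith
qed

text \<open>
  The points with \<open>\<sigma> y_(n+1) = y_n\<close> and \<open>y_0 = 1\<close> decrease to
  \<open>m\<close>. Since \<open>|h 1| = 1\<close>, the functional equation gives \<open>h y_n = h
  1\<close> for all \<open>n\<close>, which is impossible for a nonconstant function that is
  meromorphic at \<open>m\<close>.
\<close>

lemma maximal_eq_m:
  assumes max: "maximal_mero_continuation R \<phi> \<mu> h"
  shows "\<mu> = m"
proof (rule antisym[OF maximal_le_m[OF max]], rule ccontr)
  assume "\<not> m \<le> \<mu>"
  hence lt: "\<mu> < m" by simp
  have mu: "0 \<le> \<mu>" "\<mu> \<le> 2 / R" and h: "mero_continuation R \<phi> \<mu> h"
    using max by (auto simp: maximal_mero_continuation_def rho_def)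
  have hm: "mero_continuation R \<phi> m h" using mero_restrict[OF h] lt by simp
  define y where "y = (\<lambda>n. ((\<lambda>t. 1 / (R - t)) ^^ n) 1)"
  have y0: "y 0 = 1" and ySuc: "y (Suc n) = 1 / (R - y n)" for n by (simp_all add: y_def)
  have y: "m < y n \<and> y n \<le> 1 \<and> y n - m \<le> m ^ n * (1 - m)" for n
  proof (induction n)
    case 0
    show ?case using m_less_1 by (simp add: y0)
  next
    case (Suc n)
    have d: "1 < R - y n" using Suc R_gt_2 by linarith
    have eq: "y (Suc n) - m = m * (y n - m) / (R - y n)"
    proof -
      have "m * (y n - m) = 1 - m * (R - y n)" using m_quadratic by (simp add: algebra_simps power2_eq_square)
      thus ?thesis unfolding ySuc using d by (simp add: field_simps)
    qed
    have pos: "0 < m * (y n - m)" using Suc m_pos by simp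
    have "y (Suc n) - m \<le> m * (y n - m) / 1"
      unfolding eq using d pos by (intro divide_left_mono) auto
    also have "\<dots> \<le> m * (m ^ n * (1 - m))" using Suc m_pos by simp
    finally have "y (Suc n) - m \<le> m ^ Suc n * (1 - m)" by simp
    moreover have "0 < y (Suc n) - m" unfolding eq using pos d by simp
    moreover have "y (Suc n) \<le> 1" unfolding ySuc using d by simp
    ultimately show ?case by simp
  qed
  define c where "c = h 1"
  have c1: "cmod c = 1" unfolding c_def using mero_boundary(2)[OF h mu(2), of 1] by simp
  have cc: "inverse (cnj c) = c"
  proof -
    have "cmod c ^ 2 = 1" using c1 by simp
    hence "c * cnj c = 1" by (simp add: complex_norm_square[symmetric])
    thus ?thesis by (metis inverse_unique mult.commute)
  qed
  have hy: "h (of_real (y n)) = c" for n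
  proof (induction n)
    case 0
    show ?case by (simp add: y0 c_def)
  next
    case (Suc n)
    have s: "swap_reflect (of_real (y (Suc n))) = of_real (y n)"
      unfolding swap_reflect_def ySuc by simp
    have "h (of_real (y (Suc n))) = inverse (cnj (h (cnj (of_real (y n)))))"
      unfolding s[symmetric]
    proof (rule cont_flip[OF hm])
      show "m < cmod (complex_of_real (y (Suc n)))" using y[of "Suc n"] m_pos by simp
      show "cmod (swap_reflect (of_real (y (Suc n)))) < R / 2"
        unfolding s using y[of n] m_pos two_over_R(3) by simp
    qed
    thus ?case using Suc cc by simp
  qed
  have lim: "(\<lambda>n. complex_of_real (y n)) \<longlonglongrightarrow> of_real m"
  proof -
    have "(\<lambda>n. m ^ n * (1 - m)) \<longlonglongrightarrow> 0 * (1 - m)"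
      using m_pos m_less_1 by (intro tendsto_intros LIMSEQ_power_zero) auto
    hence "(\<lambda>n. m ^ n * (1 - m)) \<longlonglongrightarrow> 0" by simp
    hence "(\<lambda>n. y n - m) \<longlonglongrightarrow> 0"
      by (rule Lim_null_comparison[rotated]) (use y in \<open>auto intro!: always_eventually simp: abs_of_pos\<close>)
    hence "y \<longlonglongrightarrow> m" by (simp add: LIM_zero_iff)
    thus ?thesis by (rule tendsto_of_real)
  qed
  have "complex_of_real (y n) \<noteq> of_real m" for n
    using y[of n] unfolding of_real_eq_iff by linarith
  hence lim_at: "filterlim (\<lambda>n. complex_of_real (y n)) (at (of_real m)) sequentially"
    using lim by (intro filterlim_atI) auto
  have freq: "frequently (\<lambda>w. h w = c) (at (of_real m))"
    unfolding frequently_def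
  proof
    assume "eventually (\<lambda>w. h w \<noteq> c) (at (of_real m))"
    with lim_at have "eventually (\<lambda>n. h (of_real (y n)) \<noteq> c) sequentially"
      unfolding filterlim_iff by blast
    thus False by (simp add: hy)
  qed
  have "eventually (\<lambda>w. h w \<noteq> c) (at (complex_of_real m))"
    using lt m_pos m_less_1 two_over_R(3) by (intro mero_nonconst[OF h mu]) auto
  thus False using freq by (simp add: frequently_def)
qed

text \<open>
  Two applications of the functional equation preserve the value of \<open>h\<close>. After one
  application \<open>|h|\<close> is large, so the intermediate point cannot lie where \<open>h =
  \<phi> (psi R w)\<close> or on the unit circle, and a second application is possible. Smallness
  of \<open>|h|\<close> is required in a punctured neighbourhood, not only at the point, because
  the value \<open>0\<close> is also the dummy value at a pole.
\<close>

lemma descent_step: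
  assumes h: "mero_continuation R \<phi> m h" and w: "m < cmod w" "cmod w < 1" "cmod (swap_reflect w) \<le> 1"
    and small: "eventually (\<lambda>v. cmod (h v) < 1) (at w)" "cmod (h w) < 1"
  shows "\<exists>w'. m < cmod w' \<and> cmod w' < 1 \<and> (cmod w - m) / m \<le> cmod w' - m \<and>
              h w' = h w \<and> eventually (\<lambda>v. cmod (h v) < 1) (at w')"
proof -
  define w1 where "w1 = cnj (swap_reflect w)"
  define w2 where "w2 = cnj (swap_reflect w1)"
  have wnz: "w \<noteq> 0" using w m_pos by auto
  have ev_swap_reflect: "eventually (\<lambda>v. m < cmod v \<and> cmod (swap_reflect v) < R / 2) (at v0)"
    if "m < cmod v0" "cmod (swap_reflect v0) \<le> 1" for v0
  proof -
    have v0: "v0 \<noteq> 0" using that m_pos by auto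
    have "eventually (\<lambda>v. v \<in> - cball 0 m) (at v0)"
      using that(1) by (intro eventually_at_in_open') auto
    moreover have "eventually (\<lambda>v. v \<in> {v. v \<noteq> 0 \<and> cmod (swap_reflect v) < R / 2}) (at v0)"
      using that(2) two_over_R(3) v0 by (intro eventually_at_in_open' open_swap_reflect) auto
    ultimately show ?thesis by eventually_elim auto
  qed
  have w1: "m < cmod w1" "(cmod w - m) / m \<le> cmod w1 - m" "cmod w1 \<le> 1"
    using swap_reflect_expands[of w] w by (auto simp: w1_def)
  have w1nz: "w1 \<noteq> 0" using w1 m_pos by auto
  have not0: "eventually (\<lambda>v. h v \<noteq> 0) (at w1)"
    by (rule mero_nonconst[OF h less_imp_le[OF m_pos] less_imp_le[OF two_over_R(5)] w1(1)])
      (use w1(3) two_over_R(3) in linarith)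
  have big: "eventually (\<lambda>v. 1 < cmod (h v)) (at w1)"
  proof -
    have "eventually (\<lambda>v. cmod (h v) < 1 \<and> h v = inverse (cnj (h (cnj (swap_reflect v))))) (at w)"
      using small(1) ev_swap_reflect[OF w(1,3)] by eventually_elim (use cont_flip[OF h] in blast)
    from eventually_at_flip[OF this wnz] have
      "eventually (\<lambda>v. cmod (inverse (cnj (h v))) < 1) (at w1)"
      unfolding w1_def[symmetric] by eventually_elim (auto simp: swap_reflect_def)
    with not0 show ?thesis
      by eventually_elim (auto simp: norm_inverse inverse_less_1_iff)
  qed
  \<comment> \<open>At such points h is a value of the conformal map, hence smaller than 1 in modulus.\<close>
  have no_psi: False if fr: "frequently (\<lambda>v. m < cmod v \<and> cmod v < 1 \<and> 1 < cmod (swap_reflect v)) (at w1)"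
  proof -
    have "frequently (\<lambda>v. False) (at w1)"
    proof (rule frequently_rev_mp[OF fr eventually_mono[OF big]])
      fix v assume b: "1 < cmod (h v)"
      show "m < cmod v \<and> cmod v < 1 \<and> 1 < cmod (swap_reflect v) \<longrightarrow> False"
      proof
        assume v: "m < cmod v \<and> cmod v < 1 \<and> 1 < cmod (swap_reflect v)"
        hence "v \<noteq> 0" using m_pos by auto
        hence "cmod (h v) < 1" using cont_psi[OF h] v phi_norm[OF psi_in_G1] by simp
        thus False using b by simp
      qed
    qed
    thus False by simp
  qed
  have lt1: "cmod w1 < 1"
  proof (rule ccontr)
    assume "\<not> cmod w1 < 1"
    hence w1_norm: "cmod w1 = 1" using w1 by simp
    have "frequently (\<lambda>v. 2 / R < cmod v \<and> cmod v < 1) (at w1)"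
      unfolding frequently_at
    proof (intro allI impI)
      fix d :: real assume "0 < d"
      define e where "e = min (d / 2) ((1 - 2 / R) / 2)"
      define q where "q = 2 / R"
      have e: "0 < e" "e < d" "e < 1 - q" "0 < q"
        using \<open>0 < d\<close> two_over_R(1,2) unfolding q_def[symmetric] e_def by (auto simp: min_def)
      define v where "v = of_real (1 - e) * w1"
      have "cmod v = \<bar>1 - e\<bar>" using w1_norm by (simp only: v_def norm_mult norm_of_real) simp
      hence "cmod v = 1 - e" using e by simp
      moreover have "v - w1 = - (of_real e * w1)" by (simp add: v_def algebra_simps)
      hence "dist v w1 = e" using w1_norm e by (simp add: dist_norm norm_mult)
      ultimately show "\<exists>x\<in>UNIV. x \<noteq> w1 \<and> dist x w1 < d \<and> 2 / R < cmod x \<and> cmod x < 1"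
        using e unfolding q_def[symmetric] by (intro bexI[of _ v]) auto
    qed
    hence "frequently (\<lambda>v. m < cmod v \<and> cmod v < 1 \<and> 1 < cmod (swap_reflect v)) (at w1)"
    proof (rule frequently_elim1)
      fix v assume "2 / R < cmod v \<and> cmod v < 1"
      thus "m < cmod v \<and> cmod v < 1 \<and> 1 < cmod (swap_reflect v)" using swap_reflect_far[of v] two_over_R(3,5) by linarith
    qed
    thus False by (rule no_psi)
  qed
  have sg1: "cmod (swap_reflect w1) \<le> 1"
  proof (rule ccontr)
    assume "\<not> cmod (swap_reflect w1) \<le> 1"
    hence s: "1 < cmod (swap_reflect w1)" by simp
    have "eventually (\<lambda>v. v \<in> ball 0 1 - cball 0 m) (at w1)"
      using lt1 w1 by (intro eventually_at_in_open') auto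
    moreover have "eventually (\<lambda>v. v \<in> {v. v \<noteq> 0 \<and> 1 < cmod (swap_reflect v)}) (at w1)"
      using s w1nz by (intro eventually_at_in_open' open_swap_reflect) auto
    ultimately have "eventually (\<lambda>v. m < cmod v \<and> cmod v < 1 \<and> 1 < cmod (swap_reflect v)) (at w1)"
      by eventually_elim auto
    hence "frequently (\<lambda>v. m < cmod v \<and> cmod v < 1 \<and> 1 < cmod (swap_reflect v)) (at w1)"
      by (intro eventually_frequently) auto
    thus False by (rule no_psi)
  qed
  have w2: "m < cmod w2" "cmod w2 \<le> 1" "(cmod w1 - m) / m \<le> cmod w2 - m"
    using swap_reflect_expands[of w1] w1 sg1 by (auto simp: w2_def)
  have small2: "eventually (\<lambda>v. cmod (h v) < 1) (at w2)"
  proof -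
    have "eventually (\<lambda>v. 1 < cmod (h v) \<and> h v = inverse (cnj (h (cnj (swap_reflect v))))) (at w1)"
      using big ev_swap_reflect[OF w1(1) sg1] by eventually_elim (use cont_flip[OF h] in blast)
    from eventually_at_flip[OF this w1nz] have
      "eventually (\<lambda>v. 1 < cmod (inverse (cnj (h v)))) (at w2)"
      unfolding w2_def[symmetric] by eventually_elim (auto simp: swap_reflect_def)
    thus ?thesis
      by eventually_elim (auto simp: norm_inverse one_less_inverse_iff)
  qed
  have "h w = inverse (cnj (h w1))"
    unfolding w1_def by (rule cont_flip[OF h w(1)]) (use w(3) two_over_R(3) in linarith)
  moreover have "h w1 = inverse (cnj (h w2))"
    unfolding w2_def by (rule cont_flip[OF h w1(1)]) (use sg1 two_over_R(3) in linarith)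
  ultimately have hw: "h w2 = h w" by simp
  have "cmod w1 - m \<le> (cmod w1 - m) / m"
    using w1(1) m_pos m_less_1 by (simp add: le_divide_eq)
  hence grow: "(cmod w - m) / m \<le> cmod w2 - m" using w1(2) w2(3) by linarith
  have "cmod w2 < 1"
  proof (rule ccontr)
    assume "\<not> cmod w2 < 1"
    hence "cmod w2 = 1" using w2 by simp
    hence "cmod (h w2) = 1" by (rule mero_boundary(2)[OF h less_imp_le[OF two_over_R(5)]])
    thus False using hw small(2) by simp
  qed
  thus ?thesis using w2 hw grow small2 by blast
qed

end

section \<open>The sets Sigma_0 and Sigma_1\<close>

text \<open>
  The only ambiguity outside the unit disc is \<open>v = cnj u\<close> on the unit circle.
\<close>

lemma jouk_eq_imp_norms:
  assumes "jouk u = jouk v" "1 \<le> cmod u" "1 \<le> cmod v"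
  shows "cmod (u + 1) = cmod (v + 1)"
proof -
  have nz: "u \<noteq> 0" "v \<noteq> 0" using assms by auto
  show ?thesis
  proof (cases "u = v")
    case False
    hence uv: "u * v = 1" using assms(1) jouk_eq_iff[OF nz] by simp
    hence "cmod u * cmod v = 1" by (metis norm_mult norm_one)
    hence "cmod u = 1" using assms(2,3) nz
      by (metis less_eq_real_def mult_cancel_left1 mult_less_cancel_left1 not_one_less_zero linorder_not_le norm_not_less_zero mult_le_cancel_left1 not_less_iff_gr_or_eq zero_less_norm_iff)
    moreover have "u * (v + 1) = u + 1" using uv by (simp add: algebra_simps)
    ultimately show ?thesis by (metis mult_1 norm_mult)
  qed simp
qed

context interior_map begin

text \<open>
  The distance \<open>|w| - m\<close> grows by the factor \<open>1/m\<close> in each step, so the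
  iteration stops after at most \<open>N\<close> steps.
\<close>

lemma descent:
  assumes h: "mero_continuation R \<phi> m h"
  shows "m < cmod w \<Longrightarrow> cmod w < 1 \<Longrightarrow> eventually (\<lambda>v. cmod (h v) < 1) (at w) \<Longrightarrow>
    cmod (h w) < 1 \<Longrightarrow> m ^ N < cmod w - m \<Longrightarrow>
    \<exists>w'. m < cmod w' \<and> cmod w' < 1 \<and> 1 < cmod (swap_reflect w') \<and> h w' = h w \<and> cmod w \<le> cmod w'"
proof (induction N arbitrary: w)
  case 0
  thus ?case using m_pos by simp
next
  case (Suc N)
  show ?case
  proof (cases "1 < cmod (swap_reflect w)")
    case False
    hence "cmod (swap_reflect w) \<le> 1" by simp
    from descent_step[OF h Suc.prems(1,2) this Suc.prems(3,4)] obtain w' where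
      w': "m < cmod w'" "cmod w' < 1" "(cmod w - m) / m \<le> cmod w' - m" "h w' = h w"
        "eventually (\<lambda>v. cmod (h v) < 1) (at w')" by auto
    have "m * m ^ N < cmod w - m" using Suc.prems(5) by simp
    hence "m ^ N < (cmod w - m) / m" using m_pos by (simp add: pos_less_divide_eq mult.commute)
    hence "m ^ N < cmod w' - m" using w'(3) by linarith
    moreover have "cmod (h w') < 1" using Suc.prems(4) w'(4) by simp
    ultimately obtain w'' where w'': "m < cmod w''" "cmod w'' < 1" "1 < cmod (swap_reflect w'')" "h w'' = h w'" "cmod w' \<le> cmod w''"
      using Suc.IH[OF w'(1,2,5)] by blast
    have "cmod w - m \<le> (cmod w - m) / m"
      using Suc.prems(1) m_pos m_less_1 by (simp add: le_divide_eq)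
    hence "cmod w \<le> cmod w''" using w'(3) w''(5) by linarith
    thus ?thesis using w'' w'(4) by (intro exI[of _ w'']) simp
  qed (use Suc.prems in blast)
qed

lemma solution_analytic:
  assumes h: "mero_continuation R \<phi> m h" and w: "w \<in> solutions \<phi> m h z"
  shows "h analytic_on {w}"
proof -
  have "h nicely_meromorphic_on {w}"
    using w two_over_R(3) by (intro mero_at[OF h]) (auto simp: solutions_def)
  thus ?thesis using nicely_meromorphic_on_imp_analytic_at[of h "{w}" w] w by (simp add: solutions_def)
qed

text \<open>
  By the descent there is a solution \<open>w'\<close> of at least the same modulus with
  \<open>psi R w' = jouk u\<close>, hence \<open>w' = (u + 1) / R\<close> or \<open>w' = (1/u + 1)
  / R\<close>; the first one is at least as large.
\<close>

lemma solution_norm_le: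
  assumes h: "mero_continuation R \<phi> m h" and u: "1 \<le> cmod u" "cmod (u + 1) < R"
    and w: "w \<in> solutions \<phi> m h (jouk u)"
  shows "cmod w \<le> cmod (u + 1) / R"
proof -
  have z: "jouk u \<in> G1 R" using u unfolding G1_eq[OF R_gt_2] by blast
  have w1: "m < cmod w" "cmod w < 1" "h w = \<phi> (jouk u)" using w by (auto simp: solutions_def)
  have small: "cmod (h w) < 1" using phi_norm[OF z] w1(3) by simp
  have "isCont h w" using solution_analytic[OF h w] by (rule analytic_at_imp_isCont)
  hence "((\<lambda>v. cmod (h v)) \<longlongrightarrow> cmod (h w)) (at w)" by (intro tendsto_norm) (simp add: isCont_def)
  hence ev: "eventually (\<lambda>v. cmod (h v) < 1) (at w)" using small by (rule order_tendstoD(2))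
  obtain N where N: "m ^ N < cmod w - m"
    using real_arch_pow_inv[of "cmod w - m" m] w1(1) m_less_1 by auto
  obtain w' where w': "m < cmod w'" "cmod w' < 1" "1 < cmod (swap_reflect w')" "h w' = h w" "cmod w \<le> cmod w'"
    using descent[OF h w1(1,2) ev small N] by blast
  have nz: "w' \<noteq> 0" "swap_reflect w' \<noteq> 0" using w' m_pos by auto
  have "\<phi> (psi R w') = \<phi> (jouk u)" using cont_psi[OF h w'(1-3)] w'(4) w1(3) by simp
  hence eq: "jouk (of_real R * w' - 1) = jouk u"
    unfolding psi_jouk[symmetric] by (rule phi_inj[OF psi_in_G1[OF nz(1) w'(2,3)] z])
  have nz': "of_real R * w' - 1 \<noteq> 0" "u \<noteq> 0" using nz u by (auto simp flip: swap_reflect_alt)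
  have Rw: "R * cmod w' \<le> cmod (u + 1)"
  proof (cases "of_real R * w' - 1 = u")
    case True
    hence "u + 1 = of_real R * w'" by (simp add: algebra_simps)
    hence "cmod (u + 1) = R * cmod w'" using R_gt_2 by (simp add: norm_mult)
    thus ?thesis by simp
  next
    case False
    hence "(of_real R * w' - 1) * u = 1" using eq jouk_eq_iff[OF nz'] by simp
    hence "u + 1 = of_real R * w' * u" by (simp add: algebra_simps)
    hence "cmod (u + 1) = R * cmod w' * cmod u" using R_gt_2 by (simp add: norm_mult)
    moreover have "R * cmod w' * 1 \<le> R * cmod w' * cmod u"
      using u R_gt_2 by (intro mult_left_mono) auto
    ultimately show ?thesis by simp
  qed
  have "cmod w' \<le> cmod (u + 1) / R" using Rw R_gt_2 by (simp add: pos_le_divide_eq mult.commute)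
  thus ?thesis using w'(5) by linarith
qed

lemma solution_eventually_psi:
  assumes h: "mero_continuation R \<phi> m h" and w: "m < cmod w" "cmod w < 1" "1 < cmod (swap_reflect w)"
  shows "eventually (\<lambda>v. h v = \<phi> (psi R v)) (nhds w)"
proof -
  have "w \<noteq> 0" using w m_pos by auto
  hence "eventually (\<lambda>v. v \<in> {w. w \<noteq> 0 \<and> cmod w < 1 \<and> 1 < cmod (swap_reflect w)}) (nhds w)"
    using w by (intro eventually_nhds_in_open open_V1) auto
  moreover have "eventually (\<lambda>v. v \<in> - cball 0 m) (nhds w)"
    using w by (intro eventually_nhds_in_open) auto
  ultimately show ?thesis by eventually_elim (use cont_psi[OF h] in auto)
qed

text \<open>
  Stated for \<open>v\<close> so as to cover both preimages \<open>u\<close> and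
  \<open>1/u\<close> when \<open>|u| = 1\<close>.
\<close>

lemma outer_point:
  assumes v: "v \<noteq> 0" "R * m < cmod (v + 1)" "cmod (v + 1) < R" "cmod (v + 1) < R * cmod v"
  defines "w \<equiv> (v + 1) / of_real R"
  shows "m < cmod w" "cmod w < 1" "1 < cmod (swap_reflect w)" "psi R w = jouk v" "cmod w = cmod (v + 1) / R"
proof -
  have R0: "R > 0" using R_gt_2 by simp
  show cw: "cmod w = cmod (v + 1) / R" using R0 by (simp add: w_def norm_divide)
  show m: "m < cmod w" "cmod w < 1" unfolding cw using v R0 by (simp_all add: field_simps)
  have Rw: "of_real R * w - 1 = v" using R0 by (simp add: w_def)
  show "psi R w = jouk v" unfolding psi_jouk Rw ..
  have wnz: "w \<noteq> 0" using m m_pos by auto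
  have "cmod w * cmod (swap_reflect w) = cmod v" using swap_reflect_alt[OF wnz] unfolding Rw by (metis norm_mult)
  moreover have "cmod w * 1 < cmod v" unfolding cw using v R0 by (simp add: field_simps)
  ultimately have "cmod w * 1 < cmod w * cmod (swap_reflect w)" by simp
  thus "1 < cmod (swap_reflect w)" by (rule mult_less_cancel_left_pos[THEN iffD1, rotated]) (use wnz in simp)
qed

lemma outer_solution:
  assumes h: "mero_continuation R \<phi> m h"
    and v: "v \<noteq> 0" "R * m < cmod (v + 1)" "cmod (v + 1) < R" "cmod (v + 1) < R * cmod v"
  shows "(v + 1) / of_real R \<in> solutions \<phi> m h (jouk v)"
proof -
  let ?w = "(v + 1) / of_real R"
  note w = outer_point[OF v]
  have wnz: "?w \<noteq> 0" using w(1) m_pos by auto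
  let ?V = "{w. w \<noteq> 0 \<and> cmod w < 1 \<and> 1 < cmod (swap_reflect w)}"
  have "(\<lambda>v. \<phi> (psi R v)) analytic_on ?V"
    using phi_psi_holomorphic open_V1 by (simp add: analytic_on_open)
  moreover have "?w \<in> ?V" using w(2,3) wnz by (intro CollectI conjI)
  hence "{?w} \<subseteq> ?V" by (simp only: insert_subset empty_subsetI simp_thms)
  ultimately have "(\<lambda>v. \<phi> (psi R v)) analytic_on {?w}" by (rule analytic_on_subset)
  hence "\<not> is_pole (\<lambda>v. \<phi> (psi R v)) ?w" by (rule analytic_at_imp_no_pole)
  moreover have "eventually (\<lambda>v. h v = \<phi> (psi R v)) (at ?w)"
    using solution_eventually_psi[OF h w(1-3)] by (simp add: eventually_at_filter eventually_mono)
  hence "is_pole h ?w \<longleftrightarrow> is_pole (\<lambda>v. \<phi> (psi R v)) ?w" by (rule is_pole_cong) simp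
  moreover have "h ?w = \<phi> (jouk v)" using cont_psi[OF h w(1-3)] w(4) by simp
  ultimately show ?thesis using w by (simp add: solutions_def)
qed

lemma outer_solution_u:
  assumes h: "mero_continuation R \<phi> m h"
    and u: "1 \<le> cmod u" "R * m < cmod (u + 1)" "cmod (u + 1) < R"
  shows "(u + 1) / of_real R \<in> solutions \<phi> m h (jouk u)"
proof -
  have "R * 1 \<le> R * cmod u" using u R_gt_2 by (intro mult_left_mono) auto
  thus ?thesis using u by (intro outer_solution[OF h]) auto
qed

text \<open>
  A largest solution is \<open>(u + 1) / R\<close> if its modulus exceeds \<open>m\<close>;
  otherwise there is none.
\<close>

lemma Sigma_zero_eq:
  assumes h: "mero_continuation R \<phi> m h"
  shows "Sigma_zero R \<phi> m h = jouk ` {u. 1 \<le> cmod u \<and> cmod (u + 1) \<le> R * m}"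
proof (intro equalityI subsetI)
  fix z assume "z \<in> Sigma_zero R \<phi> m h"
  hence z: "z \<in> G1 R" "solutions \<phi> m h z = {}" by (auto simp: Sigma_zero_def Sigma_all_def)
  then obtain u where u: "1 \<le> cmod u" "cmod (u + 1) < R" "z = jouk u"
    unfolding G1_eq[OF R_gt_2] by blast
  have "\<not> R * m < cmod (u + 1)" using outer_solution_u[OF h u(1) _ u(2)] z(2) u(3) by blast
  thus "z \<in> jouk ` {u. 1 \<le> cmod u \<and> cmod (u + 1) \<le> R * m}" using u by auto
next
  fix z assume "z \<in> jouk ` {u. 1 \<le> cmod u \<and> cmod (u + 1) \<le> R * m}"
  then obtain u where u: "1 \<le> cmod u" "cmod (u + 1) \<le> R * m" "z = jouk u" by blast
  have lt: "cmod (u + 1) < R" using u(2) Rm_pos by linarith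
  have "w \<notin> solutions \<phi> m h z" for w
  proof
    assume w: "w \<in> solutions \<phi> m h z"
    have "cmod w \<le> cmod (u + 1) / R" using solution_norm_le[OF h u(1) lt] w u(3) by simp
    also have "\<dots> \<le> R * m / R" using u(2) R_gt_2 by (intro divide_right_mono) auto
    also have "\<dots> = m" using R_gt_2 by simp
    finally show False using w by (simp add: solutions_def)
  qed
  moreover have "z \<in> G1 R" unfolding G1_eq[OF R_gt_2] using u lt by blast
  ultimately show "z \<in> Sigma_zero R \<phi> m h" by (auto simp: Sigma_zero_def Sigma_all_def)
qed

lemma multiplicity_pos:
  assumes h: "mero_continuation R \<phi> m h" and w: "w \<in> solutions \<phi> m h z"
  shows "1 \<le> multiplicity_at h w"
proof -
  have w1: "m < cmod w" "cmod w < R / 2" using w two_over_R(3) by (auto simp: solutions_def)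
  have "eventually (\<lambda>v. h v \<noteq> h w) (at w)"
    by (rule mero_nonconst[OF h less_imp_le[OF m_pos] less_imp_le[OF two_over_R(5)] w1])
  hence "frequently (\<lambda>v. h v - h w \<noteq> 0) (at w)" by (intro eventually_frequently) auto
  moreover have "(\<lambda>v. h v - h w) analytic_on {w}"
    using solution_analytic[OF h w] by (intro analytic_intros)
  ultimately have "zorder (\<lambda>v. h v - h w) w > 0" by (subst zorder_pos_iff') auto
  thus ?thesis by (simp add: multiplicity_at_def)
qed

text \<open>
  At \<open>w = 2/R\<close>, that is \<open>u = 1\<close>, the derivative of \<open>psi R\<close>
  vanishes, because the two preimages coincide.
\<close>

lemma multiplicity_at_double_point:
  assumes h: "mero_continuation R \<phi> m h"
  shows "2 \<le> multiplicity_at h (2 / of_real R)"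
proof -
  let ?w = "2 / complex_of_real R"
  have R0: "R > 0" using R_gt_2 by simp
  have cw: "cmod ?w = 2 / R" using R0 by (simp add: norm_divide)
  have sgw: "swap_reflect ?w = of_real (R / 2)" by (simp add: swap_reflect_def)
  have w: "m < cmod ?w" "cmod ?w < 1" "1 < cmod (swap_reflect ?w)"
  proof -
    show "m < cmod ?w" "cmod ?w < 1" unfolding cw by (rule two_over_R)+
    have "cmod (swap_reflect ?w) = R / 2" unfolding sgw norm_of_real using R0 by simp
    thus "1 < cmod (swap_reflect ?w)" using two_over_R(3) by linarith
  qed
  have wnz: "?w \<noteq> 0" using R0 by simp
  define f where "f = (\<lambda>v. h v - h ?w)"
  have ev: "eventually (\<lambda>v. h v = \<phi> (psi R v)) (nhds ?w)" by (rule solution_eventually_psi[OF h w])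
  let ?V = "{w. w \<noteq> 0 \<and> cmod w < 1 \<and> 1 < cmod (swap_reflect w)}"
  have "(\<lambda>v. \<phi> (psi R v)) analytic_on ?V"
    using phi_psi_holomorphic open_V1 by (simp add: analytic_on_open)
  moreover have "?w \<in> ?V" using w(2,3) wnz by (intro CollectI conjI)
  hence "{?w} \<subseteq> ?V" by (simp only: insert_subset empty_subsetI simp_thms)
  ultimately have "(\<lambda>v. \<phi> (psi R v)) analytic_on {?w}" by (rule analytic_on_subset)
  hence "h analytic_on {?w}" using analytic_at_cong[OF ev refl] by simp
  hence fan: "f analytic_on {?w}" unfolding f_def by (intro analytic_intros)
  then obtain e where e: "e > 0" "f holomorphic_on ball ?w e" by (auto simp: analytic_on_def)
  have dpsi: "(psi R has_field_derivative 0) (at ?w)"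
    unfolding psi_def by (rule derivative_eq_intros refl | use R0 in simp)+
  have inG: "psi R ?w \<in> G1 R" by (rule psi_in_G1[OF wnz w(2,3)])
  have "(\<phi> has_field_derivative deriv \<phi> (psi R ?w)) (at (psi R ?w))"
    by (rule holomorphic_derivI[OF phi_hol open_G1 inG])
  hence "((\<lambda>v. \<phi> (psi R v)) has_field_derivative deriv \<phi> (psi R ?w) * 0) (at ?w)"
    using dpsi by (rule DERIV_chain2)
  hence "(h has_field_derivative 0) (at ?w)"
    using DERIV_cong_ev[OF refl ev refl] by simp
  hence "(f has_field_derivative 0) (at ?w)" unfolding f_def by (auto intro!: derivative_eq_intros)
  hence df: "deriv f ?w = 0" by (rule DERIV_imp_deriv)
  have "eventually (\<lambda>v. h v \<noteq> h ?w) (at ?w)"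
    using w two_over_R(3)
    by (intro mero_nonconst[OF h less_imp_le[OF m_pos] less_imp_le[OF two_over_R(5)]]) linarith+
  moreover have "eventually (\<lambda>v. v \<in> ball ?w e) (at ?w)"
    using e by (intro eventually_at_in_open') auto
  ultimately have "eventually (\<lambda>v. v \<in> ball ?w e \<and> f v \<noteq> 0) (at ?w)"
    by eventually_elim (simp add: f_def)
  then obtain v where v: "v \<in> ball ?w e" "f v \<noteq> 0"
    using eventually_happens'[OF at_neq_bot] by blast
  have "(deriv ^^ k) f ?w = 0" if "k < 2" for k
    using that df by (auto simp: less_2_cases_iff f_def)
  hence "zorder f ?w \<ge> int 2"
    by (intro zorder_geI[OF fan e(2) _ _ _ v]) (use e in auto)
  thus ?thesis by (simp add: multiplicity_at_def f_def)
qed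

text \<open>
  For \<open>|u| = 1\<close> both \<open>(u + 1) / R\<close> and \<open>(1/u + 1) / R\<close> are
  solutions of largest modulus; they are distinct or, for \<open>u = 1\<close>, a double solution.
  Either way the multiplicities add up to at least two.
\<close>

lemma Sigma_one_subset:
  assumes h: "mero_continuation R \<phi> m h" and z: "z \<in> Sigma_level R \<phi> m h 1"
  shows "\<exists>u. z = jouk u \<and> 1 < cmod u \<and> R * m < cmod (u + 1) \<and> cmod (u + 1) < R"
proof -
  have zG: "z \<in> G1 R" "solutions \<phi> m h z \<noteq> {}"
    and total: "(\<Sum>w\<in>top_solutions \<phi> m h z. multiplicity_at h w) = 1"
    using z by (auto simp: Sigma_level_def Sigma_all_def)
  then obtain u where u: "1 \<le> cmod u" "cmod (u + 1) < R" "z = jouk u"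
    unfolding G1_eq[OF R_gt_2] by blast
  have big: "R * m < cmod (u + 1)"
  proof (rule ccontr)
    assume "\<not> R * m < cmod (u + 1)"
    hence "z \<in> Sigma_zero R \<phi> m h" unfolding Sigma_zero_eq[OF h] using u by auto
    thus False using zG by (simp add: Sigma_zero_def Sigma_all_def)
  qed
  have top: "w \<in> top_solutions \<phi> m h z" if "w \<in> solutions \<phi> m h z" "cmod w = cmod (u + 1) / R" for w
    using that solution_norm_le[OF h u(1,2)] u(3) by (auto simp: top_solutions_def)
  have fin: "finite (top_solutions \<phi> m h z)"
    by (rule ccontr) (use total in simp)
  have mult: "1 \<le> multiplicity_at h w" if "w \<in> top_solutions \<phi> m h z" for w
    using that multiplicity_pos[OF h] by (auto simp: top_solutions_def)
  have sum_ge: "(\<Sum>w\<in>A. multiplicity_at h w) \<le> 1" if "A \<subseteq> top_solutions \<phi> m h z" for A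
  proof -
    have "(\<Sum>w\<in>A. multiplicity_at h w) \<le> (\<Sum>w\<in>top_solutions \<phi> m h z. multiplicity_at h w)"
    proof (rule sum_mono2[OF fin that])
      fix w assume "w \<in> top_solutions \<phi> m h z - A"
      thus "0 \<le> multiplicity_at h w" using mult[of w] by simp
    qed
    thus ?thesis using total by simp
  qed
  define w0 where "w0 = (u + 1) / complex_of_real R"
  have cR: "cmod (complex_of_real R) = R" using R_gt_2 by simp
  have w0: "w0 \<in> top_solutions \<phi> m h z"
  proof (rule top)
    show "w0 \<in> solutions \<phi> m h z" unfolding w0_def u(3) by (rule outer_solution_u[OF h u(1) big u(2)])
    show "cmod w0 = cmod (u + 1) / R" unfolding w0_def norm_divide cR ..
  qed
  have "cmod u \<noteq> 1"
  proof
    assume u1: "cmod u = 1"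
    hence unz: "u \<noteq> 0" by auto
    define v where "v = inverse u"
    have v: "v \<noteq> 0" "cmod v = 1" "jouk v = z" using unz u1 u(3) by (simp_all add: v_def norm_inverse)
    have "u * (v + 1) = u + 1" using unz by (simp add: v_def algebra_simps)
    hence cv: "cmod (v + 1) = cmod (u + 1)" by (metis mult_1 norm_mult u1)
    define w1 where "w1 = (v + 1) / complex_of_real R"
    have "w1 \<in> solutions \<phi> m h z"
      using outer_solution_u[OF h, of v] v big u(2) cv by (simp add: w1_def)
    hence w1: "w1 \<in> top_solutions \<phi> m h z" 
      by (rule top) (simp only: w1_def norm_divide cR cv)
    show False
    proof (cases "u = 1")
      case True
      hence "2 \<le> multiplicity_at h w0" using multiplicity_at_double_point[OF h] by (simp add: w0_def)
      thus False using sum_ge[of "{w0}"] w0 by simp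
    next
      case False
      have "u \<noteq> -1" using big Rm_pos by auto
      have "w0 \<noteq> w1"
      proof
        assume "w0 = w1"
        hence "u = v" using R_gt_2 by (simp add: w0_def w1_def)
        hence "u * u = u * inverse u" unfolding v_def by (rule arg_cong)
        hence "u * u = 1" using unz by simp
        hence "u = 1 \<or> u = -1" by (simp add: square_eq_1_iff)
        thus False using False \<open>u \<noteq> -1\<close> by simp
      qed
      hence "(\<Sum>w\<in>{w0, w1}. multiplicity_at h w) = multiplicity_at h w0 + multiplicity_at h w1" by simp
      thus False using sum_ge[of "{w0, w1}"] w0 w1 mult[OF w0] mult[OF w1] by simp
    qed
  qed
  thus ?thesis using u big by (intro exI[of _ u]) auto
qed

text \<open>
  The part of \<open>Sigma_zero\<close> with \<open>|u + 1| < R m\<close> is open, so boundary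
  points have \<open>|u + 1| = R m\<close>. If moreover \<open>|u| = 1\<close>, then \<open>z = 2
  Re u = |u + 1|\<^sup>2 - 2\<close> is the excluded point.
\<close>

lemma frontier_Sigma_zero_subset:
  assumes h: "mero_continuation R \<phi> m h" and z: "z \<in> frontier (Sigma_zero R \<phi> m h)"
    and ne: "z \<noteq> of_real (x_mu m)"
  shows "\<exists>u. z = jouk u \<and> 1 < cmod u \<and> cmod (u + 1) = R * m"
proof -
  let ?S = "jouk ` {u. 1 \<le> cmod u \<and> cmod (u + 1) \<le> R * m}"
  let ?T = "jouk ` {u. 1 \<le> cmod u \<and> cmod (u + 1) < R * m}"
  let ?C = "jouk ` {u. 1 \<le> cmod u \<and> R * m \<le> cmod (u + 1)}"
  have "closed {u. 1 \<le> cmod u \<and> cmod (u + 1) \<le> R * m}" "closed {u. 1 \<le> cmod u \<and> R * m \<le> cmod (u + 1)}"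
    by (intro closed_Collect_conj closed_Collect_le continuous_intros)+
  hence cl: "closed ?S" "closed ?C" by (auto intro: closed_jouk_image)
  have "?T = - ?C"
  proof (intro equalityI subsetI)
    fix y assume "y \<in> ?T"
    then obtain u where u: "1 \<le> cmod u" "cmod (u + 1) < R * m" "y = jouk u" by blast
    show "y \<in> - ?C"
    proof
      assume "y \<in> ?C"
      then obtain v where v: "1 \<le> cmod v" "R * m \<le> cmod (v + 1)" "y = jouk v" by blast
      have "cmod (u + 1) = cmod (v + 1)" by (rule jouk_eq_imp_norms) (use u v in auto)
      thus False using u v by linarith
    qed
  next
    fix y assume y: "y \<in> - ?C"
    obtain u where u: "1 \<le> cmod u" "jouk u = y" using jouk_surj .
    hence "\<not> R * m \<le> cmod (u + 1)" using y by blast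
    thus "y \<in> ?T" using u by auto
  qed
  hence "open ?T" using cl(2) by (simp only: open_Compl)
  moreover have "?T \<subseteq> ?S" by auto
  ultimately have "?T \<subseteq> interior ?S" by (rule interior_maximal[rotated])
  moreover have "z \<in> closure ?S - interior ?S" using z unfolding Sigma_zero_eq[OF h] frontier_def .
  ultimately have zS: "z \<in> ?S" "z \<notin> ?T" using cl(1) by auto
  then obtain u where u: "1 \<le> cmod u" "cmod (u + 1) \<le> R * m" "z = jouk u" by blast
  hence eq: "cmod (u + 1) = R * m" using zS(2) by force
  have "cmod u \<noteq> 1"
  proof
    assume u1: "cmod u = 1"
    hence "u * cnj u = 1" by (simp add: complex_norm_square[symmetric])
    hence iu: "inverse u = cnj u" by (rule inverse_unique)
    have "(R * m)\<^sup>2 = 1 + 2 * 1 * Re u + 1\<^sup>2 * (cmod u)\<^sup>2"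
      unfolding eq[symmetric] cmod_one_plus_sq[symmetric] by (simp add: add.commute)
    hence "2 * Re u = x_mu m" using u1 by (simp add: x_mu_props(1))
    moreover have "z = of_real (2 * Re u)" unfolding u(3) jouk_def iu by (simp add: complex_add_cnj)
    ultimately show False using ne by simp
  qed
  thus ?thesis using u eq by (intro exI[of _ u]) auto
qed

end

section \<open>The asymptotic formulas\<close>

theorem theorem1p4:
  fixes R \<mu> :: real and p :: "nat \<Rightarrow> complex poly" and \<phi> h :: "complex \<Rightarrow> complex"
  assumes "R > 2"
    and "area_orthonormal_polys (G1 R) p"
    and "conformal_onto_disk (G1 R) \<phi>"
    and "maximal_mero_continuation R \<phi> \<mu> h"
  shows "(\<forall>K. compact K \<and>
            K \<subseteq> (Sigma_level R \<phi> \<mu> h 1 \<union> frontier (Sigma_zero R \<phi> \<mu> h)) - {of_real (x_mu \<mu>)} \<longrightarrow>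
            (\<exists>C. \<forall>\<^sub>F n in sequentially. \<forall>z\<in>K.
               cmod (of_real ((2 * R) ^ (n + 1)) * poly (p n) z /
                       (of_real (sqrt (real n + 1)) * (z + 2 + sqrt4 z) ^ n)
                     - (z + sqrt4 z) / sqrt4 z) \<le> C / real n)) \<and>
         (\<exists>\<epsilon> :: nat \<Rightarrow> real \<Rightarrow> complex.
            (\<forall>n. \<forall>\<theta>. 0 \<le> \<theta> \<and> \<theta> \<le> arccos (x_mu \<mu> / 2) \<longrightarrow>
               poly (p n) (of_real (2 * cos \<theta>)) =
                 of_real (sqrt (real n + 1) * (2 / R) ^ (n + 1) * cos (\<theta> / 2) ^ n) *
                 (of_real (sine_quotient n \<theta>) + \<epsilon> n (2 * cos \<theta>))) \<and>
            (\<forall>K. compact K \<and> K \<subseteq> {x_mu \<mu><..2} \<longrightarrow>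
               (\<exists>C>0. \<exists>c. 0 < c \<and> c < 1 \<and>
                  (\<forall>\<^sub>F n in sequentially. \<forall>x\<in>K. cmod (\<epsilon> n x) \<le> C * c ^ n))) \<and>
            (\<exists>C. \<forall>\<^sub>F n in sequentially. \<forall>x\<in>{x_mu \<mu>..2}. cmod (\<epsilon> n x) \<le> C / real n))"
proof -
  interpret interior_map R \<phi> using assms(1,3) by unfold_locales
  have mu: "\<mu> = m" by (rule maximal_eq_m[OF assms(4)])
  have h: "mero_continuation R \<phi> m h"
    using assms(4) unfolding mu by (simp add: maximal_mero_continuation_def)
  show ?thesis unfolding mu
  proof (intro conjI allI impI)
    fix K assume K: "compact K \<and> K \<subseteq> (Sigma_level R \<phi> m h 1 \<union> frontier (Sigma_zero R \<phi> m h)) - {of_real (x_mu m)}"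
    show "\<exists>C. \<forall>\<^sub>F n in sequentially. \<forall>z\<in>K.
               cmod (of_real ((2 * R) ^ (n + 1)) * poly (p n) z /
                       (of_real (sqrt (real n + 1)) * (z + 2 + sqrt4 z) ^ n)
                     - (z + sqrt4 z) / sqrt4 z) \<le> C / real n"
    proof (rule exterior_asymptotics[OF assms(2)])
      show "compact K" using K by blast
      fix z assume "z \<in> K"
      hence z: "z \<in> Sigma_level R \<phi> m h 1 \<or> z \<in> frontier (Sigma_zero R \<phi> m h)" "z \<noteq> of_real (x_mu m)"
        using K by blast+
      from z(1) show "\<exists>u. z = jouk u \<and> 1 < cmod u \<and> R * m \<le> cmod (1 + u) \<and> cmod (1 + u) \<le> R"
      proof
        assume "z \<in> Sigma_level R \<phi> m h 1"
        from Sigma_one_subset[OF h this] obtain u where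
          "z = jouk u" "1 < cmod u" "R * m < cmod (u + 1)" "cmod (u + 1) < R" by blast
        thus ?thesis by (intro exI[of _ u]) (simp add: add.commute)
      next
        assume "z \<in> frontier (Sigma_zero R \<phi> m h)"
        from frontier_Sigma_zero_subset[OF h this z(2)] obtain u where
          "z = jouk u" "1 < cmod u" "cmod (u + 1) = R * m" by blast
        moreover from this(3) have "cmod (u + 1) \<le> R" using Rm_pos by linarith
        ultimately show ?thesis by (intro exI[of _ u]) (simp add: add.commute)
      qed
    qed
  qed (rule interval_asymptotics[OF assms(2)])
qed

end
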